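(* Let $S$ be a set of $n$ points with integer coordinates in $[1,n]$ (word RAM model, space measured in words of $\log n$ bits), and let $\varepsilon>0$ be an arbitrarily small constant. There exists an $O(n\log^{\varepsilon} n)$ space data structure that answers two-dimensional sorted range reporting queries on $S$ in $O(\log\log n+k)$ time, where $k$ is the number of reported points.
   Context: A two-dimensional sorted range reporting query is given by a rectangle $Q=[a,b]\times[c,d]$ (and a number $k$); it reports the $k$ points of $S\cap Q$ with the smallest $x$-coordinates (or all points of $S\cap Q$ if fewer exist), sorted in increasing order of $x$-coordinate. *)

theory Defs
  imports Complex_Main
begin

section \<open>Word RAM\<close>

text \<open>
  A machine with word length \<open>w\<close>: words are the natural numbers below \<open>2 ^ w\<close>, and all arithmetic
  is modulo \<open>2 ^ w\<close>. A program is a fixed finite list of instructions and hence uses only a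
  constant number of registers. The memory is a finite list of words, addressed from \<open>0\<close>.
  Results are written to a write-only output tape, one word per instruction. Every instruction
  costs one time unit.
\<close>

datatype binop =
    Add | Sub | Mul | Div | And | Or | Xor | Shl | Shr | Less | Equal

fun eval_binop :: "nat \<Rightarrow> binop \<Rightarrow> nat \<Rightarrow> nat \<Rightarrow> nat" where
  "eval_binop w Add x y = take_bit w (x + y)"
| "eval_binop w Sub x y = take_bit w (x + 2 ^ w - y)"
| "eval_binop w Mul x y = take_bit w (x * y)"
| "eval_binop w Div x y = take_bit w (x div y)"
| "eval_binop w And x y = take_bit w (Bit_Operations.and x y)"
| "eval_binop w Or x y = take_bit w (Bit_Operations.or x y)"
| "eval_binop w Xor x y = take_bit w (Bit_Operations.xor x y)"
| "eval_binop w Shl x y = take_bit w (push_bit y x)"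
| "eval_binop w Shr x y = take_bit w (drop_bit y x)"
| "eval_binop w Less x y = take_bit w (of_bool (x < y))"
| "eval_binop w Equal x y = take_bit w (of_bool (x = y))"

type_synonym reg = nat

datatype instr =
    Const reg nat
  | Op binop reg reg reg    (* operation, destination, first operand, second operand *)
  | Load reg reg            (* destination, register holding the address *)
  | Store reg reg           (* register holding the address, source *)
  | Jump nat
  | JumpZero reg nat
  | Output reg
  | Halt

record config =
  pc :: nat
  regs :: "reg \<Rightarrow> nat"
  mem :: "nat list"
  outp :: "nat list"

text \<open>The result is \<open>None\<close> for \<open>Halt\<close> and for an access outside the memory.\<close>

fun exec_instr :: "nat \<Rightarrow> instr \<Rightarrow> config \<Rightarrow> config option" where
  "exec_instr w (Const r v) s =
     Some (s\<lparr>pc := pc s + 1, regs := (regs s)(r := take_bit w v)\<rparr>)"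
| "exec_instr w (Op f r r1 r2) s =
     Some (s\<lparr>pc := pc s + 1, regs := (regs s)(r := eval_binop w f (regs s r1) (regs s r2))\<rparr>)"
| "exec_instr w (Load r ra) s =
     (if regs s ra < length (mem s)
      then Some (s\<lparr>pc := pc s + 1, regs := (regs s)(r := mem s ! regs s ra)\<rparr>)
      else None)"
| "exec_instr w (Store ra r) s =
     (if regs s ra < length (mem s)
      then Some (s\<lparr>pc := pc s + 1, mem := (mem s)[regs s ra := regs s r]\<rparr>)
      else None)"
| "exec_instr w (Jump l) s = Some (s\<lparr>pc := l\<rparr>)"
| "exec_instr w (JumpZero r l) s =
     Some (s\<lparr>pc := (if regs s r = 0 then l else pc s + 1)\<rparr>)"
| "exec_instr w (Output r) s = Some (s\<lparr>pc := pc s + 1, outp := outp s @ [regs s r]\<rparr>)"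
| "exec_instr w Halt s = None"

definition step :: "nat \<Rightarrow> instr list \<Rightarrow> config \<Rightarrow> config option" where
  "step w P s = (if pc s < length P then exec_instr w (P ! pc s) s else None)"

fun steps :: "nat \<Rightarrow> instr list \<Rightarrow> nat \<Rightarrow> config \<Rightarrow> config option" where
  "steps w P 0 s = Some s"
| "steps w P (Suc t) s = Option.bind (step w P s) (steps w P t)"

text \<open>
  \<open>t\<close> counts all executed instructions, including the final \<open>Halt\<close>; a computation that gets
  stuck on an illegal memory access or runs off the program does not halt.
\<close>

definition halts_in :: "nat \<Rightarrow> instr list \<Rightarrow> config \<Rightarrow> nat \<Rightarrow> config \<Rightarrow> bool" where
  "halts_in w P s t s' \<longleftrightarrow>
     (\<exists>t0. t = Suc t0 \<and> steps w P t0 s = Some s' \<and> pc s' < length P \<and> P ! pc s' = Halt)"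

text \<open>The arguments are passed in the first registers; all other registers are \<open>0\<close>.\<close>

definition initial :: "nat list \<Rightarrow> nat list \<Rightarrow> config" where
  "initial args M =
     \<lparr>pc = 0, regs = (\<lambda>r. if r < length args then args ! r else 0), mem = M, outp = []\<rparr>"


section \<open>Sorted range reporting\<close>

type_synonym point = "nat \<times> nat"

text \<open>
  Points may share an \<open>x\<close>-coordinate: ties may be ordered, and cut off at the \<open>k\<close>-th point,
  arbitrarily.
\<close>

definition sorted_report :: "point set \<Rightarrow> point set \<Rightarrow> nat \<Rightarrow> point list \<Rightarrow> bool" where
  "sorted_report S Q k ps \<longleftrightarrow>
     distinct ps \<and> set ps \<subseteq> S \<inter> Q \<and> length ps = min k (card (S \<inter> Q)) \<and>
     sorted (map fst ps) \<and>
     (\<forall>p \<in> set ps. \<forall>q \<in> (S \<inter> Q) - set ps. fst p \<le> fst q)"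

definition encode_points :: "point list \<Rightarrow> nat list" where
  "encode_points ps = concat (map (\<lambda>(x, y). [x, y]) ps)"

text \<open>
  \<open>D\<close> is the stored data structure. It occupies the first cells of a memory of \<open>m\<close> words; the
  remaining cells are working space with arbitrary initial content. A query has to leave \<open>D\<close>
  intact, so that any sequence of queries can be answered. \<open>T j\<close> bounds the time of a query that
  reports \<open>j\<close> points.
\<close>

definition answers_sorted_reporting ::
    "nat \<Rightarrow> instr list \<Rightarrow> nat list \<Rightarrow> nat \<Rightarrow> point set \<Rightarrow> (nat \<Rightarrow> real) \<Rightarrow> bool" where
  "answers_sorted_reporting w P D m S T \<longleftrightarrow>
     length D \<le> m \<and> set D \<subseteq> {..<2 ^ w} \<and>
     (\<forall>M a b c d k.
        length M = m \<and> set M \<subseteq> {..<2 ^ w} \<and> take (length D) M = D \<and>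
        {a, b, c, d, k} \<subseteq> {..<2 ^ w} \<longrightarrow>
        (\<exists>t s ps.
           halts_in w P (initial [a, b, c, d, k] M) t s \<and>
           outp s = encode_points ps \<and>
           sorted_report S ({a..b} \<times> {c..d}) k ps \<and>
           take (length D) (mem s) = D \<and>
           real t \<le> T (length ps)))"


section \<open>Complexity bounds\<close>

text \<open>
  Binary logarithm, bounded below by \<open>1\<close> so that \<open>O\<close>-bounds make sense for small arguments; for
  \<open>n \<ge> 4\<close> the bound has no effect on \<open>lg n\<close> and \<open>lg (lg n)\<close>.
\<close>

definition lg :: "real \<Rightarrow> real" where
  "lg x = max 1 (log 2 x)"

text \<open>
  Machine words have \<open>\<Theta>(log n)\<close> bits, namely \<open>c\<close> times the length of the binary representation
  of \<open>n\<close>. A constant factor \<open>c\<close> is needed since an address into \<open>n log\<^sup>\<epsilon> n\<close> cells does not fit into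
  \<open>log n\<close> bits. For \<open>c \<ge> 1\<close> all of \<open>0, \<dots>, n\<close> are words.
\<close>

definition word_length :: "nat \<Rightarrow> nat \<Rightarrow> nat" where
  "word_length c n = c * (nat \<lfloor>log 2 (real n)\<rfloor> + 1)"

text \<open>The size of \<open>m\<close> cells of \<open>w\<close> bits each, in units of \<open>log n\<close> bits.\<close>

definition space_in_words :: "nat \<Rightarrow> nat \<Rightarrow> nat \<Rightarrow> real" where
  "space_in_words n w m = real (m * w) / lg (real n)"

end

theory Submission
 imports Defs "HOL-Real_Asymp.Real_Asymp"
begin

text \<open>
 Points are moved to rank space and arranged in a binary tree over the \<open>y\<close>-ranks; each node stores
 its points in the order of the \<open>x\<close>-ranks, so a four-sided query splits at one node into two
 three-sided queries, whose sorted outputs are merged. In the first child one needs, in the order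
 of positions, the positions of values above a threshold. Positions are cut into blocks of
 \<open>d ^ J\<close> positions with \<open>d \<approx> log n / log\<^sup>\<epsilon> n\<close>; within a block a tree of degree \<open>d\<close> stores the
 order type of the maxima of the children, for which all decisions are tabulated, and blocks without
 relevant values are skipped with precomputed batches of \<open>\<Theta>(log log n)\<close> blocks that are found by
 predecessor queries. Values are not stored but decoded by ball inheritance: a jump to a deeper level
 is a packed field of few bits, and a constant number of jumps reaches the leaves.
 Predecessor queries are binary searches over the levels of a trie whose nodes are hashed perfectly.
\<close>

section \<open>Choice of the parameters\<close>

text \<open>Let \<open>L\<close> be the number of bits of a rank. A degree \<open>d\<close> near
  \<open>L powr (1 - \<epsilon>)\<close> keeps the table of all \<open>d ^ d\<close> order types at
  \<open>O(2 ^ L)\<close> words, while the inner nodes of the block trees, about a fraction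
  \<open>1 / d\<close> of the positions, still sum to \<open>O(2 ^ L * L powr \<epsilon>)\<close>
  over the \<open>L + 1\<close> levels. The block trees have depth 12 because the predecessor
  structures need up to \<open>L ^ 5\<close> words per block and \<open>d\<close> is at least the
  square root of \<open>L\<close>, whence \<open>d ^ 12 >= L ^ 6\<close>. The obstacle in the
  running time is that a predecessor query costs \<open>Lam\<close>, which is of order
  \<open>log log n\<close>, and can be paid only a bounded number of times per query and once per
  \<open>Lam\<close> reported points; this fixes the size of a batch. In a node of a block tree the
  number of relevant children is found by exponential search, at a cost that these children pay for.
  The second child at the split needs values below a threshold. It is served by another copy of the
  structure, built for the order reversed by \<open>y -> 2 ^ L - 1 - y\<close>.\<close>

text \<open>Only finitely many \<open>n\<close> lie below the threshold of the asymptotic bound; the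
  sum of their ratios is added to the constant, which makes the bound uniform from
  \<open>n = 1\<close> on.\<close>

lemma bigo_nat_bound:
 fixes f g :: "real => real"
 assumes "f \<in> O(g)" "!!x. 1 <= x ==> 0 < g x"
 shows "EX K. 0 <= K & (\<forall>n::nat. 1 <= n --> f (real n) <= K * g (real n))"
proof -
 obtain c where c: "c > 0" "eventually (%x. norm (f x) <= c * norm (g x)) at_top" using landau_o.bigE[OF assms(1)] by auto
 then obtain b where b: "!!x. b <= x ==> norm (f x) <= c * norm (g x)" by (auto simp: eventually_at_top_linorder)
 define m where "m = nat \<lceil>b\<rceil>"
 define K where "K = c + (\<Sum>n=1..m. \<bar>f (real n)\<bar> / g (real n))"
 have nn: "0 <= \<bar>f (real n)\<bar> / g (real n)" if "1 <= n" for n using assms(2)[of "real n"] that by simp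
 have s0: "0 <= (\<Sum>n=1..m. \<bar>f (real n)\<bar> / g (real n))" by (rule sum_nonneg) (use nn in auto)
 have "f (real n) <= K * g (real n)" if n: "1 <= n" for n :: nat
 proof -
 have g: "0 < g (real n)" using assms(2)[of "real n"] n by simp
 show ?thesis
 proof (cases "n <= m")
 case True
 have "\<bar>f (real n)\<bar> / g (real n) <= (\<Sum>n=1..m. \<bar>f (real n)\<bar> / g (real n))"
 by (rule member_le_sum) (use True n nn in auto)
 then have "\<bar>f (real n)\<bar> / g (real n) <= K" unfolding K_def using c(1) by linarith
 then have "\<bar>f (real n)\<bar> <= K * g (real n)" using g by (simp add: field_simps)
 then show ?thesis by linarith
 next
 case False
 then have "b <= real n" unfolding m_def by linarith
 then have "f (real n) <= c * g (real n)" using b[of "real n"] g by simp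
 also have "... <= K * g (real n)" using g s0 by (intro mult_right_mono) (auto simp: K_def)
 finally show ?thesis .
 qed
 qed
 moreover have "0 <= K" using c(1) s0 by (simp add: K_def)
 ultimately show ?thesis by blast
qed

text \<open>Here \<open>x\<close> stands for \<open>L\<close>. The three left-hand sides bound
  \<open>Lam\<close>, the block length \<open>d ^ 12\<close> and the size of the table of order
  types, with \<open>d\<close> replaced by an upper bound.\<close>

lemma asymp_facts:
 fixes \<delta> :: real
 assumes "0 < \<delta>" "\<delta> <= 1 / 2"
 shows "(%x::real. 2 + log 2 (x + 1)) \<in> O(%x. x powr \<delta>)"
 and "(%x::real. 4096 * x ^ 12) \<in> O(%x. 2 powr x)"
 and "(%x::real. (2 * x powr (1 - \<delta>)) powr (2 * x powr (1 - \<delta>)) * (2 * (2 * x powr (1 - \<delta>) + 1) ^ 2)) \<in> O(%x. 2 powr x)"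
proof -
 have "1 - \<delta> > 0" "1 - \<delta> < 1" using assms by auto
 show "(%x::real. 2 + log 2 (x + 1)) \<in> O(%x. x powr \<delta>)" using assms by real_asymp
 show "(%x::real. 4096 * x ^ 12) \<in> O(%x. 2 powr x)" by real_asymp
 define a where "a = 1 - \<delta>"
 have a: "0 < a" "a < 1" using assms by (auto simp: a_def)
 show "(%x::real. (2 * x powr (1 - \<delta>)) powr (2 * x powr (1 - \<delta>)) * (2 * (2 * x powr (1 - \<delta>) + 1) ^ 2)) \<in> O(%x. 2 powr x)"
 unfolding a_def[symmetric] using a by real_asymp
qed

text \<open>Every later bound on space and time is read off from this list. \<open>\<delta>\<close>
  is capped at one half so that \<open>d\<close>, the rounded value of
  \<open>L powr (1 - \<delta>)\<close>, is at least the square root of \<open>L\<close>; this gives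
  \<open>L ^ 6 <= d ^ 12\<close> and with it the bound on \<open>L ^ 5 * Nb\<close>.
  \<open>G\<close> is about \<open>L powr \<delta>\<close>, so \<open>G ^ I >= L\<close> as soon as
  \<open>I >= 1 / \<delta>\<close>. \<open>Nb\<close> is the number of blocks of length
  \<open>d ^ 12\<close>, rounded up.\<close>

lemma ex_params:
 fixes \<epsilon> :: real
 assumes "0 < \<epsilon>"
 shows "\<exists>(I::nat) (K::nat). 1 <= K & (\<forall>L::nat. 1 <= L --> (\<exists>d Nb Lam G :: nat. 1 <= d & d <= 2 ^ Lam & 2 <= Lam &
 L + 1 < 2 ^ Lam & 2 ^ Lam <= 4 * (L + 1) & Lam <= L + 2 & 2 ^ L <= Nb * d ^ 12 & 0 < Nb & (Nb - 1) * d ^ 12 < 2 ^ L &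
 2 <= G & L <= G ^ I & G <= L + 2 & real Lam <= real K * real L powr \<epsilon> & real G <= real K * real L powr \<epsilon> &
 real ((L + 1) * (Nb * d ^ 11)) <= real K * (2 ^ L * real L powr \<epsilon>) & L ^ 5 * Nb <= K * 2 ^ L & Nb * d ^ 12 <= K * 2 ^ L &
 d ^ d * (d + (d + 1) * (d + 1)) <= K * 2 ^ L))"
proof -
 define \<delta> where "\<delta> = min \<epsilon> (1 / 2)"
 have \<delta>: "0 < \<delta>" "\<delta> <= 1 / 2" "\<delta> <= \<epsilon>" using assms by (auto simp: \<delta>_def)
 obtain K1 where K1: "0 <= K1" "!!n::nat. 1 <= n ==> 2 + log 2 (real n + 1) <= K1 * real n powr \<delta>"
 using bigo_nat_bound[OF asymp_facts(1)[OF \<delta>(1,2)]] by auto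
 obtain K2 where K2: "0 <= K2" "!!n::nat. 1 <= n ==> 4096 * real n ^ 12 <= K2 * 2 powr real n"
 using bigo_nat_bound[OF asymp_facts(2)[OF \<delta>(1,2)]] by auto
 obtain K3 where K3: "0 <= K3" "!!n::nat. 1 <= n ==> (2 * real n powr (1 - \<delta>)) powr (2 * real n powr (1 - \<delta>)) *
 (2 * (2 * real n powr (1 - \<delta>) + 1) ^ 2) <= K3 * 2 powr real n"
 using bigo_nat_bound[OF asymp_facts(3)[OF \<delta>(1,2)]] by auto
 define I where "I = nat \<lceil>1 / \<delta>\<rceil>"
 define K where "K = nat \<lceil>K1 + 3 + 2 * (1 + K2) + K3\<rceil>"
 have Kr: "K1 + 3 + 2 * (1 + K2) + K3 <= real K" unfolding K_def by linarith
 have Kb: "K1 <= K" "3 <= real K" "2 * (1 + K2) <= K" "1 + K2 <= K" "K3 <= K" using Kr K1(1) K2(1) K3(1) by (simp_all add: algebra_simps)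
 show ?thesis
 proof (rule exI[of _ I], rule exI[of _ K], intro conjI allI impI)
 show "1 <= K" using Kb(2) by linarith
 fix L :: nat assume L: "1 <= L"
 define x where "x = real L"
 have x: "1 <= x" using L by (simp add: x_def)
 define q z where "q = x powr \<delta>" and "z = x powr (1 - \<delta>)"
 have q1: "1 <= q" unfolding q_def using x \<delta> by (intro ge_one_powr_ge_zero) auto
 have z1: "1 <= z" unfolding z_def using x \<delta> by (intro ge_one_powr_ge_zero) auto
 have qx: "q <= x powr 1" "z <= x powr 1" unfolding q_def z_def using x \<delta> by (intro powr_mono; simp)+
 then have qx: "q <= x" "z <= x" using x by auto
 have qe: "q <= x powr \<epsilon>" unfolding q_def using x \<delta> by (intro powr_mono) auto
 have zq: "z * q = x" unfolding z_def q_def powr_add[symmetric] using x by simp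
 have p2: "2 powr real L = 2 ^ L" by (simp add: powr_realpow)
 define d where "d = nat \<lceil>z\<rceil>"
 have dz: "z <= real d" "real d <= z + 1" "real d <= 2 * z" unfolding d_def using z1 by linarith+
 have dL: "d <= L" unfolding d_def using qx(2) by (simp add: x_def nat_le_iff ceiling_le_iff)
 have d1: "1 <= d" using dz(1) z1 by linarith
 define Lam where "Lam = (LEAST m. L + 1 < (2::nat) ^ m)"
 have exL: "L + 1 < (2::nat) ^ (L + 1)" by (rule less_exp)
 have lam: "L + 1 < 2 ^ Lam" unfolding Lam_def using exL by (rule LeastI)
 have lam0: "Lam ~= 0" using lam L by (cases "Lam = 0") auto
 have lamu: "2 ^ Lam <= 2 * (L + 1)"
 proof -
 have "\<not> L + 1 < (2::nat) ^ (Lam - 1)" using not_less_Least[of "Lam - 1" "%m. L + 1 < (2::nat) ^ m"] lam0 by (simp add: Lam_def)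
 then have "(2::nat) * 2 ^ (Lam - 1) <= 2 * (L + 1)" by simp
 moreover have "(2::nat) * 2 ^ (Lam - 1) = 2 ^ Lam" using lam0 by (cases Lam) auto
 ultimately show ?thesis by simp
 qed
 have lamL: "Lam <= L + 2" unfolding Lam_def using Least_le[of "%m. L + 1 < (2::nat) ^ m", OF exL] by simp
 have lam2: "2 <= Lam"
 proof (rule ccontr)
 assume "\<not> 2 <= Lam"
 then have "Lam = 1" using lam0 by simp
 then show False using lam L by simp
 qed
 have lamr: "real Lam <= K1 * q"
 proof -
 have "real Lam = log 2 (2 ^ Lam)" by simp
 also have "... <= log 2 (2 * (real L + 1))"
 proof (rule log_mono)
 have "real (2 ^ Lam) <= real (2 * (L + 1))" using lamu by (rule of_nat_mono)
 then show "2 ^ Lam <= 2 * (real L + 1)" by simp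
 qed auto
 also have "... = 1 + log 2 (real L + 1)" by (subst log_mult) auto
 also have "... <= K1 * q" using K1(2)[OF L] by (simp add: q_def x_def)
 finally show ?thesis .
 qed
 define G where "G = nat \<lceil>q\<rceil> + 1"
 have G: "q <= real G" "real G <= q + 2" "2 <= G" unfolding G_def using q1 by linarith+
 have GL: "G <= L + 2" using G(2) qx(1) unfolding x_def by linarith
 have GI: "L <= G ^ I"
 proof -
 have "x = q powr (1 / \<delta>)" using x \<delta> by (simp add: q_def powr_powr)
 also have "... <= real G powr (1 / \<delta>)" using G(1) q1 \<delta> by (intro powr_mono2) auto
 also have "... <= real G powr real I" unfolding I_def using G(3) by (intro powr_mono) linarith+
 also have "... = real (G ^ I)" using G(3) by (simp add: powr_realpow)
 finally show ?thesis unfolding x_def by linarith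
 qed
 have d6: "L ^ 6 <= d ^ 12"
 proof -
 have "sqrt x = x powr (1 / 2)" using x by (simp add: powr_half_sqrt)
 also have "... <= z" unfolding z_def using x \<delta> by (intro powr_mono) auto
 also have "... <= real d" by (rule dz)
 finally have "sqrt x ^ 12 <= real d ^ 12" using x by (intro power_mono) auto
 moreover have "sqrt x ^ 12 = x ^ 6" using x power_mult[of "sqrt x" 2 6] by simp
 ultimately have "x ^ 6 <= real d ^ 12" by linarith
 then have "real (L ^ 6) <= real (d ^ 12)" by (simp add: x_def)
 then show ?thesis by linarith
 qed
 have L5: "L ^ 5 <= d ^ 12" using power_increasing[of 5 6 L] L d6 by linarith
 have d12: "real (d ^ 12) <= K2 * 2 ^ L"
 proof -
 have "d ^ 12 <= L ^ 12" using dL by (rule power_mono) simp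
 then have "real (d ^ 12) <= real (L ^ 12)" by (rule of_nat_mono)
 also have "... <= 4096 * real L ^ 12" by simp
 also have "... <= K2 * 2 ^ L" using K2(2)[OF L] p2 by simp
 finally show ?thesis .
 qed
 define B where "B = d ^ 12"
 have B: "0 < B" using d1 by (simp add: B_def)
 define Nb where "Nb = (2 ^ L - 1) div B + 1"
 have Nb1: "2 ^ L <= Nb * B"
 proof -
 have "2 ^ L - 1 < Nb * B" unfolding Nb_def using dividend_less_div_times[OF B, of "2 ^ L - 1"] by (simp add: algebra_simps)
 then show ?thesis by linarith
 qed
 have Nb2: "(Nb - 1) * B < 2 ^ L"
 proof -
 have "(2 ^ L - 1) div B * B <= 2 ^ L - 1" by (rule div_times_less_eq_dividend)
 moreover have "(1::nat) <= 2 ^ L" by simp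
 ultimately show ?thesis unfolding Nb_def by (simp only: add_diff_cancel_right')
 qed
 have NbB: "real (Nb * B) <= (1 + K2) * 2 ^ L"
 proof -
 have "Nb * B = (Nb - 1) * B + B" by (simp add: Nb_def)
 then have "Nb * B <= 2 ^ L + B" using Nb2 by linarith
 then have "real (Nb * B) <= real (2 ^ L + B)" by (rule of_nat_mono)
 then show ?thesis using d12 by (simp add: B_def algebra_simps)
 qed
 have NbK: "Nb * B <= K * 2 ^ L"
 proof -
 have "(1 + K2) * 2 ^ L <= real K * 2 ^ L" using Kb(4) by (intro mult_right_mono) auto
 then have "real (Nb * B) <= real K * 2 ^ L" using NbB by linarith
 then have "real (Nb * B) <= real (K * 2 ^ L)" by simp
 then show ?thesis by linarith
 qed
 have b1: "real Lam <= real K * x powr \<epsilon>"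
 proof -
 have "K1 * q <= real K * x powr \<epsilon>" using Kb(1) qe q1 by (intro mult_mono) auto
 then show ?thesis using lamr by linarith
 qed
 have b2: "real G <= real K * x powr \<epsilon>"
 proof -
 have "q + 2 <= 3 * q" using q1 by simp
 also have "3 * q <= real K * x powr \<epsilon>" using Kb(2) qe q1 by (intro mult_mono) auto
 finally show ?thesis using G(2) by linarith
 qed
 have b3: "real ((L + 1) * (Nb * d ^ 11)) <= real K * (2 ^ L * x powr \<epsilon>)"
 proof -
 have dB: "d * d ^ 11 = B" unfolding B_def using power_Suc[of d 11] by simp
 have "x <= real d * q" using dz(1) q1 unfolding zq[symmetric] by (intro mult_right_mono) auto
 then have "real (L + 1) <= 2 * (real d * q)" using x unfolding x_def by simp
 then have "real (L + 1) * real (Nb * d ^ 11) <= 2 * (real d * q) * real (Nb * d ^ 11)" by (intro mult_right_mono) auto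
 also have "... = 2 * q * real (Nb * B)" unfolding dB[symmetric] by simp
 also have "... <= 2 * q * ((1 + K2) * 2 ^ L)" using NbB q1 by (intro mult_left_mono) auto
 also have "... = (2 * (1 + K2)) * (2 ^ L * q)" by simp
 also have "... <= real K * (2 ^ L * x powr \<epsilon>)" using Kb(3) qe K2(1) q1 by (intro mult_mono) auto
 finally show ?thesis by (simp only: of_nat_mult)
 qed
 have b4: "d ^ d * (d + (d + 1) * (d + 1)) <= K * 2 ^ L"
 proof -
 have "real d ^ d = real d powr real d" using d1 by (simp add: powr_realpow)
 also have "... <= (2 * z) powr real d" using dz by (intro powr_mono2) auto
 also have "... <= (2 * z) powr (2 * z)" using dz z1 by (intro powr_mono) auto
 finally have e: "real d ^ d <= (2 * z) powr (2 * z)" .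
 have "real d + (real d + 1) * (real d + 1) <= 2 * (real d + 1) ^ 2" by (simp add: power2_eq_square algebra_simps)
 also have "... <= 2 * (2 * z + 1) ^ 2" using dz by (intro mult_left_mono power_mono) auto
 finally have f: "real d + (real d + 1) * (real d + 1) <= 2 * (2 * z + 1) ^ 2" .
 have m: "real d ^ d * (real d + (real d + 1) * (real d + 1)) <= (2 * z) powr (2 * z) * (2 * (2 * z + 1) ^ 2)"
 by (rule mult_mono[OF e f]) auto
 have "real (d ^ d * (d + (d + 1) * (d + 1))) <= (2 * z) powr (2 * z) * (2 * (2 * z + 1) ^ 2)"
 using m by (simp only: of_nat_mult of_nat_add of_nat_power of_nat_1)
 also have "... <= K3 * 2 ^ L" using K3(2)[OF L] unfolding p2 z_def x_def .
 also have "... <= real K * 2 ^ L" using Kb(5) by (intro mult_right_mono) auto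
 finally have "real (d ^ d * (d + (d + 1) * (d + 1))) <= real (K * 2 ^ L)" by simp
 then show ?thesis by linarith
 qed
 have b5: "L ^ 5 * Nb <= K * 2 ^ L"
 proof -
 have "L ^ 5 * Nb <= B * Nb" unfolding B_def using L5 by (rule mult_le_mono1)
 also have "... = Nb * B" by (rule mult.commute)
 also note NbK
 finally show ?thesis .
 qed
 have m: "d <= 2 ^ Lam" "2 ^ Lam <= 4 * (L + 1)" using dL lam lamu by linarith+
 have Nb0: "0 < Nb" by (simp add: Nb_def)
 show "\<exists>d Nb Lam G :: nat. 1 <= d & d <= 2 ^ Lam & 2 <= Lam &
 L + 1 < 2 ^ Lam & 2 ^ Lam <= 4 * (L + 1) & Lam <= L + 2 & 2 ^ L <= Nb * d ^ 12 & 0 < Nb & (Nb - 1) * d ^ 12 < 2 ^ L &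
 2 <= G & L <= G ^ I & G <= L + 2 & real Lam <= real K * real L powr \<epsilon> & real G <= real K * real L powr \<epsilon> &
 real ((L + 1) * (Nb * d ^ 11)) <= real K * (2 ^ L * real L powr \<epsilon>) & L ^ 5 * Nb <= K * 2 ^ L & Nb * d ^ 12 <= K * 2 ^ L &
 d ^ d * (d + (d + 1) * (d + 1)) <= K * 2 ^ L"
 unfolding x_def[symmetric]
 by (rule exI[of _ d], rule exI[of _ Nb], rule exI[of _ Lam], rule exI[of _ G], intro conjI)
 (rule d1 m lam2 lam lamL Nb1[unfolded B_def] Nb0 Nb2[unfolded B_def] G(3) GI GL b1 b2 b3 b5 NbK[unfolded B_def] b4)+
 qed
qed

section \<open>Perfect hashing and binary tries\<close>

text \<open>Greedy placement of rows in decreasing order of size: a row \<open>r0\<close> of minimal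
  size is placed after all others. A possible collision of an entry of \<open>r0\<close> with an
  entry of row \<open>r\<close> forbids one displacement, so at most the sum of
  \<open>card (Z r) * card (Z r0)\<close> are forbidden; by minimality this is at most the sum of
  squares and hence below \<open>S\<close>.\<close>

lemma displace_rows:
 fixes Z :: "nat => nat set"
 assumes "finite A" "!!r. r \<in> A ==> finite (Z r)" "(\<Sum>r\<in>A. (card (Z r))\<^sup>2) < S"
 shows "EX disp. (ALL r. disp r < S) &
 (\<forall>r\<in>A. \<forall>r'\<in>A. \<forall>z\<in>Z r. \<forall>z'\<in>Z r'. disp r + z = disp r' + z' --> r = r' & z = z')"
 using assms
proof (induction "card A" arbitrary: A)
 case 0
 then show ?case by (intro exI[of _ "%_. 0"]) auto
next
 case (Suc n)
 then have "A ~= {}" by auto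
 define r0 where "r0 = arg_min_on (%r. card (Z r)) A"
 have r0: "r0 \<in> A" "!!r. r \<in> A ==> card (Z r0) <= card (Z r)"
 using arg_min_if_finite[OF Suc.prems(1) \<open>A ~= {}\<close>, of "%r. card (Z r)"] arg_min_least[OF Suc.prems(1) \<open>A ~= {}\<close>]
 by (auto simp: r0_def)
 define A' where "A' = A - {r0}"
 have A': "finite A'" "r0 ~: A'" "A = insert r0 A'" using Suc.prems(1) r0(1) by (auto simp: A'_def)
 have sumA: "(\<Sum>r\<in>A. (card (Z r))\<^sup>2) = (card (Z r0))\<^sup>2 + (\<Sum>r\<in>A'. (card (Z r))\<^sup>2)"
 unfolding A'(3) using A'(1,2) by (rule sum.insert)
 obtain disp where d: "ALL r. disp r < S"
 "\<forall>r\<in>A'. \<forall>r'\<in>A'. \<forall>z\<in>Z r. \<forall>z'\<in>Z r'. disp r + z = disp r' + z' --> r = r' & z = z'"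
 proof -
 have "n = card A'" using Suc.hyps(2) A' by (metis card_insert_disjoint diff_Suc_1)
 moreover have "(\<Sum>r\<in>A'. (card (Z r))\<^sup>2) < S" using Suc.prems(3) sumA by linarith
 moreover have "!!r. r \<in> A' ==> finite (Z r)" using Suc.prems(2) by (simp add: A'_def)
 ultimately show ?thesis using Suc.hyps(1)[of A'] A'(1) that by metis
 qed
 define bad where "bad = (%(r, z, z0). disp r + z - z0) ` (SIGMA r:A'. Z r \<times> Z r0)"
 have fin: "finite (SIGMA r:A'. Z r \<times> Z r0)" using A' Suc.prems(2) r0(1) by auto
 have "card bad <= card (SIGMA r:A'. Z r \<times> Z r0)" unfolding bad_def using fin by (rule card_image_le)
 also have "... = (\<Sum>r\<in>A'. card (Z r) * card (Z r0))"
 using A' Suc.prems(2) r0(1) by (subst card_SigmaI) (auto simp: card_cartesian_product)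
 also have "... <= (\<Sum>r\<in>A'. (card (Z r))\<^sup>2)"
 by (rule sum_mono) (use r0(2) A'(3) in \<open>auto simp: power2_eq_square\<close>)
 also have "... < card {..<S}" using Suc.prems(3) sumA by simp
 finally have "\<not> {..<S} \<subseteq> bad"
 using card_mono[of bad "{..<S}"] fin by (auto simp: bad_def)
 then obtain b where b: "b < S" "b ~: bad" by auto
 have nb: "b + z0 ~= disp r + z" if "r \<in> A'" "z \<in> Z r" "z0 \<in> Z r0" for r z z0
 proof
 assume "b + z0 = disp r + z"
 then have "b = disp r + z - z0" by simp
 then have "b \<in> bad" unfolding bad_def using that by (force intro!: image_eqI[of _ _ "(r, z, z0)"])
 with b(2) show False by simp
 qed
 show ?case
 proof (intro exI[of _ "disp(r0 := b)"] conjI)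
 show "ALL r. (disp(r0 := b)) r < S" using d(1) b(1) by simp
 show "\<forall>r\<in>A. \<forall>r'\<in>A. \<forall>z\<in>Z r. \<forall>z'\<in>Z r'. (disp(r0 := b)) r + z = (disp(r0 := b)) r' + z' --> r = r' & z = z'"
 unfolding A'(3) using d(2) nb A'(2) by (auto simp: eq_commute)
 qed
qed

lemma ex_small_sum:
 fixes f :: "nat => nat"
 assumes "(\<Sum>\<tau><R. f \<tau>) <= B" "R > 0"
 shows "\<exists>\<tau><R. R * f \<tau> <= B"
proof (rule ccontr)
 assume "\<not> ?thesis"
 then have "\<forall>\<tau>\<in>{..<R}. B < R * f \<tau>" by auto
 then have "(\<Sum>\<tau><R. B) < (\<Sum>\<tau><R. R * f \<tau>)" using assms(2)
 by (intro sum_strict_mono) (auto simp: lessThan_empty_iff)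
 also have "... = R * (\<Sum>\<tau><R. f \<tau>)" by (simp add: sum_distrib_left)
 finally show False using assms by auto
qed

lemma mod_add_cancel_left:
 fixes a b i R :: nat
 assumes "(i + a) mod R = (i + b) mod R" "a < R" "b < R"
 shows "a = b"
 using assms
proof (induction a b rule: linorder_wlog)
 case (le a b)
 then have "R dvd (i + b) - (i + a)" using mod_eq_dvd_iff_nat[of "i + a" "i + b" R] by auto
 then show ?case using le by (auto dest: dvd_imp_le)
qed auto

lemma sum_shift_mod:
 fixes f :: "nat => nat"
 assumes "R > 0"
 shows "(\<Sum>\<tau><R. f ((i + \<tau>) mod R)) = (\<Sum>r<R. f r)"
proof (rule sum.reindex_bij_betw)
 have inj: "inj_on (%\<tau>. (i + \<tau>) mod R) {..<R}"
 using mod_add_cancel_left by (auto intro!: inj_onI)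
 then have "(%\<tau>. (i + \<tau>) mod R) ` {..<R} = {..<R}"
 using assms by (intro endo_inj_surj) auto
 with inj show "bij_betw (%\<tau>. (i + \<tau>) mod R) {..<R} {..<R}" by (simp add: bij_betw_def)
qed

text \<open>The number of pairs with column in \<open>C\<close> that land in row \<open>r\<close>
  when column \<open>z\<close> is rotated by \<open>T z\<close> modulo \<open>R\<close>. Its sum of
  squares is what the displacement of the rows needs to be small.\<close>

definition load :: "nat => (nat => nat set) => nat set => (nat => nat) => nat => nat" where
 "load R I C T r = (\<Sum>z\<in>C. \<Sum>i\<in>I z. of_bool ((i + T z) mod R = r))"

lemma sum_load:
 assumes "R > 0"
 shows "(\<Sum>r<R. load R I C T r) = (\<Sum>z\<in>C. card (I z))"
proof -
 have "(\<Sum>r<R. load R I C T r) = (\<Sum>z\<in>C. \<Sum>i\<in>I z. \<Sum>r<R. of_bool ((i + T z) mod R = r))"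
 unfolding load_def by (subst sum.swap, rule sum.cong[OF refl], rule sum.swap)
 also have "... = (\<Sum>z\<in>C. \<Sum>i\<in>I z. 1)"
 using assms by (intro sum.cong refl) (simp add: of_bool_def sum.delta)
 finally show ?thesis by simp
qed

text \<open>The columns are shifted one after the other; a shift of average cost exists by counting.\<close>

lemma shift_columns:
 assumes "finite C" "!!z. z \<in> C ==> finite (I z) & I z \<subseteq> {..<R}" "R > 0"
 shows "EX T. (ALL z. T z < R) &
 R * (\<Sum>r<R. (load R I C T r)\<^sup>2) <= R * (\<Sum>z\<in>C. card (I z)) + (\<Sum>z\<in>C. card (I z))\<^sup>2"
 using assms(1,2)
proof (induction C rule: finite_induct)
 case empty
 then show ?case using assms(3) by (intro exI[of _ "%_. 0"]) (simp add: load_def)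
next
 case (insert z0 C)
 define m where "m = (\<Sum>z\<in>C. card (I z))"
 define k where "k = card (I z0)"
 obtain T where T: "ALL z. T z < R" "R * (\<Sum>r<R. (load R I C T r)\<^sup>2) <= R * m + m\<^sup>2"
 using insert by (auto simp: m_def)
 define ld where "ld = load R I C T"
 define cost where "cost = (%\<tau>. \<Sum>i\<in>I z0. ld ((i + \<tau>) mod R))"
 have "(\<Sum>\<tau><R. cost \<tau>) = (\<Sum>i\<in>I z0. \<Sum>\<tau><R. ld ((i + \<tau>) mod R))"
 unfolding cost_def by (rule sum.swap)
 also have "... = k * m"
 using sum_shift_mod[OF assms(3), of ld] sum_load[OF assms(3), of I C T]
 by (simp add: ld_def m_def k_def)
 finally obtain \<tau> where \<tau>: "\<tau> < R" "R * cost \<tau> <= k * m"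
 using ex_small_sum[of cost R "k * m"] assms(3) by auto
 define T' where "T' = T(z0 := \<tau>)"
 define hit where "hit = (%r. \<Sum>i\<in>I z0. of_bool ((i + \<tau>) mod R = r) :: nat)"
 have I0: "finite (I z0)" "I z0 \<subseteq> {..<R}" using insert.prems by auto
 have ld': "load R I (insert z0 C) T' r = ld r + hit r" for r
 using insert.hyps unfolding load_def ld_def hit_def T'_def
 by (auto intro!: sum.cong)
 \<comment> \<open>Rotation is injective on one column, so a row receives at most one pair from the
   new column; thus \<open>hit r\<close> equals its own square.\<close>
 have hit1: "hit r <= 1" for r
 proof -
 have "hit r = card {i \<in> I z0. (i + \<tau>) mod R = r}"
 unfolding hit_def using I0 by (simp add: of_bool_def sum.If_cases Int_def)
 also have "... <= 1"
 proof (rule card_le_Suc0_iff_eq[THEN iffD2, simplified One_nat_def[symmetric]])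
 show "finite {i \<in> I z0. (i + \<tau>) mod R = r}" using I0 by auto
 show "\<forall>a1\<in>{i \<in> I z0. (i + \<tau>) mod R = r}. \<forall>a2\<in>{i \<in> I z0. (i + \<tau>) mod R = r}. a1 = a2"
 proof (intro ballI)
 fix a b assume "a \<in> {i \<in> I z0. (i + \<tau>) mod R = r}" "b \<in> {i \<in> I z0. (i + \<tau>) mod R = r}"
 then have "(\<tau> + a) mod R = (\<tau> + b) mod R" "a < R" "b < R" using I0 by (auto simp: add.commute)
 then show "a = b" by (rule mod_add_cancel_left)
 qed
 qed
 finally show ?thesis .
 qed
 then have hit2: "(hit r)\<^sup>2 = hit r" for r
 by (metis One_nat_def bot_nat_0.extremum le_Suc_eq le_antisym power_0 power_one zero_power2 One_nat_def)
 have sumhit: "(\<Sum>r<R. hit r) = k"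
 using sum_load[OF assms(3), of I "{z0}" "%_. \<tau>"] by (simp add: load_def hit_def k_def)
 have cross: "(\<Sum>r<R. ld r * hit r) = cost \<tau>"
 proof -
 have "(\<Sum>r<R. ld r * hit r) = (\<Sum>i\<in>I z0. \<Sum>r<R. ld r * of_bool ((i + \<tau>) mod R = r))"
 unfolding hit_def sum_distrib_left by (rule sum.swap)
 also have "... = cost \<tau>" unfolding cost_def
 using assms(3) by (intro sum.cong refl) (simp add: of_bool_def if_distrib sum.delta cong: if_cong)
 finally show ?thesis .
 qed
 have "(\<Sum>r<R. (load R I (insert z0 C) T' r)\<^sup>2) = (\<Sum>r<R. (ld r)\<^sup>2 + 2 * (ld r * hit r) + hit r)"
 unfolding ld' by (simp add: power2_sum hit2 algebra_simps)
 also have "... = (\<Sum>r<R. (ld r)\<^sup>2) + 2 * cost \<tau> + k"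
 by (simp add: sum.distrib sum_distrib_left[symmetric] cross sumhit)
 finally have eq: "R * (\<Sum>r<R. (load R I (insert z0 C) T' r)\<^sup>2) =
 R * (\<Sum>r<R. (ld r)\<^sup>2) + 2 * (R * cost \<tau>) + R * k"
 by (simp add: algebra_simps)
 have "R * (\<Sum>r<R. (load R I (insert z0 C) T' r)\<^sup>2) <= R * (m + k) + (m + k)\<^sup>2"
 unfolding eq using T(2) \<tau>(2) by (simp add: ld_def power2_sum algebra_simps)
 moreover have "(\<Sum>z\<in>insert z0 C. card (I z)) = m + k"
 using insert.hyps by (simp add: m_def k_def)
 moreover have "ALL z. T' z < R" using T(1) \<tau>(1) by (simp add: T'_def)
 ultimately show ?case by (intro exI[of _ T']) simp
qed

text \<open>The double displacement scheme of Tarjan and Yao: sparse sets of pairs have a perfect hash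
 function that is evaluated with two table lookups.\<close>

lemma double_displacement:
 fixes K :: "(nat \<times> nat) set"
 assumes "finite K" "fst ` K \<subseteq> {..<R}" "card K <= R" "R > 0"
 shows "EX T disp. (ALL z. T z < R) & (ALL r. disp r <= 2 * R) &
 (\<forall>(i, z) \<in> K. \<forall>(i', z') \<in> K.
 disp ((i + T z) mod R) + z = disp ((i' + T z') mod R) + z' --> i = i' & z = z')"
proof -
 define C where "C = snd ` K"
 define I where "I = (%z. {i. (i, z) \<in> K})"
 have fC: "finite C" using assms(1) by (simp add: C_def)
 have I: "finite (I z) & I z \<subseteq> {..<R}" for z
 proof -
 have "I z \<subseteq> fst ` K" by (force simp: I_def)
 then show ?thesis using assms(1,2) by (meson finite_imageI finite_subset order_trans)
 qed
 have K: "K = (%(z, i). (i, z)) ` (SIGMA z:C. I z)"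
 by (force simp: C_def I_def)
 have "card K = card (SIGMA z:C. I z)" unfolding K by (rule card_image) (auto simp: inj_on_def)
 also have "... = (\<Sum>z\<in>C. card (I z))" using fC I by (subst card_SigmaI) auto
 finally have m: "(\<Sum>z\<in>C. card (I z)) = card K" by simp
 obtain T where T: "ALL z. T z < R"
 "R * (\<Sum>r<R. (load R I C T r)\<^sup>2) <= R * card K + (card K)\<^sup>2"
 using shift_columns[of C I R] fC I assms(4) unfolding m by auto
 note T(2)
 also have "R * card K + (card K)\<^sup>2 <= R * (2 * R)"
 proof -
 have "R * card K <= R * R" "card K * card K <= R * R" using assms(3) by (intro mult_le_mono; simp)+
 then show ?thesis unfolding power2_eq_square by linarith
 qed
 finally have ld: "(\<Sum>r<R. (load R I C T r)\<^sup>2) <= 2 * R" using assms(4) by simp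
 \<comment> \<open>After the rotation row \<open>r\<close> holds the columns in \<open>Z r\<close>.
   Row and column together still determine the pair, because the rotation of a fixed column is
   injective.\<close>
 define Z where "Z = (%r. {z \<in> C. \<exists>i\<in>I z. (i + T z) mod R = r})"
 have fZ: "finite (Z r)" for r using fC by (simp add: Z_def)
 have cZ: "card (Z r) <= load R I C T r" for r
 proof -
 have "card (Z r) = (\<Sum>z\<in>Z r. 1)" by simp
 also have "... <= (\<Sum>z\<in>Z r. \<Sum>i\<in>I z. of_bool ((i + T z) mod R = r))"
 proof (rule sum_mono)
 fix z assume "z \<in> Z r"
 then obtain i where i: "i \<in> I z" "(i + T z) mod R = r" by (auto simp: Z_def)
 have "(\<Sum>i\<in>{i}. of_bool ((i + T z) mod R = r)) <= (\<Sum>i\<in>I z. of_bool ((i + T z) mod R = r) :: nat)"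
 by (rule sum_mono2) (use i I in auto)
 then show "(1::nat) <= (\<Sum>i\<in>I z. of_bool ((i + T z) mod R = r))" using i by simp
 qed
 also have "... <= load R I C T r" unfolding load_def
 by (rule sum_mono2) (use fC in \<open>auto simp: Z_def\<close>)
 finally show ?thesis .
 qed
 have "(\<Sum>r<R. (card (Z r))\<^sup>2) <= (\<Sum>r<R. (load R I C T r)\<^sup>2)"
 by (intro sum_mono power_mono cZ) auto
 also have "... < 2 * R + 1" using ld by simp
 finally obtain disp where disp: "ALL r. disp r < 2 * R + 1"
 "\<forall>r\<in>{..<R}. \<forall>r'\<in>{..<R}. \<forall>z\<in>Z r. \<forall>z'\<in>Z r'. disp r + z = disp r' + z' --> r = r' & z = z'"
 using displace_rows[of "{..<R}" Z "2 * R + 1"] fZ by auto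
 have Zm: "z \<in> Z ((i + T z) mod R)" if "(i, z) \<in> K" for i z
 using that by (force simp: Z_def C_def I_def)
 have inj: "i = i' & z = z'"
 if A: "(i, z) \<in> K" "(i', z') \<in> K" "disp ((i + T z) mod R) + z = disp ((i' + T z') mod R) + z'"
 for i z i' z'
 proof -
 have "(i + T z) mod R \<in> {..<R}" "(i' + T z') mod R \<in> {..<R}" using assms(4) by auto
 then have eq: "(i + T z) mod R = (i' + T z') mod R" "z = z'"
 using disp(2) Zm[OF A(1)] Zm[OF A(2)] A(3) by blast+
 moreover have "i < R" "i' < R" using A assms(2) by force+
 ultimately show "i = i' & z = z'"
 using mod_add_cancel_left[of "T z" i R i'] by (simp add: add.commute)
 qed
 show ?thesis
 by (intro exI[of _ T] exI[of _ disp] conjI)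
 (use T(1) disp(1) inj in \<open>auto simp: less_Suc_eq_le\<close>)
qed

section \<open>Binary tries in which the exit node of a query determines the answer\<close>

text \<open>Heap numbering: the prefix of length \<open>j\<close> of the \<open>L\<close>-bit number
  \<open>q\<close> with a leading 1, so that nodes of different depths get different
  numbers.\<close>

definition trie_key :: "nat => nat => nat => nat" where
 "trie_key L j q = 2 ^ j + q div 2 ^ (L - j)"

text \<open>The root is a node even if \<open>X\<close> is empty, so every query has a deepest node
  in the trie.\<close>

definition trie_keys :: "nat => nat set => nat set" where
 "trie_keys L X = insert 1 (\<Union>j\<le>L. trie_key L j ` X)"

lemma trie_key_less:
 assumes "q < 2 ^ L" "j <= L"
 shows "q div 2 ^ (L - j) < 2 ^ j" "trie_key L j q < 2 ^ Suc j"
proof -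
 have "q < 2 ^ j * 2 ^ (L - j)" using assms by (simp add: power_add[symmetric])
 then show "q div 2 ^ (L - j) < 2 ^ j" by (simp add: less_mult_imp_div_less)
 then show "trie_key L j q < 2 ^ Suc j" by (simp add: trie_key_def)
qed

lemma trie_key_inj:
 assumes "trie_key L j q = trie_key L j' q'" "q < 2 ^ L" "q' < 2 ^ L" "j <= L" "j' <= L"
 shows "j = j' & q div 2 ^ (L - j) = q' div 2 ^ (L - j)"
proof -
 have *: "\<not> a < b" if "trie_key L a x = trie_key L b y" "x < 2 ^ L" "a <= L" for a b x y
 proof
 assume "a < b"
 then have "(2::nat) ^ Suc a <= 2 ^ b" by (intro power_increasing) auto
 then show False using trie_key_less(2)[OF that(2,3)] that(1) by (simp add: trie_key_def)
 qed
 have "j = j'" using *[OF assms(1,2,4)] *[OF assms(1)[symmetric] assms(3,5)] by simp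
 then show ?thesis using assms(1) by (simp add: trie_key_def)
qed

lemma div_pow2_Suc: "Suc j <= L ==> q div 2 ^ (L - j) = q div 2 ^ (L - Suc j) div (2::nat)"
 by (metis Suc_diff_Suc Suc_le_lessD div_mult2_eq power_Suc2)

lemma trie_keys_iff:
 assumes "X \<subseteq> {..<2 ^ L}" "q < 2 ^ L" "j <= L"
 shows "trie_key L j q \<in> trie_keys L X \<longleftrightarrow>
 j = 0 \<or> (\<exists>x\<in>X. x div 2 ^ (L - j) = q div 2 ^ (L - j))"
proof -
 have "trie_key L j q ~= 1" if "j ~= 0"
 proof -
 have "(2::nat) ^ 1 <= 2 ^ j" using that by (intro power_increasing) auto
 then show ?thesis unfolding trie_key_def power_one_right by linarith
 qed
 then have "trie_key L j q = 1 \<longleftrightarrow> j = 0"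
 using assms(2) by (auto simp: trie_key_def)
 moreover have "trie_key L j q \<in> (\<Union>j\<le>L. trie_key L j ` X) \<longleftrightarrow>
 (\<exists>x\<in>X. x div 2 ^ (L - j) = q div 2 ^ (L - j))"
 proof
 assume "trie_key L j q \<in> (\<Union>j\<le>L. trie_key L j ` X)"
 then obtain j' x where "j' <= L" "x \<in> X" "trie_key L j q = trie_key L j' x" by auto
 then show "\<exists>x\<in>X. x div 2 ^ (L - j) = q div 2 ^ (L - j)"
 using trie_key_inj[of L j q j' x] assms by force
 next
 assume "\<exists>x\<in>X. x div 2 ^ (L - j) = q div 2 ^ (L - j)"
 then obtain x where "x \<in> X" "trie_key L j x = trie_key L j q" by (auto simp: trie_key_def)
 then show "trie_key L j q \<in> (\<Union>j\<le>L. trie_key L j ` X)" using assms(3) by (metis UN_I atMost_iff imageI)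
 qed
 ultimately show ?thesis by (auto simp: trie_keys_def)
qed

lemma trie_keys_mono:
 assumes "X \<subseteq> {..<2 ^ L}" "q < 2 ^ L" "Suc j <= L" "trie_key L (Suc j) q \<in> trie_keys L X"
 shows "trie_key L j q \<in> trie_keys L X"
 using assms trie_keys_iff[OF assms(1,2)] div_pow2_Suc[OF assms(3)] by (metis Suc_leD nat.distinct(1))

lemma less_iff_div_less: "x div m ~= y div m ==> x < y \<longleftrightarrow> x div m < y div (m::nat)"
 by (metis div_le_mono linorder_not_le nat_less_le)

text \<open>A key below the common exit node lies in a child that both queries avoid, so both
  continue in the other child and compare with the key alike. A key outside that node compares alike
  with everything below it. At depth \<open>L\<close> the two queries coincide.\<close>

lemma trie_agree:
 assumes X: "X \<subseteq> {..<2 ^ L}" and q: "q < 2 ^ L" "q' < 2 ^ L" and j: "j <= L"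
 and eq: "q div 2 ^ (L - j) = q' div 2 ^ (L - j)"
 and "j = L \<or> trie_key L (Suc j) q ~: trie_keys L X & trie_key L (Suc j) q' ~: trie_keys L X"
 and x: "x \<in> X"
 shows "x < q \<longleftrightarrow> x < q'"
proof (cases "j = L")
 case True
 then show ?thesis using eq by simp
next
 case False
 then have sj: "Suc j <= L" using j by simp
 define a where "a = x div 2 ^ (L - Suc j)"
 define b where "b = q div 2 ^ (L - Suc j)"
 define b' where "b' = q' div 2 ^ (L - Suc j)"
 have ne: "a ~= b" "a ~= b'"
 using assms(6) False x trie_keys_iff[OF X q(1) sj] trie_keys_iff[OF X q(2) sj]
 by (auto simp: a_def b_def b'_def)
 have bb: "b div 2 = b' div 2" using eq div_pow2_Suc[OF sj] by (simp add: b_def b'_def)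
 have "x < q \<longleftrightarrow> a < b" "x < q' \<longleftrightarrow> a < b'"
 using less_iff_div_less ne unfolding a_def b_def b'_def by blast+
 moreover have "a < b \<longleftrightarrow> a < b'" using bb ne by linarith
 ultimately show ?thesis by simp
qed

text \<open>Reduces a predecessor query to one table access: an answer that depends only on the
  comparisons with \<open>X\<close> is a function of the node at which the query leaves the trie,
  and can be stored there.\<close>

lemma trie_record:
 assumes X: "X \<subseteq> {..<2 ^ L}"
 and F: "!!q q'. q < 2 ^ L ==> q' < 2 ^ L ==> \<forall>x\<in>X. x < q \<longleftrightarrow> x < q' ==> F q = F q'"
 shows "EX G. ALL q j. q < 2 ^ L --> j <= L -->
 (j = L \<or> trie_key L (Suc j) q ~: trie_keys L X) --> G (trie_key L j q) = F q"
proof -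
 define ok where "ok = (%z q. q < 2 ^ L & (\<exists>j\<le>L. z = trie_key L j q &
 (j = L \<or> trie_key L (Suc j) q ~: trie_keys L X)))"
 define G where "G = (%z. F (SOME q. ok z q))"
 have "G (trie_key L j q) = F q"
 if q: "q < 2 ^ L" "j <= L" "j = L \<or> trie_key L (Suc j) q ~: trie_keys L X" for q j
 proof -
 define q' where "q' = (SOME q'. ok (trie_key L j q) q')"
 have "ok (trie_key L j q) q'" unfolding q'_def
 by (rule someI[of _ q]) (use q in \<open>auto simp: ok_def\<close>)
 then obtain j' where j': "q' < 2 ^ L" "j' <= L" "trie_key L j q = trie_key L j' q'"
 "j' = L \<or> trie_key L (Suc j') q' ~: trie_keys L X" by (auto simp: ok_def)
 have "j = j'" "q div 2 ^ (L - j) = q' div 2 ^ (L - j)"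
 using trie_key_inj[OF j'(3) q(1) j'(1) q(2) j'(2)] by auto
 then have "\<forall>x\<in>X. x < q' \<longleftrightarrow> x < q"
 using trie_agree[OF X q(1) j'(1) q(2)] q(3) j'(4) by blast
 then show ?thesis using F[OF j'(1) q(1)] by (simp add: G_def q'_def)
 qed
 then show ?thesis by blast
qed

lemma card_trie_keys:
 assumes "finite X"
 shows "finite (trie_keys L X)" "card (trie_keys L X) <= 1 + (L + 1) * card X"
proof -
 show "finite (trie_keys L X)" using assms by (auto simp: trie_keys_def)
 have "card (\<Union>j\<le>L. trie_key L j ` X) <= (\<Sum>j\<le>L. card (trie_key L j ` X))"
 by (rule card_UN_le) simp
 also have "... <= (\<Sum>j\<le>L. card X)" by (intro sum_mono card_image_le assms)
 finally have "card (\<Union>j\<le>L. trie_key L j ` X) <= (L + 1) * card X" by simp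
 then show "card (trie_keys L X) <= 1 + (L + 1) * card X"
 unfolding trie_keys_def using assms by (simp add: card_insert_if)
qed

lemma trie_keys_less:
 assumes "X \<subseteq> {..<2 ^ L}" "z \<in> trie_keys L X"
 shows "z < 2 ^ Suc L"
proof (cases "z = 1")
 case True
 have "1 <= (2::nat) ^ L" by simp
 then show ?thesis unfolding True power_Suc by linarith
next
 case False
 then obtain j x where "j <= L" "x \<in> X" "z = trie_key L j x" using assms(2) by (auto simp: trie_keys_def)
 then have "z < 2 ^ Suc j" using trie_key_less(2)[of x L j] assms(1) by auto
 also have "(2::nat) ^ Suc j <= 2 ^ Suc L" using \<open>j <= L\<close> by (intro power_increasing) auto
 finally show ?thesis .
qed

section \<open>The binary tree over the second coordinate\<close>

text \<open>\<open>X\<close> sends the \<open>y\<close>-rank of a point to its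
  \<open>x\<close>-rank. Points are identified with their \<open>y\<close>-ranks, which are the
  leaves of the binary tree.\<close>

locale perm_tree =
 fixes L :: nat and X :: "nat => nat"
 assumes bij: "bij_betw X {..<2 ^ L} {..<2 ^ L}"
begin

abbreviation N :: nat where "N \<equiv> 2 ^ L"

definition S :: "nat => nat" where "S t = 2 ^ (L - t)"

text \<open>Each depth \<open>t\<close> is a permutation of all points: nodes from left to right,
  each an interval of \<open>S t\<close> positions, and inside a node the order of the
  \<open>x\<close>-ranks. Below, \<open>A t\<close> is the inverse, so \<open>A t p\<close> is the
  \<open>y\<close>-rank of the point at position \<open>p\<close>.\<close>

definition pos :: "nat => nat => nat" where
 "pos t y = y div S t * S t + card {y'. y' < N & y' div S t = y div S t & X y' < X y}"

lemma S_pos [simp]: "S t > 0"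
 by (simp add: S_def)

lemma S_dvd: "t <= L ==> N = 2 ^ t * S t"
 by (simp add: S_def power_add[symmetric])

lemma X_inj: "y < N ==> y' < N ==> X y = X y' \<longleftrightarrow> y = y'"
 using bij by (auto simp: bij_betw_def inj_on_def)

lemma X_less: "y < N ==> X y < N"
 using bij by (auto simp: bij_betw_def)

lemma div_S_less: "t <= L ==> y < N ==> y div S t < 2 ^ t"
 using S_dvd[of t] by (simp add: less_mult_imp_div_less)

lemma card_node: "card {y'. y' div S t = v} = S t" and finite_node: "finite {y'. y' div S t = v}"
proof -
 have eq: "{y'. y' div S t = v} = {v * S t..<v * S t + S t}"
 proof (intro set_eqI iffI)
 fix y assume "y \<in> {y'. y' div S t = v}"
 then have "v * S t + y mod S t = y" using div_mult_mod_eq[of y "S t"] by simp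
 moreover have "y mod S t < S t" by simp
 ultimately show "y \<in> {v * S t..<v * S t + S t}" by (metis add_less_cancel_left atLeastLessThan_iff le_add1)
 next
 fix y assume "y \<in> {v * S t..<v * S t + S t}"
 then show "y \<in> {y'. y' div S t = v}" by (auto intro!: div_nat_eqI simp: mult.commute)
 qed
 show "card {y'. y' div S t = v} = S t" unfolding eq by simp
 show "finite {y'. y' div S t = v}" unfolding eq by simp
qed

lemma card_before_less:
 assumes "y < N"
 shows "card {y'. y' < N & y' div S t = y div S t & X y' < X y} < S t"
proof -
 have "{y'. y' < N & y' div S t = y div S t & X y' < X y} \<subset> {y'. y' div S t = y div S t}"
 by auto
 from psubset_card_mono[OF finite_node this] show ?thesis by (simp only: card_node)
qed

lemma pos_div: "y < N ==> pos t y div S t = y div S t"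
 using card_before_less[of y t] by (simp add: pos_def)

lemma pos_less: assumes "y < N" "t <= L" shows "pos t y < N"
proof -
 have "pos t y div S t < 2 ^ t" using pos_div[OF assms(1)] div_S_less[OF assms(2,1)] by simp
 then show ?thesis using S_dvd[OF assms(2)] by (simp add: div_less_iff_less_mult)
qed

lemma pos_less_iff:
 assumes "y < N" "y' < N" "y div S t = y' div S t"
 shows "pos t y < pos t y' \<longleftrightarrow> X y < X y'"
proof -
 have *: "pos t a < pos t b" if "a < N" "b < N" "a div S t = b div S t" "X a < X b" for a b
 proof -
 have "card {y'. y' < N & y' div S t = a div S t & X y' < X a} <
 card {y'. y' < N & y' div S t = b div S t & X y' < X b}"
 by (rule psubset_card_mono) (use that in auto)
 then show ?thesis using that by (simp add: pos_def)
 qed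
 show ?thesis
 using *[OF assms] *[OF assms(2,1) assms(3)[symmetric]] X_inj[OF assms(1,2)]
 by (cases "X y" "X y'" rule: linorder_cases) auto
qed

lemma pos_inj:
 assumes "y < N" "y' < N" "pos t y = pos t y'"
 shows "y = y'"
proof -
 have d: "y div S t = y' div S t"
 using pos_div[OF assms(1), of t] pos_div[OF assms(2), of t] assms(3) by simp
 show ?thesis
 using pos_less_iff[OF assms(1,2) d] pos_less_iff[OF assms(2,1) d[symmetric]] assms(3) X_inj[OF assms(1,2)]
 by (cases "X y" "X y'" rule: linorder_cases) auto
qed

lemma bij_pos: "t <= L ==> bij_betw (pos t) {..<N} {..<N}"
proof -
 assume t: "t <= L"
 have inj: "inj_on (pos t) {..<N}" using pos_inj by (auto simp: inj_on_def)
 moreover have "pos t ` {..<N} = {..<N}"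
 by (rule endo_inj_surj) (use inj pos_less[OF _ t] in auto)
 ultimately show ?thesis by (simp add: bij_betw_def)
qed

lemma pos_L: "y < N ==> pos L y = y"
 by (simp add: pos_def S_def)

definition A :: "nat => nat => nat" where
 "A t = the_inv_into {..<N} (pos t)"

lemma pos_A: "t <= L ==> p < N ==> pos t (A t p) = p"
 using bij_pos[of t] by (simp add: A_def bij_betw_def f_the_inv_into_f)

lemma A_pos: "t <= L ==> y < N ==> A t (pos t y) = y"
 using bij_pos[of t] by (simp add: A_def bij_betw_def the_inv_into_f_f)

lemma A_less: "t <= L ==> p < N ==> A t p < N"
 using bij_betw_the_inv_into[OF bij_pos[of t]] by (auto simp: A_def bij_betw_def)

lemma A_div: "t <= L ==> p < N ==> A t p div S t = p div S t"
 using pos_div[OF A_less] pos_A by metis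

lemma A_inj: "t <= L ==> p < N ==> p' < N ==> A t p = A t p' ==> p = p'"
 by (metis pos_A)

lemma X_A_less:
 "t <= L ==> p < N ==> p' < N ==> p div S t = p' div S t ==> X (A t p) < X (A t p') \<longleftrightarrow> p < p'"
 using pos_less_iff[of "A t p" "A t p'" t] A_less A_div pos_A by metis

text \<open>The position at depth \<open>t\<close> where the points of node \<open>v\<close> with
  \<open>x\<close>-rank at least \<open>l\<close> begin; it is the end of the node if there are
  none.\<close>

definition rank :: "nat => nat => nat => nat" where
 "rank t v l = v * S t + card {y. y < N & y div S t = v & X y < l}"

lemma rank_le: "rank t v l <= v * S t + S t"
proof -
 have "card {y. y < N & y div S t = v & X y < l} <= card {y'. y' div S t = v}"
 by (rule card_mono[OF finite_node]) auto
 then show ?thesis by (simp add: rank_def card_node)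
qed

lemma rank_ge: "v * S t <= rank t v l"
 by (simp add: rank_def)

lemma less_rank_iff:
 assumes "t <= L" "p < N" "p div S t = v"
 shows "X (A t p) < l \<longleftrightarrow> p < rank t v l"
proof -
 define y where "y = A t p"
 have y: "y < N" "y div S t = v" using A_less A_div assms by (auto simp: y_def)
 have p: "p = v * S t + card {y'. y' < N & y' div S t = v & X y' < X y}"
 using pos_A[OF assms(1,2)] y by (simp add: pos_def y_def)
 have fin: "finite {y. y < N & y div S t = v & X y < l}" for l
 by (rule finite_subset[OF _ finite_node[of t v]]) auto
 show ?thesis
 proof (cases "X y < l")
 case True
 then have "card {y'. y' < N & y' div S t = v & X y' < X y} < card {y. y < N & y div S t = v & X y < l}"
 by (intro psubset_card_mono fin) (use y in auto)
 then have "p < rank t v l" unfolding rank_def using p by linarith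
 then show ?thesis using True by (simp add: y_def)
 next
 case False
 then have "card {y'. y' < N & y' div S t = v & X y' < l} <= card {y'. y' < N & y' div S t = v & X y' < X y}"
 by (intro card_mono fin) auto
 then have "\<not> p < rank t v l" unfolding rank_def using p by linarith
 then show ?thesis using False by (simp add: y_def)
 qed
qed

text \<open>The step of the ball inheritance structure: a position is translated to a deeper level by
 means of a sparse table (\<^term>\<open>base\<close>) and two short fields.\<close>

lemma inherit:
 assumes t: "t <= t'" "t' <= L"
 shows "EX base sel off. (ALL i. base i <= 2 * N) & (ALL p. sel p < 2 ^ (t' - t)) & (ALL p. off p < 2 ^ \<kappa>) &
 (\<forall>p < N. pos t' (A t p) = base (p div 2 ^ \<kappa> * 2 ^ (t' - t) + sel p) + off p)"
proof -
 define g where "g = t' - t"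
 define K :: nat where "K = 2 ^ \<kappa>"
 have tL: "t <= L" using t by simp
 have SS: "S t = 2 ^ g * S t'" using t by (simp add: S_def g_def power_add[symmetric])
 have sel0: "0 < (2::nat) ^ (t' - t)" "0 < K" by (auto simp: K_def)
 show ?thesis
 proof (cases "\<kappa> <= L - t")
 case False
 \<comment> \<open>A block consists of whole nodes and a point never leaves its node, so the block
   number is kept by the jump. \<open>base\<close> returns the start of the block,
   \<open>off\<close> is the residue, and \<open>sel\<close> can be 0.\<close>
 then have "S t dvd K" by (simp add: K_def S_def le_imp_power_dvd)
 then obtain c where c: "K = S t * c" by auto
 define off where "off = (%p. (pos t' (A t p)) mod K)"
 have same: "pos t' (A t p) div K = p div K" if "p < N" for p
 proof -
 have "A t p < N" using A_less tL that by simp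
 then have "pos t' (A t p) div S t' = A t p div S t'" by (rule pos_div)
 then have "pos t' (A t p) div S t = A t p div S t"
 unfolding SS by (metis div_mult2_eq mult.commute)
 also have "... = p div S t" using A_div tL that by simp
 finally show ?thesis unfolding c by (simp add: div_mult2_eq)
 qed
 have d: "pos t' (A t p) = min (2 * N) ((p div 2 ^ \<kappa> * 2 ^ (t' - t) + 0) div 2 ^ (t' - t) * K) + off p"
 if "p < N" for p
 proof -
 have "p div K * K <= N" using that by (meson div_times_less_eq_dividend le_trans less_imp_le)
 moreover have "pos t' (A t p) = p div K * K + off p"
 using same[OF that] div_mult_mod_eq[of "pos t' (A t p)" K] by (simp add: off_def)
 ultimately show ?thesis by (simp add: K_def)
 qed
 show ?thesis
 by (intro exI[of _ "%i. min (2 * N) (i div 2 ^ (t' - t) * K)"] exI[of _ "%_. 0"] exI[of _ off])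
 (use d in \<open>auto simp: off_def K_def\<close>)
 next
 case True
 then have "K dvd S t" by (simp add: K_def S_def le_imp_power_dvd)
 then obtain c where c: "S t = K * c" by auto
 \<comment> \<open>A block lies inside one node. An index \<open>i\<close> codes a block and one of
   the \<open>2 ^ g\<close> descendants of that node at the deeper level; \<open>Y0 i\<close> is the
   number of the descendant. \<open>base\<close> counts its points up to the start of the block, and
   \<open>off\<close> counts the earlier points of the block with the same descendant, which are
   fewer than the block length.\<close>
 define Y0 where "Y0 = (%i. i div 2 ^ g * K div S t * 2 ^ g + i mod 2 ^ g)"
 define base where "base = (%i. min (2 * N) (Y0 i * S t' +
 card {y'. y' < N & y' div S t' = Y0 i & pos t y' < i div 2 ^ g * K}))"
 define sel where "sel = (%p. A t p div S t' mod 2 ^ g)"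
 define off where "off = (%p. min (K - 1) (card {y'. y' < N & y' div S t' = A t p div S t' &
 p div K * K <= pos t y' & pos t y' < p}))"
 have "pos t' (A t p) = base (p div 2 ^ \<kappa> * 2 ^ g + sel p) + off p" if p: "p < N" for p
 proof -
 define y where "y = A t p"
 define q where "q = p div K"
 have y: "y < N" "y div S t = p div S t" "pos t y = p"
 using A_less A_div pos_A tL p by (auto simp: y_def)
 define i where "i = q * 2 ^ g + sel p"
 have i: "i div 2 ^ g = q" "i mod 2 ^ g = sel p" by (auto simp: i_def sel_def)
 have "q * K div S t = p div S t"
 proof -
 have "q * K div S t = q * K div K div c" unfolding c by (simp add: div_mult2_eq)
 also have "... = p div K div c" using sel0 by (simp add: q_def)
 also have "... = p div S t" unfolding c by (simp add: div_mult2_eq)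
 finally show ?thesis .
 qed
 moreover have "y div S t = y div S t' div 2 ^ g" unfolding SS by (metis div_mult2_eq mult.commute)
 ultimately have Y0: "Y0 i = y div S t'"
 using y(2) div_mult_mod_eq[of "y div S t'" "2 ^ g"]
 by (simp add: Y0_def i sel_def y_def[symmetric])
 have xlt: "X y' < X y \<longleftrightarrow> pos t y' < p" if "y' < N" "y' div S t' = y div S t'" for y'
 proof -
 have "y' div S t = y div S t" unfolding SS using that(2) by (metis div_mult2_eq mult.commute)
 then show ?thesis using pos_less_iff[OF that(1) y(1), of t] y(3) by simp
 qed
 define before where "before = {y'. y' < N & y' div S t' = y div S t' & pos t y' < q * K}"
 define inside where "inside = {y'. y' < N & y' div S t' = y div S t' & q * K <= pos t y' & pos t y' < p}"
 have fin: "finite before" "finite inside"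
 by (rule finite_subset[of _ "{..<N}"]; auto simp: before_def inside_def)+
 have qp: "q * K <= p" by (simp add: q_def)
 have "{y'. y' < N & y' div S t' = y div S t' & X y' < X y} = before \<union> inside"
 using xlt qp by (auto simp: before_def inside_def)
 then have "card {y'. y' < N & y' div S t' = y div S t' & X y' < X y} = card before + card inside"
 using fin by (simp add: card_Un_disjoint before_def inside_def disjoint_iff)
 then have pos: "pos t' y = y div S t' * S t' + card before + card inside"
 by (simp add: pos_def)
 have "card inside <= card {q * K..<p}"
 by (rule card_inj_on_le[of "pos t"]) (use pos_inj in \<open>auto simp: inj_on_def inside_def\<close>)
 also have "... <= K - 1"
 proof -
 have "p = q * K + p mod K" by (simp add: q_def)
 moreover have "p mod K < K" using sel0 by simp
 ultimately show ?thesis by simp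
 qed
 finally have "off p = card inside"
 by (simp add: off_def inside_def y_def[symmetric] q_def)
 moreover have "base i = y div S t' * S t' + card before"
 proof -
 have "y div S t' * S t' + card before <= 2 * N" using pos pos_less[OF y(1) t(2)] by linarith
 then show ?thesis by (simp add: base_def Y0 i before_def)
 qed
 ultimately show ?thesis using pos by (simp add: i_def q_def K_def y_def)
 qed
 note main = this
 show ?thesis
 proof (rule exI[of _ base], rule exI[of _ sel], rule exI[of _ off], intro conjI allI impI)
 show "base i <= 2 * N" for i by (simp add: base_def)
 show "sel p < 2 ^ (t' - t)" for p by (simp add: sel_def g_def)
 show "off p < 2 ^ \<kappa>" for p
 proof -
 have "off p <= K - 1" by (simp add: off_def)
 then show ?thesis using sel0 unfolding K_def by linarith
 qed
 show "pos t' (A t p) = base (p div 2 ^ \<kappa> * 2 ^ (t' - t) + sel p) + off p" if "p < N" for p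
 using main[OF that] unfolding g_def .
 qed
 qed
qed

end

section \<open>Jumps, packed fields and block skipping\<close>

lemma pack_fields:
 fixes u :: "nat => nat"
 assumes "!!i. i < f ==> u i < 2 ^ b"
 shows "\<exists>W < 2 ^ (b * f). \<forall>i < f. W div 2 ^ (i * b) mod 2 ^ b = u i"
 using assms
proof (induction f arbitrary: u)
 case 0
 then show ?case by simp
next
 case (Suc f)
 obtain W where W: "W < 2 ^ (b * f)" "\<forall>i < f. W div 2 ^ (i * b) mod 2 ^ b = u (Suc i)"
 using Suc.IH[of "%i. u (Suc i)"] Suc.prems by auto
 have u0: "u 0 < 2 ^ b" using Suc.prems by simp
 define W' where "W' = W * 2 ^ b + u 0"
 have d: "W' div 2 ^ b = W" "W' mod 2 ^ b = u 0" using u0 by (auto simp: W'_def)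
 have "W' < (W + 1) * 2 ^ b" using u0 by (simp add: W'_def)
 also have "... <= 2 ^ (b * f) * 2 ^ b" using W(1) by (intro mult_right_mono) auto
 also have "... = 2 ^ (b * Suc f)" by (simp add: power_add algebra_simps)
 finally have "W' < 2 ^ (b * Suc f)" .
 moreover have "W' div 2 ^ (i * b) mod 2 ^ b = u i" if i: "i < Suc f" for i
 proof (cases i)
 case 0
 then show ?thesis using d by simp
 next
 case (Suc k)
 have "W' div 2 ^ (i * b) = W' div 2 ^ b div 2 ^ (k * b)"
 by (simp add: Suc power_add div_mult2_eq)
 then show ?thesis using d W(2) i Suc by simp
 qed
 ultimately show ?case by blast
qed

lemma card_multiples:
 assumes "m > 0"
 shows "card {t. 0 < t & t < l & m dvd t} * m <= (l::nat)"
proof -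
 have "{t. 0 < t & t < l & m dvd t} \<subseteq> (%i. m * i) ` {1..l div m}"
 proof
 fix t assume "t \<in> {t. 0 < t & t < l & m dvd t}"
 then obtain i where i: "t = m * i" "0 < t" "t < l" by auto
 then have "1 <= i" "i <= l div m" using assms
 by (auto simp: less_eq_div_iff_mult_less_eq mult.commute intro: Suc_leI)
 then show "t \<in> (%i. m * i) ` {1..l div m}" using i by auto
 qed
 then have "card {t. 0 < t & t < l & m dvd t} <= card ((%i. m * i) ` {1..l div m})"
 by (rule card_mono[rotated]) simp
 also have "... <= card {1..l div m}" by (rule card_image_le) simp
 finally show ?thesis using assms by (simp add: less_eq_div_iff_mult_less_eq)
qed

text \<open>Levels are numbers in base \<^term>\<open>G\<close>; a jump leads to the next level with more trailing
 zeros.\<close>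

lemma jump_schedule:
 assumes G: "G >= (2::nat)" and LG: "L <= G ^ I"
 shows "EX nxt cl. (\<forall>t<L. t < nxt t & nxt t <= L & cl (nxt t) < cl t) & (ALL t. cl t <= I + 1) &
 (\<Sum>t<L. nxt t - t) <= L + I * L * G"
proof -
 \<comment> \<open>The number of trailing zeros of \<open>t\<close> in base \<open>G\<close>, capped
   at \<open>I\<close>. Because of \<open>L <= G ^ I\<close>, level 0 is the only level below
   \<open>L\<close> that reaches the cap; it jumps straight to \<open>L\<close>.\<close>
 define v where "v = (%t. Max {i. i <= I & G ^ i dvd t})"
 have v: "v t <= I" "G ^ v t dvd t" for t
 proof -
 have "v t \<in> {i. i <= I & G ^ i dvd t}" unfolding v_def
 by (rule Max_in) (auto intro!: exI[of _ 0])
 then show "v t <= I" "G ^ v t dvd t" by auto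
 qed
 have v_ge: "i <= v t" if "i <= I" "G ^ i dvd t" for i t
 unfolding v_def by (rule Max_ge) (use that in auto)
 have v_less: "v t < I" if "0 < t" "t < L" for t
 proof (rule ccontr)
 assume "\<not> v t < I"
 then have "G ^ I dvd t" using v[of t] by simp
 then have "G ^ I <= t" using that(1) by (rule dvd_imp_le)
 then show False using that LG by linarith
 qed
 define up where "up = (%t. (t div G ^ (v t + 1) + 1) * G ^ (v t + 1))"
 define nxt where "nxt = (%t. if t = 0 then L else min L (up t))"
 define cl where "cl = (%t. if t >= L then 0 else if t = 0 then I + 1 else I - v t)"
 have Gp: "G ^ i > 0" for i using G by simp
 have up: "t < up t" "up t <= t + G ^ (v t + 1)" for t
 proof -
 have "t div G ^ (v t + 1) * G ^ (v t + 1) + t mod G ^ (v t + 1) = t" by (rule div_mult_mod_eq)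
 moreover have "t mod G ^ (v t + 1) < G ^ (v t + 1)" by (rule mod_less_divisor[OF Gp])
 ultimately show "t < up t" "up t <= t + G ^ (v t + 1)" unfolding up_def add_mult_distrib by linarith+
 qed
 have step: "t < nxt t & nxt t <= L & cl (nxt t) < cl t" if t: "t < L" for t
 proof (cases "t = 0")
 case True
 then show ?thesis using t by (auto simp: nxt_def cl_def)
 next
 case False
 have vl: "v t < I" using v_less False t by simp
 have "cl (nxt t) < cl t"
 proof (cases "up t < L")
 case True
 have "G ^ (v t + 1) dvd up t" by (simp add: up_def)
 then have "v t + 1 <= v (up t)" using vl by (intro v_ge) auto
 moreover have "up t > 0" using up(1)[of t] by simp
 ultimately show ?thesis using True False t vl by (simp add: nxt_def cl_def)
 next
 case up: False
 then show ?thesis using t vl False by (simp add: nxt_def cl_def)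
 qed
 then show ?thesis using False t up(1)[of t] by (auto simp: nxt_def)
 qed
 have "(\<Sum>t<L. nxt t - t) <= (\<Sum>t<L. if t = 0 then L else G ^ (v t + 1))"
 by (rule sum_mono) (use up(2) in \<open>auto simp: nxt_def le_diff_conv add.commute min.coboundedI2\<close>)
 also have "... <= L + (\<Sum>t\<in>{0<..<L}. G ^ (v t + 1))"
 proof (cases "L = 0")
 case False
 then have "{..<L} = insert 0 {0<..<L}" by auto
 then have "(\<Sum>t<L. if t = 0 then L else G ^ (v t + 1)) =
 L + (\<Sum>t\<in>{0<..<L}. if t = 0 then L else G ^ (v t + 1))" by simp
 also have "(\<Sum>t\<in>{0<..<L}. if t = 0 then L else G ^ (v t + 1)) = (\<Sum>t\<in>{0<..<L}. G ^ (v t + 1))"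
 by (rule sum.cong) auto
 finally show ?thesis by simp
 qed simp
 \<comment> \<open>A level with \<open>v t\<close> trailing zeros jumps at most
   \<open>G ^ (v t + 1)\<close> levels. Replacing this by the sum over all \<open>i\<close> with
   \<open>G ^ i dvd t\<close> and exchanging sums, each \<open>i\<close> contributes at most
   \<open>L / G ^ i\<close> multiples of weight \<open>G ^ (i + 1)\<close>, that is
   \<open>L * G\<close>.\<close>
 also have "(\<Sum>t\<in>{0<..<L}. G ^ (v t + 1)) <= (\<Sum>t\<in>{0<..<L}. \<Sum>i<I. if G ^ i dvd t then G ^ (i + 1) else 0)"
 proof (rule sum_mono)
 fix t assume t: "t \<in> {0<..<L}"
 have "(\<Sum>i\<in>{v t}. if G ^ i dvd t then G ^ (i + 1) else 0) <= (\<Sum>i<I. if G ^ i dvd t then G ^ (i + 1) else 0)"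
 by (rule sum_mono2) (use v_less t in auto)
 then show "G ^ (v t + 1) <= (\<Sum>i<I. if G ^ i dvd t then G ^ (i + 1) else 0)" using v(2)[of t] by simp
 qed
 also have "... = (\<Sum>i<I. \<Sum>t\<in>{0<..<L}. if G ^ i dvd t then G ^ (i + 1) else 0)" by (rule sum.swap)
 also have "... = (\<Sum>i<I. card {t. 0 < t & t < L & G ^ i dvd t} * G ^ (i + 1))"
 by (intro sum.cong refl) (simp add: sum.If_cases Int_def conj_assoc)
 also have "... <= (\<Sum>i<I. L * G)"
 proof (rule sum_mono)
 fix i
 show "card {t. 0 < t & t < L & G ^ i dvd t} * G ^ (i + 1) <= L * G"
 using mult_le_mono1[OF card_multiples[OF Gp[of i], of L], of G] by (simp add: algebra_simps)
 qed
 finally have "(\<Sum>t<L. nxt t - t) <= L + I * L * G" by simp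
 moreover have "ALL t. cl t <= I + 1" by (auto simp: cl_def)
 ultimately show ?thesis using step by blast
qed

section \<open>Order types of the maxima of the children\<close>

text \<open>The relevant children are a prefix \<open>take c sg\<close> of the children in
  decreasing order of their maxima. The value \<open>d\<close> is a sentinel for the absence of a
  further relevant child.\<close>

definition next_child :: "nat => nat list => nat => nat => nat" where
 "next_child d sg c q = (LEAST q'. q <= q' & (d <= q' \<or> q' \<in> set (take c sg)))"

lemma next_child:
 assumes "q <= d" "set sg \<subseteq> {..<d}"
 shows "q <= next_child d sg c q" "next_child d sg c q <= d"
 "next_child d sg c q < d ==> next_child d sg c q \<in> set (take c sg)"
 "q <= q' ==> q' < next_child d sg c q ==> q' ~: set (take c sg)"
proof -
 have "q <= next_child d sg c q & (d <= next_child d sg c q \<or> next_child d sg c q \<in> set (take c sg))"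
 unfolding next_child_def by (rule LeastI[of _ d]) (use assms in auto)
 then show "q <= next_child d sg c q" "next_child d sg c q < d ==> next_child d sg c q \<in> set (take c sg)"
 by auto
 show "next_child d sg c q <= d" unfolding next_child_def by (rule Least_le) (use assms in auto)
 show "q <= q' ==> q' < next_child d sg c q ==> q' ~: set (take c sg)"
 unfolding next_child_def using not_less_Least by blast
qed

definition order_desc :: "nat => (nat => nat) => nat list" where
 "order_desc d m = rev (sort_key m [0..<d])"

lemma order_desc:
 "length (order_desc d m) = d" "set (order_desc d m) = {..<d}" "distinct (order_desc d m)"
 "i <= j ==> j < d ==> m (order_desc d m ! j) <= m (order_desc d m ! i)"
proof -
 show "length (order_desc d m) = d" "set (order_desc d m) = {..<d}" "distinct (order_desc d m)"
 by (auto simp: order_desc_def)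
 assume ij: "i <= j" "j < d"
 define xs where "xs = sort_key m [0..<d]"
 have len: "length xs = d" by (simp add: xs_def)
 have "sorted (map m xs)" by (simp add: xs_def)
 then have "map m xs ! (d - Suc j) <= map m xs ! (d - Suc i)"
 by (rule sorted_nth_mono) (use ij len in auto)
 then show "m (order_desc d m ! j) <= m (order_desc d m ! i)"
 using ij len by (simp add: order_desc_def xs_def[symmetric] rev_nth)
qed

lemma order_desc_take:
 assumes "c <= d" "!!i. i < c ==> s <= m (order_desc d m ! i)"
 "!!i. c <= i ==> i < d ==> m (order_desc d m ! i) < s"
 shows "set (take c (order_desc d m)) = {q. q < d & s <= m q}"
proof (intro set_eqI iffI)
 fix q assume "q \<in> set (take c (order_desc d m))"
 then obtain i where "i < c" "q = order_desc d m ! i"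
 using order_desc(1)[of d m] assms(1) by (auto simp: in_set_conv_nth)
 moreover have "order_desc d m ! i \<in> {..<d}"
 using nth_mem[of i "order_desc d m"] order_desc(1,2)[of d m] \<open>i < c\<close> assms(1) by auto
 ultimately show "q \<in> {q. q < d & s <= m q}" using assms(2) by auto
next
 fix q assume q: "q \<in> {q. q < d & s <= m q}"
 then have "q \<in> set (order_desc d m)" using order_desc(2) by auto
 then obtain i where i: "i < d" "q = order_desc d m ! i"
 using order_desc(1)[of d m] by (auto simp: in_set_conv_nth)
 then have "i < c" using assms(3)[of i] q by force
 then show "q \<in> set (take c (order_desc d m))"
 using i order_desc(1)[of d m] by (auto simp: in_set_conv_nth)
qed

lemma ex_type_code:
 "EX enc. inj_on enc {xs :: nat list. set xs \<subseteq> {..<d} & length xs = d} &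
 (ALL xs. set xs \<subseteq> {..<d} & length xs = d --> enc xs < d ^ d)"
proof -
 have "finite {xs :: nat list. set xs \<subseteq> {..<d} & length xs = d}"
 by (rule finite_lists_length_eq) simp
 then obtain enc where "bij_betw enc {xs :: nat list. set xs \<subseteq> {..<d} & length xs = d}
 {0..<card {xs :: nat list. set xs \<subseteq> {..<d} & length xs = d}}"
 using ex_bij_betw_finite_nat by blast
 then have "inj_on enc {xs :: nat list. set xs \<subseteq> {..<d} & length xs = d}"
 "enc ` {xs :: nat list. set xs \<subseteq> {..<d} & length xs = d} = {0..<d ^ d}"
 by (auto simp: bij_betw_def card_lists_length_eq)
 then show ?thesis by (intro exI[of _ enc]) auto
qed

lemma upt_split: "u <= v ==> v <= x ==> [u..<x] = [u..<v] @ [v..<x]"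
 using upt_add_eq_append[of u v "x - v"] by simp

section \<open>Precomputed batches of blocks with relevant values\<close>

text \<open>\<open>tm j\<close> stands for the largest value in block \<open>j\<close> at one level
  of the binary tree; maxima of different blocks differ because they belong to different
  points.\<close>

locale blocks =
 fixes L Nb Lam :: nat and tm :: "nat => nat"
 assumes tm_inj: "inj_on tm {..<Nb}" and tm_less: "j < Nb ==> tm j < 2 ^ L"
 and Nb: "Nb <= 2 ^ L" and Lam: "Lam >= 2"
begin

definition above :: "nat => nat => nat => nat list" where
 "above s u v = filter (%j. s <= tm j) [u..<v]"

definition wend :: "nat => nat => nat" where
 "wend j0 h = min Nb ((j0 div 2 ^ h + 1) * 2 ^ h)"

text \<open>The least height whose window, from \<open>j0\<close> to the end of its dyadic interval,
  holds \<open>Lam\<close> relevant blocks. The value \<open>L + 1\<close> means that no window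
  does.\<close>

definition hs :: "nat => nat => nat" where
 "hs j0 s = (LEAST h. h = L + 1 \<or> Lam <= length (above s j0 (wend j0 h)))"

text \<open>The thresholds at which the stored answer may change: in each window the
  \<open>Lam\<close> largest maxima. Thresholds at or below all of these leave \<open>Lam\<close>
  relevant blocks whenever the window has that many blocks, and such a window is not listed.\<close>

definition breaks :: "nat => nat set" where
 "breaks j0 = (\<Union>h\<le>L. tm ` {j \<in> {j0..<wend j0 h}. card {j' \<in> {j0..<wend j0 h}. tm j <= tm j'} <= Lam})"

definition rlist :: "nat => nat => nat => nat list" where
 "rlist h i s = above s (min Nb (i * 2 ^ h)) (min Nb ((i + 1) * 2 ^ h))"

definition rnext :: "nat => nat => nat => nat" where
 "rnext h i s = (if Lam <= length (rlist h i s) then rlist h i s ! (Lam - 1) + 1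
 else min Nb ((i + 1) * 2 ^ h))"

lemma above_append: "u <= v ==> v <= x ==> above s u v @ above s v x = above s u x"
 unfolding above_def filter_append[symmetric] using upt_split by metis

lemma length_above: "length (above s u v) = card {j \<in> {u..<v}. s <= tm j}"
 by (simp add: above_def distinct_length_filter Int_def conj_commute)

text \<open>If some maximum of the window lies in the gap from \<open>s\<close> to
  \<open>s'\<close>, the largest such maximum is not a break. Hence more than \<open>Lam\<close>
  maxima are at least as large, and all of them except that one are at least
  \<open>s'\<close>.\<close>

lemma above_agree:
 assumes ss: "s <= s'" and h: "h <= L" and B: "\<forall>x\<in>breaks j0. x < s \<longleftrightarrow> x < s'"
 shows "above s j0 (wend j0 h) = above s' j0 (wend j0 h) \<or>
 Lam <= length (above s j0 (wend j0 h)) & Lam <= length (above s' j0 (wend j0 h))"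
proof (cases "\<exists>j\<in>{j0..<wend j0 h}. s <= tm j & tm j < s'")
 case False
 then have "above s j0 (wend j0 h) = above s' j0 (wend j0 h)"
 unfolding above_def by (intro filter_cong refl) (use ss in auto)
 then show ?thesis by simp
next
 case True
 define W where "W = {j0..<wend j0 h}"
 define E where "E = {j \<in> W. s <= tm j & tm j < s'}"
 have E: "finite E" "E ~= {}" using True by (auto simp: E_def W_def)
 define x where "x = Max (tm ` E)"
 have "x \<in> tm ` E" unfolding x_def using E by (intro Max_in) auto
 then obtain j where j: "j \<in> E" "x = tm j" by auto
 have mx: "tm i <= tm j" if "i \<in> E" for i
 using E that j(2) unfolding x_def by (metis Max_ge finite_imageI imageI)
 have jE: "j \<in> W" "s <= tm j" "tm j < s'" using j(1) by (auto simp: E_def)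
 have "tm j ~: breaks j0" using B jE by force
 have "Lam < card {j' \<in> W. tm j <= tm j'}"
 proof (rule ccontr)
 assume "\<not> ?thesis"
 then have "j \<in> {j \<in> {j0..<wend j0 h}. card {j' \<in> {j0..<wend j0 h}. tm j <= tm j'} <= Lam}"
 using jE(1) by (simp add: W_def)
 then have "tm j \<in> breaks j0" unfolding breaks_def using h by blast
 with \<open>tm j ~: breaks j0\<close> show False by simp
 qed
 also have "... <= card (insert j {j' \<in> W. s' <= tm j'})"
 proof (rule card_mono)
 show "finite (insert j {j' \<in> W. s' <= tm j'})" by (simp add: W_def)
 show "{j' \<in> W. tm j <= tm j'} \<subseteq> insert j {j' \<in> W. s' <= tm j'}"
 proof (rule subsetI, rule ccontr)
 fix i assume "i \<in> {j' \<in> W. tm j <= tm j'}" "i ~: insert j {j' \<in> W. s' <= tm j'}"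
 then have i: "i \<in> W" "tm j <= tm i" "i ~= j" "\<not> s' <= tm i" by auto
 have "i \<in> E" using i jE by (auto simp: E_def)
 then have "tm i = tm j" using mx i(2) by (meson le_antisym)
 moreover have "i < Nb" "j < Nb" using i(1) jE(1) by (auto simp: W_def wend_def)
 ultimately have "i = j" using tm_inj by (auto simp: inj_on_def)
 then show False using i(3) by simp
 qed
 qed
 also have "... <= card {j' \<in> W. s' <= tm j'} + 1" by (simp add: card_insert_if W_def)
 finally have 1: "Lam <= card {j' \<in> W. s' <= tm j'}" by simp
 also have "... <= card {j' \<in> W. s <= tm j'}"
 by (rule card_mono) (use ss in \<open>auto simp: W_def\<close>)
 finally show ?thesis using 1 unfolding length_above W_def by blast
qed

lemma above_agree':
 assumes "h <= L" "\<forall>x\<in>breaks j0. x < s \<longleftrightarrow> x < s'"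
 shows "above s j0 (wend j0 h) = above s' j0 (wend j0 h) \<or>
 Lam <= length (above s j0 (wend j0 h)) & Lam <= length (above s' j0 (wend j0 h))"
proof (cases "s <= s'")
 case True
 then show ?thesis using above_agree assms by blast
next
 case False
 then show ?thesis using above_agree[of s' s h j0] assms by fastforce
qed

lemma hs_props:
 "hs j0 s <= L + 1" "hs j0 s = L + 1 \<or> Lam <= length (above s j0 (wend j0 (hs j0 s)))"
 "h < hs j0 s ==> length (above s j0 (wend j0 h)) < Lam" "1 <= hs j0 s"
proof -
 show "hs j0 s <= L + 1" unfolding hs_def by (rule Least_le) simp
 show a: "hs j0 s = L + 1 \<or> Lam <= length (above s j0 (wend j0 (hs j0 s)))"
 unfolding hs_def by (rule LeastI[of _ "L + 1"]) simp
 show "length (above s j0 (wend j0 h)) < Lam" if "h < hs j0 s"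
 using not_less_Least[OF that[unfolded hs_def]] by (auto simp: not_le)
 show "1 <= hs j0 s"
 proof (rule ccontr)
 assume "\<not> 1 <= hs j0 s"
 then have "hs j0 s = 0" by simp
 then have "Lam <= length (above s j0 (wend j0 0))" using a by auto
 also have "... <= length [j0..<wend j0 0]" unfolding above_def by (rule length_filter_le)
 also have "... <= 1" by (simp add: wend_def)
 finally show False using Lam by simp
 qed
qed

lemma hs_agree:
 assumes "\<forall>x\<in>breaks j0. x < s \<longleftrightarrow> x < s'"
 shows "hs j0 s = hs j0 s'"
 "above s j0 (wend j0 (hs j0 s - 1)) = above s' j0 (wend j0 (hs j0 s' - 1))"
proof -
 have "(h = L + 1 \<or> Lam <= length (above s j0 (wend j0 h))) \<longleftrightarrow>
 (h = L + 1 \<or> Lam <= length (above s' j0 (wend j0 h)))" if "h <= L + 1" for h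
 using above_agree'[OF _ assms, of h] that by (cases "h = L + 1") auto
 note iff = this
 show eq: "hs j0 s = hs j0 s'"
 proof (rule antisym)
 show "hs j0 s <= hs j0 s'" unfolding hs_def[of j0 s]
 by (rule Least_le) (use iff[OF hs_props(1)[of j0 s']] hs_props(2)[of j0 s'] in blast)
 show "hs j0 s' <= hs j0 s" unfolding hs_def[of j0 s']
 by (rule Least_le) (use iff[OF hs_props(1)[of j0 s]] hs_props(2)[of j0 s] in blast)
 qed
 have "hs j0 s - 1 < hs j0 s" "hs j0 s - 1 <= L" using hs_props(1,4)[of j0 s] by linarith+
 then show "above s j0 (wend j0 (hs j0 s - 1)) = above s' j0 (wend j0 (hs j0 s' - 1))"
 using above_agree'[OF _ assms, of "hs j0 s - 1"] hs_props(3)[of "hs j0 s - 1" j0 s] eq by force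
qed

lemma rlist_agree:
 assumes "\<forall>x\<in>tm ` {min Nb (i * 2 ^ h)..<min Nb ((i + 1) * 2 ^ h)}. x < s \<longleftrightarrow> x < s'"
 shows "rlist h i s = rlist h i s'" "rnext h i s = rnext h i s'"
proof -
 show "rlist h i s = rlist h i s'" unfolding rlist_def above_def
 by (intro filter_cong refl) (use assms in \<open>auto simp: not_less[symmetric]\<close>)
 then show "rnext h i s = rnext h i s'" by (simp add: rnext_def)
qed

lemma breaks_props: "breaks j0 \<subseteq> {..<2 ^ L}" "finite (breaks j0)" "card (breaks j0) <= (L + 1) * Lam"
proof -
 show "breaks j0 \<subseteq> {..<2 ^ L}" using tm_less by (auto simp: breaks_def wend_def)
 then show "finite (breaks j0)" by (rule finite_subset) simp
 define Z where "Z = (%h. {j \<in> {j0..<wend j0 h}. card {j' \<in> {j0..<wend j0 h}. tm j <= tm j'} <= Lam})"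
 have cZ: "card (Z h) <= Lam" for h
 proof (cases "Z h = {}")
 case False
 have fin: "finite (Z h)" by (simp add: Z_def)
 \<comment> \<open>The member with the least maximum sees all other members among the maxima at
   least as large, so the membership condition for it bounds the whole set.\<close>
 define j where "j = arg_min_on tm (Z h)"
 have j: "j \<in> Z h" "!!i. i \<in> Z h ==> tm j <= tm i"
 using arg_min_if_finite(1)[OF fin False] arg_min_least[OF fin False] by (auto simp: j_def)
 have "card (Z h) <= card {j' \<in> {j0..<wend j0 h}. tm j <= tm j'}"
 by (rule card_mono) (use j(2) in \<open>auto simp: Z_def\<close>)
 also have "... <= Lam" using j(1) by (simp add: Z_def)
 finally show ?thesis .
 qed simp
 have "breaks j0 = (\<Union>h\<le>L. tm ` Z h)" by (simp add: breaks_def Z_def)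
 then have "card (breaks j0) <= (\<Sum>h\<le>L. card (tm ` Z h))" using card_UN_le[of "{..L}" "%h. tm ` Z h"] by simp
 also have "... <= (\<Sum>h\<le>L. Lam)"
 proof (rule sum_mono)
 fix h
 have "card (tm ` Z h) <= card (Z h)" by (rule card_image_le) (simp add: Z_def)
 then show "card (tm ` Z h) <= Lam" using cZ[of h] by simp
 qed
 finally show "card (breaks j0) <= (L + 1) * Lam" by simp
qed

lemma take_filter_upt:
 assumes "0 < k" "k <= length (filter P [u..<v])"
 shows "take k (filter P [u..<v]) = filter P [u..<filter P [u..<v] ! (k - 1) + 1]"
 "u <= filter P [u..<v] ! (k - 1)" "filter P [u..<v] ! (k - 1) < v"
proof -
 define x where "x = filter P [u..<v] ! (k - 1)"
 have "x \<in> set (filter P [u..<v])" unfolding x_def by (rule nth_mem) (use assms in simp)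
 then have x: "u <= x" "x < v" "P x" by auto
 then show "u <= filter P [u..<v] ! (k - 1)" "filter P [u..<v] ! (k - 1) < v" by (auto simp: x_def)
 have "[u..<v] = [u..<x] @ x # [x + 1..<v]"
 using x upt_split[of u x v] upt_conv_Cons[of x v] by simp
 then have fl: "filter P [u..<v] = filter P [u..<x] @ x # filter P [x + 1..<v]" using x by simp
 have "distinct (filter P [u..<v])" by simp
 moreover have "filter P [u..<v] ! length (filter P [u..<x]) = x" unfolding fl by simp
 moreover have "length (filter P [u..<x]) < length (filter P [u..<v])" unfolding fl by simp
 ultimately have "length (filter P [u..<x]) = k - 1"
 using assms nth_eq_iff_index_eq[of "filter P [u..<v]" "length (filter P [u..<x])" "k - 1"]
 by (simp add: x_def)
 then have "take k (filter P [u..<v]) = filter P [u..<x] @ [x]"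
 unfolding fl using assms(1) by (cases k) auto
 also have "... = filter P [u..<x + 1]" using x by simp
 finally show "take k (filter P [u..<v]) = filter P [u..<filter P [u..<v] ! (k - 1) + 1]"
 by (simp add: x_def)
qed

text \<open>A batch is split in two so that the thresholds stay few. At height \<open>h\<close>, one
  below the first window with \<open>Lam\<close> relevant blocks, the window has fewer than
  \<open>Lam\<close> of them and its list changes only at \<open>breaks\<close>. The remainder comes
  from the next dyadic interval of the same length, whose list is shared by all \<open>j0\<close>.
  Together they cover the window of height \<open>h + 1\<close>, which has \<open>Lam\<close>
  relevant blocks.\<close>

lemma batch:
 fixes j0 s :: nat
 assumes "j0 < Nb"
 defines "h \<equiv> hs j0 s - 1"
 defines "i \<equiv> j0 div 2 ^ h + 1"
 shows "above s j0 (wend j0 h) @ take Lam (rlist h i s) = above s j0 (rnext h i s)"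
 "length (above s j0 (wend j0 h)) <= Lam" "j0 < rnext h i s" "rnext h i s <= Nb"
 "rnext h i s = Nb \<or> Lam <= length (above s j0 (rnext h i s))" "h <= L" "i <= Nb"
proof -
 have h: "h < hs j0 s" "h <= L" "hs j0 s = h + 1" using hs_props(1,4)[of j0 s] by (auto simp: h_def)
 show "h <= L" by fact
 show "length (above s j0 (wend j0 h)) <= Lam" using hs_props(3)[OF h(1)] by simp
 have "j0 div 2 ^ h <= j0" by simp
 then show "i <= Nb" unfolding i_def using assms(1) by linarith
 have e: "wend j0 h = min Nb (i * 2 ^ h)" by (simp add: wend_def i_def)
 have j0e: "j0 < i * 2 ^ h"
 unfolding i_def using dividend_less_div_times[of "2 ^ h" j0] by (simp add: add.commute)
 define r where "r = min Nb ((i + 1) * 2 ^ h)"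
 have er: "wend j0 h <= r" "j0 < wend j0 h" using e j0e assms(1) by (auto simp: r_def)
 have rl: "rlist h i s = above s (wend j0 h) r" by (simp add: rlist_def e r_def)
 show main: "above s j0 (wend j0 h) @ take Lam (rlist h i s) = above s j0 (rnext h i s)"
 proof (cases "Lam <= length (rlist h i s)")
 case True
 define x where "x = rlist h i s ! (Lam - 1)"
 have tk: "take Lam (rlist h i s) = above s (wend j0 h) (x + 1)" "wend j0 h <= x"
 using take_filter_upt[of Lam "%j. s <= tm j" "wend j0 h" r] True Lam unfolding rl above_def x_def
 by auto
 have "rnext h i s = x + 1" using True by (simp add: rnext_def x_def)
 then show ?thesis using tk above_append[of j0 "wend j0 h" "x + 1" s] er by simp
 next
 case False
 then have "rnext h i s = r" "take Lam (rlist h i s) = rlist h i s" by (auto simp: rnext_def r_def)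
 then show ?thesis using above_append[of j0 "wend j0 h" r s] er rl by simp
 qed
 show "j0 < rnext h i s" "rnext h i s <= Nb"
 proof -
 have "wend j0 h <= rnext h i s & rnext h i s <= Nb"
 proof (cases "Lam <= length (rlist h i s)")
 case True
 then show ?thesis
 using take_filter_upt(2,3)[of Lam "%j. s <= tm j" "wend j0 h" r] Lam unfolding rl above_def rnext_def
 by (auto simp: rl above_def r_def)
 next
 case False
 then show ?thesis using er by (auto simp: rnext_def r_def)
 qed
 then show "j0 < rnext h i s" "rnext h i s <= Nb" using er by auto
 qed
 show "rnext h i s = Nb \<or> Lam <= length (above s j0 (rnext h i s))"
 proof (cases "Lam <= length (rlist h i s)")
 case True
 then show ?thesis unfolding main[symmetric] by simp
 next
 case False
 then have rn: "rnext h i s = r" by (simp add: rnext_def r_def)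
 show ?thesis
 proof (cases "hs j0 s = L + 1")
 case True
 \<comment> \<open>No window has \<open>Lam\<close> relevant blocks; the next interval of length
   \<open>2 ^ L\<close> then ends beyond all \<open>Nb <= 2 ^ L\<close> blocks.\<close>
 then have "h = L" using h by simp
 have "1 * 2 ^ h <= (i + 1) * 2 ^ h" by (rule mult_le_mono1) simp
 then have "Nb <= (i + 1) * 2 ^ h" using Nb unfolding \<open>h = L\<close> by linarith
 then show ?thesis using rn by (simp add: r_def)
 next
 case False
 then have c: "Lam <= length (above s j0 (wend j0 (h + 1)))" using hs_props(2)[of j0 s] h by simp
 have "j0 div 2 ^ (h + 1) = j0 div 2 ^ h div 2" using div_mult2_eq[of j0 "2 ^ h" 2] by (simp only: power_add power_one_right)
 then have "(j0 div 2 ^ (h + 1) + 1) * 2 <= i + 1" by (simp add: i_def)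
 then have "(j0 div 2 ^ (h + 1) + 1) * 2 * 2 ^ h <= (i + 1) * 2 ^ h" by (rule mult_le_mono1)
 then have w: "wend j0 (h + 1) <= r"
 unfolding wend_def r_def by (intro min.mono) (simp_all add: mult.assoc)
 have "j0 <= wend j0 (h + 1)"
 using assms(1) dividend_less_div_times[of "2 ^ (h + 1)" j0] by (simp add: wend_def add.commute)
 then have "length (above s j0 (wend j0 (h + 1))) <= length (above s j0 r)"
 using above_append[of j0 "wend j0 (h + 1)" r s] w by (metis length_append le_add1)
 then show ?thesis using c rn by simp
 qed
 qed
qed

end

section \<open>Structured programs on the word RAM\<close>

datatype exp = Var reg | Num nat | Bin binop exp exp | Mem exp

datatype com =
 Assign reg exp
 | Write exp exp
 | Emit exp
 | Seq com com
 | If exp com com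
 | While exp com

text \<open>Arithmetic on the natural numbers; \<open>binop_ok\<close> states when the machine,
  working modulo \<open>2 ^ w\<close>, agrees with it. Operations of the machine that are left out
  get the value 0 and are never \<open>binop_ok\<close>.\<close>

fun ideal_binop :: "binop => nat => nat => nat" where
 "ideal_binop Add x y = x + y"
| "ideal_binop Sub x y = x - y"
| "ideal_binop Mul x y = x * y"
| "ideal_binop Div x y = x div y"
| "ideal_binop Shr x y = x div 2 ^ y"
| "ideal_binop Less x y = of_bool (x < y)"
| "ideal_binop Equal x y = of_bool (x = y)"
| "ideal_binop _ x y = 0"

fun binop_ok :: "nat => binop => nat => nat => bool" where
 "binop_ok w Add x y \<longleftrightarrow> x + y < 2 ^ w"
| "binop_ok w Sub x y \<longleftrightarrow> y <= x"
| "binop_ok w Mul x y \<longleftrightarrow> x * y < 2 ^ w"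
| "binop_ok w Div x y \<longleftrightarrow> True"
| "binop_ok w Shr x y \<longleftrightarrow> True"
| "binop_ok w Less x y \<longleftrightarrow> True"
| "binop_ok w Equal x y \<longleftrightarrow> True"
| "binop_ok w _ x y \<longleftrightarrow> False"

lemma eval_binop_ideal:
 assumes "binop_ok w f x y" "x < 2 ^ w" "y < 2 ^ w" "w > 0"
 shows "eval_binop w f x y = ideal_binop f x y & ideal_binop f x y < 2 ^ w"
proof -
 have "x div z < 2 ^ w" for z using assms(2) div_le_dividend le_less_trans by blast
 moreover have "(1::nat) < 2 ^ w" using assms(4) by (metis one_less_numeral_iff one_less_power semiring_norm(76))
 ultimately show ?thesis using assms
 by (cases f) (auto simp: take_bit_nat_eq_self drop_bit_eq_div take_bit_eq_mod mod_if Nat.add_diff_assoc2)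
qed

fun ev :: "(reg => nat) => nat list => exp => nat" where
 "ev sg M (Var x) = sg x"
| "ev sg M (Num k) = k"
| "ev sg M (Bin f a b) = ideal_binop f (ev sg M a) (ev sg M b)"
| "ev sg M (Mem a) = M ! ev sg M a"

fun ok :: "nat => (reg => nat) => nat list => exp => bool" where
 "ok w sg M (Var x) \<longleftrightarrow> True"
| "ok w sg M (Num k) \<longleftrightarrow> k < 2 ^ w"
| "ok w sg M (Bin f a b) \<longleftrightarrow> ok w sg M a & ok w sg M b & binop_ok w f (ev sg M a) (ev sg M b)"
| "ok w sg M (Mem a) \<longleftrightarrow> ok w sg M a & ev sg M a < length M"

fun ecost :: "exp => nat" where
 "ecost (Var x) = 1"
| "ecost (Num k) = 1"
| "ecost (Bin f a b) = ecost a + ecost b + 1"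
| "ecost (Mem a) = ecost a + 1"

type_synonym st = "(reg => nat) \<times> nat list \<times> nat list"

text \<open>The times are exact: each counts the instructions that the compiled code executes,
  including the jump after the first branch of a conditional and the jump back in a loop.\<close>

inductive exec :: "nat => com => st => nat => st => bool" for w where
 Assign: "ok w sg M e ==>
 exec w (Assign x e) (sg, M, out) (ecost e + 1) (sg(x := ev sg M e), M, out)"
| Write: "ok w sg M e1 ==> ok w sg M e2 ==> ev sg M e1 < length M ==>
 exec w (Write e1 e2) (sg, M, out) (ecost e1 + ecost e2 + 1)
 (sg, M[ev sg M e1 := ev sg M e2], out)"
| Emit: "ok w sg M e ==> exec w (Emit e) (sg, M, out) (ecost e + 1) (sg, M, out @ [ev sg M e])"
| Seq: "exec w c1 s t1 s1 ==> exec w c2 s1 t2 s2 ==> exec w (Seq c1 c2) s (t1 + t2) s2"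
| IfTrue: "ok w sg M e ==> ev sg M e ~= 0 ==> exec w c1 (sg, M, out) t s ==>
 exec w (If e c1 c2) (sg, M, out) (ecost e + 1 + t + 1) s"
| IfFalse: "ok w sg M e ==> ev sg M e = 0 ==> exec w c2 (sg, M, out) t s ==>
 exec w (If e c1 c2) (sg, M, out) (ecost e + 1 + t) s"
| WhileFalse: "ok w sg M e ==> ev sg M e = 0 ==>
 exec w (While e c) (sg, M, out) (ecost e + 1) (sg, M, out)"
| WhileTrue: "ok w sg M e ==> ev sg M e ~= 0 ==> exec w c (sg, M, out) t1 s1 ==>
 exec w (While e c) s1 t2 s2 ==>
 exec w (While e c) (sg, M, out) (ecost e + 1 + t1 + 1 + t2) s2"

inductive_cases exec_AssignE: "exec w (Assign x e) s t s'"
inductive_cases exec_WriteE: "exec w (Write e1 e2) s t s'"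
inductive_cases exec_EmitE: "exec w (Emit e) s t s'"
inductive_cases exec_SeqE: "exec w (Seq c1 c2) s t s'"
inductive_cases exec_IfE: "exec w (If e c1 c2) s t s'"
inductive_cases exec_WhileE: "exec w (While e c) s t s'"

text \<open>Registers below \<^term>\<open>1000 :: nat\<close> hold the program variables, those above are used for the
 evaluation of expressions.\<close>

fun comp_exp :: "reg => exp => instr list" where
 "comp_exp r (Var x) = [Op Or r x x]"
| "comp_exp r (Num k) = [Const r k]"
| "comp_exp r (Bin f a b) = comp_exp r a @ comp_exp (r + 1) b @ [Op f r r (r + 1)]"
| "comp_exp r (Mem a) = comp_exp r a @ [Load r r]"

fun comp_len :: "com => nat" where
 "comp_len (Assign x e) = ecost e + 1"
| "comp_len (Write e1 e2) = ecost e1 + ecost e2 + 1"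
| "comp_len (Emit e) = ecost e + 1"
| "comp_len (Seq c1 c2) = comp_len c1 + comp_len c2"
| "comp_len (If e c1 c2) = ecost e + comp_len c1 + comp_len c2 + 2"
| "comp_len (While e c) = ecost e + comp_len c + 2"

text \<open>The argument \<open>a\<close> is the address of the first instruction; it is needed
  because jump targets are absolute.\<close>

fun comp :: "nat => com => instr list" where
 "comp a (Assign x e) = comp_exp 1000 e @ [Op Or x 1000 1000]"
| "comp a (Write e1 e2) = comp_exp 1000 e1 @ comp_exp 1001 e2 @ [Store 1000 1001]"
| "comp a (Emit e) = comp_exp 1000 e @ [Output 1000]"
| "comp a (Seq c1 c2) = comp a c1 @ comp (a + comp_len c1) c2"
| "comp a (If e c1 c2) =
 comp_exp 1000 e @ [JumpZero 1000 (a + ecost e + comp_len c1 + 2)] @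
 comp (a + ecost e + 1) c1 @ [Jump (a + ecost e + comp_len c1 + comp_len c2 + 2)] @
 comp (a + ecost e + comp_len c1 + 2) c2"
| "comp a (While e c) =
 comp_exp 1000 e @ [JumpZero 1000 (a + ecost e + comp_len c + 2)] @
 comp (a + ecost e + 1) c @ [Jump a]"

lemma length_comp_exp [simp]: "length (comp_exp r e) = ecost e"
 by (induction e arbitrary: r) auto

lemma length_comp [simp]: "length (comp a c) = comp_len c"
 by (induction c arbitrary: a) auto

fun exp_vars_ok :: "exp => bool" where
 "exp_vars_ok (Var x) \<longleftrightarrow> x < 1000"
| "exp_vars_ok (Num k) \<longleftrightarrow> True"
| "exp_vars_ok (Bin f a b) \<longleftrightarrow> exp_vars_ok a & exp_vars_ok b"
| "exp_vars_ok (Mem a) \<longleftrightarrow> exp_vars_ok a"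

fun vars_ok :: "com => bool" where
 "vars_ok (Assign x e) \<longleftrightarrow> x < 1000 & exp_vars_ok e"
| "vars_ok (Write e1 e2) \<longleftrightarrow> exp_vars_ok e1 & exp_vars_ok e2"
| "vars_ok (Emit e) \<longleftrightarrow> exp_vars_ok e"
| "vars_ok (Seq c1 c2) \<longleftrightarrow> vars_ok c1 & vars_ok c2"
| "vars_ok (If e c1 c2) \<longleftrightarrow> exp_vars_ok e & vars_ok c1 & vars_ok c2"
| "vars_ok (While e c) \<longleftrightarrow> exp_vars_ok e & vars_ok c"

definition code_at :: "instr list => nat => instr list => bool" where
 "code_at P a xs \<longleftrightarrow> (\<forall>i < length xs. a + i < length P & P ! (a + i) = xs ! i)"

lemma code_at_Nil [simp]: "code_at P a []"
 by (simp add: code_at_def)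

lemma code_at_Cons [simp]:
 "code_at P a (x # xs) \<longleftrightarrow> a < length P & P ! a = x & code_at P (Suc a) xs"
 unfolding code_at_def by (auto simp: less_Suc_eq_0_disj)

lemma code_at_append [simp]:
 "code_at P a (xs @ ys) \<longleftrightarrow> code_at P a xs & code_at P (a + length xs) ys"
 by (induction xs arbitrary: a) auto

lemma code_at_self: "code_at (xs @ ys) 0 xs"
 by (simp add: code_at_def nth_append)

lemma steps_add: "steps w P (t1 + t2) s = Option.bind (steps w P t1 s) (steps w P t2)"
 by (induction t1 arbitrary: s) (auto split: Option.bind_split)

lemma steps_trans:
 "steps w P t1 s = Some s1 ==> steps w P t2 s1 = Some s2 ==> steps w P (t1 + t2) s = Some s2"
 by (simp add: steps_add)

lemma steps_one: "step w P s = Some s' ==> steps w P 1 s = Some s'"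
 by simp

definition words_ok :: "nat => (reg => nat) => nat list => bool" where
 "words_ok w sg M \<longleftrightarrow> (\<forall>r < 1000. sg r < 2 ^ w) & set M \<subseteq> {..<2 ^ w}"

lemma ev_less:
 "ok w sg M e ==> exp_vars_ok e ==> words_ok w sg M ==> w > 0 ==> ev sg M e < 2 ^ w"
 by (induction e) (use eval_binop_ideal in \<open>auto simp: words_ok_def subset_iff\<close>)

lemma comp_exp_steps:
 assumes "w > 0" "words_ok w sg M"
 shows "ok w sg M e ==> exp_vars_ok e ==> code_at P a (comp_exp r e) ==> r >= 1000 ==>
 \<forall>x < 1000. \<rho> x = sg x ==>
 \<exists>\<rho>'. steps w P (ecost e) (|pc = a, regs = \<rho>, mem = M, outp = out|) =
 Some (|pc = a + ecost e, regs = \<rho>', mem = M, outp = out|) &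
 \<rho>' r = ev sg M e & (\<forall>x < r. \<rho>' x = \<rho> x)"
proof (induction e arbitrary: a r \<rho>)
 case (Var x)
 then show ?case using assms(2)
 by (intro exI[of _ "\<rho>(r := sg x)"]) (auto simp: step_def words_ok_def take_bit_nat_eq_self)
next
 case (Num k)
 then show ?case
 by (intro exI[of _ "\<rho>(r := k)"]) (auto simp: step_def take_bit_nat_eq_self)
next
 case (Bin f e1 e2)
 obtain \<rho>1 where 1: "steps w P (ecost e1) (|pc = a, regs = \<rho>, mem = M, outp = out|) =
 Some (|pc = a + ecost e1, regs = \<rho>1, mem = M, outp = out|)"
 "\<rho>1 r = ev sg M e1" "\<forall>x < r. \<rho>1 x = \<rho> x"
 using Bin.IH(1)[of a r \<rho>] Bin.prems by auto
 obtain \<rho>2 where 2: "steps w P (ecost e2) (|pc = a + ecost e1, regs = \<rho>1, mem = M, outp = out|) =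
 Some (|pc = a + ecost e1 + ecost e2, regs = \<rho>2, mem = M, outp = out|)"
 "\<rho>2 (r + 1) = ev sg M e2" "\<forall>x < r + 1. \<rho>2 x = \<rho>1 x"
 using Bin.IH(2)[of "a + ecost e1" "r + 1" \<rho>1] Bin.prems 1(3) by auto
 have e: "eval_binop w f (ev sg M e1) (ev sg M e2) = ideal_binop f (ev sg M e1) (ev sg M e2)"
 using eval_binop_ideal ev_less Bin.prems assms by auto
 define \<rho>3 where "\<rho>3 = \<rho>2(r := ideal_binop f (ev sg M e1) (ev sg M e2))"
 have 3: "steps w P 1 (|pc = a + ecost e1 + ecost e2, regs = \<rho>2, mem = M, outp = out|) =
 Some (|pc = a + ecost e1 + ecost e2 + 1, regs = \<rho>3, mem = M, outp = out|)"
 by (rule steps_one) (use Bin.prems 1 2 e in \<open>simp add: step_def \<rho>3_def add.assoc\<close>)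
 have "steps w P (ecost e1 + ecost e2 + 1) (|pc = a, regs = \<rho>, mem = M, outp = out|) =
 Some (|pc = a + ecost e1 + ecost e2 + 1, regs = \<rho>3, mem = M, outp = out|)"
 using steps_trans[OF steps_trans[OF 1(1) 2(1)] 3] .
 then show ?case
 by (intro exI[of _ \<rho>3]) (use 1 2 in \<open>auto simp: \<rho>3_def add.assoc\<close>)
next
 case (Mem e)
 obtain \<rho>1 where 1: "steps w P (ecost e) (|pc = a, regs = \<rho>, mem = M, outp = out|) =
 Some (|pc = a + ecost e, regs = \<rho>1, mem = M, outp = out|)"
 "\<rho>1 r = ev sg M e" "\<forall>x < r. \<rho>1 x = \<rho> x"
 using Mem.IH[of a r \<rho>] Mem.prems by auto
 define \<rho>3 where "\<rho>3 = \<rho>1(r := M ! ev sg M e)"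
 have 3: "steps w P 1 (|pc = a + ecost e, regs = \<rho>1, mem = M, outp = out|) =
 Some (|pc = a + ecost e + 1, regs = \<rho>3, mem = M, outp = out|)"
 by (rule steps_one) (use Mem.prems 1 in \<open>simp add: step_def \<rho>3_def\<close>)
 show ?case
 by (intro exI[of _ \<rho>3]) (use 1 steps_trans[OF 1(1) 3] in \<open>auto simp: \<rho>3_def\<close>)
qed

lemma exec_words_ok:
 "exec w c s t s' ==> vars_ok c ==> w > 0 ==> words_ok w (fst s) (fst (snd s)) ==>
 words_ok w (fst s') (fst (snd s'))"
proof (induction rule: exec.induct)
 case (Assign sg M e x out)
 then show ?case using ev_less[OF Assign.hyps(1)] by (auto simp: words_ok_def)
next
 case (Write sg M e1 e2 out)
 then show ?case using ev_less[OF Write.hyps(2)]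
 by (auto simp: words_ok_def dest!: set_update_subset_insert[THEN subsetD])
qed auto

text \<open>Only the registers below 1000 are related to the state of the structured program, since
  the others change during the evaluation of expressions.\<close>

lemma comp_steps:
 assumes "w > 0"
 shows "exec w c s t s' ==> vars_ok c ==> words_ok w (fst s) (fst (snd s)) ==>
 code_at P a (comp a c) ==> \<forall>x < 1000. \<rho> x = fst s x ==>
 \<exists>\<rho>'. steps w P t (|pc = a, regs = \<rho>, mem = fst (snd s), outp = snd (snd s)|) =
 Some (|pc = a + comp_len c, regs = \<rho>', mem = fst (snd s'), outp = snd (snd s')|) &
 (\<forall>x < 1000. \<rho>' x = fst s' x)"
proof (induction arbitrary: a \<rho> rule: exec.induct)
 case (Assign sg M e x out)
 obtain \<rho>1 where 1: "steps w P (ecost e) (|pc = a, regs = \<rho>, mem = M, outp = out|) =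
 Some (|pc = a + ecost e, regs = \<rho>1, mem = M, outp = out|)"
 "\<rho>1 1000 = ev sg M e" "\<forall>x < 1000. \<rho>1 x = \<rho> x"
 using comp_exp_steps[OF assms, of sg M e P a 1000 \<rho> out] Assign by auto
 have b: "ev sg M e < 2 ^ w" using ev_less Assign assms by auto
 have "steps w P 1 (|pc = a + ecost e, regs = \<rho>1, mem = M, outp = out|) =
 Some (|pc = a + ecost e + 1, regs = \<rho>1(x := ev sg M e), mem = M, outp = out|)"
 by (rule steps_one) (use Assign.prems 1 b in \<open>simp add: step_def take_bit_nat_eq_self\<close>)
 from steps_trans[OF 1(1) this] show ?case using 1 Assign.prems
 by (intro exI[of _ "\<rho>1(x := ev sg M e)"]) auto
next
 case (Write sg M e1 e2 out)
 obtain \<rho>1 where 1: "steps w P (ecost e1) (|pc = a, regs = \<rho>, mem = M, outp = out|) =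
 Some (|pc = a + ecost e1, regs = \<rho>1, mem = M, outp = out|)"
 "\<rho>1 1000 = ev sg M e1" "\<forall>x < 1000. \<rho>1 x = \<rho> x"
 using comp_exp_steps[OF assms, of sg M e1 P a 1000 \<rho> out] Write by auto
 obtain \<rho>2 where 2: "steps w P (ecost e2) (|pc = a + ecost e1, regs = \<rho>1, mem = M, outp = out|) =
 Some (|pc = a + ecost e1 + ecost e2, regs = \<rho>2, mem = M, outp = out|)"
 "\<rho>2 1001 = ev sg M e2" "\<forall>x < 1001. \<rho>2 x = \<rho>1 x"
 using comp_exp_steps[OF assms, of sg M e2 P "a + ecost e1" 1001 \<rho>1 out] Write 1 by auto
 have 3: "steps w P 1 (|pc = a + ecost e1 + ecost e2, regs = \<rho>2, mem = M, outp = out|) =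
 Some (|pc = a + ecost e1 + ecost e2 + 1, regs = \<rho>2, mem = M[ev sg M e1 := ev sg M e2], outp = out|)"
 by (rule steps_one) (use Write 1 2 in \<open>simp add: step_def add.assoc\<close>)
 from steps_trans[OF steps_trans[OF 1(1) 2(1)] 3] show ?case using 1 2 Write.prems
 by (intro exI[of _ \<rho>2]) (auto simp: add.assoc)
next
 case (Emit sg M e out)
 obtain \<rho>1 where 1: "steps w P (ecost e) (|pc = a, regs = \<rho>, mem = M, outp = out|) =
 Some (|pc = a + ecost e, regs = \<rho>1, mem = M, outp = out|)"
 "\<rho>1 1000 = ev sg M e" "\<forall>x < 1000. \<rho>1 x = \<rho> x"
 using comp_exp_steps[OF assms, of sg M e P a 1000 \<rho> out] Emit by auto
 have "steps w P 1 (|pc = a + ecost e, regs = \<rho>1, mem = M, outp = out|) =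
 Some (|pc = a + ecost e + 1, regs = \<rho>1, mem = M, outp = out @ [ev sg M e]|)"
 by (rule steps_one) (use Emit.prems 1 in \<open>simp add: step_def\<close>)
 from steps_trans[OF 1(1) this] show ?case using 1 Emit.prems
 by (intro exI[of _ \<rho>1]) auto
next
 case (Seq c1 s t1 s1 c2 t2 s2)
 obtain \<rho>1 where 1: "steps w P t1 (|pc = a, regs = \<rho>, mem = fst (snd s), outp = snd (snd s)|) =
 Some (|pc = a + comp_len c1, regs = \<rho>1, mem = fst (snd s1), outp = snd (snd s1)|)"
 "\<forall>x < 1000. \<rho>1 x = fst s1 x"
 using Seq.IH(1)[of a \<rho>] Seq.prems by auto
 obtain \<rho>2 where 2: "steps w P t2 (|pc = a + comp_len c1, regs = \<rho>1, mem = fst (snd s1), outp = snd (snd s1)|) =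
 Some (|pc = a + comp_len c1 + comp_len c2, regs = \<rho>2, mem = fst (snd s2), outp = snd (snd s2)|)"
 "\<forall>x < 1000. \<rho>2 x = fst s2 x"
 using Seq.IH(2)[of "a + comp_len c1" \<rho>1] Seq.prems 1 exec_words_ok[OF Seq.hyps(1)] assms by auto
 from steps_trans[OF 1(1) 2(1)] 2 show ?case by (intro exI[of _ \<rho>2]) (auto simp: add.assoc)
next
 case (IfTrue sg M e c1 out t s c2)
 obtain \<rho>1 where 1: "steps w P (ecost e) (|pc = a, regs = \<rho>, mem = M, outp = out|) =
 Some (|pc = a + ecost e, regs = \<rho>1, mem = M, outp = out|)"
 "\<rho>1 1000 = ev sg M e" "\<forall>x < 1000. \<rho>1 x = \<rho> x"
 using comp_exp_steps[OF assms, of sg M e P a 1000 \<rho> out] IfTrue by auto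
 have 2: "steps w P 1 (|pc = a + ecost e, regs = \<rho>1, mem = M, outp = out|) =
 Some (|pc = a + ecost e + 1, regs = \<rho>1, mem = M, outp = out|)"
 by (rule steps_one) (use IfTrue.prems 1 IfTrue.hyps in \<open>simp add: step_def\<close>)
 obtain \<rho>2 where 3: "steps w P t (|pc = a + ecost e + 1, regs = \<rho>1, mem = M, outp = out|) =
 Some (|pc = a + ecost e + 1 + comp_len c1, regs = \<rho>2, mem = fst (snd s), outp = snd (snd s)|)"
 "\<forall>x < 1000. \<rho>2 x = fst s x"
 using IfTrue.IH[of "a + ecost e + 1" \<rho>1] IfTrue.prems 1 by auto
 have 4: "steps w P 1 (|pc = a + ecost e + 1 + comp_len c1, regs = \<rho>2, mem = fst (snd s), outp = snd (snd s)|) =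
 Some (|pc = a + ecost e + comp_len c1 + comp_len c2 + 2, regs = \<rho>2, mem = fst (snd s), outp = snd (snd s)|)"
 by (rule steps_one) (use IfTrue.prems in \<open>simp add: step_def\<close>)
 from steps_trans[OF steps_trans[OF steps_trans[OF 1(1) 2] 3(1)] 4] 3 show ?case
 by (intro exI[of _ \<rho>2]) (auto simp: add.assoc)
next
 case (IfFalse sg M e c2 out t s c1)
 obtain \<rho>1 where 1: "steps w P (ecost e) (|pc = a, regs = \<rho>, mem = M, outp = out|) =
 Some (|pc = a + ecost e, regs = \<rho>1, mem = M, outp = out|)"
 "\<rho>1 1000 = ev sg M e" "\<forall>x < 1000. \<rho>1 x = \<rho> x"
 using comp_exp_steps[OF assms, of sg M e P a 1000 \<rho> out] IfFalse by auto
 have 2: "steps w P 1 (|pc = a + ecost e, regs = \<rho>1, mem = M, outp = out|) =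
 Some (|pc = a + ecost e + comp_len c1 + 2, regs = \<rho>1, mem = M, outp = out|)"
 by (rule steps_one) (use IfFalse.prems 1 IfFalse.hyps in \<open>simp add: step_def\<close>)
 obtain \<rho>2 where 3: "steps w P t (|pc = a + ecost e + comp_len c1 + 2, regs = \<rho>1, mem = M, outp = out|) =
 Some (|pc = a + ecost e + comp_len c1 + 2 + comp_len c2, regs = \<rho>2, mem = fst (snd s), outp = snd (snd s)|)"
 "\<forall>x < 1000. \<rho>2 x = fst s x"
 using IfFalse.IH[of "a + ecost e + comp_len c1 + 2" \<rho>1] IfFalse.prems 1 by auto
 have eq: "a + ecost e + comp_len c1 + 2 + comp_len c2 = a + comp_len (If e c1 c2)" by simp
 from steps_trans[OF steps_trans[OF 1(1) 2] 3(1)] 3(2) show ?case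
 unfolding eq by (intro exI[of _ \<rho>2]) (simp only: fst_conv snd_conv simp_thms)
next
 case (WhileFalse sg M e c out)
 obtain \<rho>1 where 1: "steps w P (ecost e) (|pc = a, regs = \<rho>, mem = M, outp = out|) =
 Some (|pc = a + ecost e, regs = \<rho>1, mem = M, outp = out|)"
 "\<rho>1 1000 = ev sg M e" "\<forall>x < 1000. \<rho>1 x = \<rho> x"
 using comp_exp_steps[OF assms, of sg M e P a 1000 \<rho> out] WhileFalse by auto
 have 2: "steps w P 1 (|pc = a + ecost e, regs = \<rho>1, mem = M, outp = out|) =
 Some (|pc = a + comp_len (While e c), regs = \<rho>1, mem = M, outp = out|)"
 by (rule steps_one) (use WhileFalse 1 in \<open>simp add: step_def\<close>)
 from steps_trans[OF 1(1) 2] show ?case using 1 WhileFalse.prems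
 by (intro exI[of _ \<rho>1]) (simp only: fst_conv snd_conv simp_thms, simp)
next
 case (WhileTrue sg M e c out t1 s1 t2 s2)
 obtain \<rho>1 where 1: "steps w P (ecost e) (|pc = a, regs = \<rho>, mem = M, outp = out|) =
 Some (|pc = a + ecost e, regs = \<rho>1, mem = M, outp = out|)"
 "\<rho>1 1000 = ev sg M e" "\<forall>x < 1000. \<rho>1 x = \<rho> x"
 using comp_exp_steps[OF assms, of sg M e P a 1000 \<rho> out] WhileTrue by auto
 have 2: "steps w P 1 (|pc = a + ecost e, regs = \<rho>1, mem = M, outp = out|) =
 Some (|pc = a + ecost e + 1, regs = \<rho>1, mem = M, outp = out|)"
 by (rule steps_one) (use WhileTrue.prems 1 WhileTrue.hyps in \<open>simp add: step_def\<close>)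
 obtain \<rho>2 where 3: "steps w P t1 (|pc = a + ecost e + 1, regs = \<rho>1, mem = M, outp = out|) =
 Some (|pc = a + ecost e + 1 + comp_len c, regs = \<rho>2, mem = fst (snd s1), outp = snd (snd s1)|)"
 "\<forall>x < 1000. \<rho>2 x = fst s1 x"
 using WhileTrue.IH(1)[of "a + ecost e + 1" \<rho>1] WhileTrue.prems 1 by auto
 have 4: "steps w P 1 (|pc = a + ecost e + 1 + comp_len c, regs = \<rho>2, mem = fst (snd s1), outp = snd (snd s1)|) =
 Some (|pc = a, regs = \<rho>2, mem = fst (snd s1), outp = snd (snd s1)|)"
 by (rule steps_one) (use WhileTrue.prems in \<open>simp add: step_def\<close>)
 obtain \<rho>3 where 5: "steps w P t2 (|pc = a, regs = \<rho>2, mem = fst (snd s1), outp = snd (snd s1)|) =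
 Some (|pc = a + comp_len (While e c), regs = \<rho>3, mem = fst (snd s2), outp = snd (snd s2)|)"
 "\<forall>x < 1000. \<rho>3 x = fst s2 x"
 using WhileTrue.IH(2)[of a \<rho>2] WhileTrue.prems 3 exec_words_ok[OF WhileTrue.hyps(3)] assms by auto
 from steps_trans[OF steps_trans[OF steps_trans[OF steps_trans[OF 1(1) 2] 3(1)] 4] 5(1)] 5(2)
 show ?case by (intro exI[of _ \<rho>3]) (simp only: fst_conv snd_conv simp_thms)
qed

definition program :: "com => instr list" where
 "program c = comp 0 c @ [Halt]"

lemma program_halts:
 assumes "exec w c (sg, M, []) t (sg', M', out)" "vars_ok c" "words_ok w sg M" "w > 0"
 shows "EX s. halts_in w (program c) (|pc = 0, regs = sg, mem = M, outp = []|) (Suc t) s &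
 mem s = M' & outp s = out"
proof -
 obtain \<rho> where "steps w (program c) t (|pc = 0, regs = sg, mem = M, outp = []|) =
 Some (|pc = comp_len c, regs = \<rho>, mem = M', outp = out|)"
 using comp_steps[OF assms(4,1,2), of "program c" 0 sg] assms(3)
 by (auto simp: program_def code_at_self)
 then show ?thesis unfolding halts_in_def
 by (intro exI[of _ "(|pc = comp_len c, regs = \<rho>, mem = M', outp = out|)"])
 (auto simp: program_def nth_append)
qed

section \<open>A calculus of total correctness with running times\<close>

text \<open>A weakest precondition in which the postcondition also receives the running time, so
  that time bounds are proved along with correctness.\<close>

definition T :: "nat => com => (nat => st => bool) => st => bool" where
 "T w c Q s \<longleftrightarrow> (EX t s'. exec w c s t s' & Q t s')"

lemma T_Assign [simp]:
 "T w (Assign x e) Q (sg, M, out) \<longleftrightarrow>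
 ok w sg M e & Q (ecost e + 1) (sg(x := ev sg M e), M, out)"
 unfolding T_def
 by (rule iffI, elim exE conjE exec_AssignE, simp, blast intro: exec.Assign)

lemma T_Write [simp]:
 "T w (Write e1 e2) Q (sg, M, out) \<longleftrightarrow>
 ok w sg M e1 & ok w sg M e2 & ev sg M e1 < length M &
 Q (ecost e1 + ecost e2 + 1) (sg, M[ev sg M e1 := ev sg M e2], out)"
 unfolding T_def
 by (rule iffI, elim exE conjE exec_WriteE, simp, blast intro: exec.Write)

lemma T_Emit [simp]:
 "T w (Emit e) Q (sg, M, out) \<longleftrightarrow> ok w sg M e & Q (ecost e + 1) (sg, M, out @ [ev sg M e])"
 unfolding T_def
 by (rule iffI, elim exE conjE exec_EmitE, simp, blast intro: exec.Emit)

lemma T_Seq [simp]: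
 "T w (Seq c1 c2) Q s \<longleftrightarrow> T w c1 (%t1. T w c2 (%t2. Q (t1 + t2))) s"
 unfolding T_def
 by (rule iffI, elim exE conjE exec_SeqE, blast, blast intro: exec.Seq)

lemma T_If [simp]:
 "T w (If e c1 c2) Q (sg, M, out) \<longleftrightarrow> ok w sg M e &
 (if ev sg M e ~= 0 then T w c1 (%t. Q (ecost e + 1 + t + 1)) (sg, M, out)
 else T w c2 (%t. Q (ecost e + 1 + t)) (sg, M, out))"
 (is "?L \<longleftrightarrow> ?R")
proof
 assume ?L
 then obtain t s' where "exec w (If e c1 c2) (sg, M, out) t s'" "Q t s'" unfolding T_def by blast
 then show ?R unfolding T_def by (elim exec_IfE) (auto simp del: split_paired_Ex)
next
 assume ?R
 then show ?L unfolding T_def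
 by (cases "ev sg M e = 0") (simp_all only: simp_thms if_True if_False, (blast intro: exec.IfTrue exec.IfFalse)+)
qed

lemma T_While_unfold:
 "T w (While e c) Q (sg, M, out) \<longleftrightarrow> ok w sg M e &
 (if ev sg M e = 0 then Q (ecost e + 1) (sg, M, out)
 else T w c (%t1. T w (While e c) (%t2. Q (ecost e + 1 + t1 + 1 + t2))) (sg, M, out))"
 (is "?L \<longleftrightarrow> ?R")
proof
 assume ?L
 then obtain t s' where ex: "exec w (While e c) (sg, M, out) t s'" and q: "Q t s'"
 unfolding T_def by blast
 from ex show ?R
 by (rule exec_WhileE) (use q in \<open>auto simp: T_def simp del: split_paired_Ex\<close>)
next
 assume ?R
 then show ?L unfolding T_def
 by (cases "ev sg M e = 0") (simp_all only: simp_thms if_True if_False, (blast intro: exec.WhileFalse exec.WhileTrue)+)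
qed

lemma T_mono: "T w c Q s ==> (!!t s'. Q t s' ==> Q' t s') ==> T w c Q' s"
 unfolding T_def by blast

fun mods :: "com => reg set" where
 "mods (Assign x e) = {x}"
| "mods (Write e1 e2) = {}"
| "mods (Emit e) = {}"
| "mods (Seq c1 c2) = mods c1 \<union> mods c2"
| "mods (If e c1 c2) = mods c1 \<union> mods c2"
| "mods (While e c) = mods c"

fun pure :: "com => bool" where
 "pure (Assign x e) \<longleftrightarrow> True"
| "pure (Write e1 e2) \<longleftrightarrow> False"
| "pure (Emit e) \<longleftrightarrow> False"
| "pure (Seq c1 c2) \<longleftrightarrow> pure c1 & pure c2"
| "pure (If e c1 c2) \<longleftrightarrow> pure c1 & pure c2"
| "pure (While e c) \<longleftrightarrow> pure c"

fun silent :: "com => bool" where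
 "silent (Assign x e) \<longleftrightarrow> True"
| "silent (Write e1 e2) \<longleftrightarrow> True"
| "silent (Emit e) \<longleftrightarrow> False"
| "silent (Seq c1 c2) \<longleftrightarrow> silent c1 & silent c2"
| "silent (If e c1 c2) \<longleftrightarrow> silent c1 & silent c2"
| "silent (While e c) \<longleftrightarrow> silent c"

lemma exec_frame:
 "exec w c s t s' ==> (ALL r. r ~: mods c --> fst s' r = fst s r) &
 (pure c --> snd s' = snd s) & (silent c --> snd (snd s') = snd (snd s))"
 by (induction rule: exec.induct) auto

lemma T_frame:
 assumes "T w c Q (sg, M, out)"
 shows "T w c (%t (sg', M', out'). Q t (sg', M', out') & (ALL r. r ~: mods c --> sg' r = sg r) &
 (pure c --> M' = M & out' = out) & (silent c --> out' = out)) (sg, M, out)"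
 using assms exec_frame[of w c "(sg, M, out)"] unfolding T_def by fastforce

text \<open>The standard way to use the specification of a subroutine: besides its postcondition, the
 registers that it does not mention are known to be unchanged.\<close>

lemma T_call:
 assumes "T w c Q (sg, M, out)" "pure c"
 and "!!t sg'. Q t (sg', M, out) ==> (!!r. r ~: mods c ==> sg' r = sg r) ==> Q' t (sg', M, out)"
 shows "T w c Q' (sg, M, out)"
 by (rule T_mono[OF T_frame[OF assms(1)]]) (use assms(2,3) in auto)

text \<open>The index \<open>k\<close> of the invariant bounds the number of remaining iterations;
  it is a logical variable and need not be stored by the program. \<open>\<tau>\<close> bounds the
  time of one execution of the body.\<close>

lemma T_while:
 assumes "!!k sg M out. Inv k (sg, M, out) ==> ok w sg M e &
 (ev sg M e ~= 0 --> k > 0 & T w c (%t s'. t <= \<tau> & Inv (k - 1) s') (sg, M, out))"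
 and "Inv k s"
 shows "T w (While e c) (%t (sg, M, out). t <= k * (\<tau> + ecost e + 2) + ecost e + 1 &
 ev sg M e = 0 & (EX k'. Inv k' (sg, M, out))) s"
 using assms(2)
proof (induction k arbitrary: s)
 case 0
 obtain sg M out where s: "s = (sg, M, out)" by (cases s) auto
 show ?case using assms(1)[of 0 sg M out] 0 unfolding s by (subst T_While_unfold) auto
next
 case (Suc k)
 obtain sg M out where s: "s = (sg, M, out)" by (cases s) auto
 show ?case
 proof (cases "ev sg M e = 0")
 case True
 then show ?thesis using assms(1)[of "Suc k" sg M out] Suc.prems unfolding s
 by (subst T_While_unfold) auto
 next
 case False
 have "T w c (%t s'. t <= \<tau> & Inv k s') (sg, M, out)"
 using assms(1)[of "Suc k" sg M out] Suc.prems s False by auto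
 then have "T w c (%t1. T w (While e c) (%t2 (sg, M, out).
 ecost e + 1 + t1 + 1 + t2 <= Suc k * (\<tau> + ecost e + 2) + ecost e + 1 &
 ev sg M e = 0 & (EX k'. Inv k' (sg, M, out)))) (sg, M, out)"
 by (elim T_mono, elim conjE, elim T_mono[OF Suc.IH]) auto
 then show ?thesis using False assms(1)[of "Suc k" sg M out] Suc.prems unfolding s
 by (subst T_While_unfold) simp
 qed
qed

section \<open>Binary search\<close>

definition bisect :: "reg => reg => reg => reg => com => com" where
 "bisect rl rh rm rf test =
 While (Bin Less (Var rl) (Var rh))
 (Seq (Assign rm (Bin Div (Bin Add (Var rl) (Var rh)) (Num 2)))
 (Seq test
 (If (Var rf) (Assign rh (Var rm)) (Assign rl (Bin Add (Var rm) (Num 1))))))"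

lemma mods_bisect [simp]: "mods (bisect rl rh rm rf test) = {rl, rh, rm} \<union> mods test"
 by (auto simp: bisect_def)

lemma pure_bisect [simp]: "pure (bisect rl rh rm rf test) = pure test"
 by (auto simp: bisect_def)

lemma vars_ok_bisect [simp]:
 "vars_ok (bisect rl rh rm rf test) \<longleftrightarrow>
 rl < 1000 & rh < 1000 & rm < 1000 & rf < 1000 & vars_ok test"
 by (auto simp: bisect_def)

text \<open>Register \<open>rl\<close> ends at the first place of the half-open range where the
  monotone \<open>P\<close> holds, or at \<open>hi\<close>. A range shorter than
  \<open>2 ^ k\<close> is exhausted after \<open>k\<close> rounds, and 19 covers the instructions of
  a round other than \<open>test\<close>. The bound on \<open>hi + hi\<close> keeps the computation
  of the midpoint from overflowing.\<close>

lemma T_bisect: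
 assumes pure: "pure test" and dist: "rl ~= rh" "rl ~= rm" "rh ~= rm"
 and nm: "rl ~: mods test" "rh ~: mods test" "rm ~: mods test"
 and test: "!!sg'. (!!r. r ~: insert rl (insert rh (insert rm (mods test))) ==> sg' r = sg r) ==>
 lo <= sg' rm ==> sg' rm < hi ==>
 T w test (%t (sg'', _). t <= \<tau> & (sg'' rf ~= 0 \<longleftrightarrow> P (sg' rm))) (sg', M, out)"
 and mono: "!!i j. lo <= i ==> i <= j ==> j < hi ==> P i ==> P j"
 and init: "sg rl = lo" "sg rh = hi" "lo <= hi" "hi - lo < 2 ^ k" "hi + hi < 2 ^ w" "2 < (2::nat) ^ w"
 shows "T w (bisect rl rh rm rf test) (%t (sg', _). t <= k * (\<tau> + 19) + 4 &
 lo <= sg' rl & sg' rl <= hi & (ALL i. lo <= i & i < sg' rl --> \<not> P i) &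
 (ALL i. sg' rl <= i & i < hi --> P i)) (sg, M, out)"
proof -
 define Inv where "Inv = (%k (s :: st). fst (snd s) = M & snd (snd s) = out &
 (ALL r. r ~: insert rl (insert rh (insert rm (mods test))) --> fst s r = sg r) &
 lo <= fst s rl & fst s rl <= fst s rh & fst s rh <= hi & fst s rh - fst s rl < 2 ^ k &
 (ALL i. lo <= i & i < fst s rl --> \<not> P i) & (ALL i. fst s rh <= i & i < hi --> P i))"
 have "T w (bisect rl rh rm rf test) (%t (sg, M, out).
 t <= k * ((\<tau> + 14) + ecost (Bin Less (Var rl) (Var rh)) + 2) + ecost (Bin Less (Var rl) (Var rh)) + 1 &
 ev sg M (Bin Less (Var rl) (Var rh)) = 0 & (EX k'. Inv k' (sg, M, out))) (sg, M, out)"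
 unfolding bisect_def
 proof (rule T_while)
 show "Inv k (sg, M, out)" using init by (auto simp: Inv_def)
 fix k' sg1 M1 out1
 assume I: "Inv k' (sg1, M1, out1)"
 have M1: "M1 = M" "out1 = out" using I by (auto simp: Inv_def)
 show "ok w sg1 M1 (Bin Less (Var rl) (Var rh)) & (ev sg1 M1 (Bin Less (Var rl) (Var rh)) ~= 0 -->
 k' > 0 & T w (Seq (Assign rm (Bin Div (Bin Add (Var rl) (Var rh)) (Num 2)))
 (Seq test (If (Var rf) (Assign rh (Var rm)) (Assign rl (Bin Add (Var rm) (Num 1))))))
 (%t s'. t <= \<tau> + 14 & Inv (k' - 1) s') (sg1, M1, out1))"
 proof (intro conjI impI)
 show "ok w sg1 M1 (Bin Less (Var rl) (Var rh))" by simp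
 assume "ev sg1 M1 (Bin Less (Var rl) (Var rh)) ~= 0"
 then have lt: "sg1 rl < sg1 rh" by (auto split: if_splits)
 show k0: "k' > 0" using I lt by (cases k') (auto simp: Inv_def)
 define m where "m = (sg1 rl + sg1 rh) div 2"
 have m: "sg1 rl <= m" "m < sg1 rh" using lt by (auto simp: m_def)
 have le: "lo <= sg1 rl" "sg1 rh <= hi" using I by (auto simp: Inv_def)
 have sm: "sg1 rl + sg1 rh < 2 ^ w" using lt le init(5) by linarith
 define sg2 where "sg2 = sg1(rm := m)"
 have "T w test (%t (sg'', _). t <= \<tau> & (sg'' rf ~= 0 \<longleftrightarrow> P m)) (sg2, M, out)"
 using test[of sg2] I m le by (auto simp: Inv_def sg2_def)
 then have *: "T w test (%t s'. T w (If (Var rf) (Assign rh (Var rm)) (Assign rl (Bin Add (Var rm) (Num 1))))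
 (%t2 s'. t + t2 <= \<tau> + 8 & Inv (k' - 1) s') s') (sg2, M, out)"
 proof (rule T_call)
 show "pure test" by fact
 fix t sg3
 assume A: "case (sg3, M, out) of (sg'', _) => t <= \<tau> & (sg'' rf ~= 0 \<longleftrightarrow> P m)"
 and fr: "!!r. r ~: mods test ==> sg3 r = sg2 r"
 have f: "sg3 rl = sg1 rl" "sg3 rh = sg1 rh" "sg3 rm = m"
 using fr nm dist by (auto simp: sg2_def)
 obtain k'' where k'': "k' = Suc k''" using k0 by (cases k') auto
 have szh: "m - sg1 rl < 2 ^ k''" "sg1 rh - (m + 1) < 2 ^ k''"
 using I lt k'' by (auto simp: Inv_def m_def)
 have m1: "m + 1 < 2 ^ w" using m le init(5) by linarith
 show "T w (If (Var rf) (Assign rh (Var rm)) (Assign rl (Bin Add (Var rm) (Num 1))))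
 (%t2 s'. t + t2 <= \<tau> + 8 & Inv (k' - 1) s') (sg3, M, out)"
 proof (cases "P m")
 case True
 have "Inv k'' (sg3(rh := m), M, out)"
 using I True f fr m szh le dist mono[of m] unfolding Inv_def by (auto simp: sg2_def)
 then show ?thesis using A True f k'' by simp
 next
 case False
 have "ALL i. lo <= i & i < Suc m --> \<not> P i"
 using mono[of _ m] False m le by (metis less_Suc_eq_le order_less_le_trans)
 then have "Inv k'' (sg3(rl := Suc m), M, out)"
 using I False f fr m szh le dist unfolding Inv_def by (auto simp: sg2_def)
 then show ?thesis using A False f k'' m1 init by simp
 qed
 qed
 show "T w (Seq (Assign rm (Bin Div (Bin Add (Var rl) (Var rh)) (Num 2)))
 (Seq test (If (Var rf) (Assign rh (Var rm)) (Assign rl (Bin Add (Var rm) (Num 1))))))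
 (%t s'. t <= \<tau> + 14 & Inv (k' - 1) s') (sg1, M1, out1)"
 using sm init(6) unfolding M1
 by (simp del: One_nat_def add: m_def[symmetric] sg2_def[symmetric])
 (rule T_mono[OF *], elim T_mono, auto)
 qed
 qed
 then show ?thesis
 proof (rule T_mono, goal_cases)
 case (1 t s')
 obtain sg' M' out' where s': "s' = (sg', M', out')" by (cases s')
 have "sg' rl = sg' rh" using 1 unfolding s' Inv_def by (auto split: if_splits)
 then show ?case using 1 unfolding s' Inv_def by (simp add: algebra_simps)
 qed
qed

section \<open>Tables in memory\<close>

text \<open>Register 10 holds the address of a directory whose cell \<open>k\<close> contains either
  a scalar or, for \<open>Arr\<close>, the address of a table. Changing this register lets the same
  code run on another structure in the same memory.\<close>

definition Scal :: "nat => exp" where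
 "Scal k = Mem (Bin Add (Var 10) (Num k))"

definition Arr :: "nat => exp => exp" where
 "Arr k e = Mem (Bin Add (Scal k) e)"

definition Mod :: "exp => exp => exp" where
 "Mod a b = Bin Sub a (Bin Mul (Bin Div a b) b)"

lemma ecost_macros [simp]:
 "ecost (Scal k) = 4" "ecost (Arr k e) = ecost e + 6"
 "ecost (Mod a b) = 2 * ecost a + 2 * ecost b + 3"
 by (auto simp: Scal_def Arr_def Mod_def)

lemma exp_vars_ok_macros [simp]:
 "exp_vars_ok (Scal k)" "exp_vars_ok (Arr k e) = exp_vars_ok e"
 "exp_vars_ok (Mod a b) \<longleftrightarrow> exp_vars_ok a & exp_vars_ok b"
 by (auto simp: Scal_def Arr_def Mod_def)

lemma ev_Mod [simp]: "ev sg M (Mod a b) = ev sg M a mod ev sg M b"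
 by (simp add: Mod_def minus_div_mult_eq_mod)

lemma ok_Mod [simp]:
 "ok w sg M (Mod a b) \<longleftrightarrow> ok w sg M a & ok w sg M b & ev sg M a div ev sg M b * ev sg M b < 2 ^ w"
 by (auto simp: Mod_def div_times_less_eq_dividend)

lemma T_seq_assign:
 assumes "ok w sg M e" "ev sg M e = v"
 "T w c (%t. Q (ecost e + 1 + t)) (sg(x := v), M, out)"
 shows "T w (Seq (Assign x e) c) Q (sg, M, out)"
 using assms by simp

lemma T_seq_call:
 assumes "T w c1 Q1 (sg, M, out)" "pure c1"
 and "!!t sg'. Q1 t (sg', M, out) ==> (!!r. r ~: mods c1 ==> sg' r = sg r) ==>
 T w c2 (%t2. Q (t + t2)) (sg', M, out)"
 shows "T w (Seq c1 c2) Q (sg, M, out)"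
 unfolding T_Seq by (rule T_call[OF assms(1,2)]) (rule assms(3))

definition scal :: "nat list => nat => nat => nat => bool" where
 "scal D hb k v \<longleftrightarrow> hb + k < length D & D ! (hb + k) = v"

definition tab :: "nat list => nat => nat => nat => (nat => nat) => bool" where
 "tab D hb k n f \<longleftrightarrow> hb + k < length D & D ! (hb + k) + n <= length D &
 (\<forall>i < n. D ! (D ! (hb + k) + i) = f i)"

text \<open>\<open>D\<close> is the stored structure and \<open>M\<close> the current memory. The
  bound on the length of \<open>M\<close> makes every address of a cell a word.\<close>

definition extends :: "nat => nat list => nat list => bool" where
 "extends w D M \<longleftrightarrow> take (length D) M = D & length M < 2 ^ w"

lemma extends_nth: "extends w D M ==> i < length D ==> M ! i = D ! i"
 unfolding extends_def by (metis nth_take)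

lemma extends_length: "extends w D M ==> length D <= length M"
 unfolding extends_def by (metis length_take min.cobounded1)

lemma Scal_eval:
 assumes "scal D hb k v" "extends w D M" "sg 10 = hb"
 shows "ev sg M (Scal k) = v" "ok w sg M (Scal k)"
proof -
 have l: "hb + k < length M" "length M < 2 ^ w"
 using assms extends_length by (auto simp: scal_def extends_def intro: less_le_trans)
 then show "ok w sg M (Scal k)" using assms(3) by (simp add: Scal_def)
 show "ev sg M (Scal k) = v"
 using assms extends_nth[OF assms(2)] by (simp add: scal_def Scal_def)
qed

lemma Arr_eval:
 assumes "tab D hb k n f" "extends w D M" "sg 10 = hb" "ev sg M e < n"
 shows "ev sg M (Arr k e) = f (ev sg M e)" "ok w sg M (Arr k e) = ok w sg M e"
proof -
 have s: "scal D hb k (D ! (hb + k))" using assms(1) by (simp add: scal_def tab_def)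
 note S = Scal_eval[where sg = sg, OF s assms(2,3)]
 have b: "D ! (hb + k) + ev sg M e < length D" using assms(1,4) by (auto simp: tab_def)
 then have "D ! (hb + k) + ev sg M e < length M" "length M < 2 ^ w"
 using extends_length[OF assms(2)] assms(2) by (auto simp: extends_def)
 then show "ok w sg M (Arr k e) = ok w sg M e" using S by (simp add: Arr_def)
 show "ev sg M (Arr k e) = f (ev sg M e)"
 using S b assms(1,4) extends_nth[OF assms(2)] by (simp add: Arr_def tab_def)
qed

lemma div_mod_mult_add: "i < m ==> (s * m + i) div m = s & (s * m + i) mod m = (i :: nat)"
 by simp

text \<open>The predecessor structure: two displacement tables and a table of records, each preceded by
 a code of its key (or by \<^term>\<open>0 :: nat\<close>).\<close>

definition pred_fun ::
 "nat => nat => (nat => nat set) => (nat => nat => nat => nat) => nat => nat =>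
 (nat => nat) => (nat => nat) => (nat => nat) => bool" where
 "pred_fun L ids Xs F om R Tf disp cf \<longleftrightarrow>
 ids <= R & (ALL z. Tf z < R) & (ALL r. disp r <= 2 * R) &
 (ALL id z. id < ids --> z < 2 * 2 ^ L -->
 (cf ((disp ((id + Tf z) mod R) + z) * (om + 1)) = id * (2 * 2 ^ L) + z + 1) =
 (z \<in> trie_keys L (Xs id))) &
 (ALL id q j i. id < ids --> q < 2 ^ L --> j <= L --> i < om -->
 trie_key L j q \<in> trie_keys L (Xs id) -->
 (j = L \<or> trie_key L (Suc j) q ~: trie_keys L (Xs id)) -->
 cf ((disp ((id + Tf (trie_key L j q)) mod R) + trie_key L j q) * (om + 1) + 1 + i) = F id q i)"

text \<open>The trie nodes of all sets of the family, tagged by the number of the set, form one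
  sparse set of pairs, so a single hash table of size \<open>O(R)\<close> slots serves the whole
  family.\<close>

lemma ex_pred_fun:
 assumes X: "!!id. id < ids ==> Xs id \<subseteq> {..<2 ^ L}"
 and F: "!!id q q' i. id < ids ==> i < om ==> q < 2 ^ L ==> q' < 2 ^ L ==>
 \<forall>x\<in>Xs id. x < q \<longleftrightarrow> x < q' ==> F id q i = F id q' i"
 and Fb: "!!id q i. id < ids ==> i < om ==> q < 2 ^ L ==> F id q i <= V"
 and R: "ids <= R" "0 < R" "ids + (L + 1) * (\<Sum>id<ids. card (Xs id)) <= R"
 shows "EX Tf disp cf. pred_fun L ids Xs F om R Tf disp cf & (ALL i. cf i <= V + 2 * R * 2 ^ L)"
proof -
 define K where "K = (SIGMA id:{..<ids}. trie_keys L (Xs id))"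
 have fX: "finite (Xs id)" if "id < ids" for id using X[OF that] finite_subset by blast
 have fK: "finite K" unfolding K_def using card_trie_keys(1) fX by auto
 have "card K = (\<Sum>id<ids. card (trie_keys L (Xs id)))"
 unfolding K_def using card_trie_keys(1) fX by (subst card_SigmaI) auto
 also have "... <= (\<Sum>id<ids. 1 + (L + 1) * card (Xs id))"
 by (rule sum_mono) (use card_trie_keys(2) fX in auto)
 also have "... = ids + (L + 1) * (\<Sum>id<ids. card (Xs id))"
 by (simp only: sum.distrib sum_distrib_left sum_constant card_lessThan) simp
 finally have cK: "card K <= R" using R(3) by simp
 have "fst ` K \<subseteq> {..<R}" using R(1) by (auto simp: K_def)
 then obtain Tf disp where H: "ALL z. Tf z < R" "ALL r. disp r <= 2 * R"
 "\<forall>(i, z) \<in> K. \<forall>(i', z') \<in> K.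
 disp ((i + Tf z) mod R) + z = disp ((i' + Tf z') mod R) + z' --> i = i' & z = z'"
 using double_displacement[OF fK _ cK R(2)] by blast
 define slot where "slot = (%(id, z). disp ((id + Tf z) mod R) + z)"
 \<comment> \<open>The code is positive, so an empty slot, marked by 0, is never mistaken for a key;
   and it is injective on the nodes in question, so a slot owned by another key is
   recognised.\<close>
 define code :: "nat \<times> nat => nat" where "code = (%(id, z). id * (2 * 2 ^ L) + z + 1)"
 have inj: "inj_on slot K" using H(3) by (force simp: inj_on_def slot_def)
 have "EX G. ALL id i. id < ids --> i < om --> (ALL q j. q < 2 ^ L --> j <= L -->
 (j = L \<or> trie_key L (Suc j) q ~: trie_keys L (Xs id)) --> G id i (trie_key L j q) = F id q i)"
 proof -
 have "EX g. id < ids --> i < om --> (ALL q j. q < 2 ^ L --> j <= L -->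
 (j = L \<or> trie_key L (Suc j) q ~: trie_keys L (Xs id)) --> g (trie_key L j q) = F id q i)" for id i
 using trie_record[OF X, of id "%q. F id q i"] F by blast
 then show ?thesis by metis
 qed
 then obtain G where G: "!!id i q j. id < ids ==> i < om ==> q < 2 ^ L ==> j <= L ==>
 (j = L \<or> trie_key L (Suc j) q ~: trie_keys L (Xs id)) ==> G id i (trie_key L j q) = F id q i"
 by blast
 \<comment> \<open>The minimum with \<open>V\<close> only affects records of nodes at which no query
   ends, where \<open>G\<close> is arbitrary; the answers themselves are at most
   \<open>V\<close>.\<close>
 define cf where "cf = (%a. let s = a div (om + 1); i = a mod (om + 1) in
 if s \<in> slot ` K then let (id, z) = the_inv_into K slot s in
 if i = 0 then code (id, z) else min V (G id (i - 1) z) else 0)"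
 have cf: "cf (slot (id, z) * (om + 1) + i) =
 (if i = 0 then code (id, z) else min V (G id (i - 1) z))"
 if "(id, z) \<in> K" "i < om + 1" for id z i
 proof -
 have "(slot (id, z) * (om + 1) + i) div (om + 1) = slot (id, z)"
 "(slot (id, z) * (om + 1) + i) mod (om + 1) = i" using div_mod_mult_add[OF that(2)] by auto
 moreover have "the_inv_into K slot (slot (id, z)) = (id, z)"
 by (rule the_inv_into_f_f[OF inj that(1)])
 ultimately show ?thesis using that(1) by (simp add: cf_def)
 qed
 have zb: "z < 2 * 2 ^ L" if "(id, z) \<in> K" for id z
 using that trie_keys_less[OF X] by (auto simp: K_def)
 have code_inj: "(id, z) = (id', z')" if "code (id, z) = code (id', z')" "z < 2 * 2 ^ L" "z' < 2 * 2 ^ L" for id z id' z'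
 proof -
 have e: "id * (2 * 2 ^ L) + z = id' * (2 * 2 ^ L) + z'" using that(1) by (simp add: code_def)
 have "(id * (2 * 2 ^ L) + z) div (2 * 2 ^ L) = id" "(id' * (2 * 2 ^ L) + z') div (2 * 2 ^ L) = id'"
 using that by auto
 then have "id = id'" using e by metis
 then show ?thesis using e by simp
 qed
 have "pred_fun L ids Xs F om R Tf disp cf" unfolding pred_fun_def
 proof (intro conjI allI impI)
 fix id z :: nat
 assume a: "id < ids" "z < 2 * 2 ^ L"
 have e: "(disp ((id + Tf z) mod R) + z) * (om + 1) = slot (id, z) * (om + 1) + 0"
 by (simp add: slot_def)
 show "(cf ((disp ((id + Tf z) mod R) + z) * (om + 1)) = id * (2 * 2 ^ L) + z + 1) =
 (z \<in> trie_keys L (Xs id))"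
 proof (cases "slot (id, z) \<in> slot ` K")
 case True
 then obtain id' z' where K': "(id', z') \<in> K" "slot (id, z) = slot (id', z')" by force
 have "cf (slot (id', z') * (om + 1) + 0) = code (id', z')" using cf[OF K'(1), of 0] by simp
 then have "cf ((disp ((id + Tf z) mod R) + z) * (om + 1)) = code (id', z')" unfolding e K'(2) .
 then have "cf ((disp ((id + Tf z) mod R) + z) * (om + 1)) = id * (2 * 2 ^ L) + z + 1 \<longleftrightarrow> (id, z) = (id', z')"
 using code_inj[of id' z' id z] a zb[OF K'(1)] by (auto simp: code_def)
 also have "... \<longleftrightarrow> (id, z) \<in> K" using inj K' by (auto simp: inj_on_def)
 finally show ?thesis using a by (simp add: K_def)
 next
 case False
 then have "(id, z) ~: K" by blast
 moreover have "cf ((disp ((id + Tf z) mod R) + z) * (om + 1)) = 0"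
 using div_mod_mult_add[of 0 "om + 1" "slot (id, z)"] False unfolding e cf_def Let_def by simp
 ultimately show ?thesis using a by (simp add: K_def)
 qed
 next
 fix id q j i
 assume a: "id < ids" "q < 2 ^ L" "j <= L" "i < om" "trie_key L j q \<in> trie_keys L (Xs id)"
 "j = L \<or> trie_key L (Suc j) q ~: trie_keys L (Xs id)"
 have "(id, trie_key L j q) \<in> K" using a by (simp add: K_def)
 from cf[OF this, of "1 + i"] show
 "cf ((disp ((id + Tf (trie_key L j q)) mod R) + trie_key L j q) * (om + 1) + 1 + i) = F id q i"
 using a G[of id i q j] Fb[of id i q] by (simp add: slot_def add.assoc)
 qed (use H R in auto)
 moreover have "cf i <= V + 2 * R * 2 ^ L" for i
 proof (cases "i div (om + 1) \<in> slot ` K")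
 case True
 obtain id z where t: "the_inv_into K slot (i div (om + 1)) = (id, z)" by fastforce
 have "(id, z) \<in> K" using the_inv_into_into[OF inj True, of K] t by simp
 then have "id < R" "z < 2 * 2 ^ L" using zb R(1) by (auto simp: K_def)
 then have "id + 1 <= R" "z + 1 <= 2 * 2 ^ L" by auto
 from mult_le_mono1[OF this(1), of "2 * 2 ^ L"] this(2)
 have "(id + 1) * (2 * 2 ^ L) <= R * (2 * 2 ^ L)" "z + 1 <= 2 * 2 ^ L" by auto
 then have "code (id, z) <= V + 2 * R * 2 ^ L" by (simp add: code_def)
 moreover have "cf i = (if i mod (om + 1) = 0 then code (id, z) else min V (G id (i mod (om + 1) - 1) z))"
 unfolding cf_def Let_def t if_P[OF True] by simp
 ultimately show ?thesis by (auto intro: trans_le_add1)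
 qed (simp add: cf_def Let_def)
 ultimately show ?thesis by blast
qed

section \<open>Predecessor queries\<close>

lemma trie_key_bound:
 assumes "q < 2 ^ L" "j <= L"
 shows "trie_key L j q < 2 * 2 ^ L"
proof -
 have "(2::nat) ^ Suc j <= 2 ^ Suc L" using assms(2) by (intro power_increasing) auto
 then show ?thesis using trie_key_less(2)[OF assms] unfolding power_Suc by linarith
qed

lemma pred_fun_record:
 assumes "pred_fun L ids Xs F om R Tf disp cf" "i < ids" "q < 2 ^ L" "j <= L" "k < om"
 "trie_key L j q \<in> trie_keys L (Xs i)" "j = L \<or> trie_key L (Suc j) q ~: trie_keys L (Xs i)"
 shows "cf ((disp ((i + Tf (trie_key L j q)) mod R) + trie_key L j q) * (om + 1) + 1 + k) = F i q k"
 using assms unfolding pred_fun_def by blast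

text \<open>Registers 20, 21 and 24 hold the number of the set, the query and a depth; 26 receives
  the trie node, 27 the address of its slot, and 25 becomes nonzero if the node is absent. Absence
  is monotone in the depth, which is the form that \<open>bisect\<close> expects.\<close>

definition lookup :: "nat => nat => nat => nat => nat => com" where
 "lookup kT kD kC kR kW =
 Seq (Assign 26 (Bin Add (Arr 2 (Var 24)) (Bin Div (Var 21) (Arr 2 (Bin Sub (Scal 0) (Var 24))))))
 (Seq (Assign 27 (Bin Add (Scal kC) (Bin Mul (Bin Add (Arr kD (Mod (Bin Add (Var 20) (Arr kT (Var 26))) (Scal kR))) (Var 26)) (Scal kW))))
 (Assign 25 (Bin Equal (Bin Equal (Mem (Var 27))
 (Bin Add (Bin Mul (Var 20) (Bin Mul (Num 2) (Scal 1))) (Bin Add (Var 26) (Num 1)))) (Num 0))))"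

text \<open>Since the root is always present, the depth just before the first absent one exists; its
  node is the exit node. Register 28 receives the address of the record behind the key code.\<close>

definition pred_query :: "nat => nat => nat => nat => nat => com" where
 "pred_query kT kD kC kR kW =
 Seq (Assign 22 (Num 0))
 (Seq (Assign 23 (Bin Add (Scal 0) (Num 1)))
 (Seq (bisect 22 23 24 25 (lookup kT kD kC kR kW))
 (Seq (Assign 24 (Bin Sub (Var 22) (Num 1)))
 (Seq (lookup kT kD kC kR kW)
 (Assign 28 (Bin Add (Var 27) (Num 1)))))))"

lemma mods_lookup [simp]: "mods (lookup kT kD kC kR kW) = {25, 26, 27}"
 by (auto simp: lookup_def)

lemma mods_pred [simp]: "mods (pred_query kT kD kC kR kW) = {22, 23, 24, 25, 26, 27, 28}"
 by (auto simp: pred_query_def)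

lemma pure_pred [simp]: "pure (lookup kT kD kC kR kW)" "pure (pred_query kT kD kC kR kW)"
 by (auto simp: lookup_def pred_query_def)

lemma vars_ok_pred [simp]: "vars_ok (lookup kT kD kC kR kW)" "vars_ok (pred_query kT kD kC kR kW)"
 by (auto simp: lookup_def pred_query_def)

locale memory =
 fixes w L hb :: nat and D :: "nat list"
 assumes scal_L: "scal D hb 0 L" and scal_N: "scal D hb 1 (2 ^ L)"
 and tab_pow: "tab D hb 2 (L + 1) (%i. 2 ^ i)" and word: "1000 + 8 * 2 ^ L < (2::nat) ^ w"
begin

definition pred_mem ::
 "nat => nat => nat => nat => nat => nat => (nat => nat set) => (nat => nat => nat => nat) => nat => bool" where
 "pred_mem kT kD kC kR kW ids Xs F om \<longleftrightarrow> (EX R Tf disp cf. pred_fun L ids Xs F om R Tf disp cf &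
 tab D hb kT (2 * 2 ^ L) Tf & tab D hb kD R disp &
 tab D hb kC ((2 * R + 2 * 2 ^ L) * (om + 1)) cf & scal D hb kR R & scal D hb kW (om + 1) &
 0 < R & 2 * R * 2 ^ L + 2 * R + 4 * 2 ^ L + 1 < 2 ^ w & (\<forall>id<ids. Xs id \<subseteq> {..<2 ^ L}))"

lemma T_lookup:
 fixes id q j :: nat
 assumes M: "extends w D M" and 10: "sg 10 = hb" and id: "sg 20 = id" "id < ids" and q: "sg 21 = q" "q < 2 ^ L"
 and j: "sg 24 = j" "j <= L"
 and pf: "pred_fun L ids Xs F om R Tf disp cf"
 and tabs: "tab D hb kT (2 * 2 ^ L) Tf" "tab D hb kD R disp"
 "tab D hb kC ((2 * R + 2 * 2 ^ L) * (om + 1)) cf" "scal D hb kR R" "scal D hb kW (om + 1)"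
 and R: "0 < R" "2 * R * 2 ^ L + 2 * R + 4 * 2 ^ L + 1 < 2 ^ w"
 shows "T w (lookup kT kD kC kR kW) (%t (sg', _). t <= 200 &
 sg' 27 = D ! (hb + kC) + (disp ((id + Tf (trie_key L j q)) mod R) + trie_key L j q) * (om + 1) &
 (sg' 25 ~= 0 \<longleftrightarrow> trie_key L j q ~: trie_keys L (Xs id))) (sg, M, out)"
proof -
 define z where "z = trie_key L j q"
 define s where "s = disp ((id + Tf z) mod R) + z"
 have pow: "ev sg M (Arr 2 e) = 2 ^ ev sg M e" "ok w sg M (Arr 2 e) = ok w sg M e"
 if "ev sg M e <= L" for e
 using Arr_eval[OF tab_pow M, of sg e] 10 that by auto
 note SL = Scal_eval[OF scal_L M] and SN = Scal_eval[OF scal_N M]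
 have z: "z < 2 * 2 ^ L" using trie_key_bound[OF q(2) j(2)] by (simp add: z_def)
 have P: "ids <= R" "Tf z < R" "disp ((id + Tf z) mod R) <= 2 * R"
 using pf by (auto simp: pred_fun_def)
 have code: "(cf (s * (om + 1)) = id * (2 * 2 ^ L) + z + 1) = (z \<in> trie_keys L (Xs id))"
 using pf id(2) z by (auto simp: pred_fun_def s_def)
 have s: "s < 2 * R + 2 * 2 ^ L" using P z by (simp add: s_def)
 then have sm: "(s + 1) * (om + 1) <= (2 * R + 2 * 2 ^ L) * (om + 1)" by (intro mult_le_mono1) simp
 have sb: "s * (om + 1) < (2 * R + 2 * 2 ^ L) * (om + 1)" using s by (intro mult_less_mono1) auto
 have Mw: "length M < 2 ^ w" "length D <= length M" using M extends_length by (auto simp: extends_def)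
 have ab: "D ! (hb + kC) + s * (om + 1) < length D" using tabs(3) sb by (auto simp: tab_def)
 have cM: "M ! (D ! (hb + kC) + s * (om + 1)) = cf (s * (om + 1))"
 using extends_nth[OF M ab] tabs(3) sb by (auto simp: tab_def)
 have "scal D hb kC (D ! (hb + kC))" using tabs(3) by (auto simp: scal_def tab_def)
 note SC = Scal_eval[OF this M] and SR = Scal_eval[OF tabs(4) M] and SW = Scal_eval[OF tabs(5) M]
 define sg1 where "sg1 = sg(26 := z)"
 define sg2 where "sg2 = sg1(27 := D ! (hb + kC) + s * (om + 1))"
 have A1: "ok w sg M (Bin Add (Arr 2 (Var 24)) (Bin Div (Var 21) (Arr 2 (Bin Sub (Scal 0) (Var 24)))))"
 "ev sg M (Bin Add (Arr 2 (Var 24)) (Bin Div (Var 21) (Arr 2 (Bin Sub (Scal 0) (Var 24))))) = z"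
 using pow SL[of sg] 10 j q z word by (simp_all add: z_def trie_key_def)
 have AT: "ev sg1 M (Arr kT (Var 26)) = Tf z" "ok w sg1 M (Arr kT (Var 26))"
 using Arr_eval[OF tabs(1) M, of sg1 "Var 26"] 10 z by (simp_all add: sg1_def)
 have idR: "id + Tf z < 2 ^ w" using P id(2) R by linarith
 define e where "e = Mod (Bin Add (Var 20) (Arr kT (Var 26))) (Scal kR)"
 have AE: "ev sg1 M e = (id + Tf z) mod R" "ok w sg1 M e"
 using AT SR[of sg1] 10 id idR le_less_trans[OF div_times_less_eq_dividend idR, of R]
 by (simp_all add: e_def sg1_def)
 have AD: "ev sg1 M (Arr kD e) = disp ((id + Tf z) mod R)" "ok w sg1 M (Arr kD e)"
 using Arr_eval[OF tabs(2) M, of sg1 e] 10 AE R(1) by (simp_all add: sg1_def)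
 have s2: "s < 2 ^ w" using s R by linarith
 have smw: "s * (om + 1) < 2 ^ w" "D ! (hb + kC) + s * (om + 1) < 2 ^ w" using ab Mw by linarith+
 define e2 where "e2 = Bin Add (Scal kC) (Bin Mul (Bin Add (Arr kD e) (Var 26)) (Scal kW))"
 have A2: "ok w sg1 M e2" "ev sg1 M e2 = D ! (hb + kC) + s * (om + 1)"
 using AD SC[of sg1] SW[of sg1] 10 s2 smw by (simp_all add: e2_def sg1_def s_def)
 have "(id + 1) * (2 * 2 ^ L) <= R * (2 * 2 ^ L)" using id(2) P(1) by (intro mult_le_mono1) simp
 then have cw: "id * (2 * 2 ^ L) + z + 1 < 2 ^ w" using z R by (simp add: algebra_simps)
 then have cw': "id * (2 * 2 ^ L) < 2 ^ w" "z + 1 < 2 ^ w" by linarith+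
 define e3 where "e3 = Bin Equal (Bin Equal (Mem (Var 27))
 (Bin Add (Bin Mul (Var 20) (Bin Mul (Num 2) (Scal 1))) (Bin Add (Var 26) (Num 1)))) (Num 0)"
 have A3: "ok w sg2 M e3" "ev sg2 M e3 ~= 0 \<longleftrightarrow> z ~: trie_keys L (Xs id)"
 using SN[of sg2] 10 id cM code cw cw' ab Mw word
 by (simp_all add: e3_def sg2_def sg1_def add.assoc)
 have eq: "lookup kT kD kC kR kW = Seq (Assign 26 (Bin Add (Arr 2 (Var 24)) (Bin Div (Var 21) (Arr 2 (Bin Sub (Scal 0) (Var 24))))))
 (Seq (Assign 27 e2) (Assign 25 e3))"
 by (simp add: lookup_def e2_def e_def e3_def)
 have cost: "ecost e2 <= 60" "ecost e3 <= 20" by (simp_all add: e2_def e_def e3_def)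
 show ?thesis unfolding eq
 using A1 A2 A3 cost by (simp add: sg1_def[symmetric] sg2_def[symmetric] z_def[symmetric] s_def[symmetric]) (simp add: sg2_def)
qed

text \<open>The search runs over \<open>L + 1 < 2 ^ k\<close> depths, so it takes \<open>k\<close>
  rounds of constant cost. With \<open>k = Lam\<close> this is the source of the term
  \<open>log log n\<close>.\<close>

lemma T_pred:
 assumes M: "extends w D M" and 10: "sg 10 = hb" and id: "sg 20 < ids" and q: "sg 21 < 2 ^ L"
 and pm: "pred_mem kT kD kC kR kW ids Xs F om" and k: "L + 1 < 2 ^ k"
 shows "T w (pred_query kT kD kC kR kW) (%t (sg', _). t <= 300 * (k + 1) &
 sg' 28 + om <= length D & (\<forall>i<om. M ! (sg' 28 + i) = F (sg 20) (sg 21) i)) (sg, M, out)"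
proof -
 obtain R Tf disp cf where pf: "pred_fun L ids Xs F om R Tf disp cf"
 and tabs: "tab D hb kT (2 * 2 ^ L) Tf" "tab D hb kD R disp"
 "tab D hb kC ((2 * R + 2 * 2 ^ L) * (om + 1)) cf" "scal D hb kR R" "scal D hb kW (om + 1)"
 and R: "0 < R" "2 * R * 2 ^ L + 2 * R + 4 * 2 ^ L + 1 < 2 ^ w"
 and X: "\<forall>id<ids. Xs id \<subseteq> {..<2 ^ L}"
 using pm by (auto simp: pred_mem_def)
 define id where "id = sg 20"
 define q where "q = sg 21"
 have Xi: "Xs id \<subseteq> {..<2 ^ L}" using X id by (simp add: id_def)
 note SL = Scal_eval[OF scal_L M]
 have Lw: "L + 1 + (L + 1) < 2 ^ w" "2 < (2::nat) ^ w"
 proof -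
 have "L < 2 ^ L" by simp
 then show "L + 1 + (L + 1) < 2 ^ w" "2 < (2::nat) ^ w" using word by linarith+
 qed
 define sg1 where "sg1 = sg(22 := 0, 23 := L + 1)"
 define miss where "miss = (%j. j <= L --> trie_key L j q ~: trie_keys L (Xs id))"
 have B: "T w (bisect 22 23 24 25 (lookup kT kD kC kR kW)) (%t (sg', _). t <= k * (200 + 19) + 4 &
 0 <= sg' 22 & sg' 22 <= L + 1 & (ALL i. 0 <= i & i < sg' 22 --> \<not> miss i) &
 (ALL i. sg' 22 <= i & i < L + 1 --> miss i)) (sg1, M, out)"
 proof (rule T_bisect)
 fix sg' :: "reg => nat" assume fr: "!!r. r ~: insert 22 (insert 23 (insert 24 (mods (lookup kT kD kC kR kW)))) ==> sg' r = sg1 r"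
 and lt: "0 <= sg' 24" "sg' 24 < L + 1"
 have v: "sg' 10 = hb" "sg' 20 = id" "sg' 21 = q"
 using fr[of 10] fr[of 20] fr[of 21] 10 by (auto simp: sg1_def id_def q_def)
 show "T w (lookup kT kD kC kR kW) (%t (sg'', _). t <= 200 & (sg'' 25 ~= 0) = miss (sg' 24)) (sg', M, out)"
 by (rule T_mono[OF T_lookup[OF M v(1,2) _ v(3) _ refl _ pf tabs R]])
 (use id q lt in \<open>auto simp: id_def q_def miss_def\<close>)
 next
 fix i j assume "i <= j" "j < L + 1" "miss i"
 then show "miss j"
 proof (induction j rule: dec_induct)
 case (step n)
 then show ?case using trie_keys_mono[OF Xi, of q n] q by (auto simp: miss_def q_def)
 qed
 qed (use Lw k in \<open>auto simp: sg1_def\<close>)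
 have root: "\<not> miss 0" by (simp add: miss_def trie_key_def trie_keys_def q q_def)
 have B': "T w (bisect 22 23 24 25 (lookup kT kD kC kR kW)) (%t1 s. T w (Seq (Assign 24 (Bin Sub (Var 22) (Num 1)))
 (Seq (lookup kT kD kC kR kW)
 (Assign 28 (Bin Add (Var 27) (Num 1))))) (%t (sg', _). t1 + t <= 300 * k + 250 &
 sg' 28 + om <= length D & (\<forall>i<om. M ! (sg' 28 + i) = F id q i)) s) (sg1, M, out)"
 proof (rule T_call[OF B])
 fix t and sg' :: "reg => nat"
 assume "case (sg', M, out) of (sg', _) => t <= k * (200 + 19) + 4 &
 0 <= sg' 22 & sg' 22 <= L + 1 & (ALL i. 0 <= i & i < sg' 22 --> \<not> miss i) &
 (ALL i. sg' 22 <= i & i < L + 1 --> miss i)"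
 then have a: "t <= k * (200 + 19) + 4" "sg' 22 <= L + 1" "\<forall>i<sg' 22. \<not> miss i"
 "ALL i. sg' 22 <= i & i < L + 1 --> miss i" by auto
 assume fr: "!!r. r ~: mods (bisect 22 23 24 25 (lookup kT kD kC kR kW)) ==> sg' r = sg1 r"
 have pos: "sg' 22 >= 1" using a(4) root by (metis One_nat_def Suc_leI le_add2 add.commute le_imp_less_Suc not_gr_zero plus_1_eq_Suc zero_le)
 define j where "j = sg' 22 - 1"
 have j: "j <= L" "sg' 22 = j + 1" using a pos by (auto simp: j_def)
 define sg2 where "sg2 = sg'(24 := j)"
 have v: "sg2 10 = hb" "sg2 20 = id" "sg2 21 = q" "sg2 24 = j"
 using fr[of 10] fr[of 20] fr[of 21] 10 by (auto simp: sg1_def sg2_def id_def q_def)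
 have kin: "trie_key L j q \<in> trie_keys L (Xs id)" using a(3) j by (auto simp: miss_def)
 have kout: "j = L \<or> trie_key L (Suc j) q ~: trie_keys L (Xs id)"
 using a(4) j by (auto simp: miss_def)
 define s where "s = disp ((id + Tf (trie_key L j q)) mod R) + trie_key L j q"
 have cfF: "cf (s * (om + 1) + 1 + i) = F id q i" if "i < om" for i
 using pred_fun_record[OF pf, of id q j i] that j(1) kin kout id q unfolding s_def id_def q_def by blast
 have "trie_key L j q < 2 * 2 ^ L" using trie_key_bound[of q L j] q j by (simp add: q_def)
 moreover have "disp ((id + Tf (trie_key L j q)) mod R) <= 2 * R" using pf by (auto simp: pred_fun_def)
 ultimately have "(s + 1) * (om + 1) <= (2 * R + 2 * 2 ^ L) * (om + 1)"
 by (intro mult_le_mono1) (simp add: s_def)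
 then have sb: "s * (om + 1) + 1 + om <= (2 * R + 2 * 2 ^ L) * (om + 1)" by (simp add: algebra_simps)
 define b where "b = D ! (hb + kC) + s * (om + 1) + 1"
 have bo: "b + om <= length D" using tabs(3) sb by (auto simp: tab_def b_def)
 have Mb: "M ! (b + i) = F id q i" if "i < om" for i
 proof -
 have "b + i < length D" using bo that by simp
 then have "M ! (b + i) = D ! (D ! (hb + kC) + (s * (om + 1) + 1 + i))"
 using extends_nth[OF M] by (simp add: b_def add.assoc)
 also have "... = cf (s * (om + 1) + 1 + i)"
 proof -
 have "s * (om + 1) + 1 + i < (2 * R + 2 * 2 ^ L) * (om + 1)" using sb that by linarith
 then show ?thesis using tabs(3) unfolding tab_def by blast
 qed
 finally show ?thesis using cfF[OF that] by simp
 qed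
 have bw: "b < 2 ^ w" using bo M extends_length[OF M] by (auto simp: extends_def)
 have "T w (lookup kT kD kC kR kW) (%t1. T w (Assign 28 (Bin Add (Var 27) (Num 1))) (%t (sg', _).
 t1 + t <= 204 & sg' 28 = b)) (sg2, M, out)"
 by (rule T_call[OF T_lookup[OF M v(1,2) _ v(3) _ v(4) j(1) pf tabs R]])
 (use id q bw word in \<open>auto simp: id_def q_def b_def s_def\<close>)
 then show "T w (Seq (Assign 24 (Bin Sub (Var 22) (Num 1))) (Seq (lookup kT kD kC kR kW)
 (Assign 28 (Bin Add (Var 27) (Num 1))))) (%ta (sg', _). t + ta <= 300 * k + 250 &
 sg' 28 + om <= length D & (\<forall>i<om. M ! (sg' 28 + i) = F id q i)) (sg', M, out)"
 using pos a(1) word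
 by (simp add: j(2) sg2_def[symmetric], elim T_mono) (use bo Mb in auto)
 qed simp
 have B'': "T w (Seq (bisect 22 23 24 25 (lookup kT kD kC kR kW)) (Seq (Assign 24 (Bin Sub (Var 22) (Num 1)))
 (Seq (lookup kT kD kC kR kW) (Assign 28 (Bin Add (Var 27) (Num 1))))))
 (%t (sg', _). t <= 300 * k + 250 &
 sg' 28 + om <= length D & (\<forall>i<om. M ! (sg' 28 + i) = F id q i)) (sg1, M, out)"
 using B' unfolding T_Seq[of w "bisect _ _ _ _ _"] .
 show ?thesis unfolding pred_query_def
 proof (rule T_seq_assign[where v = 0], goal_cases)
 case 3
 show ?case
 proof (rule T_seq_assign[where v = "L + 1"], goal_cases)
 case 3
 show ?case
 by (rule T_mono[OF B''[unfolded sg1_def]]) (auto simp: id_def q_def)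
 qed (use SL[of "sg(22 := 0)"] 10 Lw word in auto)
 qed (use word in simp_all)
qed

end

section \<open>Translating positions to the leaves\<close>

lemma ex_flatten:
 fixes sz :: "nat => nat" and h :: "nat => nat => nat"
 assumes "!!t q. h t q <= V"
 shows "EX F. (\<forall>t<n. \<forall>q<sz t. F ((\<Sum>t'<t. sz t') + q) = h t q) & (ALL i. F i <= V)"
proof (induction n)
 case 0
 then show ?case by (intro exI[of _ "%_. 0"]) simp
next
 case (Suc n)
 then obtain F where F: "\<forall>t<n. \<forall>q<sz t. F ((\<Sum>t'<t. sz t') + q) = h t q" "ALL i. F i <= V" by blast
 define F' where "F' = (%i. if i < (\<Sum>t'<n. sz t') then F i else h n (i - (\<Sum>t'<n. sz t')))"
 have "F' ((\<Sum>t'<t. sz t') + q) = h t q" if "t < Suc n" "q < sz t" for t q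
 proof (cases "t = n")
 case True
 then show ?thesis by (simp add: F'_def)
 next
 case False
 then have t: "t < n" using that by simp
 have "(\<Sum>t'<t. sz t') + sz t = (\<Sum>t'<Suc t. sz t')" by simp
 also have "... <= (\<Sum>t'<n. sz t')" using t by (intro sum_mono2) auto
 finally show ?thesis using F(1) t that by (simp add: F'_def)
 qed
 moreover have "ALL i. F' i <= V" using F(2) assms by (simp add: F'_def)
 ultimately show ?case by blast
qed

lemma flatten_less:
 fixes sz :: "nat => nat"
 assumes "t < n" "q < sz t"
 shows "(\<Sum>t'<t. sz t') + q < (\<Sum>t'<n. sz t')"
proof -
 have "(\<Sum>t'<t. sz t') + sz t = (\<Sum>t'<Suc t. sz t')" by simp
 also have "... <= (\<Sum>t'<n. sz t')" using assms(1) by (intro sum_mono2) auto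
 finally show ?thesis using assms(2) by simp
qed

context perm_tree
begin

text \<open>One jump from level \<open>t\<close> to level \<open>nx\<close>: \<open>fo\<close> and
  \<open>bo\<close> are the offsets of the level in the table of packed words and in the table of
  bases, a word holds \<open>f\<close> fields of \<open>b\<close> bits each, \<open>m\<close> is
  \<open>2 ^ b\<close>, \<open>K\<close> is the block length and \<open>g\<close> the number of
  descendants to choose from. The quotient of a field by \<open>K\<close> is the choice, the
  remainder is the offset.\<close>

definition dec_step :: "nat => (nat => nat) => nat => (nat => nat) => nat =>
 nat => nat => nat => nat => nat => nat => nat => nat => bool" where
 "dec_step FL fld BL bas t fo f b m bo K g nx \<longleftrightarrow>
 (\<forall>p<N. fo + p div f < FL &
 bo + p div K * g + fld (fo + p div f) div 2 ^ (p mod f * b) mod m div K < BL &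
 bas (bo + p div K * g + fld (fo + p div f) div 2 ^ (p mod f * b) mod m div K) +
 fld (fo + p div f) div 2 ^ (p mod f * b) mod m mod K = pos nx (A t p))"

text \<open>Eight parameters are kept per level. The class \<open>cl\<close> is not stored; it falls
  with every jump and so bounds their number by \<open>I\<close>.\<close>

definition dec_fun :: "nat => nat => nat => (nat => nat) => nat => (nat => nat) => (nat => nat) => bool" where
 "dec_fun w I FL fld BL bas par \<longleftrightarrow> (EX cl. (ALL t. cl t <= I) &
 (\<forall>t<L. t < par (t * 8 + 7) & par (t * 8 + 7) <= L & cl (par (t * 8 + 7)) < cl t &
 0 < par (t * 8 + 1) & par (t * 8 + 1) * par (t * 8 + 2) < 2 ^ w &
 dec_step FL fld BL bas t (par (t * 8)) (par (t * 8 + 1)) (par (t * 8 + 2)) (par (t * 8 + 3))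
 (par (t * 8 + 4)) (par (t * 8 + 5)) (par (t * 8 + 6)) (par (t * 8 + 7))))"

text \<open>For a jump over \<open>g\<close> levels the block length is
  \<open>2 ^ (g + ell)\<close>. This makes the base table of the level about
  \<open>N / 2 ^ ell + 2 ^ g\<close> entries long, and a field has to hold \<open>g\<close> bits for
  the descendant and \<open>g + ell\<close> bits for the offset.\<close>

lemma ex_dec_fun:
 assumes nxt: "\<forall>t<L. t < nxt t & nxt t <= L & cl (nxt t) < cl t" "ALL t. cl t <= I"
 and w: "4 * L + 4 * ell + 4 < w"
 defines "FL \<equiv> \<Sum>t<L. N div (w div (2 * (nxt t - t) + ell + 1)) + 1"
 and "BL \<equiv> \<Sum>t<L. (N div 2 ^ (nxt t - t + ell) + 1) * 2 ^ (nxt t - t)"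
 shows "EX fld bas par. dec_fun w I FL fld BL bas par & (ALL i. fld i < 2 ^ w) & (ALL i. bas i <= 2 * N) &
 (FL < 2 ^ w --> BL < 2 ^ w --> (ALL i. par i < 2 ^ w))"
proof -
 define g where "g = (%t. nxt t - t)"
 define \<kappa> where "\<kappa> = (%t. g t + ell)"
 define b where "b = (%t. 2 * g t + ell + 1)"
 define f where "f = (%t. w div b t)"
 have gL: "g t <= L" if "t < L" for t using nxt(1) that by (auto simp: g_def)
 have bw: "b t < w" "0 < f t" "f t * b t <= w" if "t < L" for t
 proof -
 show "b t < w" using w gL[OF that] by (simp add: b_def)
 then show "0 < f t" by (simp add: f_def b_def div_greater_zero_iff)
 show "f t * b t <= w" by (simp add: f_def)
 qed
 have "EX base sel off. t < L --> ((ALL i. base i <= 2 * N) & (ALL p. sel p < 2 ^ g t) & (ALL p. off p < 2 ^ \<kappa> t) &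
 (\<forall>p < N. pos (nxt t) (A t p) = base (p div 2 ^ \<kappa> t * 2 ^ g t + sel p) + off p))" for t
 using inherit[of t "nxt t" "\<kappa> t"] nxt(1) unfolding g_def by (cases "t < L") auto
 then obtain base sel off where B: "!!t. t < L ==> (ALL i. base t i <= 2 * N) & (ALL p. sel t p < 2 ^ g t) &
 (ALL p. off t p < 2 ^ \<kappa> t) &
 (\<forall>p < N. pos (nxt t) (A t p) = base t (p div 2 ^ \<kappa> t * 2 ^ g t + sel t p) + off t p)" by metis
 define u where "u = (%t p. sel t p * 2 ^ \<kappa> t + off t p :: nat)"
 have ub: "u t p < 2 ^ b t" if "t < L" for t p
 proof -
 have "(sel t p + 1) * 2 ^ \<kappa> t <= 2 ^ g t * 2 ^ \<kappa> t" using B[OF that] by (intro mult_le_mono1) (simp add: Suc_leI)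
 then have "u t p < 2 ^ g t * 2 ^ \<kappa> t" using B[OF that] unfolding u_def
 by (metis add.commute add_less_cancel_left less_le_trans mult_Suc Suc_eq_plus1)
 also have "(2::nat) ^ g t * 2 ^ \<kappa> t <= 2 ^ b t"
 unfolding power_add[symmetric] by (intro power_increasing) (auto simp: \<kappa>_def b_def)
 finally show ?thesis .
 qed
 have "EX W. t < L --> (W < 2 ^ (b t * f t) & (\<forall>i<f t. W div 2 ^ (i * b t) mod 2 ^ b t = u t (q * f t + i)))" for t q
 using pack_fields[of "f t" "%i. u t (q * f t + i)" "b t"] ub by (cases "t < L") auto
 then obtain W where W: "!!t q. t < L ==> W t q < 2 ^ (b t * f t) &
 (\<forall>i<f t. W t q div 2 ^ (i * b t) mod 2 ^ b t = u t (q * f t + i))" by metis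
 have Ww: "W t q < 2 ^ w" if "t < L" for t q
 proof -
 have "(2::nat) ^ (b t * f t) <= 2 ^ w" using bw(3)[OF that] by (intro power_increasing) (auto simp: mult.commute)
 then show ?thesis using W[OF that, of q] by (meson less_le_trans)
 qed
 define fsz where "fsz = (%t. N div f t + 1)"
 define bsz where "bsz = (%t. (N div 2 ^ \<kappa> t + 1) * 2 ^ g t)"
 have FL: "FL = (\<Sum>t<L. fsz t)" by (simp add: FL_def fsz_def f_def b_def g_def)
 have BL: "BL = (\<Sum>t<L. bsz t)" by (simp add: BL_def bsz_def \<kappa>_def g_def)
 obtain fld where fld: "\<forall>t<L. \<forall>q<fsz t. fld ((\<Sum>t'<t. fsz t') + q) = min (2 ^ w - 1) (W t q)" "ALL i. fld i <= 2 ^ w - 1"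
 using ex_flatten[of "%t q. min (2 ^ w - 1) (W t q)" "2 ^ w - 1" L fsz] by auto
 obtain bas where bas: "\<forall>t<L. \<forall>q<bsz t. bas ((\<Sum>t'<t. bsz t') + q) = min (2 * N) (base t q)" "ALL i. bas i <= 2 * N"
 using ex_flatten[of "%t q. min (2 * N) (base t q)" "2 * N" L bsz] by auto
 define par where "par = (%i. if i div 8 >= L then 0 else
 [\<Sum>t'<i div 8. fsz t', f (i div 8), b (i div 8), 2 ^ b (i div 8), \<Sum>t'<i div 8. bsz t',
 2 ^ \<kappa> (i div 8), 2 ^ g (i div 8), nxt (i div 8)] ! (i mod 8))"
 have pv: "par (t * 8) = (\<Sum>t'<t. fsz t')" "par (t * 8 + 1) = f t" "par (t * 8 + 2) = b t"
 "par (t * 8 + 3) = 2 ^ b t" "par (t * 8 + 4) = (\<Sum>t'<t. bsz t')" "par (t * 8 + 5) = 2 ^ \<kappa> t"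
 "par (t * 8 + 6) = 2 ^ g t" "par (t * 8 + 7) = nxt t" if "t < L" for t
 proof -
 have d: "(t * 8 + i) div 8 = t" "(t * 8 + i) mod 8 = i" if "i < 8" for i
 using div_mod_mult_add[OF that, of t] by auto
 have "par (t * 8 + i) = [\<Sum>t'<t. fsz t', f t, b t, 2 ^ b t, \<Sum>t'<t. bsz t', 2 ^ \<kappa> t, 2 ^ g t, nxt t] ! i" if "i < 8" for i
 unfolding par_def d[OF that] using \<open>t < L\<close> by simp
 from this[of 0] this[of 1] this[of 2] this[of 3] this[of 4] this[of 5] this[of 6] this[of 7]
 show "par (t * 8) = (\<Sum>t'<t. fsz t')" "par (t * 8 + 1) = f t" "par (t * 8 + 2) = b t"
 "par (t * 8 + 3) = 2 ^ b t" "par (t * 8 + 4) = (\<Sum>t'<t. bsz t')" "par (t * 8 + 5) = 2 ^ \<kappa> t"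
 "par (t * 8 + 6) = 2 ^ g t" "par (t * 8 + 7) = nxt t" by simp_all
 qed
 have step: "dec_step FL fld BL bas t (\<Sum>t'<t. fsz t') (f t) (b t) (2 ^ b t) (\<Sum>t'<t. bsz t') (2 ^ \<kappa> t) (2 ^ g t) (nxt t)"
 if t: "t < L" for t unfolding dec_step_def
 proof (intro allI impI)
 fix p assume p: "p < N"
 have q: "p div f t < fsz t" using p by (simp add: fsz_def div_le_mono le_imp_less_Suc)
 have fl: "fld ((\<Sum>t'<t. fsz t') + p div f t) = W t (p div f t)"
 using fld(1) t q Ww[OF t, of "p div f t"] by simp
 have i: "p mod f t < f t" using bw(2)[OF t] by simp
 have "W t (p div f t) div 2 ^ (p mod f t * b t) mod 2 ^ b t = u t (p div f t * f t + p mod f t)"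
 using W[OF t, of "p div f t"] i by blast
 then have un: "fld ((\<Sum>t'<t. fsz t') + p div f t) div 2 ^ (p mod f t * b t) mod 2 ^ b t = u t p"
 unfolding fl by simp
 have ud: "u t p div 2 ^ \<kappa> t = sel t p" "u t p mod 2 ^ \<kappa> t = off t p"
 using div_mod_mult_add[of "off t p" "2 ^ \<kappa> t" "sel t p"] B[OF t] by (auto simp: u_def)
 have ix: "p div 2 ^ \<kappa> t * 2 ^ g t + sel t p < bsz t"
 proof -
 have "p div 2 ^ \<kappa> t + 1 <= N div 2 ^ \<kappa> t + 1" using p by (simp add: div_le_mono)
 from mult_le_mono1[OF this, of "2 ^ g t"]
 have "p div 2 ^ \<kappa> t * 2 ^ g t + 2 ^ g t <= bsz t" unfolding bsz_def by (simp only: add_mult_distrib mult_1)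
 moreover have "sel t p < 2 ^ g t" using B[OF t] by blast
 ultimately show ?thesis by linarith
 qed
 show "(\<Sum>t'<t. fsz t') + p div f t < FL &
 (\<Sum>t'<t. bsz t') + p div 2 ^ \<kappa> t * 2 ^ g t + fld ((\<Sum>t'<t. fsz t') + p div f t) div 2 ^ (p mod f t * b t) mod 2 ^ b t div 2 ^ \<kappa> t < BL &
 bas ((\<Sum>t'<t. bsz t') + p div 2 ^ \<kappa> t * 2 ^ g t + fld ((\<Sum>t'<t. fsz t') + p div f t) div 2 ^ (p mod f t * b t) mod 2 ^ b t div 2 ^ \<kappa> t) +
 fld ((\<Sum>t'<t. fsz t') + p div f t) div 2 ^ (p mod f t * b t) mod 2 ^ b t mod 2 ^ \<kappa> t = pos (nxt t) (A t p)"
 unfolding un ud add.assoc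
 using flatten_less[of t L "p div f t" fsz] flatten_less[of t L "p div 2 ^ \<kappa> t * 2 ^ g t + sel t p" bsz]
 bas(1) t q ix B[OF t] p unfolding FL BL by simp
 qed
 have "dec_fun w I FL fld BL bas par" unfolding dec_fun_def
 proof (intro exI[of _ cl] conjI allI impI)
 fix t assume t: "t < L"
 show "dec_step FL fld BL bas t (par (t * 8)) (par (t * 8 + 1)) (par (t * 8 + 2)) (par (t * 8 + 3))
 (par (t * 8 + 4)) (par (t * 8 + 5)) (par (t * 8 + 6)) (par (t * 8 + 7))"
 unfolding pv[OF t] by (rule step[OF t])
 have "w < 2 ^ w" by simp
 then show "par (t * 8 + 1) * par (t * 8 + 2) < 2 ^ w" unfolding pv[OF t] using bw(3)[OF t] by linarith
 show "0 < par (t * 8 + 1)" unfolding pv[OF t] using bw(2)[OF t] .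
 show "t < par (t * 8 + 7)" "par (t * 8 + 7) <= L" "cl (par (t * 8 + 7)) < cl t"
 unfolding pv[OF t] using nxt(1) t by auto
 qed (use nxt(2) in blast)
 moreover have "par i < 2 ^ w" if "FL < 2 ^ w" "BL < 2 ^ w" for i
 proof (cases "i div 8 < L")
 case True
 define t where "t = i div 8"
 have t: "t < L" using True by (simp add: t_def)
 have "i mod 8 \<in> {0,1,2,3,4,5,6,7}" by auto
 moreover have "i = t * 8 + i mod 8" by (simp add: t_def)
 moreover have "(\<Sum>t'<t. fsz t') < 2 ^ w" "(\<Sum>t'<t. bsz t') < 2 ^ w"
 using that flatten_less[of t L 0 fsz] flatten_less[of t L 0 bsz] t unfolding FL BL
 by (auto simp: fsz_def bsz_def)
 moreover have ww: "w < 2 ^ w" by simp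
 moreover have "f t < 2 ^ w" unfolding f_def by (rule le_less_trans[OF div_le_dividend ww])
 moreover have "b t < 2 ^ w" using bw(1)[OF t] ww by linarith
 moreover have "(2::nat) ^ b t < 2 ^ w" using bw(1)[OF t] by simp
 moreover have "(2::nat) ^ \<kappa> t < 2 ^ w" "(2::nat) ^ g t < 2 ^ w"
 using bw(1)[OF t] by (auto simp: b_def \<kappa>_def)
 moreover have "nxt t < 2 ^ w" proof -
 have "nxt t <= L" using nxt(1) t by blast
 then show ?thesis using w ww by linarith
 qed
 ultimately show ?thesis using pv[OF t] by (auto simp del: One_nat_def)
 next
 case False
 then show ?thesis by (simp add: par_def)
 qed
 moreover have "fld i < 2 ^ w" for i
 proof -
 have "fld i <= 2 ^ w - 1" using fld(2) by simp
 then show ?thesis by (simp add: Suc_le_lessD nat_less_le le_diff_conv2)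
 qed
 ultimately show ?thesis using bas(2) by blast
qed

end

section \<open>The program that decodes a value\<close>

definition Par :: "nat => exp" where
 "Par j = Arr 3 (Bin Add (Bin Mul (Var 32) (Num 8)) (Num j))"

definition decode_step :: com where
 "decode_step =
 Seq (Assign 34 (Bin Shr (Arr 4 (Bin Add (Par 0) (Bin Div (Var 33) (Par 1))))
 (Bin Mul (Mod (Var 33) (Par 1)) (Par 2))))
 (Seq (Assign 34 (Mod (Var 34) (Par 3)))
 (Seq (Assign 33 (Bin Add (Arr 5 (Bin Add (Bin Add (Par 4) (Bin Mul (Bin Div (Var 33) (Par 5)) (Par 6)))
 (Bin Div (Var 34) (Par 5)))) (Mod (Var 34) (Par 5))))
 (Assign 32 (Par 7))))"

definition decode :: com where
 "decode = Seq (Assign 32 (Var 30)) (Seq (Assign 33 (Var 31))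
 (Seq (While (Bin Less (Var 32) (Scal 0)) decode_step) (Assign 36 (Var 33))))"

lemma decode_syntax [simp]:
 "mods decode_step = {32, 33, 34}" "mods decode = {32, 33, 34, 36}" "pure decode_step" "pure decode"
 "vars_ok decode_step" "vars_ok decode" "silent decode"
 by (auto simp: decode_def decode_step_def Par_def)

locale decoder = perm_tree L X + memory w L hb D for L X w hb D +
 fixes I FL BL :: nat and fld bas par :: "nat => nat"
 assumes dec: "dec_fun w I FL fld BL bas par" and fld_word: "fld i < 2 ^ w"
 and tab_par: "tab D hb 3 (8 * (L + 1)) par"
 and tab_fld: "tab D hb 4 FL fld" and tab_bas: "tab D hb 5 BL bas"
begin

lemma T_decode_step:
 assumes M: "extends w D M" and 10: "sg 10 = hb" and t: "sg 32 < L" and p: "sg 33 < N"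
 shows "T w decode_step (%t' (sg', _). t' <= 300 & sg' 32 = par (sg 32 * 8 + 7) &
 sg' 33 = pos (par (sg 32 * 8 + 7)) (A (sg 32) (sg 33))) (sg, M, out)"
proof -
 define t p where "t = sg 32" and "p = sg 33"
 define fo f b m bo K g nx where "fo = par (t * 8)" and "f = par (t * 8 + 1)" and "b = par (t * 8 + 2)"
 and "m = par (t * 8 + 3)" and "bo = par (t * 8 + 4)" and "K = par (t * 8 + 5)" and "g = par (t * 8 + 6)"
 and "nx = par (t * 8 + 7)"
 have tL: "t < L" and pN: "p < N" using t p by (auto simp: t_def p_def)
 have P: "ev sg' M (Par j) = par (t * 8 + j)" "ok w sg' M (Par j)"
 if "j < 8" "sg' 10 = hb" "sg' 32 = t" for sg' j
 proof -
 have a: "t * 8 + j < 8 * (L + 1)" using tL that by simp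
 have "8 * (L + 1) <= 8 * 2 ^ L" using Suc_leI[OF less_exp[of L]] by (intro mult_le_mono2) linarith
 then have b: "t * 8 + j < 2 ^ w" "t * 8 < 2 ^ w" "j < 2 ^ w" "8 < (2::nat) ^ w" using a word by linarith+
 show "ev sg' M (Par j) = par (t * 8 + j)" "ok w sg' M (Par j)"
 using Arr_eval[OF tab_par M, of sg' "Bin Add (Bin Mul (Var 32) (Num 8)) (Num j)"] a b that
 by (auto simp: Par_def)
 qed
 have st: "dec_step FL fld BL bas t fo f b m bo K g nx" "0 < f" "f * b < 2 ^ w"
 using dec tL unfolding dec_fun_def fo_def f_def b_def m_def bo_def K_def g_def nx_def by blast+
 define W where "W = fld (fo + p div f)"
 define V where "V = W div 2 ^ (p mod f * b)"
 define u where "u = V mod m"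
 have s: "fo + p div f < FL" "bo + p div K * g + u div K < BL" "bas (bo + p div K * g + u div K) + u mod K = pos nx (A t p)"
 using st(1) pN unfolding dec_step_def u_def V_def W_def by blast+
 have Mw: "length M < 2 ^ w" "length D <= length M" using M extends_length by (auto simp: extends_def)
 have FBw: "FL < 2 ^ w" "BL < 2 ^ w" using tab_fld tab_bas Mw by (auto simp: tab_def)
 define e1 where "e1 = Bin Shr (Arr 4 (Bin Add (Par 0) (Bin Div (Var 33) (Par 1))))
 (Bin Mul (Mod (Var 33) (Par 1)) (Par 2))"
 have P': "ev sg M (Par 0) = fo" "ev sg M (Par 1) = f" "ev sg M (Par 2) = b"
 "ok w sg M (Par 0)" "ok w sg M (Par 1)" "ok w sg M (Par 2)"
 using P[of 0 sg] P[of 1 sg] P[of 2 sg] 10 t_def by (simp_all add: fo_def f_def b_def)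
 have E: "ev sg M (Arr 4 (Bin Add (Par 0) (Bin Div (Var 33) (Par 1)))) = W"
 "ok w sg M (Arr 4 (Bin Add (Par 0) (Bin Div (Var 33) (Par 1))))"
 using Arr_eval[OF tab_fld M, of sg "Bin Add (Par 0) (Bin Div (Var 33) (Par 1))"] s(1) P' 10 FBw
 by (simp_all add: p_def[symmetric] W_def)
 have "p mod f * b <= f * b" using st(2) by (intro mult_le_mono1) (simp add: less_imp_le)
 then have mb: "p mod f * b < 2 ^ w" using st(3) by linarith
 have pw: "p div a * a < 2 ^ w" for a
 proof -
 have "p div a * a <= p" by simp
 then show ?thesis using pN word by linarith
 qed
 have e1: "ev sg M e1 = V" "ok w sg M e1"
 using E P' mb pw by (simp_all add: e1_def p_def[symmetric] V_def)
 define sg1 where "sg1 = sg(34 := V)"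
 have "V <= W" by (simp add: V_def)
 then have Vw: "V < 2 ^ w" using fld_word[of "fo + p div f"] by (simp add: W_def)
 have Vm: "V div a * a < 2 ^ w" for a by (rule le_less_trans[OF div_times_less_eq_dividend Vw])
 have "u <= V" by (simp add: u_def)
 then have uw: "u div a * a < 2 ^ w" for a using Vw by (meson div_times_less_eq_dividend le_less_trans)
 define sg2 where "sg2 = sg1(34 := u)"
 have P3: "ev sg1 M (Par 3) = m" "ok w sg1 M (Par 3)"
 using P[of 3 sg1] 10 t_def by (simp_all add: m_def sg1_def)
 have P2: "ev sg2 M (Par 4) = bo" "ev sg2 M (Par 5) = K" "ev sg2 M (Par 6) = g"
 "ok w sg2 M (Par 4)" "ok w sg2 M (Par 5)" "ok w sg2 M (Par 6)"
 using P[of 4 sg2] P[of 5 sg2] P[of 6 sg2] 10 t_def by (simp_all add: bo_def K_def g_def sg2_def sg1_def)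
 define e3 where "e3 = Bin Add (Bin Add (Par 4) (Bin Mul (Bin Div (Var 33) (Par 5)) (Par 6))) (Bin Div (Var 34) (Par 5))"
 have v2: "sg2 33 = p" "sg2 34 = u" "sg2 10 = hb" by (simp_all add: sg2_def sg1_def p_def 10)
 have e3: "ev sg2 M e3 = bo + p div K * g + u div K" "ok w sg2 M e3"
 using P2 s(2) FBw by (simp_all add: e3_def v2)
 have e4: "ev sg2 M (Arr 5 e3) = bas (bo + p div K * g + u div K)" "ok w sg2 M (Arr 5 e3)"
 using Arr_eval[OF tab_bas M, of sg2 e3] e3 s(2) v2 by simp_all
 have tL': "t <= L" "nx <= L" using dec tL by (auto simp: dec_fun_def nx_def)
 have posw: "pos nx (A t p) < 2 ^ w" using pos_less[OF A_less[OF tL'(1) pN] tL'(2)] word by linarith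
 define sg3 where "sg3 = sg2(33 := pos nx (A t p))"
 have P7: "ev sg3 M (Par 7) = nx" "ok w sg3 M (Par 7)"
 using P[of 7 sg3] 10 t_def by (simp_all add: nx_def sg3_def sg2_def sg1_def)
 have c: "ecost (Par j) = 11" for j by (simp add: Par_def)
 have v3: "sg3 33 = pos nx (A t p)" by (simp add: sg3_def)
 show ?thesis unfolding decode_step_def
 apply (rule T_seq_assign[OF e1(2)[unfolded e1_def] e1(1)[unfolded e1_def]])
 apply (rule T_seq_assign[where v = u])
 subgoal using P3 Vm by (simp add: sg1_def)
 subgoal using P3 by (simp add: sg1_def u_def)
 apply (fold sg1_def, fold sg2_def e3_def)
 apply (rule T_seq_assign[where v = "pos nx (A t p)"])
 subgoal using e4 P2 v2 s(3) uw posw by simp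
 subgoal using e4 P2 v2 s(3) by simp
 using P7 v3 by (fold sg3_def) (simp add: c e3_def nx_def t_def p_def)
qed

text \<open>All positions on the way belong to the same point \<open>y\<close>, and
  \<open>pos L y = y\<close>, so the position reached at level \<open>L\<close> is itself the
  decoded value. Each jump lowers the class, which is at most \<open>I\<close>.\<close>

lemma T_decode:
 assumes M: "extends w D M" and 10: "sg 10 = hb" and t: "sg 30 <= L" and p: "sg 31 < N"
 shows "T w decode (%t' (sg', _). t' <= 400 * (I + 1) & sg' 36 = A (sg 30) (sg 31)) (sg, M, out)"
proof -
 obtain cl where cl: "ALL t. cl t <= I" "\<forall>t<L. t < par (t * 8 + 7) & par (t * 8 + 7) <= L & cl (par (t * 8 + 7)) < cl t"
 using dec unfolding dec_fun_def by blast
 define y where "y = A (sg 30) (sg 31)"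
 have y: "y < N" "pos (sg 30) y = sg 31" using A_less pos_A t p by (auto simp: y_def)
 define Inv where "Inv = (%k (s :: st). fst (snd s) = M & fst s 10 = hb & fst s 32 <= L &
 fst s 33 = pos (fst s 32) y & cl (fst s 32) <= k)"
 define sg0 where "sg0 = sg(32 := sg 30, 33 := sg 31)"
 have W: "T w (While (Bin Less (Var 32) (Scal 0)) decode_step)
 (%t (sg, M, out). t <= I * (300 + ecost (Bin Less (Var 32) (Scal 0)) + 2) + ecost (Bin Less (Var 32) (Scal 0)) + 1 &
 ev sg M (Bin Less (Var 32) (Scal 0)) = 0 & (EX k'. Inv k' (sg, M, out))) (sg0, M, out)"
 proof (rule T_while)
 show "Inv I (sg0, M, out)" using cl(1) t y 10 by (simp add: Inv_def sg0_def)
 fix k sg1 M1 out1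
 assume Inv: "Inv k (sg1, M1, out1)"
 then have M1: "M1 = M" and 101: "sg1 10 = hb" by (auto simp: Inv_def)
 note SL = Scal_eval[OF scal_L M, of sg1, OF 101]
 show "ok w sg1 M1 (Bin Less (Var 32) (Scal 0)) & (ev sg1 M1 (Bin Less (Var 32) (Scal 0)) ~= 0 -->
 0 < k & T w decode_step (%t s'. t <= 300 & Inv (k - 1) s') (sg1, M1, out1))"
 proof (intro conjI impI)
 show "ok w sg1 M1 (Bin Less (Var 32) (Scal 0))" using SL M1 by simp
 assume "ev sg1 M1 (Bin Less (Var 32) (Scal 0)) ~= 0"
 then have lt: "sg1 32 < L" using SL M1 by (auto split: if_splits)
 then have c: "cl (par (sg1 32 * 8 + 7)) < cl (sg1 32)" "par (sg1 32 * 8 + 7) <= L" using cl(2) by auto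
 then show "0 < k" using Inv by (auto simp: Inv_def)
 have pl: "sg1 33 < N" using Inv pos_less[OF y(1)] by (auto simp: Inv_def)
 have Aq: "A (sg1 32) (sg1 33) = y" using Inv A_pos[OF _ y(1)] by (auto simp: Inv_def)
 show "T w decode_step (%t s'. t <= 300 & Inv (k - 1) s') (sg1, M1, out1)" unfolding M1
 by (rule T_call[OF T_decode_step[OF M 101 lt pl]]) (use c Inv 101 Aq in \<open>auto simp: Inv_def\<close>)
 qed
 qed
 show ?thesis unfolding decode_def
 apply (rule T_seq_assign[OF _ refl], simp)
 apply (rule T_seq_assign[OF _ refl], simp)
 apply simp
 apply (fold sg0_def)
 apply (rule T_call[OF W])
 apply simp
 apply (clarsimp simp: Inv_def)
 subgoal for ta sg' k'
 using Scal_eval[OF scal_L M, of sg'] pos_L[OF y(1)] by (auto simp: y_def[symmetric] split: if_splits)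
 done
qed

end

section \<open>Enumerating large values in one node\<close>

text \<open>The specification of every enumeration below. Positions arrive in increasing order,
  \<open>rem\<close> is the number of points still wanted, and a position past the right border sets
  it to 0; the value 0 therefore means in all cases that nothing more is to be output.\<close>

fun feed :: "(nat => bool) => (nat => nat) => nat list => nat list \<times> nat => nat list \<times> nat" where
 "feed bad xp [] st = st"
| "feed bad xp (p # ps) (o', rem) =
 (if rem = 0 then (o', 0) else if bad p then (o', 0) else feed bad xp ps (o' @ [xp p], rem - 1))"

lemma feed_0 [simp]: "feed bad xp ps (ou, 0) = (ou, 0)"
 by (cases ps) auto

lemma feed_append: "feed bad xp (ps @ qs) st = feed bad xp qs (feed bad xp ps st)"
 by (induction ps arbitrary: st) (auto split: prod.split)

lemma feed_props:
 assumes "feed bad xp ps (ou, rem) = (ou', rem')"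
 shows "length ou' + rem' <= length ou + rem" "length ou <= length ou'"
 "ps ~= [] ==> rem > 0 ==> length ou < length ou' \<or> rem' = 0"
 "rem' > 0 ==> length ou' = length ou + length ps"
proof -
 have le: "length ou <= length ou'" if "feed bad xp ps (ou, rem) = (ou', rem')" for ps ou rem ou' rem'
 using that by (induction ps arbitrary: ou rem) (auto split: if_splits, fastforce)
 show "length ou <= length ou'" by (rule le[OF assms])
 show "length ou' + rem' <= length ou + rem"
 using assms by (induction ps arbitrary: ou rem) (auto split: if_splits, fastforce)
 show "ps ~= [] ==> rem > 0 ==> length ou < length ou' \<or> rem' = 0"
 using assms le by (cases ps) (fastforce split: if_splits)+
 show "rem' > 0 ==> length ou' = length ou + length ps"
 using assms by (induction ps arbitrary: ou rem) (auto split: if_splits)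
qed

definition wr :: "nat list => nat => nat list => nat list" where
 "wr M bp ou = take bp M @ ou @ drop (bp + length ou) M"

lemma wr_props:
 assumes "bp + length ou <= length M"
 shows "length (wr M bp ou) = length M" "i < bp ==> wr M bp ou ! i = M ! i"
 "i < length ou ==> wr M bp ou ! (bp + i) = ou ! i"
 "bp + length ou < length M ==> (wr M bp ou)[bp + length ou := x] = wr M bp (ou @ [x])"
proof -
 show l: "length (wr M bp ou) = length M" using assms by (simp add: wr_def)
 show "i < bp ==> wr M bp ou ! i = M ! i" "i < length ou ==> wr M bp ou ! (bp + i) = ou ! i"
 using assms by (auto simp: wr_def nth_append)
 assume a: "bp + length ou < length M"
 have "drop (bp + length ou) M = M ! (bp + length ou) # drop (Suc (bp + length ou)) M"
 using a by (simp add: Cons_nth_drop_Suc)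
 then show "(wr M bp ou)[bp + length ou := x] = wr M bp (ou @ [x])"
 using a by (simp add: wr_def list_update_append)
qed

lemma wr_extends:
 assumes "bp + length ou <= length M" "extends w D M" "length D <= bp"
 shows "extends w D (wr M bp ou)"
proof -
 have "take (length D) (wr M bp ou) = take (length D) M"
 using assms(1,3) by (simp add: wr_def min_def)
 then show ?thesis using assms wr_props(1)[OF assms(1)] by (simp add: extends_def)
qed

lemma T_call_gen:
 assumes "T w c Q (sg, M, out)" "silent c"
 and "!!t sg' M'. Q t (sg', M', out) ==> (!!r. r ~: mods c ==> sg' r = sg r) ==> Q' t (sg', M', out)"
 shows "T w c Q' (sg, M, out)"
 by (rule T_mono[OF T_frame[OF assms(1)]]) (use assms(2,3) in auto)

text \<open>Used to charge the number of relevant children of a node to the points found below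
  them.\<close>

lemma card_blocks_le:
 fixes a m k :: nat
 shows "card {q. q < m & (\<exists>p\<in>{a + q * k..<a + (q + 1) * k}. g p)} <= length (filter g [a..<a + m * k])"
proof (induction m)
 case 0
 then show ?case by simp
next
 case (Suc m)
 have up: "[a..<a + Suc m * k] = [a..<a + m * k] @ [a + m * k..<a + Suc m * k]"
 by (rule upt_split) (auto simp: algebra_simps)
 show ?case
 proof (cases "\<exists>p\<in>{a + m * k..<a + (m + 1) * k}. g p")
 case True
 then have "{q. q < Suc m & (\<exists>p\<in>{a + q * k..<a + (q + 1) * k}. g p)} =
 insert m {q. q < m & (\<exists>p\<in>{a + q * k..<a + (q + 1) * k}. g p)}" by (auto simp: less_Suc_eq)
 then have "card {q. q < Suc m & (\<exists>p\<in>{a + q * k..<a + (q + 1) * k}. g p)} =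
 Suc (card {q. q < m & (\<exists>p\<in>{a + q * k..<a + (q + 1) * k}. g p)})" by simp
 moreover have "0 < length (filter g [a + m * k..<a + Suc m * k])"
 using True by (auto simp: filter_empty_conv)
 ultimately show ?thesis using Suc unfolding up filter_append length_append by linarith
 next
 case False
 then have "{q. q < Suc m & (\<exists>p\<in>{a + q * k..<a + (q + 1) * k}. g p)} =
 {q. q < m & (\<exists>p\<in>{a + q * k..<a + (q + 1) * k}. g p)}" using less_Suc_eq by blast
 then show ?thesis using Suc unfolding up by simp
 qed
qed

section \<open>The relevant children of a node of a block tree\<close>

text \<open>At height 0 the value is decoded and increased by 1, so that 0 can stand for padding
  beyond the last position; at larger heights the maximum is read from a table whose entries carry
  the same offset.\<close>

definition getval :: "nat => reg => reg => com" where
 "getval i a b = (if i = 0 then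
 If (Bin Less (Var a) (Scal 1))
 (Seq (Assign 30 (Var 11)) (Seq (Assign 31 (Var a)) (Seq decode (Assign b (Bin Add (Var 36) (Num 1))))))
 (Assign b (Num 0))
 else Assign b (Arr (31 + 2 * i) (Bin Add (Bin Mul (Var 11) (Arr 8 (Num i))) (Var a))))"

text \<open>Each height of the unfolded recursion has its own 20 registers: offset 0 holds the node,
  1 the number of relevant children, 2 to 4 serve the search for that number, 5 is the current
  child, 6 the row of the order type, 7 and 8 are auxiliary.\<close>

abbreviation bank :: "nat => nat" where "bank i \<equiv> 100 + 20 * i"

definition test :: "nat => com" where
 "test i = Seq (Assign (bank (Suc i) + 7) (Bin Add (Bin Mul (Var (bank (Suc i))) (Scal 10))
 (Arr 7 (Bin Add (Var (bank (Suc i) + 6)) (Var (bank (Suc i) + 3))))))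
 (Seq (getval i (bank (Suc i) + 7) (bank (Suc i) + 8))
 (Assign (bank (Suc i) + 4) (Bin Less (Var (bank (Suc i) + 8)) (Var 13))))"

text \<open>Exponential search instead of binary search over all \<open>d\<close> children: the
  number of probes is logarithmic in the number of relevant children and can be charged to
  them.\<close>

definition gallop :: "nat => com" where
 "gallop i = While (Bin Equal (Var (bank (Suc i) + 4)) (Num 0))
 (If (Bin Less (Var (bank (Suc i) + 2)) (Scal 10))
 (Seq (Assign (bank (Suc i) + 3) (Var (bank (Suc i) + 2)))
 (Seq (test i)
 (If (Var (bank (Suc i) + 4)) (Assign (bank (Suc i) + 4) (Num 1))
 (Assign (bank (Suc i) + 2) (Bin Add (Var (bank (Suc i) + 2)) (Var (bank (Suc i) + 2)))))))
 (Assign (bank (Suc i) + 4) (Num 1)))"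

definition count_children :: "nat => com" where
 "count_children i =
 Seq (Assign (bank (Suc i) + 2) (Num 1))
 (Seq (Assign (bank (Suc i) + 4) (Num 0))
 (Seq (gallop i)
 (Seq (If (Bin Less (Scal 10) (Var (bank (Suc i) + 2))) (Assign (bank (Suc i) + 2) (Scal 10))
 (Assign (bank (Suc i) + 2) (Var (bank (Suc i) + 2))))
 (Seq (Assign (bank (Suc i) + 1) (Num 0))
 (bisect (bank (Suc i) + 1) (bank (Suc i) + 2) (bank (Suc i) + 3) (bank (Suc i) + 4) (test i))))))"

lemma test_syntax:
 "mods (test i) \<subseteq> {30..36} \<union> {bank (Suc i) + 4, bank (Suc i) + 7, bank (Suc i) + 8}"
 "pure (test i)" "i < 40 ==> vars_ok (test i)"
 by (auto simp: test_def getval_def)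

lemma count_children_syntax:
 "mods (count_children i) \<subseteq> {30..36} \<union> {bank (Suc i) + 1..<bank (Suc i) + 5} \<union> {bank (Suc i) + 7, bank (Suc i) + 8}"
 "pure (count_children i)" "i < 40 ==> vars_ok (count_children i)"
 using test_syntax[of i] by (auto simp: count_children_def gallop_def)

text \<open>\<open>enc\<close> numbers the order types and \<open>trow\<close> tabulates them. A row
  lists the children in decreasing order of their maxima, followed by \<open>next_child\<close> for
  each of the \<open>d + 1\<close> prefix lengths and each of the \<open>d + 1\<close> starting
  places.\<close>

locale core = decoder L X w hb D I FL BL fld bas par
 for L X w hb D I FL BL fld bas par +
 fixes d J Nb Lam :: nat and enc :: "nat list => nat" and trow :: "nat => nat"
 assumes d: "d >= 1" "d <= 2 ^ Lam" and J: "J >= 1" "J < 30" and Lam2: "Lam >= 2"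
 and Nb: "N <= Nb * d ^ J" "0 < Nb" "(Nb - 1) * d ^ J < N" and strw: "2 * (Nb * d ^ J) + 2 * d < 2 ^ w"
 and enc: "!! xs. set xs \<subseteq> {..<d} ==> length xs = d ==> enc xs < d ^ d"
 and trow_sel: "!! xs i. set xs \<subseteq> {..<d} ==> length xs = d ==> i < d ==>
 trow (enc xs * (d + (d + 1) * (d + 1)) + i) = xs ! i"
 and trow_next: "!! xs c q. set xs \<subseteq> {..<d} ==> length xs = d ==> c <= d ==> q <= d ==>
 trow (enc xs * (d + (d + 1) * (d + 1)) + d + c * (d + 1) + q) = next_child d xs c q"
 and tab_X: "tab D hb 6 (2 ^ L) X"
 and tab_row: "tab D hb 7 (d ^ d * (d + (d + 1) * (d + 1))) trow"
 and tab_str: "tab D hb 8 (J + 1) (%i. Nb * d ^ (J - i))"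
 and tab_dp: "tab D hb 9 (J + 1) (%i. d ^ i)"
 and scal_d: "scal D hb 10 d"
begin

abbreviation "width \<equiv> d + (d + 1) * (d + 1)"

text \<open>The number of nodes of height \<open>i\<close> in all \<open>Nb\<close> block trees of
  one level; it is the stride of the tables.\<close>

definition str :: "nat => nat" where "str i = Nb * d ^ (J - i)"

text \<open>Positions from \<open>N\<close> on fill up the last block. Their value 0 is below every
  threshold in use, as \<open>s1 >= 1\<close>.\<close>

definition val :: "nat => nat => nat" where
 "val t p = (if p < N then A t p + 1 else 0)"

definition mx :: "nat => nat => nat => nat" where
 "mx t i j = Max (val t ` {j * d ^ i..<(j + 1) * d ^ i})"

definition ord :: "nat => nat => nat => nat list" where
 "ord t i j = order_desc d (%q. mx t i (j * d + q))"

lemma mx_ge_iff: "s <= mx t i j \<longleftrightarrow> (\<exists>p\<in>{j * d ^ i..<(j + 1) * d ^ i}. s <= val t p)"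
proof -
 have "val t ` {j * d ^ i..<(j + 1) * d ^ i} ~= {}" using d(1) by auto
 then show ?thesis unfolding mx_def by (subst Max_ge_iff) auto
qed

lemma mx_0: "mx t 0 j = val t j"
 by (simp add: mx_def)

lemma mx_le: "t <= L ==> mx t i j <= N"
proof -
 assume t: "t <= L"
 have "val t ` {j * d ^ i..<(j + 1) * d ^ i} ~= {}" using d(1) by auto
 then show ?thesis unfolding mx_def using A_less[OF t] by (subst Max_le_iff) (auto simp: val_def Suc_leI)
qed

lemma ord: "length (ord t i j) = d" "set (ord t i j) = {..<d}" "distinct (ord t i j)"
 by (auto simp: ord_def order_desc)

lemma str_Suc: "i < J ==> str i = str (Suc i) * d"
 by (simp add: str_def) (metis Suc_diff_Suc mult.assoc mult.commute power_Suc)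

lemma str_le: "str i <= Nb * d ^ J"
 unfolding str_def using d(1) by (intro mult_le_mono2 power_increasing) auto

lemma child_less: "j < str (Suc i) ==> q < d ==> i < J ==> j * d + q < str i"
proof -
 assume a: "j < str (Suc i)" "q < d" "i < J"
 have "(j + 1) * d <= str (Suc i) * d" using a(1) by (intro mult_le_mono1) simp
 then show ?thesis using a by (simp add: str_Suc)
qed

lemma row_less: "enc (ord t i j) * width + k < d ^ d * width" if "k < width"
proof -
 define W where "W = width"
 have "(enc (ord t i j) + 1) * W <= d ^ d * W"
 using enc[of "ord t i j"] ord[of t i j] by (intro mult_le_mono1) simp
 then have "enc (ord t i j) * W + W <= d ^ d * W" by simp
 then have "enc (ord t i j) * W + k < d ^ d * W" using that unfolding W_def[symmetric] by linarith
 then show ?thesis unfolding W_def .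
qed

end

locale core_tables = core +
 assumes tab_ty: "!!i. 1 <= i ==> i <= J ==> tab D hb (30 + 2 * i) ((L + 1) * str i)
 (%k. enc (ord (k div str i) (i - 1) (k mod str i)) * width)"
 and tab_mx: "!!i. 1 <= i ==> i <= J ==> tab D hb (31 + 2 * i) ((L + 1) * str i)
 (%k. mx (k div str i) i (k mod str i))"

text \<open>The data of one three-sided search at level \<open>t\<close>: \<open>s1\<close> is the
  threshold increased by 1 like the values, \<open>p0\<close> the position where the search begins,
  \<open>pend\<close> the end of the tree node, \<open>r\<close> the exclusive border for
  \<open>x\<close>-ranks, and \<open>bp\<close> the address of the output buffer.\<close>

locale core_query = core_tables +
 fixes t s1 p0 pend r bp :: nat and M0 :: "nat list"
 assumes t: "t <= L" and s1: "1 <= s1" and M0: "extends w D M0" "length D <= bp"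
begin

definition glob :: "(reg => nat) => bool" where
 "glob sg \<longleftrightarrow> sg 10 = hb & sg 11 = t & sg 13 = s1 & sg 14 = p0 & sg 15 = pend & sg 16 = r"

lemma globD: "glob sg ==> sg 10 = hb" "glob sg ==> sg 11 = t" "glob sg ==> sg 13 = s1"
 "glob sg ==> sg 14 = p0" "glob sg ==> sg 15 = pend" "glob sg ==> sg 16 = r"
 by (auto simp: glob_def)

lemma glob_upd [simp]: "x ~: {10..16} ==> glob (sg(x := v)) = glob sg"
 by (auto simp: glob_def)

lemma glob_frame: "glob sg ==> (!!r. r \<in> {10..16} ==> sg' r = sg r) ==> glob sg'"
 by (auto simp: glob_def)

lemma str_index:
 assumes "1 <= i" "i <= J" "j < str i"
 shows "t * str i + j < (L + 1) * str i" "(t * str i + j) div str i = t" "(t * str i + j) mod str i = j"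
proof -
 have "t * str i + str i <= (L + 1) * str i" using mult_le_mono1[of "t + 1" "L + 1" "str i"] t by simp
 then show "t * str i + j < (L + 1) * str i" using assms by linarith
 show "(t * str i + j) div str i = t" "(t * str i + j) mod str i = j"
 using div_mod_mult_add[OF assms(3), of t] by auto
qed

lemma level_index:
 assumes M: "extends w D M" and g: "glob sg" and i: "1 <= i" "i <= J" and j: "sg a < str i"
 defines "e \<equiv> Bin Add (Bin Mul (Var 11) (Arr 8 (Num i))) (Var a)"
 shows "ev sg M (Arr (30 + 2 * i) e) = enc (ord t (i - 1) (sg a)) * width" "ok w sg M (Arr (30 + 2 * i) e)"
 "ev sg M (Arr (31 + 2 * i) e) = mx t i (sg a)" "ok w sg M (Arr (31 + 2 * i) e)"
proof -
 have iw: "i < 2 ^ w" using i J word by simp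
 have e8: "ev sg M (Arr 8 (Num i)) = str i" "ok w sg M (Arr 8 (Num i))"
 using Arr_eval[OF tab_str M, of sg "Num i"] i globD[OF g] iw by (auto simp: str_def)
 note ix = str_index[OF i j]
 have Dw: "length D < 2 ^ w" using M extends_length[OF M] by (simp add: extends_def)
 have "(L + 1) * str i <= length D" using tab_ty[OF i] unfolding tab_def by linarith
 then have "t * str i + sg a < 2 ^ w" using ix Dw by linarith
 then have e: "ev sg M e = t * str i + sg a" "ok w sg M e"
 using e8 globD[OF g] by (auto simp: e_def)
 show "ev sg M (Arr (30 + 2 * i) e) = enc (ord t (i - 1) (sg a)) * width" "ok w sg M (Arr (30 + 2 * i) e)"
 "ev sg M (Arr (31 + 2 * i) e) = mx t i (sg a)" "ok w sg M (Arr (31 + 2 * i) e)"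
 using Arr_eval[OF tab_ty[OF i] M, of sg e] Arr_eval[OF tab_mx[OF i] M, of sg e] e ix globD[OF g] by auto
qed

definition tc :: nat where "tc = 400 * (I + 1) + 100"

lemma T_getval:
 assumes M: "extends w D M" and g: "glob sg" and i: "i <= J" and j: "sg a < str i" and ab: "a ~: {30..36}"
 shows "T w (getval i a b) (%tm (sg', _). tm <= 400 * (I + 1) + 40 & sg' b = mx t i (sg a)) (sg, M, out)"
proof (cases "i = 0")
 case False
 then show ?thesis using level_index[OF M g, of i a] i j by (simp add: getval_def)
next
 case True
 note SN = Scal_eval[OF scal_N M, of sg, OF globD(1)[OF g]]
 show ?thesis
 proof (cases "sg a < N")
 case lt: True
 have Aw: "A t (sg a) + 1 < 2 ^ w" using A_less[OF t lt] word by linarith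
 have dec: "T w decode (%t' (sg', _). t' <= 400 * (I + 1) & sg' 36 = A t (sg a)) (sg(30 := t, 31 := sg a), M, out)"
 using T_decode[OF M, of "sg(30 := t, 31 := sg a)" out] globD[OF g] t lt by simp
 show ?thesis unfolding getval_def if_P[OF True] T_If
 proof (intro conjI)
 show "ok w sg M (Bin Less (Var a) (Scal 1))" using SN by simp
 have "T w (Seq (Assign 30 (Var 11)) (Seq (Assign 31 (Var a)) (Seq decode (Assign b (Bin Add (Var 36) (Num 1))))))
 (%tm (sg', _). tm <= 400 * (I + 1) + 20 & sg' b = mx t i (sg a)) (sg, M, out)"
 apply (rule T_seq_assign[where v = t], simp, simp add: globD[OF g])
 apply (rule T_seq_assign[where v = "sg a"], simp, use ab in force)
 apply (rule T_seq_call[OF dec])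
 apply simp
 using Aw word lt True by (auto simp: mx_0 val_def)
 then show "if ev sg M (Bin Less (Var a) (Scal 1)) ~= 0
 then T w (Seq (Assign 30 (Var 11)) (Seq (Assign 31 (Var a)) (Seq decode (Assign b (Bin Add (Var 36) (Num 1))))))
 (%ta s. (case s of (sg', _) => ecost (Bin Less (Var a) (Scal 1)) + 1 + ta + 1 <= 400 * (I + 1) + 40 & sg' b = mx t i (sg a))) (sg, M, out)
 else T w (Assign b (Num 0)) (%ta s. (case s of (sg', _) => ecost (Bin Less (Var a) (Scal 1)) + 1 + ta <= 400 * (I + 1) + 40 & sg' b = mx t i (sg a))) (sg, M, out)"
 using SN lt by (auto elim!: T_mono)
 qed
 next
 case False
 then show ?thesis using SN word True by (simp add: getval_def mx_0 val_def)
 qed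
qed

lemma T_test:
 assumes M: "extends w D M" and g: "glob sg" and i: "i < J" and j: "sg (bank (Suc i)) = j" "j < str (Suc i)"
 and row: "sg (bank (Suc i) + 6) = enc (ord t i j) * width" and c: "sg (bank (Suc i) + 3) = c" "c < d"
 shows "T w (test i) (%tm (sg', _). tm <= tc &
 (sg' (bank (Suc i) + 4) ~= 0 \<longleftrightarrow> mx t i (j * d + ord t i j ! c) < s1)) (sg, M, out)"
proof -
 note Sd = Scal_eval[OF scal_d M, of sg, OF globD(1)[OF g]]
 have Dw: "length D < 2 ^ w" using M extends_length[OF M] by (simp add: extends_def)
 have rl: "enc (ord t i j) * width + c < d ^ d * width" using c(2) by (intro row_less) simp
 have "d ^ d * width <= length D" using tab_row by (auto simp: tab_def)
 then have rw: "enc (ord t i j) * width + c < 2 ^ w" using rl Dw by linarith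
 have o: "ord t i j ! c < d" using ord[of t i j] nth_mem[of c "ord t i j"] c(2) by auto
 have e7: "ev sg M (Arr 7 (Bin Add (Var (bank (Suc i) + 6)) (Var (bank (Suc i) + 3)))) = ord t i j ! c"
 "ok w sg M (Arr 7 (Bin Add (Var (bank (Suc i) + 6)) (Var (bank (Suc i) + 3))))"
 using Arr_eval[OF tab_row M, of sg "Bin Add (Var (bank (Suc i) + 6)) (Var (bank (Suc i) + 3))"]
 row c rl rw globD[OF g] trow_sel[of "ord t i j" c] ord[of t i j] by auto
 define ch where "ch = j * d + ord t i j ! c"
 have ch: "ch < str i" using child_less[OF j(2) o i] by (simp add: ch_def)
 then have chw: "ch < 2 ^ w" using str_le[of i] strw by linarith
 define sg1 where "sg1 = sg(bank (Suc i) + 7 := ch)"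
 have gv: "T w (getval i (bank (Suc i) + 7) (bank (Suc i) + 8))
 (%tm (sg', _). tm <= 400 * (I + 1) + 40 & sg' (bank (Suc i) + 8) = mx t i ch) (sg1, M, out)"
 using T_getval[OF M, of sg1 i "bank (Suc i) + 7" "bank (Suc i) + 8" out] g i ch by (simp add: sg1_def)
 have nm: "13 ~: mods (getval i (bank (Suc i) + 7) (bank (Suc i) + 8))" "pure (getval i (bank (Suc i) + 7) (bank (Suc i) + 8))"
 by (auto simp: getval_def)
 show ?thesis unfolding test_def
 apply (rule T_seq_assign[where v = ch])
 subgoal using e7 Sd j chw by (simp add: ch_def)
 subgoal using e7 Sd j by (simp add: ch_def)
 apply (fold sg1_def)
 apply (rule T_seq_call[OF gv nm(2)])
 subgoal premises prems for tm sg'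
 using prems(1) prems(2)[OF nm(1)] globD(3)[OF g] by (simp add: sg1_def tc_def ch_def)
 done
qed

end

definition Next :: "nat => exp => exp" where
 "Next i e = Arr 7 (Bin Add (Bin Add (Bin Add (Var (bank (Suc i) + 6)) (Scal 10))
 (Bin Mul (Var (bank (Suc i) + 1)) (Bin Add (Scal 10) (Num 1)))) e)"

text \<open>Children that end before \<open>p0\<close> are skipped; only the node containing
  \<open>p0\<close> is entered in its middle.\<close>

definition first_child :: "nat => com" where
 "first_child i = If (Bin Less (Bin Mul (Var (bank (Suc i))) (Scal 10)) (Bin Div (Var 14) (Arr 9 (Num i))))
 (Assign (bank (Suc i) + 5) (Bin Sub (Bin Div (Var 14) (Arr 9 (Num i))) (Bin Mul (Var (bank (Suc i))) (Scal 10))))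
 (Assign (bank (Suc i) + 5) (Num 0))"

text \<open>The recursion over the height happens when the program is built, so the result is nested
  code without a stack. Registers 17 and 18 hold the number of points still wanted and the next
  output address; a leaf past the border clears register 17, which ends all enclosing loops.\<close>

fun visit :: "nat => com" where
 "visit 0 = Seq (Assign 30 (Var 11)) (Seq (Assign 31 (Var 100)) (Seq decode (Seq (Assign 37 (Arr 6 (Var 36)))
 (If (Bin Mul (Bin Less (Var 100) (Var 15)) (Bin Less (Var 37) (Var 16)))
 (Seq (Write (Var 18) (Var 37)) (Seq (Assign 18 (Bin Add (Var 18) (Num 1))) (Assign 17 (Bin Sub (Var 17) (Num 1)))))
 (Assign 17 (Num 0))))))"
| "visit (Suc i) =
 Seq (Assign (bank (Suc i) + 6) (Arr (30 + 2 * Suc i) (Bin Add (Bin Mul (Var 11) (Arr 8 (Num (Suc i)))) (Var (bank (Suc i))))))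
 (Seq (count_children i)
 (Seq (first_child i)
 (Seq (Assign (bank (Suc i) + 5) (Next i (Var (bank (Suc i) + 5))))
 (While (Bin Mul (Bin Less (Var (bank (Suc i) + 5)) (Scal 10)) (Bin Less (Num 0) (Var 17)))
 (Seq (Assign (bank i) (Bin Add (Bin Mul (Var (bank (Suc i))) (Scal 10)) (Var (bank (Suc i) + 5))))
 (Seq (visit i)
 (Assign (bank (Suc i) + 5) (Next i (Bin Add (Var (bank (Suc i) + 5)) (Num 1))))))))))"

lemma Next_syntax [simp]: "ecost (Next i e) = ecost e + 22" "exp_vars_ok (Next i e) \<longleftrightarrow> i < 40 & exp_vars_ok e" if "i < 40"
 using that by (auto simp: Next_def)

lemma visit_syntax:
 "mods (visit i) \<subseteq> {17, 18} \<union> {30..37} \<union> {100..<bank (Suc i)}"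
 "silent (visit i)" "i < 40 ==> vars_ok (visit i)"
proof -
 have pure_silent: "silent c" if "pure c" for c
 using that by (induction c) auto
 show "mods (visit i) \<subseteq> {17, 18} \<union> {30..37} \<union> {100..<bank (Suc i)}"
 proof (induction i)
 case (Suc i)
 have "mods (count_children i) \<subseteq> {30..37} \<union> {100..<bank (Suc (Suc i))}"
 using count_children_syntax(1)[of i] by (rule order_trans) auto
 moreover have "mods (visit i) \<subseteq> {17, 18} \<union> {30..37} \<union> {100..<bank (Suc (Suc i))}"
 using Suc by (rule order_trans) auto
 ultimately show ?case by (auto simp: first_child_def)
 qed auto
 show "silent (visit i)"
 by (induction i) (auto simp: first_child_def pure_silent count_children_syntax)
 show "i < 40 ==> vars_ok (visit i)"
 by (induction i) (auto simp: first_child_def count_children_syntax)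
qed

context core_query
begin

text \<open>The witness \<open>k\<close> is the exponent reached by the exponential search. It is at
  most the number of relevant children and at most \<open>Lam\<close>, so the cost can be charged
  either to output points or to an allowance of \<open>Lam\<close>.\<close>

lemma T_count_children:
 assumes M: "extends w D M" and g: "glob sg" and i: "i < J" and j: "sg (bank (Suc i)) = j" "j < str (Suc i)"
 and row: "sg (bank (Suc i) + 6) = enc (ord t i j) * width"
 shows "T w (count_children i) (%tm (sg', _). EX k. tm <= (k + 1) * (2 * tc + 100) + 100 &
 k <= sg' (bank (Suc i) + 1) & k <= Lam & sg' (bank (Suc i) + 1) <= d &
 set (take (sg' (bank (Suc i) + 1)) (ord t i j)) = {q. q < d & s1 <= mx t i (j * d + q)}) (sg, M, out)"
proof -
 define B where "B = bank (Suc i)"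
 have B: "B >= 120" "bank (Suc i) = B" by (simp_all add: B_def)
 define P where "P = (%c. mx t i (j * d + ord t i j ! c) < s1)"
 have mono: "P b" if "a <= b" "b < d" "P a" for a b
 using order_desc(4)[OF that(1,2), of "%q. mx t i (j * d + q)"] that(3) by (simp add: P_def ord_def)
 define cs where "cs = (LEAST c. c = d \<or> P c)"
 have cs: "cs <= d" "cs = d \<or> P cs" "!!c. c < cs ==> \<not> P c"
 proof -
 show "cs <= d" unfolding cs_def by (rule Least_le) simp
 show "cs = d \<or> P cs" unfolding cs_def by (rule LeastI[of _ d]) simp
 show "\<not> P c" if "c < cs" for c using not_less_Least[OF that[unfolded cs_def]] by simp
 qed
 have Piff: "P c \<longleftrightarrow> cs <= c" if "c < d" for c
 using cs mono[of cs c] that by (metis leD le_less_linear nat_less_le)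
 define E where "E = (LEAST e. cs <= 2 ^ e)"
 have E: "cs <= 2 ^ E" unfolding E_def by (rule LeastI[of _ cs]) (simp add: less_imp_le)
 have E_le: "E <= e" if "cs <= 2 ^ e" for e unfolding E_def using that by (rule Least_le)
 have Ecs: "E <= cs" by (rule E_le) (simp add: less_imp_le)
 have ELam: "E <= Lam" using cs(1) d(2) by (intro E_le) simp
 note ts = test_syntax[of i, folded B_def]
 have fr0: "r ~: mods (test i)" if "r ~: {30..36} \<union> {B + 4, B + 7, B + 8}" for r using ts that by blast
 have test: "T w (test i) (%tm (sg', _). tm <= tc & (sg' (B + 4) ~= 0 \<longleftrightarrow> P c)) (sg', M, out)"
 if "glob sg'" "sg' B = j" "sg' (B + 6) = enc (ord t i j) * width" "sg' (B + 3) = c" "c < d" for sg' c out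
 using T_test[OF M that(1) i, of j c out] that j by (simp add: B_def P_def)
 define keep where "keep = (%sg'. glob sg' & sg' B = j & sg' (B + 6) = enc (ord t i j) * width)"
 have keep_upd: "keep (sg'(x := v)) = keep sg'" if "x ~: {10..16}" "x ~= B" "x ~= B + 6" for sg' x v
 using that by (auto simp: keep_def)
 have keep_fr: "keep sg''" if "keep sg'" "!!r. r ~: {30..36} \<union> {B + 1, B + 2, B + 3, B + 4, B + 7, B + 8} ==> sg'' r = sg' r" for sg' sg''
 unfolding keep_def
 proof (intro conjI)
 show "glob sg''" by (rule glob_frame[of sg']) (use that B in \<open>auto simp: keep_def\<close>)
 show "sg'' B = j" "sg'' (B + 6) = enc (ord t i j) * width"
 using that(2)[of B] that(2)[of "B + 6"] that(1) B by (auto simp: keep_def)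
 qed
 define Inv where "Inv = (%k (s :: st). fst (snd s) = M & keep (fst s) &
 (fst s (B + 4) = 0 & (\<exists>e\<le>E. fst s (B + 2) = 2 ^ e & E - e + 1 <= k) \<or>
 fst s (B + 4) = 1 & fst s (B + 2) = 2 ^ E))"
 define cond where "cond = Bin Equal (Var (B + 4)) (Num 0)"
 define body where "body = If (Bin Less (Var (B + 2)) (Scal 10))
 (Seq (Assign (B + 3) (Var (B + 2)))
 (Seq (test i)
 (If (Var (B + 4)) (Assign (B + 4) (Num 1))
 (Assign (B + 2) (Bin Add (Var (B + 2)) (Var (B + 2)))))))
 (Assign (B + 4) (Num 1))"
 have gal: "T w (gallop i) (%t (sg, M, out). t <= (E + 1) * ((tc + 30) + ecost cond + 2) + ecost cond + 1 &
 ev sg M cond = 0 & (EX k'. Inv k' (sg, M, out))) (sg', M, out)"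
 if k: "keep sg'" "sg' (B + 4) = 0" "sg' (B + 2) = 1" for sg' out
 unfolding gallop_def B(2) cond_def[symmetric] body_def[symmetric]
 proof (rule T_while)
 show "Inv (E + 1) (sg', M, out)" using k by (auto simp: Inv_def intro!: exI[of _ 0])
 fix k sg1 M1 out1
 assume Iv: "Inv k (sg1, M1, out1)"
 have M1: "M1 = M" using Iv by (simp add: Inv_def)
 have kp: "keep sg1" using Iv by (simp add: Inv_def)
 note Sd = Scal_eval[OF scal_d M, of sg1]
 show "ok w sg1 M1 cond & (ev sg1 M1 cond ~= 0 --> 0 < k & T w body (%t s'. t <= tc + 30 & Inv (k - 1) s') (sg1, M1, out1))"
 proof (intro conjI impI)
 show "ok w sg1 M1 cond" by (simp add: cond_def)
 assume "ev sg1 M1 cond ~= 0"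
 then have f0: "sg1 (B + 4) = 0" by (auto simp: cond_def split: if_splits)
 then obtain e where e: "e <= E" "sg1 (B + 2) = 2 ^ e" "E - e + 1 <= k" using Iv by (auto simp: Inv_def)
 then show "0 < k" by simp
 have 10: "sg1 10 = hb" using kp by (simp add: keep_def glob_def)
 have lessok: "ok w sg1 M (Bin Less (Var (B + 2)) (Scal 10))"
 "ev sg1 M (Bin Less (Var (B + 2)) (Scal 10)) ~= 0 \<longleftrightarrow> 2 ^ e < d"
 using Sd 10 e(2) by auto
 show "T w body (%t s'. t <= tc + 30 & Inv (k - 1) s') (sg1, M1, out1)"
 proof (cases "2 ^ e < d")
 case False
 then have "cs <= 2 ^ e" using cs(1) by simp
 then have "e = E" using E_le e(1) by (simp add: le_antisym)
 then have "Inv (k - 1) (sg1(B + 4 := 1), M, out1)" using kp e B by (simp add: Inv_def keep_upd)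
 then show ?thesis unfolding body_def M1 using lessok False word by (simp add: tc_def)
 next
 case True
 define sg2 where "sg2 = sg1(B + 3 := 2 ^ e)"
 have kp2: "keep sg2" using kp B by (simp add: sg2_def keep_upd)
 have tst: "T w (test i) (%tm (sg', _). tm <= tc & (sg' (B + 4) ~= 0 \<longleftrightarrow> P (2 ^ e))) (sg2, M, out1)"
 using test[of sg2 "2 ^ e" out1] kp2 True by (simp add: keep_def sg2_def)
 have iff: "P (2 ^ e) \<longleftrightarrow> e = E"
 using Piff[OF True] E_le[of e] E e(1) by auto
 have dw: "2 ^ e + 2 ^ e < (2::nat) ^ w" using True strw by linarith
 have "T w (Seq (Assign (B + 3) (Var (B + 2))) (Seq (test i)
 (If (Var (B + 4)) (Assign (B + 4) (Num 1)) (Assign (B + 2) (Bin Add (Var (B + 2)) (Var (B + 2)))))))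
 (%t s'. t <= tc + 20 & Inv (k - 1) s') (sg1, M, out1)"
 apply (rule T_seq_assign[where v = "2 ^ e"], simp, use e(2) in simp)
 apply (fold sg2_def)
 apply (rule T_seq_call[OF tst ts(2)])
 subgoal premises prems for tm sg3
 proof -
 have kp3: "keep sg3" by (rule keep_fr[OF kp2]) (use prems(2) fr0 in auto)
 have h3: "sg3 (B + 2) = 2 ^ e" using prems(2)[OF fr0, of "B + 2"] e(2) B by (simp add: sg2_def)
 show ?thesis
 proof (cases "e = E")
 case True
 have "Inv (k - 1) (sg3(B + 4 := 1), M, out1)" using kp3 h3 True B by (simp add: Inv_def keep_upd)
 then show ?thesis using prems(1) iff True word by simp
 next
 case False
 then have "Inv (k - 1) (sg3(B + 2 := 2 ^ e + 2 ^ e), M, out1)"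
 using kp3 h3 e prems(1) iff B
 by (auto simp: Inv_def keep_upd intro!: exI[of _ "Suc e"])
 then show ?thesis using prems(1) iff False dw h3 by simp
 qed
 qed
 done
 then show ?thesis unfolding body_def M1 T_If using lessok True by (auto elim!: T_mono)
 qed
 qed
 qed
 define lo hi where "lo = (0::nat)" and "hi = min d (2 ^ E)"
 have bis: "T w (bisect (B + 1) (B + 2) (B + 3) (B + 4) (test i)) (%t (sg', _). t <= (E + 1) * (tc + 19) + 4 &
 lo <= sg' (B + 1) & sg' (B + 1) <= hi & (ALL i. lo <= i & i < sg' (B + 1) --> \<not> P i) &
 (ALL i. sg' (B + 1) <= i & i < hi --> P i)) (sg', M, out)"
 if k: "keep sg'" "sg' (B + 1) = lo" "sg' (B + 2) = hi" for sg' out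
 proof (rule T_bisect[OF ts(2)])
 show "B + 1 ~: mods (test i)" "B + 2 ~: mods (test i)" "B + 3 ~: mods (test i)"
 using B by (auto intro!: fr0)
 fix sg2 :: "reg => nat"
 assume fr: "!!r. r ~: insert (B + 1) (insert (B + 2) (insert (B + 3) (mods (test i)))) ==> sg2 r = sg' r"
 and lt: "lo <= sg2 (B + 3)" "sg2 (B + 3) < hi"
 have "keep sg2" by (rule keep_fr[OF k(1)]) (use fr fr0 in auto)
 then show "T w (test i) (%t (sg'', _). t <= tc & (sg'' (B + 4) ~= 0) = P (sg2 (B + 3))) (sg2, M, out)"
 using test[of sg2 "sg2 (B + 3)" out] lt by (simp add: keep_def hi_def)
 next
 show "P b" if "lo <= a" "a <= b" "b < hi" "P a" for a b using mono[of a b] that by (simp add: hi_def)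
 show "sg' (B + 1) = lo" "sg' (B + 2) = hi" by fact+
 show "hi - lo < 2 ^ (E + 1)"
 proof -
 have "hi <= 2 ^ E" "(0::nat) < 2 ^ E" by (auto simp: hi_def)
 then show ?thesis unfolding power_add power_one_right by linarith
 qed
 show "hi + hi < 2 ^ w" using strw unfolding hi_def by linarith
 show "2 < (2::nat) ^ w" using word by linarith
 qed (auto simp: lo_def)
 define gpost where "gpost = (%tm sg'. keep sg' & sg' (B + 2) = 2 ^ E & tm <= (E + 1) * (tc + 35) + 10)"
 have k0: "keep (sg(B + 2 := 1, B + 4 := 0))"
 using g j[unfolded B(2)] row[unfolded B(2)] B(1) by (simp add: keep_def glob_def)
 have gal': "T w (gallop i) (%tm (sg', _). gpost tm sg') (sg(B + 2 := 1, B + 4 := 0), M, out)"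
 by (rule T_mono[OF gal[OF k0]]) (use B(1) in \<open>auto simp: gpost_def Inv_def cond_def algebra_simps split: if_splits\<close>)
 have pg: "pure (gallop i)" using ts(2) by (simp add: gallop_def)
 show ?thesis unfolding count_children_def B(2)
 apply (rule T_seq_assign[where v = 1], use word in simp, simp)
 apply (rule T_seq_assign[where v = 0], simp, simp)
 apply (rule T_seq_call[OF gal' pg])
 subgoal premises prems for tm sg1
 proof -
 have gp: "keep sg1" "sg1 (B + 2) = 2 ^ E" "tm <= (E + 1) * (tc + 35) + 10" using prems(1) by (auto simp: gpost_def)
 have 10: "sg1 10 = hb" using gp(1) by (simp add: keep_def glob_def)
 note Sd = Scal_eval[OF scal_d M, of sg1, OF 10]
 define sg2 where "sg2 = sg1(B + 2 := hi)"
 have s2: "T w (If (Bin Less (Scal 10) (Var (B + 2))) (Assign (B + 2) (Scal 10)) (Assign (B + 2) (Var (B + 2))))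
 (%ta s. ta <= 20 & s = (sg2, M, out)) (sg1, M, out)"
 using Sd gp(2) by (auto simp: sg2_def hi_def min_def)
 have k2: "keep (sg2(B + 1 := lo))" using gp(1) B by (simp add: sg2_def keep_upd)
 have fin: "T w (Seq (Assign (B + 1) (Num 0)) (bisect (B + 1) (B + 2) (B + 3) (B + 4) (test i)))
 (%ta (sg', _). ta <= (E + 1) * (tc + 19) + 10 & sg' (B + 1) <= d & E <= sg' (B + 1) &
 set (take (sg' (B + 1)) (ord t i j)) = {q. q < d & s1 <= mx t i (j * d + q)}) (sg2, M, out)"
 apply (rule T_seq_assign[where v = lo], simp, simp add: lo_def)
 apply (rule T_mono[OF bis[OF k2]], simp, simp add: sg2_def)
 subgoal premises prems for ta s'
 proof -
 obtain sg3 M3 out3 where s': "s' = (sg3, M3, out3)" by (cases s')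
 define z where "z = sg3 (B + 1)"
 have z: "z <= hi" "\<forall>i<z. \<not> P i" "ALL i. z <= i & i < hi --> P i" "ta <= (E + 1) * (tc + 19) + 4"
 using prems unfolding s' by (auto simp: z_def lo_def)
 have zd: "z <= d" using z(1) by (simp add: hi_def)
 have cz: "cs <= z"
 proof (rule ccontr)
 assume "\<not> cs <= z"
 then have "z < hi" "\<not> P z" using cs E by (auto simp: hi_def)
 then show False using z(3) by auto
 qed
 have "set (take z (ord t i j)) = {q. q < d & s1 <= mx t i (j * d + q)}"
 unfolding ord_def
 proof (rule order_desc_take[OF zd])
 fix a assume "a < z"
 then show "s1 <= mx t i (j * d + order_desc d (%q. mx t i (j * d + q)) ! a)"
 using z(2) by (simp add: P_def ord_def not_less)
 next
 fix a assume "z <= a" "a < d"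
 then have "P a" using Piff[of a] cz by simp
 then show "mx t i (j * d + order_desc d (%q. mx t i (j * d + q)) ! a) < s1" by (simp add: P_def ord_def)
 qed
 then show ?thesis using z(4) zd cz Ecs unfolding s' by (simp add: z_def)
 qed
 done
 have "T w (If (Bin Less (Scal 10) (Var (B + 2))) (Assign (B + 2) (Scal 10)) (Assign (B + 2) (Var (B + 2))))
 (%ta. T w (Seq (Assign (B + 1) (Num 0)) (bisect (B + 1) (B + 2) (B + 3) (B + 4) (test i)))
 (%tb (sg', _). ta + tb <= (E + 1) * (tc + 19) + 30 & sg' (B + 1) <= d & E <= sg' (B + 1) &
 set (take (sg' (B + 1)) (ord t i j)) = {q. q < d & s1 <= mx t i (j * d + q)})) (sg1, M, out)"
 by (rule T_mono[OF s2], clarify, rule T_mono[OF fin]) auto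
 then have *: "T w (Seq (If (Bin Less (Scal 10) (Var (B + 2))) (Assign (B + 2) (Scal 10)) (Assign (B + 2) (Var (B + 2))))
 (Seq (Assign (B + 1) (Num 0)) (bisect (B + 1) (B + 2) (B + 3) (B + 4) (test i))))
 (%tb (sg', _). tb <= (E + 1) * (tc + 19) + 30 & sg' (B + 1) <= d & E <= sg' (B + 1) &
 set (take (sg' (B + 1)) (ord t i j)) = {q. q < d & s1 <= mx t i (j * d + q)}) (sg1, M, out)"
 unfolding T_Seq[of w "If _ _ _"] .
 have le: "(E + 1) * (tc + 35) + (E + 1) * (tc + 19) <= (E + 1) * (2 * tc + 100)"
 unfolding distrib_left[symmetric] by (intro mult_le_mono2) simp
 show ?thesis
 proof (rule T_mono[OF *], goal_cases)
 case (1 tb s')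
 obtain sg3 M3 out3 where s': "s' = (sg3, M3, out3)" by (cases s')
 have b: "tb <= (E + 1) * (tc + 19) + 30" "sg3 (B + 1) <= d" "E <= sg3 (B + 1)"
 "set (take (sg3 (B + 1)) (ord t i j)) = {q. q < d & s1 <= mx t i (j * d + q)}"
 using 1 unfolding s' by blast+
 have "ecost (Num 1) + 1 + (ecost (Num 0) + 1 + (tm + tb)) <= (E + 1) * (2 * tc + 100) + 100"
 using b(1) gp(3) le by simp
 then show ?case unfolding s' prod.case using b ELam by blast
 qed
 qed
 done
qed

end

lemma T_seq_call_gen:
 assumes "T w c1 Q1 (sg, M, out)" "silent c1"
 and "!!t sg' M'. Q1 t (sg', M', out) ==> (!!r. r ~: mods c1 ==> sg' r = sg r) ==>
 T w c2 (%t2. Q (t + t2)) (sg', M', out)"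
 shows "T w (Seq c1 c2) Q (sg, M, out)"
 unfolding T_Seq by (rule T_call_gen[OF assms(1,2)]) (rule assms(3))

section \<open>Amortised cost of visiting a block tree\<close>

text \<open>One iteration costs at most \<open>V * (1 + x) + 80\<close>, where \<open>x\<close>
  counts the output it produces. As \<open>x >= 1\<close>, the isolated \<open>V\<close> is absorbed
  by another \<open>V * x\<close>; this is why the constant doubles with every height.\<close>

lemma loop_cost:
 fixes V x y t1 t2 :: nat
 assumes "t1 <= V * (1 + x) + 80" "1 <= x" "t2 <= (2 * V + 100) * (1 + y)"
 shows "t1 + t2 <= (2 * V + 100) * (1 + x + y)"
proof -
 have "V * 1 <= V * x" using assms(2) by (intro mult_le_mono2)
 moreover have "(2 * V + 100) * (1 + x + y) = (2 * V + 100) * (1 + y) + 2 * (V * x) + 100 * x"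
 by (simp add: algebra_simps)
 moreover have "V * (1 + x) = V + V * x" by simp
 ultimately show ?thesis using assms by linarith
qed

context core_query
begin

definition bad :: "nat => bool" where "bad p \<longleftrightarrow> pend <= p \<or> r <= X (A t p)"
definition xp :: "nat => nat" where "xp p = X (A t p)"
definition good :: "nat => bool" where "good p \<longleftrightarrow> p0 <= p & s1 <= val t p"

definition pre :: "(reg => nat) => nat list => nat => bool" where
 "pre sg ou rem \<longleftrightarrow> glob sg & sg 17 = rem & sg 18 = bp + length ou & bp + length ou + rem <= length M0"

text \<open>The cost is proportional to the new output plus \<open>Lam\<close> in two exceptional
  cases: a node that begins before \<open>p0\<close>, whose relevant children may lie entirely
  before \<open>p0\<close>, and a node in which the search ends. In a visit each case concerns only
  the nodes along one path.\<close>

definition outcome :: "nat => nat => nat => nat => nat list => nat => st => bool" where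
 "outcome tm C a b ou rem s' \<longleftrightarrow> (EX ou' rem'. feed bad xp (filter good [a..<b]) (ou, rem) = (ou', rem') &
 fst s' 17 = rem' & fst s' 18 = bp + length ou' & fst (snd s') = wr M0 bp ou' &
 tm <= C * (1 + ((length ou' - length ou) + (if a < p0 then Lam else 0)) + (if rem' = 0 then Lam else 0)))"

fun Cv :: "nat => nat" where
 "Cv 0 = tc"
| "Cv (Suc i) = 2 * Cv i + 2 * tc + 800"

definition vspec :: "nat => bool" where
 "vspec i \<longleftrightarrow> (ALL sg ou rem j out. pre sg ou rem --> 0 < rem --> sg (bank i) = j --> j < str i --> p0 div d ^ i <= j -->
 s1 <= mx t i j --> T w (visit i) (%tm s'. outcome tm (Cv i) (j * d ^ i) ((j + 1) * d ^ i) ou rem s') (sg, wr M0 bp ou, out))"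

lemma extends_wr: "pre sg ou rem ==> extends w D (wr M0 bp ou)"
 using wr_extends[of bp ou M0 w D] M0 by (simp add: pre_def)

lemma vspec_0: "vspec 0"
 unfolding vspec_def
proof (intro allI impI)
 fix sg ou rem j out
 assume pr: "pre sg ou rem" and rem: "0 < rem" and j: "sg (bank 0) = j" "p0 div d ^ 0 <= j" "s1 <= mx t 0 j"
 have M: "extends w D (wr M0 bp ou)" by (rule extends_wr[OF pr])
 have g: "glob sg" and ou: "bp + length ou <= length M0" "bp + length ou < length M0"
 and r17: "sg 17 = rem" "sg 18 = bp + length ou" using pr rem by (auto simp: pre_def)
 have jN: "j < N" using j(3) s1 by (auto simp: mx_0 val_def split: if_splits)
 have gd: "good j" using j by (simp add: good_def mx_0)
 have lw: "length M0 < 2 ^ w" using M0 by (simp add: extends_def)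
 have dec: "T w decode (%t' (sg', _). t' <= 400 * (I + 1) & sg' 36 = A t j) (sg(30 := t, 31 := j), wr M0 bp ou, out)"
 using T_decode[OF M, of "sg(30 := t, 31 := j)" out] globD[OF g] t jN by simp
 have AN: "A t j < N" using A_less[OF t jN] .
 have fd: "feed bad xp (filter good [j * d ^ 0..<(j + 1) * d ^ 0]) (ou, rem) =
 (if bad j then (ou, 0) else (ou @ [xp j], rem - 1))" using gd rem by simp
 show "T w (visit 0) (%tm s'. outcome tm (Cv 0) (j * d ^ 0) ((j + 1) * d ^ 0) ou rem s') (sg, wr M0 bp ou, out)"
 unfolding visit.simps
 apply (rule T_seq_assign[where v = t], simp, simp add: globD[OF g])
 apply (rule T_seq_assign[where v = j], simp, use j in simp)
 apply (rule T_seq_call[OF dec], simp)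
 subgoal premises prems for tm sg1
 proof -
 have tm: "tm <= 400 * (I + 1)" "sg1 36 = A t j" using prems(1) by auto
 have fr: "sg1 10 = hb" "sg1 15 = pend" "sg1 16 = r" "sg1 17 = rem" "sg1 18 = bp + length ou" "sg1 100 = j"
 using prems(2)[of 10] prems(2)[of 15] prems(2)[of 16] prems(2)[of 17] prems(2)[of 18] prems(2)[of 100]
 globD[OF g] r17 j(1) by auto
 note AX = Arr_eval[OF tab_X M, of sg1 "Var 36"]
 have ex: "ev sg1 (wr M0 bp ou) (Arr 6 (Var 36)) = xp j" "ok w sg1 (wr M0 bp ou) (Arr 6 (Var 36))"
 using AX fr tm AN by (auto simp: xp_def)
 show ?thesis
 apply (rule T_seq_assign[OF ex(2,1)])
 unfolding outcome_def fd
 using fr tm ou lw word rem wr_props(1)[OF ou(1)] wr_props(4)[OF ou(1), of "xp j"]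
 by (auto simp: bad_def xp_def tc_def algebra_simps)
 qed
 done
qed

lemma Next_eval:
 assumes M: "extends w D M" and g: "glob sg" and c: "sg (bank (Suc i) + 1) = c" "c <= d"
 and row: "sg (bank (Suc i) + 6) = enc (ord t i j) * width" and e: "ok w sg M e" "ev sg M e = q" "q <= d"
 shows "ev sg M (Next i e) = next_child d (ord t i j) c q" "ok w sg M (Next i e)"
proof -
 define R where "R = enc (ord t i j) * width"
 define k where "k = d + c * (d + 1) + q"
 note Sd = Scal_eval[OF scal_d M, of sg, OF globD(1)[OF g]]
 have "c * (d + 1) <= d * (d + 1)" using c(2) by (rule mult_le_mono1)
 then have "k < width" using e(3) by (simp add: k_def)
 from row_less[OF this, of t i j] have l: "R + k < d ^ d * width" by (simp add: R_def)
 have Dw: "length D < 2 ^ w" using M extends_length[OF M] by (simp add: extends_def)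
 have "d ^ d * width <= length D" using tab_row by (auto simp: tab_def)
 then have lw: "R + k < 2 ^ w" using l Dw by linarith
 have dw: "d + 1 < 2 ^ w" using d(1) strw by linarith
 define ex where "ex = Bin Add (Bin Add (Bin Add (Var (bank (Suc i) + 6)) (Scal 10))
 (Bin Mul (Var (bank (Suc i) + 1)) (Bin Add (Scal 10) (Num 1)))) e"
 have w1: "1 < (2::nat) ^ w" using word by linarith
 have lw': "c * (d + 1) < 2 ^ w" "R + d < 2 ^ w" "R + d + c * (d + 1) < 2 ^ w" "R + d + c * (d + 1) + q < 2 ^ w"
 using lw unfolding k_def by linarith+
 have ex: "ev sg M ex = R + d + c * (d + 1) + q" "ok w sg M ex"
 using Sd c e row[folded R_def] lw' dw w1 by (simp_all add: ex_def)
 have "trow (R + d + c * (d + 1) + q) = next_child d (ord t i j) c q"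
 unfolding R_def using trow_next[of "ord t i j" c q] ord[of t i j] c(2) e(3) by simp
 then show "ev sg M (Next i e) = next_child d (ord t i j) c q" "ok w sg M (Next i e)"
 unfolding Next_def ex_def[symmetric]
 using Arr_eval[OF tab_row M, of sg ex, OF globD(1)[OF g]] ex l by (simp_all add: k_def add.assoc)
qed

lemma no_good:
 assumes "ALL q'. a <= q' --> q' < b --> mx t i q' < s1 \<or> q' < p0 div d ^ i"
 shows "filter good [a * d ^ i..<b * d ^ i] = []"
proof -
 have "\<not> good p" if "a * d ^ i <= p" "p < b * d ^ i" for p
 proof
 assume gp: "good p"
 define k where "k = d ^ i"
 have k: "k > 0" using d(1) by (simp add: k_def)
 define q' where "q' = p div k"
 have q: "q' * k <= p" "p < (q' + 1) * k"
 using div_mult_mod_eq[of p k] mod_less_divisor[OF k, of p] unfolding q'_def add_mult_distrib mult_1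
 by linarith+
 have "a <= q'" using that(1) k unfolding q'_def k_def by (simp add: less_eq_div_iff_mult_less_eq)
 moreover have "q' < b" using that(2) k unfolding q'_def k_def by (simp add: div_less_iff_less_mult)
 moreover have "s1 <= mx t i q'" unfolding mx_ge_iff
 by (rule bexI[of _ p]) (use gp q in \<open>auto simp: good_def k_def\<close>)
 ultimately have "q' < p0 div d ^ i" using assms by force
 then have "(q' + 1) * k <= p0 div k * k" by (intro mult_le_mono1) (simp add: k_def)
 also have "... <= p0" by simp
 finally have "p < p0" using q(2) by linarith
 then show False using gp by (simp add: good_def)
 qed
 then show ?thesis by (auto simp: filter_empty_conv)
qed

lemma filter_good_split: "a <= b ==> b <= c ==> filter good [a..<c] = filter good [a..<b] @ filter good [b..<c]"
 by (simp add: upt_split[of a b c])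

text \<open>Induction on the number of children left. A visited child is relevant, so it outputs a
  point unless it begins before \<open>p0\<close> or the search ends inside it; this output pays for
  the iteration. Between one relevant child and the next there are no good positions, so the skipped
  part does not change the result of \<open>feed\<close>.\<close>

lemma visit_loop:
 assumes vs: "vspec i" and i: "i < J" and j: "j < str (Suc i)" and c: "c <= d"
 and Cs: "set (take c (ord t i j)) = {q. q < d & s1 <= mx t i (j * d + q)}"
 defines "B \<equiv> bank (Suc i)"
 defines "cond \<equiv> Bin Mul (Bin Less (Var (B + 5)) (Scal 10)) (Bin Less (Num 0) (Var 17))"
 and "body \<equiv> Seq (Assign (bank i) (Bin Add (Bin Mul (Var B) (Scal 10)) (Var (B + 5))))
 (Seq (visit i) (Assign (B + 5) (Next i (Bin Add (Var (B + 5)) (Num 1)))))"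
 shows "q <= d ==> (q < d ==> s1 <= mx t i (j * d + q)) ==> p0 div d ^ i <= j * d + q ==> pre sg ou rem ==>
 sg B = j ==> sg (B + 1) = c ==> sg (B + 6) = enc (ord t i j) * width ==> sg (B + 5) = q ==>
 T w (While cond body) (%tm s'. outcome tm (2 * Cv i + 100) ((j * d + q) * d ^ i) ((j * d + d) * d ^ i) ou rem s')
 (sg, wr M0 bp ou, out)"
proof (induction "d - q" arbitrary: q sg ou rem rule: less_induct)
 case less
 note pr = less.prems(4)
 have M: "extends w D (wr M0 bp ou)" by (rule extends_wr[OF pr])
 have g: "glob sg" and rem: "sg 17 = rem" using pr by (auto simp: pre_def)
 note Sd = Scal_eval[OF scal_d M, of sg, OF globD(1)[OF g]]
 have cond: "ok w sg (wr M0 bp ou) cond" "ev sg (wr M0 bp ou) cond ~= 0 \<longleftrightarrow> q < d & 0 < rem" "ecost cond + 1 <= 20"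
 using Sd less.prems(8) rem word by (auto simp: cond_def)
 have stop: "outcome tm (2 * Cv i + 100) a b ou 0 (sg', wr M0 bp ou, out)"
 if "tm <= 100" "sg' 17 = 0" "sg' 18 = bp + length ou" for tm a b sg' ou
 using that unfolding outcome_def by (auto intro: trans_le_add1)
 show ?case
 proof (cases "q < d & 0 < rem")
 case False
 have "outcome (ecost cond + 1) (2 * Cv i + 100) ((j * d + q) * d ^ i) ((j * d + d) * d ^ i) ou rem (sg, wr M0 bp ou, out)"
 proof (cases "rem = 0")
 case True
 then show ?thesis using stop[of "ecost cond + 1" sg ou] cond(3) pr by (simp add: pre_def)
 next
 case rp: False
 then have "q = d" using False less.prems(1) by simp
 then show ?thesis using cond(3) pr unfolding outcome_def by (auto simp: pre_def intro: trans_le_add1)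
 qed
 then show ?thesis using cond False by (subst T_While_unfold) simp
 next
 case True
 then have q: "q < d" and rem0: "0 < rem" by auto
 define k where "k = d ^ i"
 have k: "k > 0" using d(1) by (simp add: k_def)
 define ch where "ch = j * d + q"
 have ch: "ch < str i" "s1 <= mx t i ch" "p0 div k <= ch"
 using child_less[OF j q i] less.prems(2)[OF q] less.prems(3) by (auto simp: ch_def k_def)
 then have chw: "ch < 2 ^ w" using str_le[of i] strw by linarith
 define sg1 where "sg1 = sg(bank i := ch)"
 have pr1: "pre sg1 ou rem" using pr by (simp add: pre_def sg1_def)
 have V: "T w (visit i) (%tm s'. outcome tm (Cv i) (ch * d ^ i) ((ch + 1) * d ^ i) ou rem s') (sg1, wr M0 bp ou, out)"
 by (rule vs[unfolded vspec_def, rule_format, OF pr1 rem0]) (use ch in \<open>auto simp: sg1_def k_def\<close>)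
 define q' where "q' = next_child d (ord t i j) c (q + 1)"
 have oset: "set (ord t i j) \<subseteq> {..<d}" using ord by auto
 have q': "q + 1 <= q'" "q' <= d" "q' < d ==> s1 <= mx t i (j * d + q')"
 "!!a. q + 1 <= a ==> a < q' ==> mx t i (j * d + a) < s1"
 proof -
 have q1: "q + 1 <= d" using q by simp
 note nc = next_child[OF q1 oset, where c = c, folded q'_def]
 show "q + 1 <= q'" "q' <= d" using nc by auto
 show "s1 <= mx t i (j * d + q')" if "q' < d" using nc(3)[OF that] Cs by auto
 show "mx t i (j * d + a) < s1" if "q + 1 <= a" "a < q'" for a
 using nc(4)[OF that] Cs that nc(2) by auto
 qed
 have p0lt: "p0 < (ch + 1) * k"
 proof -
 have "p0 = p0 div k * k + p0 mod k" by simp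
 moreover have "p0 div k * k <= ch * k" using ch(3) by (rule mult_le_mono1)
 moreover have "p0 mod k < k" using k by simp
 ultimately show ?thesis unfolding add_mult_distrib mult_1 by linarith
 qed
 have order: "ch * k <= (ch + 1) * k" "(ch + 1) * k <= (j * d + q') * k" "(j * d + q') * k <= (j * d + d) * k"
 by (rule mult_le_mono1, use q'(1,2) in \<open>simp add: ch_def\<close>)+
 have split: "filter good [ch * k..<(j * d + d) * k] =
 filter good [ch * k..<(ch + 1) * k] @ filter good [(j * d + q') * k..<(j * d + d) * k]"
 proof -
 have "filter good [(ch + 1) * k..<(j * d + q') * k] = []" unfolding k_def
 proof (rule no_good, intro allI impI)
 fix b assume "ch + 1 <= b" "b < j * d + q'"
 then show "mx t i b < s1 \<or> b < p0 div d ^ i" using q'(4)[of "b - j * d"] by (simp add: ch_def)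
 qed
 then show ?thesis using filter_good_split[of "ch * k" "(ch + 1) * k" "(j * d + d) * k"]
 filter_good_split[of "(ch + 1) * k" "(j * d + q') * k" "(j * d + d) * k"] order
 order_trans[OF order(2,3)] by simp
 qed
 have T2: "T w body (%t1. T w (While cond body) (%t2 s'. outcome (ecost cond + 1 + t1 + 1 + t2) (2 * Cv i + 100)
 ((j * d + q) * d ^ i) ((j * d + d) * d ^ i) ou rem s')) (sg, wr M0 bp ou, out)"
 unfolding body_def
 apply (rule T_seq_assign[where v = ch])
 subgoal using Sd less.prems(5,8) chw by (simp add: ch_def)
 subgoal using Sd less.prems(5,8) by (simp add: ch_def)
 apply (fold sg1_def)
 apply (rule T_seq_call_gen[OF V visit_syntax(2)])
 subgoal premises prems for t1 sg2 M2
 proof -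
 obtain ou1 rem1 where o1: "feed bad xp (filter good [ch * k..<(ch + 1) * k]) (ou, rem) = (ou1, rem1)"
 "sg2 17 = rem1" "sg2 18 = bp + length ou1" "M2 = wr M0 bp ou1"
 "t1 <= Cv i * (1 + ((length ou1 - length ou) + (if ch * k < p0 then Lam else 0)) + (if rem1 = 0 then Lam else 0))"
 using prems(1) by (auto simp: outcome_def k_def)
 have fr: "sg2 x = sg1 x" if "x \<in> {10..16} \<union> {B..<B + 20}" for x
 by (rule prems(2), rule notI, drule subsetD[OF visit_syntax(1)], use that in \<open>auto simp: B_def\<close>)
 have g2: "glob sg2" by (rule glob_frame[of sg1]) (use g fr in \<open>auto simp: sg1_def\<close>)
 note fp = feed_props[OF o1(1)]
 have pr2: "pre sg2 ou1 rem1" using pr g2 o1 fp(1) by (auto simp: pre_def)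
 have v2: "sg2 B = j" "sg2 (B + 1) = c" "sg2 (B + 6) = enc (ord t i j) * width" "sg2 (B + 5) = q"
 using fr[of B] fr[of "B + 1"] fr[of "B + 6"] fr[of "B + 5"] less.prems(5-8) by (auto simp: sg1_def B_def)
 have M2: "extends w D M2" unfolding o1(4) by (rule extends_wr[OF pr2])
 have q1w: "q + 1 < 2 ^ w" using q strw by linarith
 have w1: "1 < (2::nat) ^ w" using word by linarith
 have nx: "ev sg2 M2 (Next i (Bin Add (Var (B + 5)) (Num 1))) = q'"
 "ok w sg2 M2 (Next i (Bin Add (Var (B + 5)) (Num 1)))"
 using Next_eval[OF M2 g2, of i c j "Bin Add (Var (B + 5)) (Num 1)" "q + 1"] v2 c q q1w w1
 by (auto simp: B_def q'_def)
 define sg3 where "sg3 = sg2(B + 5 := q')"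
 have pr3: "pre sg3 ou1 rem1" using pr2 by (simp add: pre_def sg3_def B_def)
 have "d - q' < d - q" using q' q by linarith
 have pq: "p0 div d ^ i <= j * d + q'" using ch(3) q'(1) by (simp add: ch_def k_def)
 have W: "T w (While cond body) (%tm s'. outcome tm (2 * Cv i + 100) ((j * d + q') * d ^ i) ((j * d + d) * d ^ i) ou1 rem1 s')
 (sg3, wr M0 bp ou1, out)"
 by (rule less.hyps[OF \<open>d - q' < d - q\<close> q'(2,3) pq pr3]) (use v2 in \<open>auto simp: sg3_def B_def\<close>)
 have c1: "ecost (Bin Add (Bin Mul (Var B) (Scal 10)) (Var (B + 5))) + 1 <= 10"
 "ecost (Next i (Bin Add (Var (B + 5)) (Num 1))) + 1 <= 30"
 using i J by simp_all
 define e1 e2 where "e1 = ecost (Bin Add (Bin Mul (Var B) (Scal 10)) (Var (B + 5)))"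
 and "e2 = ecost (Next i (Bin Add (Var (B + 5)) (Num 1)))"
 have e12: "e1 + 1 <= 10" "e2 + 1 <= 30" using c1 by (auto simp: e1_def e2_def)
 have main: "T w (While cond body) (%t2 s'. outcome (ecost cond + 1 + (e1 + 1 + (t1 + (e2 + 1))) + 1 + t2) (2 * Cv i + 100)
 (ch * k) ((j * d + d) * k) ou rem s') (sg3, wr M0 bp ou1, out)"
 proof (cases "rem1 = 0")
 case True
 have fd: "feed bad xp (filter good [ch * k..<(j * d + d) * k]) (ou, rem) = (ou1, 0)"
 unfolding split feed_append o1(1) True by simp
 have M3: "extends w D (wr M0 bp ou1)" using M2 o1(4) by simp
 have c3: "ok w sg3 (wr M0 bp ou1) cond" "ev sg3 (wr M0 bp ou1) cond = 0"
 using Scal_eval[OF scal_d M3, of sg3] globD(1)[OF g2] o1(2) True word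
 by (auto simp: cond_def sg3_def B_def)
 define U where "U = (length ou1 - length ou) + (if ch * k < p0 then Lam else 0)"
 have "ecost cond + 1 + (e1 + 1 + (t1 + (e2 + 1))) + 1 + (ecost cond + 1) <= Cv i * (1 + U + Lam) + 100"
 using o1(5) True cond(3) e12 by (simp add: U_def)
 also have "... <= (2 * Cv i + 100) * (1 + U + Lam)" by (simp add: algebra_simps)
 finally have "outcome (ecost cond + 1 + (e1 + 1 + (t1 + (e2 + 1))) + 1 + (ecost cond + 1)) (2 * Cv i + 100)
 (ch * k) ((j * d + d) * k) ou rem (sg3, wr M0 bp ou1, out)"
 unfolding outcome_def fd using o1 True by (simp add: U_def sg3_def B_def)
 then show ?thesis using c3 by (subst T_While_unfold) simp
 next
 case rem1: False
 show ?thesis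
 proof (rule T_mono[OF W], goal_cases)
 case (1 t2 s')
 then obtain ou2 rem2 where o2: "feed bad xp (filter good [(j * d + q') * k..<(j * d + d) * k]) (ou1, rem1) = (ou2, rem2)"
 "fst s' 17 = rem2" "fst s' 18 = bp + length ou2" "fst (snd s') = wr M0 bp ou2"
 "t2 <= (2 * Cv i + 100) * (1 + ((length ou2 - length ou1) + (if (j * d + q') * k < p0 then Lam else 0)) + (if rem2 = 0 then Lam else 0))"
 by (auto simp: outcome_def k_def)
 have np: "\<not> (j * d + q') * k < p0" using p0lt order(2) by linarith
 have fd: "feed bad xp (filter good [ch * k..<(j * d + d) * k]) (ou, rem) = (ou2, rem2)"
 unfolding split feed_append o1(1) o2(1) by simp
 define x where "x = (length ou1 - length ou) + (if ch * k < p0 then Lam else 0)"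
 define y where "y = (length ou2 - length ou1) + (if rem2 = 0 then Lam else 0)"
 have x1: "1 <= x"
 proof (cases "ch * k < p0")
 case True
 then show ?thesis using Lam2 by (simp add: x_def)
 next
 case False
 obtain p where "p \<in> {ch * k..<(ch + 1) * k}" "s1 <= val t p"
 using ch(2) unfolding mx_ge_iff k_def by blast
 then have "p \<in> set (filter good [ch * k..<(ch + 1) * k])" using False by (auto simp: good_def)
 then have "filter good [ch * k..<(ch + 1) * k] ~= []" by (metis empty_iff empty_set)
 then have "length ou < length ou1" using fp(3) rem0 rem1 by blast
 then show ?thesis by (simp add: x_def)
 qed
 have "ecost cond + 1 + (e1 + 1 + (t1 + (e2 + 1))) + 1 <= Cv i * (1 + x) + 80"
 using o1(5) rem1 cond(3) e12 by (simp add: x_def)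
 from loop_cost[OF this x1, of t2 y]
 have "ecost cond + 1 + (e1 + 1 + (t1 + (e2 + 1))) + 1 + t2 <= (2 * Cv i + 100) * (1 + x + y)"
 using o2(5) np by (simp add: y_def add.assoc)
 moreover have "1 + x + y = 1 + ((length ou2 - length ou) + (if ch * k < p0 then Lam else 0)) + (if rem2 = 0 then Lam else 0)"
 using fp(2) feed_props(2)[OF o2(1)] by (simp add: x_def y_def)
 ultimately show ?case unfolding outcome_def fd using o2 by simp
 qed
 qed
 show ?thesis
 unfolding T_Assign nx
 using main[unfolded body_def] nx(2) unfolding o1(4) e1_def e2_def sg3_def ch_def k_def by simp
 qed
 done
 show ?thesis using cond True T2 by (subst T_While_unfold) simp
 qed
qed

text \<open>The new cost is that of counting the relevant children. If the node begins at or after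
  \<open>p0\<close> and the search does not end in it, every relevant child outputs a point, so the
  count is at most the output; in the other cases the allowance \<open>Lam\<close> pays.\<close>

lemma vspec_Suc:
 assumes vs: "vspec i" and i: "i < J"
 shows "vspec (Suc i)"
 unfolding vspec_def
proof (intro allI impI)
 fix sg ou rem j out
 assume pr: "pre sg ou rem" and rem: "0 < rem" and j: "sg (bank (Suc i)) = j" "j < str (Suc i)"
 "p0 div d ^ Suc i <= j" "s1 <= mx t (Suc i) j"
 define B where "B = bank (Suc i)"
 define M where "M = wr M0 bp ou"
 define k where "k = d ^ i"
 have k: "k > 0" using d(1) by (simp add: k_def)
 have M: "extends w D M" unfolding M_def by (rule extends_wr[OF pr])
 have g: "glob sg" using pr by (auto simp: pre_def)
 have i1: "1 <= Suc i" "Suc i <= J" using i by auto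
 have jB: "sg B = j" using j(1) by (simp add: B_def)
 have ty: "ev sg M (Arr (30 + 2 * Suc i) (Bin Add (Bin Mul (Var 11) (Arr 8 (Num (Suc i)))) (Var B))) = enc (ord t i j) * width"
 "ok w sg M (Arr (30 + 2 * Suc i) (Bin Add (Bin Mul (Var 11) (Arr 8 (Num (Suc i)))) (Var B)))"
 using level_index(1,2)[OF M g i1, of B] jB j(2) by auto
 define sg1 where "sg1 = sg(B + 6 := enc (ord t i j) * width)"
 have B120: "120 <= B" by (simp add: B_def)
 have g1: "glob sg1" using g B120 by (simp add: sg1_def)
 have cc: "T w (count_children i) (%tm (sg', _). EX kk. tm <= (kk + 1) * (2 * tc + 100) + 100 &
 kk <= sg' (B + 1) & kk <= Lam & sg' (B + 1) <= d &
 set (take (sg' (B + 1)) (ord t i j)) = {q. q < d & s1 <= mx t i (j * d + q)}) (sg1, M, out)"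
 using T_count_children[OF M g1 i _ j(2), of out] jB by (simp add: B_def sg1_def)
 have jd: "j * d <= j * d + d" by simp
 have blk: "j * d ^ Suc i = j * d * k" "(j + 1) * d ^ Suc i = (j * d + d) * k"
 by (simp_all add: k_def algebra_simps)
 define z where "z = p0 div k"
 have zl: "z < j * d + d"
 proof -
 have "p0 div d ^ Suc i = z div d" by (simp only: z_def k_def power_Suc2 div_mult2_eq)
 then have "z div d < j + 1" using j(3) by simp
 then have "z < (j + 1) * d" using d(1) by (simp add: div_less_iff_less_mult)
 then show ?thesis by simp
 qed
 define q0 where "q0 = (if j * d < z then z - j * d else 0)"
 have q0: "q0 <= d" "z <= j * d + q0" using zl by (auto simp: q0_def)
 show "T w (visit (Suc i)) (%tm s'. outcome tm (Cv (Suc i)) (j * d ^ Suc i) ((j + 1) * d ^ Suc i) ou rem s') (sg, wr M0 bp ou, out)"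
 unfolding visit.simps B_def[symmetric] M_def[symmetric]
 apply (rule T_seq_assign[OF ty(2,1)])
 apply (fold sg1_def)
 apply (rule T_seq_call[OF cc count_children_syntax(2)])
 subgoal premises prems for tm1 sg2
 proof -
 define c where "c = sg2 (B + 1)"
 obtain kk where kk: "tm1 <= (kk + 1) * (2 * tc + 100) + 100" "kk <= c" "kk <= Lam" "c <= d"
 "set (take c (ord t i j)) = {q. q < d & s1 <= mx t i (j * d + q)}"
 using prems(1) unfolding c_def by auto
 have fr: "sg2 x = sg1 x" if "x \<in> {10..18} \<union> {B, B + 6}" for x
 by (rule prems(2), rule notI, drule subsetD[OF count_children_syntax(1)], use that in \<open>auto simp: B_def\<close>)
 have g2: "glob sg2" by (rule glob_frame[OF g1]) (use fr in auto)
 have v2: "sg2 B = j" "sg2 (B + 6) = enc (ord t i j) * width" "sg2 17 = rem" "sg2 18 = bp + length ou"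
 using fr[of B] fr[of "B + 6"] fr[of 17] fr[of 18] jB pr B120 by (auto simp: sg1_def pre_def)
 note Sd = Scal_eval[OF scal_d M, of sg2, OF globD(1)[OF g2]]
 have iw: "i < 2 ^ w" using i J word by simp
 have dp: "ev sg2 M (Arr 9 (Num i)) = k" "ok w sg2 M (Arr 9 (Num i))"
 using Arr_eval[OF tab_dp M, of sg2 "Num i"] i globD(1)[OF g2] iw by (auto simp: k_def)
 have jdw: "j * d < 2 ^ w" using child_less[OF j(2) _ i, of 0] d(1) str_le[of i] strw by simp
 define sg3 where "sg3 = sg2(B + 5 := q0)"
 have fc: "T w (first_child i) (%tm s. tm <= 40 & s = (sg3, M, out)) (sg2, M, out)"
 unfolding first_child_def B_def[symmetric]
 using Sd dp v2(1) jdw globD(4)[OF g2] by (auto simp: sg3_def q0_def z_def)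
 have g3: "glob sg3" using g2 B120 by (simp add: sg3_def)
 define q1 where "q1 = next_child d (ord t i j) c q0"
 have oset: "set (ord t i j) \<subseteq> {..<d}" using ord by auto
 note nc = next_child[OF q0(1) oset, where c = c, folded q1_def]
 have nx: "ev sg3 M (Next i (Var (B + 5))) = q1" "ok w sg3 M (Next i (Var (B + 5)))"
 using Next_eval[OF M g3, of i c j "Var (B + 5)" q0, folded B_def] v2 kk(4) q0
 by (simp_all add: q1_def sg3_def c_def)
 define sg4 where "sg4 = sg3(B + 5 := q1)"
 have pr4: "pre sg4 ou rem" using g3 v2 pr B120 by (simp add: pre_def sg4_def sg3_def)
 have v4: "sg4 B = j" "sg4 (B + 1) = c" "sg4 (B + 6) = enc (ord t i j) * width" "sg4 (B + 5) = q1"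
 using v2 by (simp_all add: sg4_def sg3_def c_def)
 have q1c: "q1 < d ==> s1 <= mx t i (j * d + q1)" using nc(3) kk(5) by auto
 have zq: "p0 div d ^ i <= j * d + q1" using q0(2) nc(1) by (simp add: z_def k_def)
 note W = visit_loop[OF vs i j(2) kk(4,5) nc(2) q1c zq pr4, folded B_def]
 have empt: "filter good [j * d * k..<(j * d + q1) * k] = []" unfolding k_def
 proof (rule no_good, intro allI impI)
 fix b assume b: "j * d <= b" "b < j * d + q1"
 show "mx t i b < s1 \<or> b < p0 div d ^ i"
 proof (cases "b - j * d < q0")
 case True
 then show ?thesis using b by (auto simp: q0_def z_def k_def split: if_splits)
 next
 case False
 then have "b - j * d ~: set (take c (ord t i j))" using nc(4)[of "b - j * d"] b by simp
 then have "\<not> (b - j * d < d & s1 <= mx t i (j * d + (b - j * d)))" unfolding kk(5) by simp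
 moreover have "b - j * d < d" "j * d + (b - j * d) = b" using b nc(2) by linarith+
 ultimately show ?thesis by simp
 qed
 qed
 have ord4: "j * d * k <= (j * d + q1) * k" "(j * d + q1) * k <= (j * d + d) * k"
 using nc(2) by (auto intro!: mult_le_mono1)
 have fl: "filter good [j * d * k..<(j * d + d) * k] = filter good [(j * d + q1) * k..<(j * d + d) * k]"
 using filter_good_split[OF ord4] empt by simp
 define cst where "cst = ecost (Arr (30 + 2 * Suc i) (Bin Add (Bin Mul (Var 11) (Arr 8 (Num (Suc i)))) (Var B))) + 1"
 define cs2 where "cs2 = ecost (Next i (Var (B + 5))) + 1"
 have csb: "cst <= 30" "cs2 <= 30" using i J by (simp_all add: cst_def cs2_def)
 have fin: "T w (While (Bin Mul (Bin Less (Var (B + 5)) (Scal 10)) (Bin Less (Num 0) (Var 17)))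
 (Seq (Assign (bank i) (Bin Add (Bin Mul (Var B) (Scal 10)) (Var (B + 5))))
 (Seq (visit i) (Assign (B + 5) (Next i (Bin Add (Var (B + 5)) (Num 1)))))))
 (%t2 s'. outcome (cst + (tm1 + (tm2 + (cs2 + t2)))) (Cv (Suc i)) (j * d ^ Suc i) ((j + 1) * d ^ Suc i) ou rem s')
 (sg4, M, out)" if tm2: "tm2 <= 40" for tm2
 unfolding M_def
 proof (rule T_mono[OF W], goal_cases)
 case (6 t2 s')
 then obtain ou2 rem2 where o2: "feed bad xp (filter good [(j * d + q1) * k..<(j * d + d) * k]) (ou, rem) = (ou2, rem2)"
 "fst s' 17 = rem2" "fst s' 18 = bp + length ou2" "fst (snd s') = wr M0 bp ou2"
 "t2 <= (2 * Cv i + 100) * (1 + ((length ou2 - length ou) + (if (j * d + q1) * k < p0 then Lam else 0)) + (if rem2 = 0 then Lam else 0))"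
 by (auto simp: outcome_def k_def)
 define U where "U = 1 + ((length ou2 - length ou) + (if j * d * k < p0 then Lam else 0)) + (if rem2 = 0 then Lam else 0)"
 have kU: "kk + 1 <= U"
 proof (cases "j * d * k < p0 \<or> rem2 = 0")
 case True
 then show ?thesis using kk(3) by (auto simp: U_def)
 next
 case False
 have "c = card (set (take c (ord t i j)))"
 using distinct_card[of "take c (ord t i j)"] ord[of t i j] kk(4) by simp
 also have "... <= card {q. q < d & (\<exists>p\<in>{j * d * k + q * k..<j * d * k + (q + 1) * k}. good p)}"
 proof (rule card_mono)
 show "set (take c (ord t i j)) \<subseteq> {q. q < d & (\<exists>p\<in>{j * d * k + q * k..<j * d * k + (q + 1) * k}. good p)}"
 proof
 fix q assume "q \<in> set (take c (ord t i j))"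
 then have q: "q < d" "s1 <= mx t i (j * d + q)" using kk(5) by auto
 then obtain p where p: "p \<in> {(j * d + q) * k..<(j * d + q + 1) * k}" "s1 <= val t p"
 unfolding mx_ge_iff k_def by blast
 then have "p \<in> {j * d * k + q * k..<j * d * k + (q + 1) * k}" by (simp add: add_mult_distrib)
 moreover from this have "good p" using p(2) False by (auto simp: good_def)
 ultimately show "q \<in> {q. q < d & (\<exists>p\<in>{j * d * k + q * k..<j * d * k + (q + 1) * k}. good p)}"
 using q by blast
 qed
 qed simp
 also have "... <= length (filter good [j * d * k..<j * d * k + d * k])" by (rule card_blocks_le)
 also have "... = length ou2 - length ou"
 using feed_props(4)[OF o2(1)] False fl by (simp add: add_mult_distrib)
 finally show ?thesis using kk(2) by (simp add: U_def)
 qed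
 have "t2 <= (2 * Cv i + 100) * U"
 proof (rule order_trans[OF o2(5)], rule mult_le_mono2)
 show "1 + ((length ou2 - length ou) + (if (j * d + q1) * k < p0 then Lam else 0)) + (if rem2 = 0 then Lam else 0) <= U"
 using le_less_trans[OF ord4(1), of p0] unfolding U_def by (cases "(j * d + q1) * k < p0") auto
 qed
 moreover have "(kk + 1) * (2 * tc + 100) <= U * (2 * tc + 100)" using kU by (rule mult_le_mono1)
 moreover have "200 <= U * 200" by (simp add: U_def)
 moreover have "U * (2 * tc + 100) + (2 * Cv i + 100) * U + U * 200 <= (2 * Cv i + 2 * tc + 800) * U"
 by (simp add: algebra_simps)
 ultimately have "cst + (tm1 + (tm2 + (cs2 + t2))) <= Cv (Suc i) * U"
 using kk(1) csb tm2 unfolding Cv.simps by linarith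
 then show ?case unfolding outcome_def blk fl o2(1) using o2 by (simp add: U_def)
 qed (use v4 in simp_all)
 show ?thesis
 unfolding T_Seq[of w "first_child i"]
 proof (rule T_mono[OF fc], elim conjE, hypsubst, rule T_seq_assign[OF nx(2,1)], goal_cases)
 case (1 tm2 s')
 then show ?case using fin[of tm2] unfolding sg4_def cst_def cs2_def by (simp add: add.assoc)
 qed
 qed
 done
qed

lemma vspec: "i <= J ==> vspec i"
 by (induction i) (auto intro: vspec_0 vspec_Suc)

end

section \<open>Predecessor families\<close>

context core_tables
begin

abbreviation "B \<equiv> d ^ J"

definition tmx :: "nat => nat => nat" where "tmx t j = mx t J j - 1"

lemma B_pos: "0 < B"
 using d(1) by simp

text \<open>Since \<open>(Nb - 1) * B < N\<close>, every block begins with a real position, so its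
  maximum is not the padding value 0. The subtraction in \<open>tmx\<close> is therefore exact, and
  distinct blocks have distinct maxima.\<close>

lemma mx_attained: "t <= L ==> j < Nb ==> \<exists>p<N. p div B = j & mx t J j = A t p + 1"
proof -
 assume a: "t <= L" "j < Nb"
 have ne: "val t ` {j * B..<(j + 1) * B} ~= {}" using B_pos by auto
 have "mx t J j \<in> val t ` {j * B..<(j + 1) * B}" unfolding mx_def using ne by (intro Max_in) auto
 then obtain p where p: "p \<in> {j * B..<(j + 1) * B}" "mx t J j = val t p" by auto
 have "j * B <= (Nb - 1) * B" using a(2) by (intro mult_le_mono1) simp
 then have jN: "j * B < N" using Nb(3) by linarith
 have "val t (j * B) <= mx t J j" unfolding mx_def using B_pos by (intro Max_ge) auto
 then have "p < N" using p(2) jN by (auto simp: val_def split: if_splits)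
 moreover have "p div B = j" using p(1) by (intro div_nat_eqI) (auto simp: mult.commute)
 ultimately show ?thesis using p(2) by (auto simp: val_def)
qed

lemma blocks: "t <= L ==> blocks L Nb Lam (tmx t)"
proof unfold_locales
 assume t: "t <= L"
 show "inj_on (tmx t) {..<Nb}"
 proof (rule inj_onI)
 fix i j assume ij: "i \<in> {..<Nb}" "j \<in> {..<Nb}" "tmx t i = tmx t j"
 obtain p where p: "p < N" "p div B = i" "mx t J i = A t p + 1" using mx_attained[OF t, of i] ij by auto
 obtain q where q: "q < N" "q div B = j" "mx t J j = A t q + 1" using mx_attained[OF t, of j] ij by auto
 have "A t p = A t q" using ij(3) p(3) q(3) by (simp add: tmx_def)
 then have "p = q" using A_inj[OF t p(1) q(1)] by simp
 then show "i = j" using p(2) q(2) by simp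
 qed
 show "tmx t j < 2 ^ L" if "j < Nb" for j
 using mx_attained[OF t that] A_less[OF t] by (auto simp: tmx_def)
 show "Nb <= 2 ^ L"
 proof -
 have "(Nb - 1) * 1 <= (Nb - 1) * B" by (intro mult_le_mono2) (use Suc_leI[OF B_pos] in linarith)
 then show ?thesis using Nb by linarith
 qed
 show "2 <= Lam" by (rule Lam2)
qed

text \<open>The depth of the tree node with heap number \<open>k\<close>; node \<open>v\<close> of
  depth \<open>t\<close> has number \<open>2 ^ t + v\<close>. The number 0 belongs to no node and
  gets an empty set below.\<close>

definition level :: "nat => nat" where "level k = (LEAST t. k < 2 ^ Suc t)"

lemma level: "v < 2 ^ t ==> level (2 ^ t + v) = t"
 unfolding level_def
proof (rule Least_equality)
 show "v < 2 ^ t ==> 2 ^ t + v < 2 ^ Suc t" by simp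
 show "t <= y" if "2 ^ t + v < 2 ^ Suc y" for y
 proof -
 have "(2::nat) ^ t < 2 ^ Suc y" using that by linarith
 then have "t < Suc y" by (rule power_less_imp_less_exp[rotated]) simp
 then show ?thesis by simp
 qed
qed

definition smp :: "nat => nat => nat set" where
 "smp t v = {p. p < N & p div S t = v & B dvd p}"

definition X1 :: "nat => nat set" where
 "X1 k = (if k = 0 then {} else (%p. X (A (level k) p)) ` smp (level k) (k - 2 ^ level k))"

text \<open>Only every \<open>B\<close>-th position is a key of the predecessor structure, which
  saves a factor \<open>B\<close> in space. The value is the last sampled position left of the
  border, or the start of the node.\<close>

definition start :: "nat => nat => nat => nat" where
 "start t v l = Max (insert (v * S t) {p \<in> smp t v. X (A t p) < l})"

definition F1 :: "nat => nat => nat => nat" where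
 "F1 k l i = (if k = 0 then 0 else start (level k) (k - 2 ^ level k) l)"

definition X2 :: "nat => nat set" where
 "X2 k = blocks.breaks L Nb Lam (tmx (k div Nb)) (k mod Nb)"

text \<open>The record for level \<open>t\<close> and block \<open>j\<close>: the relevant blocks of
  the window in \<open>Lam\<close> cells, filled up with \<open>Nb\<close>, and in the last cell the
  number of the set of the third family that continues the batch. Intervals are numbered up to
  \<open>Nb\<close>, whence the factor \<open>Nb + 1\<close>.\<close>

definition F2 :: "nat => nat => nat => nat" where
 "F2 k s i = (let t = k div Nb; j = k mod Nb; h = blocks.hs L Nb Lam (tmx t) j s - 1;
 xs = blocks.above (tmx t) s j (blocks.wend Nb j h) in
 if i < Lam then (if i < length xs then xs ! i else Nb)
 else (t * (L + 1) + h) * (Nb + 1) + (j div 2 ^ h + 1))"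

definition X3 :: "nat => nat set" where
 "X3 k = (let i = k mod (Nb + 1); h = k div (Nb + 1) mod (L + 1); t = k div (Nb + 1) div (L + 1) in
 tmx t ` {min Nb (i * 2 ^ h)..<min Nb ((i + 1) * 2 ^ h)})"

text \<open>The record for a dyadic interval: its first \<open>Lam\<close> relevant blocks, filled
  up with \<open>Nb\<close>, and in the last cell the block at which the next batch begins. Here all
  maxima of the interval are keys.\<close>

definition F3 :: "nat => nat => nat => nat" where
 "F3 k s j = (let i = k mod (Nb + 1); h = k div (Nb + 1) mod (L + 1); t = k div (Nb + 1) div (L + 1);
 xs = take Lam (blocks.rlist Nb (tmx t) h i s) in
 if j < Lam then (if j < length xs then xs ! j else Nb) else blocks.rnext Nb Lam (tmx t) h i s)"

text \<open>If \<open>rank\<close> were more than \<open>B\<close> beyond \<open>start\<close>, the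
  next multiple of \<open>B\<close> would still lie in the node and left of the border, and would be
  a larger sample.\<close>

lemma start_props:
 assumes t: "t <= L" and v: "v < 2 ^ t"
 shows "v * S t <= start t v l" "start t v l <= rank t v l" "rank t v l <= start t v l + B"
proof -
 have fin: "finite (insert (v * S t) {p \<in> smp t v. X (A t p) < l})"
 by (rule finite_insert[THEN iffD2], rule finite_subset[of _ "{..<N}"]) (auto simp: smp_def)
 show "v * S t <= start t v l" unfolding start_def using fin by (intro Max_ge) auto
 have "start t v l \<in> insert (v * S t) {p \<in> smp t v. X (A t p) < l}"
 unfolding start_def using fin by (intro Max_in) auto
 then show "start t v l <= rank t v l"
 using rank_ge[of v t l] less_rank_iff[OF t, of "start t v l" v l] by (auto simp: smp_def)
 show "rank t v l <= start t v l + B"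
 proof (rule ccontr)
 assume a: "\<not> rank t v l <= start t v l + B"
 define m where "m = (start t v l div B + 1) * B"
 have m: "start t v l < m" "m <= start t v l + B"
 using div_mult_mod_eq[of "start t v l" B] mod_less_divisor[OF B_pos, of "start t v l"]
 unfolding m_def add_mult_distrib mult_1 by linarith+
 have mr: "m < rank t v l" using a m by linarith
 have mv: "v * S t <= m" "m < v * S t + S t"
 using \<open>v * S t <= start t v l\<close> m(1) mr rank_le[of t v l] by linarith+
 then have md: "m div S t = v" by (intro div_nat_eqI) (auto simp: mult.commute)
 have "(v + 1) * S t <= 2 ^ t * S t" using v by (intro mult_le_mono1) simp
 then have mN: "m < N" using mv(2) S_dvd[OF t] by simp
 have "X (A t m) < l" using less_rank_iff[OF t mN md] mr by simp
 then have "m \<in> insert (v * S t) {p \<in> smp t v. X (A t p) < l}"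
 using mN md by (simp add: smp_def m_def)
 then have "m <= start t v l" unfolding start_def using fin by (intro Max_ge) auto
 then show False using m(1) by simp
 qed
qed

lemma F1_agree: "\<forall>x\<in>X1 k. x < q \<longleftrightarrow> x < q' ==> F1 k q i = F1 k q' i"
proof (cases "k = 0")
 case False
 assume a: "\<forall>x\<in>X1 k. x < q \<longleftrightarrow> x < q'"
 have "{p \<in> smp (level k) (k - 2 ^ level k). X (A (level k) p) < q} =
 {p \<in> smp (level k) (k - 2 ^ level k). X (A (level k) p) < q'}"
 using a False by (auto simp: X1_def)
 then show ?thesis using False by (simp add: F1_def start_def)
qed (simp add: F1_def)

lemma F2_agree:
 assumes "k < (L + 1) * Nb" "\<forall>x\<in>X2 k. x < q \<longleftrightarrow> x < q'"
 shows "F2 k q i = F2 k q' i"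
proof -
 have "k div Nb <= L" using assms(1) by (simp add: div_less_iff_less_mult Nb(2) less_Suc_eq_le[symmetric])
 then interpret blocks L Nb Lam "tmx (k div Nb)" by (rule blocks)
 show ?thesis using hs_agree[of "k mod Nb" q q'] assms(2) by (simp add: F2_def X2_def Let_def)
qed

lemma F3_agree:
 assumes "k < (L + 1) * (L + 1) * (Nb + 1)" "\<forall>x\<in>X3 k. x < q \<longleftrightarrow> x < q'"
 shows "F3 k q i = F3 k q' i"
proof -
 have "k div (Nb + 1) < (L + 1) * (L + 1)" using assms(1) by (simp add: less_mult_imp_div_less)
 then have "k div (Nb + 1) div (L + 1) < L + 1" by (rule less_mult_imp_div_less)
 then interpret blocks L Nb Lam "tmx (k div (Nb + 1) div (L + 1))" by (intro blocks) simp
 show ?thesis using rlist_agree[of "k mod (Nb + 1)" "k div (Nb + 1) mod (L + 1)" q q'] assms(2)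
 by (simp add: F3_def X3_def Let_def)
qed

end

section \<open>Programs for the starting position and for the scan over blocks\<close>

definition locate_test :: com where
 "locate_test = Seq (Assign 30 (Var 11)) (Seq (Assign 31 (Var 42)) (Seq decode
 (Seq (Assign 44 (Arr 6 (Var 36))) (Assign 43 (Bin Equal (Bin Less (Var 44) (Var 19)) (Num 0))))))"

definition locate :: com where
 "locate =
 Seq (Assign 20 (Bin Add (Arr 2 (Var 11)) (Var 12)))
 (Seq (Assign 21 (Var 19))
 (Seq (pred_query 14 15 16 17 18)
 (Seq (Assign 40 (Mem (Var 28)))
 (Seq (Assign 41 (Bin Add (Var 40) (Scal 13)))
 (Seq (If (Bin Less (Var 15) (Var 41)) (Assign 41 (Var 15)) (Assign 41 (Var 41)))
 (Seq (bisect 40 41 42 43 locate_test)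
 (Assign 14 (Var 40))))))))"

definition proclist :: "nat => com" where
 "proclist J = Seq (Assign 51 (Num 0))
 (While (Bin Mul (Bin Less (Var 51) (Scal 11)) (Bin Less (Num 0) (Var 17)))
 (Seq (Assign (bank J) (Mem (Bin Add (Var 52) (Var 51))))
 (Seq (If (Bin Less (Var (bank J)) (Scal 12)) (visit J) (Assign 55 (Num 0)))
 (Assign 51 (Bin Add (Var 51) (Num 1))))))"

definition batch_com :: "nat => com" where
 "batch_com J =
 Seq (Assign 20 (Bin Add (Bin Mul (Var 11) (Scal 12)) (Var 50)))
 (Seq (Assign 21 (Bin Sub (Var 13) (Num 1)))
 (Seq (pred_query 19 20 21 22 23)
 (Seq (Assign 52 (Var 28))
 (Seq (proclist J)
 (Seq (Assign 20 (Mem (Bin Add (Var 52) (Scal 11))))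
 (Seq (Assign 21 (Bin Sub (Var 13) (Num 1)))
 (Seq (pred_query 24 25 26 27 28)
 (Seq (Assign 52 (Var 28))
 (Seq (proclist J)
 (Assign 50 (Mem (Bin Add (Var 52) (Scal 11)))))))))))))"

text \<open>The block containing \<open>p0\<close> is treated apart, because its maximum may belong
  to a position before \<open>p0\<close>. In all later blocks a maximum above the threshold
  guarantees a good position, and the batches rely on this.\<close>

definition scan :: "nat => com" where
 "scan J =
 Seq (Assign 50 (Bin Div (Var 14) (Scal 13)))
 (Seq (If (Bin Less (Var 50) (Scal 12))
 (Seq (Assign (bank J) (Var 50))
 (Seq (getval J (bank J) 55)
 (If (Bin Less (Var 55) (Var 13)) (Assign 55 (Num 0)) (visit J))))
 (Assign 55 (Num 0)))
 (Seq (Assign 50 (Bin Add (Var 50) (Num 1)))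
 (While (Bin Mul (Bin Less (Var 50) (Scal 12)) (Bin Less (Num 0) (Var 17))) (batch_com J))))"

lemma locate_cost:
 fixes aQ b aY lam Q tb e :: nat
 assumes "aQ + b <= aY" "2 * lam + 3 <= b" "Q <= aQ" "tb <= 400 * aQ + 59 * Q + 10" "e <= 300 * (lam + 1) + tb + 60"
 shows "e <= 500 * aY"
proof -
 have "500 * aQ + 500 * b <= 500 * aY" "1000 * lam + 1500 <= 500 * b" using assms(1,2) by simp_all
 moreover have "e <= 300 * lam + 370 + 400 * aQ + 59 * Q" "59 * Q <= 59 * aQ" using assms(3-5) by simp_all
 ultimately show ?thesis by simp
qed

lemma pure_imp_silent: "pure c ==> silent c"
 by (induction c) auto

lemma locate_syntax [simp]:
 "mods locate_test = {30, 31, 32, 33, 34, 36, 43, 44}" "pure locate_test" "pure locate"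
 "mods locate = {20, 21, 22, 23, 24, 25, 26, 27, 28} \<union> {30, 31, 32, 33, 34, 36} \<union> {40, 41, 42, 43, 44} \<union> {14}"
 "vars_ok locate_test" "vars_ok locate"
 by (auto simp: locate_test_def locate_def)

lemma proclist_syntax:
 "mods (proclist J) \<subseteq> {17, 18, 51, 55} \<union> {30..37} \<union> {100..<bank (Suc J)}" "silent (proclist J)"
 "J < 40 ==> vars_ok (proclist J)"
 using visit_syntax[of J] by (auto simp: proclist_def)

lemma batch_syntax:
 "mods (batch_com J) \<subseteq> {17, 18} \<union> {20..28} \<union> {30..37} \<union> {50, 51, 52, 55} \<union> {100..<bank (Suc J)}"
 "silent (batch_com J)" "J < 40 ==> vars_ok (batch_com J)"
 using proclist_syntax[of J] by (auto simp: batch_com_def pure_imp_silent)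

lemma getval_syntax: "mods (getval i a b) \<subseteq> {30..36} \<union> {b}" "pure (getval i a b)" "vars_ok (getval i a b) \<longleftrightarrow> a < 1000 & b < 1000"
 by (auto simp: getval_def)

lemma scan_syntax:
 "mods (scan J) \<subseteq> {17, 18} \<union> {20..28} \<union> {30..37} \<union> {50, 51, 52, 55} \<union> {100..<bank (Suc J)}"
 "silent (scan J)" "J < 40 ==> vars_ok (scan J)"
 using batch_syntax[of J] visit_syntax[of J] getval_syntax[of J "bank J" 55]
 by (auto simp: scan_def pure_imp_silent)

locale core_full = core_tables +
 assumes L_Lam: "L + 1 < 2 ^ Lam"
 and scal_Lam: "scal D hb 11 Lam" and scal_Nb: "scal D hb 12 Nb" and scal_B: "scal D hb 13 (d ^ J)"
 and fam1: "pred_mem 14 15 16 17 18 (2 * 2 ^ L) X1 F1 1"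
 and fam2: "pred_mem 19 20 21 22 23 ((L + 1) * Nb) X2 F2 (Lam + 1)"
 and fam3: "pred_mem 24 25 26 27 28 ((L + 1) * (L + 1) * (Nb + 1)) X3 F3 (Lam + 1)"
 and idw: "(L + 1) * (L + 1) * (Nb + 1) < 2 ^ w"
begin

text \<open>The predecessor query leaves a range of at most \<open>B\<close> positions. As
  \<open>B <= 2 ^ (J * Lam)\<close>, the binary search takes \<open>J * Lam + 1\<close> rounds, and
  each round decodes one value in constant time.\<close>

lemma T_locate:
 assumes M: "extends w D M" and 10: "sg 10 = hb" and t: "sg 11 = t" "t <= L" and v: "sg 12 = v" "v < 2 ^ t"
 and l: "sg 19 = l" "l < 2 ^ L" and e: "sg 15 = (v + 1) * S t"
 shows "T w locate (%tm (sg', _). tm <= 500 * (I + 1) * (J + 2) * (Lam + 2) & sg' 14 = rank t v l) (sg, M, out)"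
proof -
 define k where "k = 2 ^ t + v"
 have tw: "(2::nat) ^ t <= 2 ^ L" using t(2) by (intro power_increasing) auto
 have k: "k < 2 * 2 ^ L" "k ~= 0" "level k = t" "k - 2 ^ level k = v"
 proof -
 show "k < 2 * 2 ^ L" unfolding k_def using v(2) tw by linarith
 show "k ~= 0" "level k = t" "k - 2 ^ level k = v" using level[OF v(2)] by (auto simp: k_def)
 qed
 have p2: "ev sg M (Arr 2 (Var 11)) = 2 ^ t" "ok w sg M (Arr 2 (Var 11))"
 using Arr_eval[OF tab_pow M, of sg "Var 11"] 10 t by auto
 define sg1 where "sg1 = sg(20 := k, 21 := l)"
 have kw: "k < 2 ^ w" using k(1) word by linarith
 have P: "T w (pred_query 14 15 16 17 18) (%tm (sg', _). tm <= 300 * (Lam + 1) &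
 sg' 28 + 1 <= length D & (\<forall>i<1. M ! (sg' 28 + i) = F1 (sg1 20) (sg1 21) i)) (sg1, M, out)"
 using T_pred[OF M, of sg1 "2 * 2 ^ L" 14 15 16 17 18 X1 F1 1 Lam out] 10 k l fam1 L_Lam by (simp add: sg1_def)
 define lo where "lo = start t v l"
 define hi where "hi = min ((v + 1) * S t) (lo + B)"
 note sp = start_props[OF t(2) v(2), of l, folded lo_def]
 have F1: "F1 k l 0 = lo" using k by (simp add: F1_def lo_def)
 have nd: "(v + 1) * S t <= N" using mult_le_mono1[of "v + 1" "2 ^ t" "S t"] v(2) S_dvd[OF t(2)] by simp
 have rk: "lo <= rank t v l" "rank t v l <= hi" using sp rank_le[of t v l] by (auto simp: hi_def)
 have hiN: "hi <= N" "hi <= v * S t + S t" using nd by (auto simp: hi_def)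
 have inn: "p < N" "p div S t = v" if "lo <= p" "p < hi" for p
 proof -
 show "p < N" using that hiN by linarith
 show "p div S t = v" using that hiN sp(1) by (intro div_nat_eqI) (auto simp: mult.commute)
 qed
 define Pr where "Pr = (%p. \<not> X (A t p) < l)"
 have Pr: "Pr p \<longleftrightarrow> rank t v l <= p" if "lo <= p" "p < hi" for p
 using less_rank_iff[OF t(2) inn[OF that], of l] unfolding Pr_def by linarith
 have lob: "lo + B < 2 ^ w"
 proof -
 have "lo <= N" using rk hiN by linarith
 moreover have "1 * B <= Nb * B" using Nb(2) by (intro mult_le_mono1) simp
 ultimately show ?thesis using Nb(1) strw d(1) by linarith
 qed
 have Bl: "B < 2 ^ (J * Lam + 1)"
 proof -
 have "B <= (2 ^ Lam) ^ J" using d(2) by (rule power_mono) simp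
 also have "... = 2 ^ (J * Lam)" by (simp add: power_mult[symmetric] mult.commute)
 also have "... < 2 ^ (J * Lam + 1)" by simp
 finally show ?thesis .
 qed
 have bis: "T w (bisect 40 41 42 43 locate_test) (%tm (sg', _). tm <= (J * Lam + 1) * ((400 * (I + 1) + 40) + 19) + 4 &
 lo <= sg' 40 & sg' 40 <= hi & (ALL i. lo <= i & i < sg' 40 --> \<not> Pr i) & (ALL i. sg' 40 <= i & i < hi --> Pr i)) (sg', M, out)"
 if s: "sg' 10 = hb" "sg' 11 = t" "sg' 19 = l" "sg' 40 = lo" "sg' 41 = hi" for sg'
 proof (rule T_bisect)
 fix sg2 :: "reg => nat"
 assume fr: "!!r. r ~: insert 40 (insert 41 (insert 42 (mods locate_test))) ==> sg2 r = sg' r"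
 and lt: "lo <= sg2 42" "sg2 42 < hi"
 have s2: "sg2 10 = hb" "sg2 11 = t" "sg2 19 = l" using fr[of 10] fr[of 11] fr[of 19] s by auto
 define p where "p = sg2 42"
 have p: "p < N" using inn[OF lt] by (simp add: p_def)
 have dec: "T w decode (%t' (sg', _). t' <= 400 * (I + 1) & sg' 36 = A t p) (sg2(30 := t, 31 := p), M, out)"
 using T_decode[OF M, of "sg2(30 := t, 31 := p)" out] s2 t p by simp
 show "T w locate_test (%t (sg'', _). t <= 400 * (I + 1) + 40 & (sg'' 43 ~= 0) = Pr (sg2 42)) (sg2, M, out)"
 unfolding locate_test_def p_def[symmetric]
 apply (rule T_seq_assign[where v = t], simp, simp add: s2)
 apply (rule T_seq_assign[where v = p], simp, simp add: p_def)
 apply (rule T_seq_call[OF dec], simp)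
 subgoal premises prems for tm sg3
 proof -
 have v3: "sg3 10 = hb" "sg3 19 = l" "sg3 36 = A t p" "tm <= 400 * (I + 1)"
 using prems(1) prems(2)[of 10] prems(2)[of 19] s2 by auto
 have ex: "ev sg3 M (Arr 6 (Var 36)) = X (A t p)" "ok w sg3 M (Arr 6 (Var 36))"
 using Arr_eval[OF tab_X M, of sg3 "Var 36"] v3 A_less[OF t(2) p] by auto
 show ?thesis by (rule T_seq_assign[OF ex(2,1)]) (use v3 in \<open>auto simp: Pr_def\<close>)
 qed
 done
 next
 show "Pr b" if "lo <= a" "a <= b" "b < hi" "Pr a" for a b using Pr[of a] Pr[of b] that by auto
 show "hi - lo < 2 ^ (J * Lam + 1)" using Bl unfolding hi_def by linarith
 show "hi + hi < 2 ^ w" "2 < (2::nat) ^ w" using hiN word by linarith+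
 qed (use s rk in auto)
 have Mw: "length D <= length M" using extends_length[OF M] .
 show ?thesis unfolding locate_def
 apply (rule T_seq_assign[where v = k])
 subgoal using p2 v kw by (simp add: k_def)
 subgoal using p2 v by (simp add: k_def)
 apply (rule T_seq_assign[where v = l], simp, simp add: l)
 apply (fold sg1_def)
 apply (rule T_seq_call[OF P], simp)
 subgoal premises prems for tm1 sg2
 proof -
 have v2: "tm1 <= 300 * (Lam + 1)" "sg2 28 < length M" "M ! sg2 28 = lo"
 "sg2 10 = hb" "sg2 11 = t" "sg2 19 = l" "sg2 15 = (v + 1) * S t"
 using prems(1) prems(2)[of 10] prems(2)[of 11] prems(2)[of 19] prems(2)[of 15] 10 t l e F1 Mw
 by (auto simp: sg1_def)
 define sg3 where "sg3 = sg2(40 := lo, 41 := lo + B)"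
 note SB = Scal_eval[OF scal_B M]
 define sg4 where "sg4 = sg3(41 := hi)"
 have s4: "T w (If (Bin Less (Var 15) (Var 41)) (Assign 41 (Var 15)) (Assign 41 (Var 41)))
 (%ta s. ta <= 20 & s = (sg4, M, out)) (sg3, M, out)"
 using v2 by (auto simp: sg4_def sg3_def hi_def min_def)
 have fin: "T w (Seq (bisect 40 41 42 43 locate_test) (Assign 14 (Var 40)))
 (%ta (sg', _). ta <= (J * Lam + 1) * (400 * (I + 1) + 59) + 10 & sg' 14 = rank t v l) (sg4, M, out)"
 apply (rule T_seq_call[OF bis])
 subgoal using v2 by (simp add: sg4_def sg3_def)
 subgoal using v2 by (simp add: sg4_def sg3_def)
 subgoal using v2 by (simp add: sg4_def sg3_def)
 subgoal by (simp add: sg4_def sg3_def)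
 subgoal by (simp add: sg4_def sg3_def)
 subgoal by simp
 subgoal premises pp for ta sg5
 proof -
 define z where "z = sg5 40"
 have z: "lo <= z" "z <= hi" "ALL i. lo <= i & i < z --> \<not> Pr i" "ALL i. z <= i & i < hi --> Pr i"
 "ta <= (J * Lam + 1) * (400 * (I + 1) + 59) + 4" using pp(1) by (auto simp: z_def)
 have "z = rank t v l"
 proof (rule ccontr)
 assume "z ~= rank t v l"
 then consider "z < rank t v l" | "rank t v l < z" by linarith
 then show False
 proof cases
 case 1
 then have "Pr z" using z(4) rk by auto
 then show False using Pr[of z] z 1 rk by auto
 next
 case 2
 then have "\<not> Pr (rank t v l)" using z(3) rk by auto
 then show False using Pr[of "rank t v l"] 2 z rk by auto
 qed
 qed
 then show ?thesis using z(5) by (simp add: z_def)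
 qed
 done
 have bound: "ecost (Bin Add (Arr 2 (Var 11)) (Var 12)) + 1 + (ecost (Var 19) + 1 + (tm1 +
 (ecost (Mem (Var 28)) + 1 + (ecost (Bin Add (Var 40) (Scal 13)) + 1 + (ta + tb))))) <= 500 * (I + 1) * (J + 2) * (Lam + 2)"
 if "ta <= 20" "tb <= (J * Lam + 1) * (400 * (I + 1) + 59) + 10" for ta tb
 proof -
 define Q Y where "Q = J * Lam + 1" and "Y = (J + 2) * (Lam + 2)"
 have "(I + 1) * (Q + (2 * Lam + 3)) <= (I + 1) * Y"
 by (rule mult_le_mono2) (simp add: Y_def Q_def algebra_simps)
 then have "(I + 1) * Q + (I + 1) * (2 * Lam + 3) <= (I + 1) * Y" by (simp only: distrib_left)
 moreover have "1 * (2 * Lam + 3) <= (I + 1) * (2 * Lam + 3)" by (rule mult_le_mono1) simp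
 moreover have "1 * Q <= (I + 1) * Q" by (rule mult_le_mono1) simp
 moreover have "Q * (400 * (I + 1) + 59) = 400 * ((I + 1) * Q) + 59 * Q" by (simp add: algebra_simps)
 moreover have "500 * (I + 1) * (J + 2) * (Lam + 2) = 500 * ((I + 1) * Y)" by (simp only: Y_def mult.assoc)
 moreover have "tb <= Q * (400 * (I + 1) + 59) + 10" using that(2) by (simp add: Q_def)
 moreover have "ecost (Bin Add (Arr 2 (Var 11)) (Var 12)) + 1 + (ecost (Var 19) + 1 + (tm1 +
 (ecost (Mem (Var 28)) + 1 + (ecost (Bin Add (Var 40) (Scal 13)) + 1 + (ta + tb))))) <= 300 * (Lam + 1) + tb + 60"
 using that(1) v2(1) by simp
 ultimately show ?thesis
 using locate_cost[of "(I + 1) * Q" "(I + 1) * (2 * Lam + 3)" "(I + 1) * Y" Lam Q tb] by simp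
 qed
 show ?thesis
 apply (rule T_seq_assign[where v = lo])
 subgoal using v2 by simp
 subgoal using v2 by simp
 apply (rule T_seq_assign[where v = "lo + B"])
 subgoal using SB[of "sg2(40 := lo)"] v2 lob by simp
 subgoal using SB[of "sg2(40 := lo)"] v2 by simp
 apply (fold sg3_def)
 unfolding T_Seq[of w "If _ _ _"]
 apply (rule T_mono[OF s4], elim conjE, hypsubst)
 apply (rule T_mono[OF fin])
 using bound by auto
 qed
 done
qed

end

section \<open>Amortised cost of the scan over blocks\<close>

locale core_run = core_query L X w hb D I FL BL fld bas par d J Nb Lam enc trow t s1 p0 pend r bp M0 +
 core_full L X w hb D I FL BL fld bas par d J Nb Lam enc trow
 for L X w hb D I FL BL fld bas par d J Nb Lam enc trow t s1 p0 pend r bp M0 +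
 assumes s1N: "s1 <= 2 ^ L"
begin

definition blk :: "nat => nat list" where "blk j = filter good [j * B..<(j + 1) * B]"

definition res :: "nat list => nat list => nat => (nat list => nat => bool) => st => bool" where
 "res xs ou rem Q s' \<longleftrightarrow> (EX ou' rem'. feed bad xp xs (ou, rem) = (ou', rem') &
 fst s' 17 = rem' & fst s' 18 = bp + length ou' & fst (snd s') = wr M0 bp ou' & Q ou' rem')"

abbreviation ab :: "nat => nat => nat list" where "ab \<equiv> blocks.above (tmx t) (s1 - 1)"

sublocale bl: blocks L Nb Lam "tmx t"
 by (rule blocks[OF t])

lemma mx_iff: "j < Nb ==> s1 - 1 <= tmx t j \<longleftrightarrow> s1 <= mx t J j"
 using mx_attained[OF t, of j] by (auto simp: tmx_def)

lemma blk_above: "u <= v ==> v <= Nb ==> filter good [u * B..<v * B] = concat (map blk (ab u v))"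
proof (induction v rule: dec_induct)
 case base
 then show ?case by (simp add: bl.above_def)
next
 case (step v)
 have "filter good [u * B..<Suc v * B] = filter good [u * B..<v * B] @ blk v"
 unfolding blk_def using filter_good_split[of "u * B" "v * B" "(v + 1) * B"] mult_le_mono1[OF step(1), of B] by simp
 moreover have "ab u (Suc v) = ab u v @ (if s1 <= mx t J v then [v] else [])"
 using step mx_iff[of v] by (simp add: bl.above_def)
 moreover have "blk v = []" if "\<not> s1 <= mx t J v"
 unfolding blk_def by (rule no_good) (use that in \<open>auto simp: less_Suc_eq\<close>)
 ultimately show ?case using step by (auto simp: )
qed

lemma blk_nonempty: "j < Nb ==> p0 <= j * B ==> s1 <= mx t J j ==> blk j ~= []"
proof -
 assume a: "j < Nb" "p0 <= j * B" "s1 <= mx t J j"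
 obtain p where "p \<in> {j * B..<(j + 1) * B}" "s1 <= val t p" using a(3) unfolding mx_ge_iff by blast
 then have "p \<in> set (blk j)" using a(2) by (auto simp: blk_def good_def)
 then show ?thesis by (metis empty_iff empty_set)
qed

lemma length_concat_blk:
 "\<forall>j\<in>set js. j < Nb & p0 <= j * B & s1 <= mx t J j ==> length js <= length (concat (map blk js))"
proof (induction js)
 case (Cons j js)
 then have "1 <= length (blk j)" using blk_nonempty[of j] by (simp add: Suc_leI)
 then show ?case using Cons by simp
qed simp

lemma extends_D: "extends w D M ==> a + i < length D ==> M ! (a + i) = D ! (a + i)"
 by (rule extends_nth)

definition pcond :: exp where
 "pcond = Bin Mul (Bin Less (Var 51) (Scal 11)) (Bin Less (Num 0) (Var 17))"

definition pbody :: com where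
 "pbody = Seq (Assign (bank J) (Mem (Bin Add (Var 52) (Var 51))))
 (Seq (If (Bin Less (Var (bank J)) (Scal 12)) (visit J) (Assign 55 (Num 0)))
 (Assign 51 (Bin Add (Var 51) (Num 1))))"

text \<open>A visited block outputs at least one point unless the search ends in it, so the factor 2
  pays for the constant part of a visit, and the term with \<open>1 + Lam\<close> is due at most
  once, when the search ends. The filling entries \<open>Nb\<close> are recognised and cost only
  constant time.\<close>

lemma proclist_loop:
 assumes a: "a + Lam <= length D"
 and ent: "\<forall>i<Lam. D ! (a + i) = (if i < length js then js ! i else Nb)"
 and js: "\<forall>j\<in>set js. j < Nb & p0 <= j * B & s1 <= mx t J j"
 shows "i <= Lam ==> pre sg ou rem ==> sg 52 = a ==> sg 51 = i ==>
 T w (While pcond pbody) (%tm s'. res (concat (map blk (take (Lam - i) (drop i js)))) ou rem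
 (%ou' rem'. tm <= 100 * (Lam - i) + 20 + 2 * (Cv J * (length ou' - length ou)) +
 (if rem' = 0 & rem ~= 0 then Cv J * (1 + Lam) else 0)) s') (sg, wr M0 bp ou, out)"
proof (induction "Lam - i" arbitrary: i sg ou rem)
 case (0 i)
 then have i: "i = Lam" by simp
 have M: "extends w D (wr M0 bp ou)" by (rule extends_wr[OF 0(3)])
 have g: "glob sg" using 0(3) by (simp add: pre_def)
 have "ok w sg (wr M0 bp ou) pcond" "ev sg (wr M0 bp ou) pcond = 0" "ecost pcond + 1 <= 20"
 using Scal_eval[OF scal_Lam M, of sg, OF globD(1)[OF g]] 0 i word by (auto simp: pcond_def)
 then show ?case using 0(3) by (subst T_While_unfold) (simp add: res_def i pre_def)
next
 case (Suc n i)
 note pr = Suc.prems(2)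
 have M: "extends w D (wr M0 bp ou)" by (rule extends_wr[OF pr])
 have g: "glob sg" and r17: "sg 17 = rem" using pr by (auto simp: pre_def)
 have i: "i < Lam" using Suc(2) by simp
 note SLam = Scal_eval[OF scal_Lam M, of sg, OF globD(1)[OF g]]
 have cond: "ok w sg (wr M0 bp ou) pcond" "ev sg (wr M0 bp ou) pcond ~= 0 \<longleftrightarrow> 0 < rem" "ecost pcond + 1 <= 20"
 using SLam i r17 Suc.prems(4) word by (auto simp: pcond_def)
 show ?case
 proof (cases "rem = 0")
 case True
 then show ?thesis using cond pr by (subst T_While_unfold) (simp add: res_def pre_def)
 next
 case False
 define e where "e = D ! (a + i)"
 have e: "e = (if i < length js then js ! i else Nb)" using ent i by (simp add: e_def)
 have ai: "a + i < length D" "length D <= length (wr M0 bp ou)" "length (wr M0 bp ou) < 2 ^ w"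
 using a i extends_length[OF M] M by (auto simp: extends_def)
 have ev1: "ok w sg (wr M0 bp ou) (Mem (Bin Add (Var 52) (Var 51)))"
 "ev sg (wr M0 bp ou) (Mem (Bin Add (Var 52) (Var 51))) = e"
 using ai Suc.prems(3,4) extends_nth[OF M ai(1)] by (auto simp: e_def)
 define sg1 where "sg1 = sg(bank J := e)"
 have pr1: "pre sg1 ou rem" using pr by (simp add: pre_def sg1_def)
 note SNb = Scal_eval[OF scal_Nb M, of sg1]
 have v1: "sg1 10 = hb" "sg1 52 = a" "sg1 51 = i" "sg1 (bank J) = e"
 using globD(1)[OF g] Suc.prems(3,4) by (auto simp: sg1_def)
 define hd1 where "hd1 = (if i < length js then blk e else [])"
 have lst: "concat (map blk (take (Lam - i) (drop i js))) = hd1 @ concat (map blk (take (Lam - Suc i) (drop (Suc i) js)))"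
 proof (cases "i < length js")
 case True
 have "drop i js = js ! i # drop (Suc i) js" using True by (simp add: Cons_nth_drop_Suc)
 moreover have "Lam - i = Suc (Lam - Suc i)" using i by simp
 ultimately show ?thesis using True e by (simp add: hd1_def)
 qed (simp add: hd1_def)
 have V: "T w (If (Bin Less (Var (bank J)) (Scal 12)) (visit J) (Assign 55 (Num 0)))
 (%tm (sg', M', out'). out' = out & glob sg' & sg' 52 = a & sg' 51 = i &
 res hd1 ou rem (%ou' rem'. tm <= 20 + 2 * (Cv J * (length ou' - length ou)) +
 (if rem' = 0 then Cv J * (1 + Lam) else 0)) (sg', M', out')) (sg1, wr M0 bp ou, out)"
 proof (cases "i < length js")
 case True
 then have em: "e \<in> set js" using e by simp
 then have ej: "e < Nb" "p0 <= e * B" "s1 <= mx t J e" using js by auto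
 have "p0 div B <= e" using ej(2) B_pos by (metis div_le_mono div_mult_self_is_m)
 then have "T w (visit J) (%tm s'. outcome tm (Cv J) (e * B) ((e + 1) * B) ou rem s') (sg1, wr M0 bp ou, out)"
 using vspec[OF order_refl, unfolded vspec_def, rule_format, OF pr1 _ v1(4)] False ej by (simp add: str_def)
 then have "T w (visit J) (%tm (sg', M', out'). out' = out & glob sg' & sg' 52 = a & sg' 51 = i &
 res hd1 ou rem (%ou' rem'. tm <= 2 * (Cv J * (length ou' - length ou)) +
 (if rem' = 0 then Cv J * (1 + Lam) else 0)) (sg', M', out')) (sg1, wr M0 bp ou, out)"
 proof (rule T_call_gen[OF _ visit_syntax(2)])
 fix tm sg' M'
 assume oc: "outcome tm (Cv J) (e * B) ((e + 1) * B) ou rem (sg', M', out)"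
 and fr: "!!r. r ~: mods (visit J) ==> sg' r = sg1 r"
 have fr': "sg' x = sg1 x" if "x \<in> {10..16} \<union> {50..60}" for x
 by (rule fr, rule notI, drule subsetD[OF visit_syntax(1)], use that in auto)
 have "glob sg1" using pr1 by (simp add: pre_def)
 then have g': "glob sg'" by (rule glob_frame) (use fr' in auto)
 obtain ou1 rem1 where o1: "feed bad xp (blk e) (ou, rem) = (ou1, rem1)"
 "sg' 17 = rem1" "sg' 18 = bp + length ou1" "M' = wr M0 bp ou1"
 "tm <= Cv J * (1 + ((length ou1 - length ou) + (if e * B < p0 then Lam else 0)) + (if rem1 = 0 then Lam else 0))"
 using oc by (auto simp: outcome_def blk_def)
 have np: "\<not> e * B < p0" using ej(2) by simp
 have "tm <= 2 * (Cv J * (length ou1 - length ou)) + (if rem1 = 0 then Cv J * (1 + Lam) else 0)"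
 proof (cases "rem1 = 0")
 case True
 then show ?thesis using o1(5) np by (simp add: algebra_simps)
 next
 case r1: False
 have "length ou < length ou1" using feed_props(3)[OF o1(1)] blk_nonempty[OF ej] False r1 by simp
 then have "Cv J * 1 <= Cv J * (length ou1 - length ou)" by (intro mult_le_mono2) simp
 then show ?thesis using o1(5) np r1 by (simp add: algebra_simps)
 qed
 then show "case (sg', M', out) of (sg', M', out') => out' = out & glob sg' & sg' 52 = a & sg' 51 = i &
 res hd1 ou rem (%ou' rem'. tm <= 2 * (Cv J * (length ou' - length ou)) +
 (if rem' = 0 then Cv J * (1 + Lam) else 0)) (sg', M', out')"
 using g' fr'[of 52] fr'[of 51] v1 o1 True by (simp add: res_def hd1_def)
 qed
 then show ?thesis using SNb v1 ej(1) by (auto simp: res_def elim!: T_mono)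
 next
 case nl: False
 then have "\<not> e < Nb" using e by simp
 then show ?thesis using SNb v1 nl pr1 False by (simp add: res_def hd1_def pre_def)
 qed
 have sil: "silent (If (Bin Less (Var (bank J)) (Scal 12)) (visit J) (Assign 55 (Num 0)))"
 using visit_syntax(2) by simp
 have body: "T w pbody (%t1. T w (While pcond pbody) (%t2 s'. res (concat (map blk (take (Lam - i) (drop i js)))) ou rem
 (%ou' rem'. ecost pcond + 1 + t1 + 1 + t2 <= 100 * (Lam - i) + 20 + 2 * (Cv J * (length ou' - length ou)) +
 (if rem' = 0 & rem ~= 0 then Cv J * (1 + Lam) else 0)) s')) (sg, wr M0 bp ou, out)"
 apply (subst pbody_def)
 apply (rule T_seq_assign[OF ev1])
 apply (fold sg1_def)
 apply (rule T_seq_call_gen[OF V sil])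
 subgoal premises prems for t1 sg2 M2
 proof -
 obtain ou1 rem1 where o1: "feed bad xp hd1 (ou, rem) = (ou1, rem1)"
 "sg2 17 = rem1" "sg2 18 = bp + length ou1" "M2 = wr M0 bp ou1"
 "t1 <= 20 + 2 * (Cv J * (length ou1 - length ou)) + (if rem1 = 0 then Cv J * (1 + Lam) else 0)"
 and g2: "glob sg2" "sg2 52 = a" "sg2 51 = i" using prems(1) by (auto simp: res_def)
 note fp = feed_props[OF o1(1)]
 define sg3 where "sg3 = sg2(51 := Suc i)"
 have pr3: "pre sg3 ou1 rem1" using g2 o1 fp(1) pr by (auto simp: pre_def sg3_def)
 have iw: "Suc i < 2 ^ w" using i ai a by linarith
 have W: "T w (While pcond pbody) (%tm s'. res (concat (map blk (take (Lam - Suc i) (drop (Suc i) js)))) ou1 rem1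
 (%ou' rem'. tm <= 100 * (Lam - Suc i) + 20 + 2 * (Cv J * (length ou' - length ou1)) +
 (if rem' = 0 & rem1 ~= 0 then Cv J * (1 + Lam) else 0)) s') (sg3, wr M0 bp ou1, out)"
 by (rule Suc.hyps(1)[OF _ _ pr3]) (use Suc(2) i g2 in \<open>auto simp: sg3_def\<close>)
 have "T w (While pcond pbody) (%t2 s'. res (concat (map blk (take (Lam - i) (drop i js)))) ou rem
 (%ou' rem'. ecost pcond + 1 + (ecost (Mem (Bin Add (Var 52) (Var 51))) + 1 + (t1 + (ecost (Bin Add (Var 51) (Num 1)) + 1))) + 1 + t2
 <= 100 * (Lam - i) + 20 + 2 * (Cv J * (length ou' - length ou)) +
 (if rem' = 0 & rem ~= 0 then Cv J * (1 + Lam) else 0)) s') (sg3, wr M0 bp ou1, out)"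
 proof (rule T_mono[OF W], goal_cases)
 case (1 t2 s')
 then obtain ou2 rem2 where o2: "feed bad xp (concat (map blk (take (Lam - Suc i) (drop (Suc i) js)))) (ou1, rem1) = (ou2, rem2)"
 "fst s' 17 = rem2" "fst s' 18 = bp + length ou2" "fst (snd s') = wr M0 bp ou2"
 "t2 <= 100 * (Lam - Suc i) + 20 + 2 * (Cv J * (length ou2 - length ou1)) +
 (if rem2 = 0 & rem1 ~= 0 then Cv J * (1 + Lam) else 0)" by (auto simp: res_def)
 have fd: "feed bad xp (concat (map blk (take (Lam - i) (drop i js)))) (ou, rem) = (ou2, rem2)"
 unfolding lst feed_append o1(1) o2(1) ..
 have r21: "rem1 = 0 ==> rem2 = 0" using o2(1) by auto
 define x y where "x = Cv J * (length ou1 - length ou)" and "y = Cv J * (length ou2 - length ou1)"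
 have xy: "Cv J * (length ou2 - length ou) = x + y"
 using fp(2) feed_props(2)[OF o2(1)] by (simp add: x_def y_def add_mult_distrib2[symmetric])
 have Li: "100 * (Lam - i) = 100 * (Lam - Suc i) + 100" using i by simp
 have "ecost pcond + 1 + (ecost (Mem (Bin Add (Var 52) (Var 51))) + 1 + (t1 + (ecost (Bin Add (Var 51) (Num 1)) + 1))) + 1 + t2
 <= 100 * (Lam - i) + 20 + 2 * (Cv J * (length ou2 - length ou)) +
 (if rem2 = 0 & rem ~= 0 then Cv J * (1 + Lam) else 0)"
 unfolding xy Li using o1(5) o2(5) cond(3) False r21 unfolding x_def[symmetric] y_def[symmetric]
 by (cases "rem1 = 0"; cases "rem2 = 0") auto
 then show ?case unfolding res_def fd using o2 by blast
 qed
 then show ?thesis using g2(3) iw o1(4) word by (simp add: sg3_def)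
 qed
 done
 show ?thesis using cond False body by (subst T_While_unfold) simp
 qed
qed

lemma T_proclist:
 assumes a: "a + Lam <= length D"
 and ent: "\<forall>i<Lam. D ! (a + i) = (if i < length js then js ! i else Nb)" and len: "length js <= Lam"
 and js: "\<forall>j\<in>set js. j < Nb & p0 <= j * B & s1 <= mx t J j"
 and pr: "pre sg ou rem" and 52: "sg 52 = a"
 shows "T w (proclist J) (%tm s'. res (concat (map blk js)) ou rem
 (%ou' rem'. tm <= 100 * Lam + 30 + 2 * (Cv J * (length ou' - length ou)) + Cv J * (1 + Lam)) s') (sg, wr M0 bp ou, out)"
proof -
 have W: "T w (While pcond pbody) (%tm s'. res (concat (map blk (take (Lam - 0) (drop 0 js)))) ou rem
 (%ou' rem'. tm <= 100 * (Lam - 0) + 20 + 2 * (Cv J * (length ou' - length ou)) +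
 (if rem' = 0 & rem ~= 0 then Cv J * (1 + Lam) else 0)) s') (sg(51 := 0), wr M0 bp ou, out)"
 by (rule proclist_loop[OF a ent js]) (use pr 52 in \<open>auto simp: pre_def\<close>)
 show ?thesis unfolding proclist_def pcond_def[symmetric] pbody_def[symmetric]
 apply (rule T_seq_assign[where v = 0], use word in simp, simp)
 apply (rule T_mono[OF W])
 subgoal for tm s'
 proof -
 assume "res (concat (map blk (take (Lam - 0) (drop 0 js)))) ou rem
 (%ou' rem'. tm <= 100 * (Lam - 0) + 20 + 2 * (Cv J * (length ou' - length ou)) +
 (if rem' = 0 & rem ~= 0 then Cv J * (1 + Lam) else 0)) s'"
 then have "res (concat (map blk js)) ou rem (%ou' rem'. tm <= 100 * Lam + 20 + 2 * (Cv J * (length ou' - length ou)) +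
 (if rem' = 0 & rem ~= 0 then Cv J * (1 + Lam) else 0)) s'" using len by simp
 then show ?thesis unfolding res_def by (auto split: if_splits)
 qed
 done
qed

definition Cb :: nat where "Cb = 4 * Cv J + 2000"

lemma batch_cost:
 fixes p1 p2 V x y lam tm :: nat
 assumes "tm <= 2 * (300 * (lam + 1)) + p1 + p2 + 200"
 "p1 <= 100 * lam + 30 + 2 * (V * x) + V * (1 + lam)" "p2 <= 100 * lam + 30 + 2 * (V * y) + V * (1 + lam)"
 shows "tm <= (4 * V + 2000) * (1 + (x + y) + lam)"
proof -
 have "(4 * V + 2000) * (1 + (x + y) + lam) =
 4 * (V * x) + 4 * (V * y) + 4 * V + 4 * (V * lam) + 2000 * x + 2000 * y + 2000 + 2000 * lam"
 by (simp add: algebra_simps)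
 moreover have "V * (1 + lam) = V + V * lam" by simp
 ultimately show ?thesis using assms by simp
qed

text \<open>Two predecessor queries and two lists cost \<open>O(Lam)\<close> besides the output. If
  the batch neither reaches the last block nor ends the search, it contains at least
  \<open>Lam\<close> relevant blocks, each with a good position, and so pays for itself.\<close>

lemma T_batch:
 assumes pr: "pre sg ou rem" and j: "sg 50 = j" "j < Nb" "p0 <= j * B" and rem: "0 < rem"
 shows "T w (batch_com J) (%tm (sg', M', out'). EX j'. sg' 50 = j' & j < j' & j' <= Nb & glob sg' &
 res (filter good [j * B..<j' * B]) ou rem (%ou' rem'. tm <= Cb * (1 + (length ou' - length ou) + Lam) &
 (j' = Nb \<or> rem' = 0 \<or> Lam <= length ou' - length ou)) (sg', M', out')) (sg, wr M0 bp ou, out)"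
proof -
 define s where "s = s1 - 1"
 define h where "h = bl.hs j s - 1"
 define i where "i = j div 2 ^ h + 1"
 define j' where "j' = bl.rnext h i s"
 define l1 where "l1 = bl.above s j (bl.wend j h)"
 define l2 where "l2 = take Lam (bl.rlist h i s)"
 note bt = bl.batch[OF j(2), of s, folded h_def i_def j'_def l1_def l2_def]

 have cat: "l1 @ l2 = ab j j'" and l1l: "length l1 <= Lam" and jj: "j < j'" "j' <= Nb"
 and big: "j' = Nb \<or> Lam <= length (ab j j')" and hi: "h <= L" "i <= Nb"
 using bt unfolding j'_def l2_def s_def by blast+
 have l2l: "length l2 <= Lam" by (simp add: l2_def)
 have mem: "\<forall>x\<in>set (l1 @ l2). x < Nb & p0 <= x * B & s1 <= mx t J x"
 proof
 fix x assume "x \<in> set (l1 @ l2)"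
 then have x: "j <= x" "x < j'" "s1 - 1 <= tmx t x" unfolding cat by (auto simp: bl.above_def)
 have "p0 <= x * B" using j(3) mult_le_mono1[OF x(1), of B] by linarith
 then show "x < Nb & p0 <= x * B & s1 <= mx t J x" using x jj mx_iff[of x] by simp
 qed
 define id2 where "id2 = t * Nb + j"
 define id3 where "id3 = (t * (L + 1) + h) * (Nb + 1) + i"
 have id2: "id2 < (L + 1) * Nb" "id2 div Nb = t" "id2 mod Nb = j"
 proof -
 have "t * Nb + Nb <= (L + 1) * Nb" using mult_le_mono1[of "t + 1" "L + 1" Nb] t by simp
 then show "id2 < (L + 1) * Nb" unfolding id2_def using j(2) by linarith
 show "id2 div Nb = t" "id2 mod Nb = j" using div_mod_mult_add[OF j(2), of t] by (auto simp: id2_def)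
 qed
 have id3: "id3 < (L + 1) * (L + 1) * (Nb + 1)" "id3 mod (Nb + 1) = i" "id3 div (Nb + 1) mod (L + 1) = h"
 "id3 div (Nb + 1) div (L + 1) = t"
 proof -
 have a: "i < Nb + 1" "h < L + 1" using hi by auto
 have "t * (L + 1) + h + 1 <= (t + 1) * (L + 1)" using a by simp
 also have "... <= (L + 1) * (L + 1)" using t by (intro mult_le_mono1) simp
 finally have "(t * (L + 1) + h + 1) * (Nb + 1) <= (L + 1) * (L + 1) * (Nb + 1)" by (rule mult_le_mono1)
 then show "id3 < (L + 1) * (L + 1) * (Nb + 1)" unfolding id3_def add_mult_distrib[of _ 1] mult_1 using a by linarith
 show "id3 mod (Nb + 1) = i" "id3 div (Nb + 1) mod (L + 1) = h" "id3 div (Nb + 1) div (L + 1) = t"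
 using div_mod_mult_add[OF a(1), of "t * (L + 1) + h"] div_mod_mult_add[OF a(2), of t] unfolding id3_def by auto
 qed
 have F2v: "F2 id2 s k = (if k < length l1 then l1 ! k else Nb)" if "k < Lam" for k
 using that unfolding F2_def id2 Let_def h_def[symmetric] l1_def[symmetric] by simp
 have F2r: "F2 id2 s Lam = id3"
 unfolding F2_def id2 Let_def h_def[symmetric] by (simp add: id3_def i_def)
 have F3v: "F3 id3 s k = (if k < length l2 then l2 ! k else Nb)" if "k < Lam" for k
 using that unfolding F3_def id3 Let_def l2_def[symmetric] by simp
 have F3r: "F3 id3 s Lam = j'" unfolding F3_def id3 Let_def by (simp add: j'_def)
 have sN: "s < 2 ^ L" using s1 s1N by (simp add: s_def)
 have M: "extends w D (wr M0 bp ou)" by (rule extends_wr[OF pr])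
 have g: "glob sg" using pr by (simp add: pre_def)
 have idw2: "id2 < 2 ^ w"
 proof -
 have "(L + 1) * Nb <= (L + 1) * (L + 1) * (Nb + 1)" by (intro mult_le_mono) auto
 then show ?thesis by (rule less_trans[OF less_le_trans[OF id2(1)] idw])
 qed
 have tNb: "t * Nb < 2 ^ w" using idw2 by (simp add: id2_def)
 note SNb = Scal_eval[OF scal_Nb M, of sg, OF globD(1)[OF g]]
 define sg1 where "sg1 = sg(20 := id2, 21 := s)"
 have P1: "T w (pred_query 19 20 21 22 23) (%tm (sg', _). tm <= 300 * (Lam + 1) &
 sg' 28 + (Lam + 1) <= length D & (\<forall>k<Lam + 1. wr M0 bp ou ! (sg' 28 + k) = F2 id2 s k)) (sg1, wr M0 bp ou, out)"
 using T_pred[OF M, of sg1 "(L + 1) * Nb" 19 20 21 22 23 X2 F2 "Lam + 1" Lam out] globD(1)[OF g] id2(1) sN fam2 L_Lam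
 by (simp add: sg1_def)
 have s1w: "1 < (2::nat) ^ w" using word by linarith
 show ?thesis unfolding batch_com_def
 apply (rule T_seq_assign[where v = id2])
 subgoal using SNb g j idw2 tNb by (simp add: glob_def id2_def)
 subgoal using SNb g j by (simp add: glob_def id2_def)
 apply (rule T_seq_assign[where v = s])
 subgoal using g s1 s1w by (simp add: glob_def)
 subgoal using g by (simp add: glob_def s_def)
 apply (fold sg1_def)
 apply (rule T_seq_call[OF P1], simp)
 subgoal premises p1 for tm1 sg2
 proof -
 define a where "a = sg2 28"
 have a: "tm1 <= 300 * (Lam + 1)" "a + (Lam + 1) <= length D" "\<forall>k<Lam + 1. D ! (a + k) = F2 id2 s k"
 using p1(1) extends_D[OF M] unfolding a_def by auto
 have fr2: "sg2 x = sg1 x" if "x ~: {22..28}" for x by (rule p1(2)) (use that in auto)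
 define sg3 where "sg3 = sg2(52 := a)"
 have pr3: "pre sg3 ou rem" using pr fr2 by (simp add: pre_def glob_def sg3_def sg1_def)
 have PL: "T w (proclist J) (%tm s'. res (concat (map blk l1)) ou rem
 (%ou' rem'. tm <= 100 * Lam + 30 + 2 * (Cv J * (length ou' - length ou)) + Cv J * (1 + Lam)) s') (sg3, wr M0 bp ou, out)"
 by (rule T_proclist[OF _ _ l1l _ pr3, of a]) (use a F2v mem in \<open>auto simp: sg3_def\<close>)
 show ?thesis
 apply (rule T_seq_assign[where v = a], simp, simp add: a_def)
 apply (fold sg3_def)
 apply (rule T_seq_call_gen[OF PL proclist_syntax(2)])
 subgoal premises p2 for tm2 sg4 M4
 proof -
 obtain ou1 rem1 where o1: "feed bad xp (concat (map blk l1)) (ou, rem) = (ou1, rem1)"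
 "sg4 17 = rem1" "sg4 18 = bp + length ou1" "M4 = wr M0 bp ou1"
 "tm2 <= 100 * Lam + 30 + 2 * (Cv J * (length ou1 - length ou)) + Cv J * (1 + Lam)"
 using p2(1) by (auto simp: res_def)
 have fr4: "sg4 x = sg3 x" if "x \<in> {10..16} \<union> {50, 52}" for x
 by (rule p2(2), rule notI, drule subsetD[OF proclist_syntax(1)], use that in auto)
 have g4: "glob sg4" by (rule glob_frame[of sg3]) (use pr3 fr4 in \<open>auto simp: pre_def\<close>)
 have pr4: "pre sg4 ou1 rem1" using g4 o1 feed_props(1)[OF o1(1)] pr by (auto simp: pre_def)
 have M4: "extends w D M4" unfolding o1(4) by (rule extends_wr[OF pr4])
 have ax: "a + Lam < length D" "D ! (a + Lam) = id3" using a F2r by auto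
 have aw: "a + Lam < length M4" "length M4 < 2 ^ w" "M4 ! (a + Lam) = id3"
 using ax extends_length[OF M4] M4 extends_nth[OF M4 ax(1)] by (auto simp: extends_def)
 note SLam = Scal_eval[OF scal_Lam M4, of sg4, OF globD(1)[OF g4]]
 have 52: "sg4 52 = a" using fr4[of 52] by (simp add: sg3_def)
 define sg5 where "sg5 = sg4(20 := id3, 21 := s)"
 have P2: "T w (pred_query 24 25 26 27 28) (%tm (sg', _). tm <= 300 * (Lam + 1) &
 sg' 28 + (Lam + 1) <= length D & (\<forall>k<Lam + 1. M4 ! (sg' 28 + k) = F3 id3 s k)) (sg5, M4, out)"
 using T_pred[OF M4, of sg5 "(L + 1) * (L + 1) * (Nb + 1)" 24 25 26 27 28 X3 F3 "Lam + 1" Lam out]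
 globD(1)[OF g4] id3(1) sN fam3 L_Lam by (simp add: sg5_def)
 show ?thesis
 apply (rule T_seq_assign[where v = id3])
 subgoal using SLam 52 aw by simp
 subgoal using SLam 52 aw by simp
 apply (rule T_seq_assign[where v = s])
 subgoal using g4 s1 s1w by (simp add: glob_def)
 subgoal using g4 by (simp add: glob_def s_def)
 apply (fold sg5_def)
 apply (rule T_seq_call[OF P2], simp)
 subgoal premises p3 for tm3 sg6
 proof -
 define b where "b = sg6 28"
 have b: "tm3 <= 300 * (Lam + 1)" "b + (Lam + 1) <= length D" "\<forall>k<Lam + 1. D ! (b + k) = F3 id3 s k"
 using p3(1) extends_D[OF M4] unfolding b_def by auto
 have fr6: "sg6 x = sg5 x" if "x ~: {22..28}" for x by (rule p3(2)) (use that in auto)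
 define sg7 where "sg7 = sg6(52 := b)"
 have pr7: "pre sg7 ou1 rem1" using pr4 fr6 by (simp add: pre_def glob_def sg7_def sg5_def)
 have PL2: "T w (proclist J) (%tm s'. res (concat (map blk l2)) ou1 rem1
 (%ou' rem'. tm <= 100 * Lam + 30 + 2 * (Cv J * (length ou' - length ou1)) + Cv J * (1 + Lam)) s')
 (sg7, wr M0 bp ou1, out)"
 by (rule T_proclist[OF _ _ l2l _ pr7, of b]) (use b F3v mem in \<open>auto simp: sg7_def\<close>)
 show ?thesis unfolding o1(4)
 apply (rule T_seq_assign[where v = b], simp, simp add: b_def)
 apply (fold sg7_def)
 apply (rule T_seq_call_gen[OF PL2 proclist_syntax(2)])
 subgoal premises p4 for tm4 sg8 M8
 proof -
 obtain ou2 rem2 where o2: "feed bad xp (concat (map blk l2)) (ou1, rem1) = (ou2, rem2)"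
 "sg8 17 = rem2" "sg8 18 = bp + length ou2" "M8 = wr M0 bp ou2"
 "tm4 <= 100 * Lam + 30 + 2 * (Cv J * (length ou2 - length ou1)) + Cv J * (1 + Lam)"
 using p4(1) by (auto simp: res_def)
 have fr8: "sg8 x = sg7 x" if "x \<in> {10..16} \<union> {50, 52}" for x
 by (rule p4(2), rule notI, drule subsetD[OF proclist_syntax(1)], use that in auto)
 have g8: "glob sg8" by (rule glob_frame[of sg7]) (use pr7 fr8 in \<open>auto simp: pre_def\<close>)
 have pr8: "pre sg8 ou2 rem2" using g8 o2 feed_props(1)[OF o2(1)] pr7 by (auto simp: pre_def)
 have M8: "extends w D M8" unfolding o2(4) by (rule extends_wr[OF pr8])
 have bx: "b + Lam < length D" "D ! (b + Lam) = j'" using b F3r by auto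
 have bw: "b + Lam < length M8" "length M8 < 2 ^ w" "M8 ! (b + Lam) = j'"
 using bx extends_length[OF M8] M8 extends_nth[OF M8 bx(1)] by (auto simp: extends_def)
 note SLam8 = Scal_eval[OF scal_Lam M8, of sg8, OF globD(1)[OF g8]]
 have 528: "sg8 52 = b" using fr8[of 52] by (simp add: sg7_def)
 have fd: "feed bad xp (filter good [j * B..<j' * B]) (ou, rem) = (ou2, rem2)"
 unfolding blk_above[OF less_imp_le[OF jj(1)] jj(2)] cat[symmetric] map_append concat_append
 feed_append o1(1) o2(1) ..
 have ls: "length ou <= length ou1" "length ou1 <= length ou2"
 using feed_props(2)[OF o1(1)] feed_props(2)[OF o2(1)] by auto
 have prog: "j' = Nb \<or> rem2 = 0 \<or> Lam <= length ou2 - length ou"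
 proof (cases "j' = Nb \<or> rem2 = 0")
 case False
 then have "length ou2 = length ou + length (filter good [j * B..<j' * B])"
 using feed_props(4)[OF fd] by simp
 moreover have "length (ab j j') <= length (filter good [j * B..<j' * B])"
 unfolding blk_above[OF less_imp_le[OF jj(1)] jj(2)]
 by (rule length_concat_blk) (use mem[unfolded cat] in blast)
 ultimately show ?thesis using big False by linarith
 qed blast
 have cost: "tt <= Cb * (1 + (length ou2 - length ou) + Lam)"
 if "tt <= 2 * (300 * (Lam + 1)) + tm2 + tm4 + 200" for tt
 proof -
 have e: "length ou2 - length ou = (length ou1 - length ou) + (length ou2 - length ou1)" using ls by simp
 show ?thesis unfolding Cb_def e by (rule batch_cost[OF that o1(5) o2(5)])
 qed
 have okx: "ok w sg8 M8 (Mem (Bin Add (Var 52) (Scal 11)))"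
 "ev sg8 M8 (Mem (Bin Add (Var 52) (Scal 11))) = j'"
 using SLam8 528 bw by simp_all
 have R: "res (filter good [j * B..<j' * B]) ou rem (%ou' rem'. tt <= Cb * (1 + (length ou' - length ou) + Lam) &
 (j' = Nb \<or> rem' = 0 \<or> Lam <= length ou' - length ou)) (sg8(50 := j'), M8, out)"
 if "tt <= 2 * (300 * (Lam + 1)) + tm2 + tm4 + 200" for tt
 unfolding res_def fd using o2 prog cost[OF that] by simp
 show ?thesis
 unfolding T_Assign prod.case okx(2)
 proof (intro conjI exI[of _ j'])
 show "glob (sg8(50 := j'))" using g8 by simp
 qed (rule R | (use okx(1) jj a(1) b(1) in simp))+
 qed
 done
 qed
 done
 qed
 done
 qed
 done
qed

definition scond :: exp where
 "scond = Bin Mul (Bin Less (Var 50) (Scal 12)) (Bin Less (Num 0) (Var 17))"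

text \<open>For a batch that pays for itself, \<open>1 + x + lam <= 3 * x\<close>; the fourth
  multiple of \<open>C * x\<close> absorbs the additive constants. Only the last batch leaves
  \<open>C * (1 + lam)\<close>.\<close>

lemma scan_cost:
 fixes C x y lam t1 t2 :: nat
 assumes "t1 <= C * (1 + x + lam)" "lam <= x" "2 <= lam" "40 <= C" "t2 <= 4 * (C * y) + C * (1 + lam) + 40"
 shows "t1 + t2 + 30 <= 4 * (C * (x + y)) + C * (1 + lam) + 40"
proof -
 have "C * (1 + x + lam) <= C * (x + x + x)" using assms(2,3) by (intro mult_le_mono2) linarith
 moreover have "C * 1 <= C * x" using assms(2,3) by (intro mult_le_mono2) linarith
 moreover have "C * (x + x + x) = 3 * (C * x)" "C * (x + y) = C * x + C * y" by (simp_all add: algebra_simps)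
 ultimately show ?thesis using assms by linarith
qed

lemma scan_loop:
 "pre sg ou rem ==> sg 50 = j ==> p0 <= j * B ==> T w (While scond (batch_com J)) (%tm s'.
 res (filter good [j * B..<Nb * B]) ou rem (%ou' rem'. tm <= 4 * (Cb * (length ou' - length ou)) + Cb * (1 + Lam) + 40) s')
 (sg, wr M0 bp ou, out)"
proof (induction "Nb - j" arbitrary: j sg ou rem rule: less_induct)
 case less
 note pr = less.prems(1)
 have M: "extends w D (wr M0 bp ou)" by (rule extends_wr[OF pr])
 have g: "glob sg" and r17: "sg 17 = rem" using pr by (auto simp: pre_def)
 have cnd: "ok w sg' M' scond" "ev sg' M' scond ~= 0 \<longleftrightarrow> sg' 50 < Nb & 0 < sg' 17" "ecost scond + 1 <= 20"
 if "extends w D M'" "glob sg'" for sg' M'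
 using Scal_eval[OF scal_Nb that(1), of sg', OF globD(1)[OF that(2)]] word by (auto simp: scond_def)
 note c0 = cnd[OF M g]
 show ?case
 proof (cases "j < Nb & 0 < rem")
 case False
 have "filter good [j * B..<Nb * B] = [] \<or> rem = 0"
 proof (cases "rem = 0")
 case rp: False
 then have "Nb * B <= j * B" using False by (intro mult_le_mono1) simp
 then show ?thesis by simp
 qed simp
 then have "res (filter good [j * B..<Nb * B]) ou rem (%ou' rem'. ecost scond + 1 <= 4 * (Cb * (length ou' - length ou)) + Cb * (1 + Lam) + 40)
 (sg, wr M0 bp ou, out)" using pr c0(3) by (auto simp: res_def pre_def)
 then show ?thesis using c0 False less.prems(2) r17 by (subst T_While_unfold) simp
 next
 case True
 then have j: "j < Nb" and rem: "0 < rem" by auto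
 have "T w (batch_com J) (%t1. T w (While scond (batch_com J)) (%t2 s'. res (filter good [j * B..<Nb * B]) ou rem
 (%ou' rem'. ecost scond + 1 + t1 + 1 + t2 <= 4 * (Cb * (length ou' - length ou)) + Cb * (1 + Lam) + 40) s')) (sg, wr M0 bp ou, out)"
 proof (rule T_call_gen[OF T_batch[OF pr less.prems(2) j less.prems(3) rem] batch_syntax(2)])
 fix t1 sg1 M1
 assume "case (sg1, M1, out) of (sg', M', out') => EX j'. sg' 50 = j' & j < j' & j' <= Nb & glob sg' &
 res (filter good [j * B..<j' * B]) ou rem (%ou' rem'. t1 <= Cb * (1 + (length ou' - length ou) + Lam) &
 (j' = Nb \<or> rem' = 0 \<or> Lam <= length ou' - length ou)) (sg', M', out')"
 then obtain j' ou1 rem1 where b: "sg1 50 = j'" "j < j'" "j' <= Nb" "glob sg1"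
 "feed bad xp (filter good [j * B..<j' * B]) (ou, rem) = (ou1, rem1)"
 "sg1 17 = rem1" "sg1 18 = bp + length ou1" "M1 = wr M0 bp ou1"
 "t1 <= Cb * (1 + (length ou1 - length ou) + Lam)" "j' = Nb \<or> rem1 = 0 \<or> Lam <= length ou1 - length ou"
 by (auto simp: res_def)
 note fp = feed_props[OF b(5)]
 have pr1: "pre sg1 ou1 rem1" using pr b fp(1) by (auto simp: pre_def)
 have M1: "extends w D M1" unfolding b(8) by (rule extends_wr[OF pr1])
 have jB: "j * B <= j' * B" "j' * B <= Nb * B" using b(2,3) by (auto intro!: mult_le_mono1)
 have split: "filter good [j * B..<Nb * B] = filter good [j * B..<j' * B] @ filter good [j' * B..<Nb * B]"
 by (rule filter_good_split[OF jB])
 show "T w (While scond (batch_com J)) (%t2 s'. res (filter good [j * B..<Nb * B]) ou rem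
 (%ou' rem'. ecost scond + 1 + t1 + 1 + t2 <= 4 * (Cb * (length ou' - length ou)) + Cb * (1 + Lam) + 40) s') (sg1, M1, out)"
 proof (cases "j' = Nb \<or> rem1 = 0")
 case True
 have "filter good [j' * B..<Nb * B] = [] \<or> rem1 = 0" using True by auto
 then have fd: "feed bad xp (filter good [j * B..<Nb * B]) (ou, rem) = (ou1, rem1)"
 unfolding split feed_append b(5) by auto
 define x where "x = length ou1 - length ou"
 have "Cb * (1 + x + Lam) = Cb * x + Cb * (1 + Lam)" by (simp add: algebra_simps)
 moreover have "ecost scond = 10" by (simp add: scond_def)
 ultimately have "ecost scond + 1 + t1 + 1 + (ecost scond + 1) <= 4 * (Cb * x) + Cb * (1 + Lam) + 40"
 using b(9) unfolding x_def[symmetric] by linarith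
 then have "res (filter good [j * B..<Nb * B]) ou rem
 (%ou' rem'. ecost scond + 1 + t1 + 1 + (ecost scond + 1) <= 4 * (Cb * (length ou' - length ou)) + Cb * (1 + Lam) + 40) (sg1, M1, out)"
 unfolding res_def fd using b by (simp add: x_def)
 moreover have "ok w sg1 M1 scond" "ev sg1 M1 scond = 0" using cnd[OF M1 b(4)] True b(1,6) by auto
 ultimately show ?thesis by (subst T_While_unfold) simp
 next
 case False
 have "Nb - j' < Nb - j" using b(2,3) by linarith
 have "p0 <= j' * B" using less.prems(3) jB by linarith
 from less.hyps[OF \<open>Nb - j' < Nb - j\<close> pr1 b(1) this]
 show ?thesis unfolding b(8)
 proof (rule T_mono, goal_cases)
 case (1 t2 s')
 then obtain ou2 rem2 where o2: "feed bad xp (filter good [j' * B..<Nb * B]) (ou1, rem1) = (ou2, rem2)"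
 "fst s' 17 = rem2" "fst s' 18 = bp + length ou2" "fst (snd s') = wr M0 bp ou2"
 "t2 <= 4 * (Cb * (length ou2 - length ou1)) + Cb * (1 + Lam) + 40" by (auto simp: res_def)
 have fd: "feed bad xp (filter good [j * B..<Nb * B]) (ou, rem) = (ou2, rem2)"
 unfolding split feed_append b(5) o2(1) ..
 have e: "length ou2 - length ou = (length ou1 - length ou) + (length ou2 - length ou1)"
 using fp(2) feed_props(2)[OF o2(1)] by simp
 have "40 <= Cb" by (simp add: Cb_def)
 have "Lam <= length ou1 - length ou" using b(10) False by blast
 from scan_cost[OF b(9) this Lam2 \<open>40 <= Cb\<close> o2(5)]
 have "ecost scond + 1 + t1 + 1 + t2 <= 4 * (Cb * (length ou2 - length ou)) + Cb * (1 + Lam) + 40"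
 unfolding e using c0(3) by linarith
 then show ?case unfolding res_def fd using o2 by blast
 qed
 qed
 qed
 then show ?thesis using c0 True less.prems(2) r17 by (subst T_While_unfold) simp
 qed
qed

definition Cs :: nat where "Cs = 8 * Cb + 400 * (I + 1) + 2000"

lemma T_scan:
 assumes pr: "pre sg [] K" and K: "0 < K" and p0: "p0 <= N"
 shows "T w (scan J) (%tm s'. res (filter good [p0..<Nb * B]) [] K (%ou' rem'. tm <= Cs * (1 + length ou' + Lam)) s')
 (sg, wr M0 bp [], out)"
proof -
 define j where "j = p0 div B"
 have M: "extends w D (wr M0 bp [])" by (rule extends_wr[OF pr])
 have g: "glob sg" using pr by (simp add: pre_def)
 have jB: "j * B <= p0" "p0 < (j + 1) * B"
 using div_mult_mod_eq[of p0 B] mod_less_divisor[OF B_pos, of p0] unfolding j_def add_mult_distrib mult_1 by linarith+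
 have low: "filter good [j * B..<p0] = []" by (auto simp: filter_empty_conv good_def)
 have p0w: "p0 <= Nb * B" using p0 Nb(1) by linarith
 have fl: "filter good [p0..<Nb * B] = filter good [j * B..<Nb * B]"
 using filter_good_split[OF jB(1) p0w] low by simp
 note SB = Scal_eval[OF scal_B M, of sg, OF globD(1)[OF g]]
 define sg1 where "sg1 = sg(50 := j)"
 have g1: "glob sg1" "pre sg1 [] K" using g pr by (auto simp: sg1_def pre_def)
 note SNb = Scal_eval[OF scal_Nb M, of sg1, OF globD(1)[OF g1(1)]]
 define fst_blk where "fst_blk = (if j < Nb then filter good [j * B..<(j + 1) * B] else [])"
 have fl2: "filter good [j * B..<Nb * B] = fst_blk @ filter good [(j + 1) * B..<Nb * B]"
 proof (cases "j < Nb")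
 case True
 then have "(j + 1) * B <= Nb * B" by (intro mult_le_mono1) simp
 then show ?thesis using True filter_good_split[of "j * B" "(j + 1) * B" "Nb * B"] by (simp add: fst_blk_def)
 next
 case False
 then have "Nb * B <= j * B" by (intro mult_le_mono1) simp
 moreover have "j * B <= (j + 1) * B" by simp
 ultimately have "[j * B..<Nb * B] = []" "[(j + 1) * B..<Nb * B] = []" by (auto simp del: mult_Suc)
 then show ?thesis using False by (simp only: fst_blk_def if_False filter.simps append_Nil)
 qed
 define FC where "FC = If (Bin Less (Var 50) (Scal 12))
 (Seq (Assign (bank J) (Var 50))
 (Seq (getval J (bank J) 55)
 (If (Bin Less (Var 55) (Var 13)) (Assign 55 (Num 0)) (visit J))))
 (Assign 55 (Num 0))"
 have FCs: "silent FC" "mods FC \<subseteq> {17, 18} \<union> {30..37} \<union> {55} \<union> {100..<bank (Suc J)}"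
 using visit_syntax[of J] getval_syntax[of J "bank J" 55] by (auto simp: FC_def pure_imp_silent)
 have First: "T w FC (%tm s'. res fst_blk [] K (%ou' rem'. tm <= 400 * (I + 1) + 100 + Cv J * (1 + length ou' + 2 * Lam)) s') (sg1, wr M0 bp [], out)"
 proof (cases "j < Nb")
 case False
 then show ?thesis using SNb g1 unfolding FC_def by (simp add: sg1_def fst_blk_def res_def pre_def)
 next
 case True
 define sg2 where "sg2 = sg1(bank J := j)"
 have g2: "glob sg2" "pre sg2 [] K" using g1 by (auto simp: sg2_def pre_def)
 have gv: "T w (getval J (bank J) 55) (%tm (sg', _). tm <= 400 * (I + 1) + 40 & sg' 55 = mx t J (sg2 (bank J))) (sg2, wr M0 bp [], out)"
 by (rule T_getval[OF M g2(1)]) (use True in \<open>auto simp: sg2_def str_def\<close>)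
 have "T w (Seq (Assign (bank J) (Var 50)) (Seq (getval J (bank J) 55)
 (If (Bin Less (Var 55) (Var 13)) (Assign 55 (Num 0)) (visit J))))
 (%tm s'. res fst_blk [] K (%ou' rem'. tm <= 400 * (I + 1) + 80 + Cv J * (1 + length ou' + 2 * Lam)) s') (sg1, wr M0 bp [], out)"
 apply (rule T_seq_assign[where v = j], simp, simp add: sg1_def)
 apply (fold sg2_def)
 apply (rule T_seq_call[OF gv getval_syntax(2)])
 subgoal premises prems for tm sg3
 proof -
 have fr: "sg3 x = sg2 x" if "x ~: {30..36} \<union> {55}" for x
 by (rule prems(2), rule notI, drule subsetD[OF getval_syntax(1)], use that in auto)
 have pr3: "pre sg3 [] K"
 using g2 fr by (auto simp: pre_def glob_def)
 have v3: "sg3 13 = s1" "sg3 55 = mx t J j" "sg3 (bank J) = j" "tm <= 400 * (I + 1) + 40"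
 using prems(1) pr3 fr[of "bank J"] by (auto simp: pre_def glob_def sg2_def)
 show ?thesis
 proof (cases "s1 <= mx t J j")
 case False
 have "fst_blk = []" using no_good[of j "j + 1" J] False True by (simp add: fst_blk_def less_Suc_eq)
 then show ?thesis using v3 False pr3 by (simp add: res_def pre_def)
 next
 case m: True
 have "p0 div B <= j" by (simp add: j_def)
 then have V: "T w (visit J) (%tm s'. outcome tm (Cv J) (j * B) ((j + 1) * B) [] K s') (sg3, wr M0 bp [], out)"
 using vspec[OF order_refl, unfolded vspec_def, rule_format, OF pr3 K v3(3)] True m by (simp add: str_def)
 have "T w (visit J) (%t2 s'. res fst_blk [] K (%ou' rem'. t2 <= Cv J * (1 + length ou' + 2 * Lam)) s') (sg3, wr M0 bp [], out)"
 proof (rule T_mono[OF V], goal_cases)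
 case (1 t2 s')
 then obtain ou1 rem1 where o1: "feed bad xp fst_blk ([], K) = (ou1, rem1)"
 "fst s' 17 = rem1" "fst s' 18 = bp + length ou1" "fst (snd s') = wr M0 bp ou1"
 "t2 <= Cv J * (1 + ((length ou1 - 0) + (if j * B < p0 then Lam else 0)) + (if rem1 = 0 then Lam else 0))"
 using True by (auto simp: outcome_def fst_blk_def)
 note o1(5)
 also have "Cv J * (1 + ((length ou1 - 0) + (if j * B < p0 then Lam else 0)) + (if rem1 = 0 then Lam else 0))
 <= Cv J * (1 + length ou1 + 2 * Lam)" by (rule mult_le_mono2) simp
 finally show ?case unfolding res_def using o1 by blast
 qed
 then show ?thesis using v3 m by (auto simp: res_def elim!: T_mono)
 qed
 qed
 done
 then show ?thesis unfolding FC_def using SNb True g1 by (auto simp: sg1_def res_def elim!: T_mono)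
 qed
 show ?thesis unfolding scan_def FC_def[symmetric] scond_def[symmetric]
 apply (rule T_seq_assign[where v = j])
 subgoal using SB by simp
 subgoal using SB g by (simp add: j_def glob_def)
 apply (fold sg1_def)
 apply (rule T_seq_call_gen[OF First FCs(1)])
 subgoal premises prems for tm1 sg4 M4
 proof -
 obtain ou1 rem1 where o1: "feed bad xp fst_blk ([], K) = (ou1, rem1)"
 "sg4 17 = rem1" "sg4 18 = bp + length ou1" "M4 = wr M0 bp ou1"
 "tm1 <= 400 * (I + 1) + 100 + Cv J * (1 + length ou1 + 2 * Lam)" using prems(1) by (auto simp: res_def)
 have fr: "sg4 x = sg1 x" if "x \<in> {10..16} \<union> {50}" for x
 by (rule prems(2), rule notI, drule subsetD[OF FCs(2)], use that in auto)
 have g4: "glob sg4" by (rule glob_frame[OF g1(1)]) (use fr in auto)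
 have 50: "sg4 50 = j" using fr[of 50] by (simp add: sg1_def)
 define sg5 where "sg5 = sg4(50 := j + 1)"
 have pr5: "pre sg5 ou1 rem1" using g4 o1 feed_props(1)[OF o1(1)] pr by (auto simp: pre_def sg5_def)
 have "j <= p0" by (simp add: j_def)
 then have jw: "j + 1 < 2 ^ w" using p0 word by linarith
 have w1: "1 < (2::nat) ^ w" using word by linarith
 have L5: "T w (While scond (batch_com J)) (%tm s'. res (filter good [(j + 1) * B..<Nb * B]) ou1 rem1
 (%ou' rem'. tm <= 4 * (Cb * (length ou' - length ou1)) + Cb * (1 + Lam) + 40) s') (sg5, wr M0 bp ou1, out)"
 by (rule scan_loop[OF pr5]) (use jB in \<open>auto simp: sg5_def\<close>)
 show ?thesis unfolding o1(4)
 apply (rule T_seq_assign[where v = "j + 1"])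
 subgoal using 50 jw w1 by simp
 subgoal using 50 by simp
 apply (fold sg5_def)
 apply (rule T_mono[OF L5])
 subgoal premises pp for t2 s'
 proof -
 obtain ou2 rem2 where o2: "feed bad xp (filter good [(j + 1) * B..<Nb * B]) (ou1, rem1) = (ou2, rem2)"
 "fst s' 17 = rem2" "fst s' 18 = bp + length ou2" "fst (snd s') = wr M0 bp ou2"
 "t2 <= 4 * (Cb * (length ou2 - length ou1)) + Cb * (1 + Lam) + 40" using pp by (auto simp: res_def)
 have fd: "feed bad xp (filter good [p0..<Nb * B]) ([], K) = (ou2, rem2)"
 unfolding fl fl2 feed_append o1(1) o2(1) ..
 define U where "U = 1 + length ou2 + Lam"
 have l12: "length ou1 <= length ou2" using feed_props(2)[OF o2(1)] .
 have "Cv J * (1 + length ou1 + 2 * Lam) <= Cb * (2 * U)"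
 by (rule mult_le_mono) (use l12 in \<open>auto simp: Cb_def U_def\<close>)
 moreover have "Cb * (length ou2 - length ou1) <= Cb * U" "Cb * (1 + Lam) <= Cb * U"
 by (rule mult_le_mono2; simp add: U_def)+
 moreover have "Cs * U = 8 * (Cb * U) + (400 * (I + 1)) * U + 2000 * U" by (simp add: Cs_def algebra_simps)
 moreover have "(400 * (I + 1)) * 1 <= (400 * (I + 1)) * U" by (rule mult_le_mono2) (simp add: U_def)
 moreover have "1 <= U" by (simp add: U_def)
 ultimately have "tm1 + t2 + 100 <= Cs * U" using o1(5) o2(5) by linarith
 then show ?thesis unfolding res_def fd using o2 by (simp add: U_def)
 qed
 done
 qed
 done
qed

end

section \<open>Three-sided queries\<close>

lemma feed_takeWhile: "fst (feed bad xp zs (ou, K)) = ou @ take K (map xp (takeWhile (%p. \<not> bad p) zs))"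
proof (induction zs arbitrary: ou K)
 case (Cons z zs)
 then show ?case by (cases K) auto
qed simp

lemma takeWhile_filter_upt:
 assumes "!!p q. a <= p ==> p <= q ==> q < b ==> P q ==> P p"
 shows "takeWhile P (filter g [a..<b]) = filter (%p. g p & P p) [a..<b]"
 using assms
proof (induction "b - a" arbitrary: a)
 case 0
 then show ?case by simp
next
 case (Suc n)
 then have ab: "a < b" by simp
 have IH: "takeWhile P (filter g [Suc a..<b]) = filter (%p. g p & P p) [Suc a..<b]"
 by (rule Suc.hyps(1)) (use Suc.hyps(2) Suc.prems in auto)
 have e: "[a..<b] = a # [Suc a..<b]" using ab by (simp add: upt_conv_Cons)
 show ?case
 proof (cases "P a")
 case True
 then show ?thesis unfolding e using IH by simp
 next
 case False
 then have "\<not> P q" if "a <= q" "q < b" for q using Suc.prems[of a q] that by auto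
 then have "filter (%p. g p & P p) [a..<b] = []" by (auto simp: filter_empty_conv)
 moreover have "takeWhile P (filter g [a..<b]) = []"
 proof (cases "filter g [a..<b] = []")
 case False
 then have "hd (filter g [a..<b]) \<in> set (filter g [a..<b])" by (rule hd_in_set)
 then have "\<not> P (hd (filter g [a..<b]))" using \<open>!!q. a <= q ==> q < b ==> \<not> P q\<close> by simp
 then show ?thesis by (simp add: takeWhile_eq_Nil_iff)
 qed simp
 ultimately show ?thesis by simp
 qed
qed

definition core_com :: "nat => com" where
 "core_com J = Seq locate (scan J)"

lemma core_com_syntax:
 "mods (core_com J) \<subseteq> {14, 17, 18} \<union> {20..28} \<union> {30..37} \<union> {40..44} \<union> {50, 51, 52, 55} \<union> {100..<bank (Suc J)}"
 "silent (core_com J)" "J < 40 ==> vars_ok (core_com J)"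
 using scan_syntax[of J] by (auto simp: core_com_def pure_imp_silent)

definition core_out :: "nat => (nat => nat) => nat => nat => nat => nat => nat => nat => nat list" where
 "core_out L Y K l r s1 t v =
 take K (filter (%x. l <= x & x < r & s1 <= Y x + 1 & Y x div 2 ^ (L - t) = v) [0..<2 ^ L])"

text \<open>A specification of the three-sided search in terms of ranks only, with \<open>Y\<close>
  the map from \<open>x\<close>-ranks to \<open>y\<close>-ranks. It does not mention the tables, so
  that two structures with different permutations can be used in one program. The threshold
  \<open>s1\<close> is shifted by 1, as everywhere.\<close>

definition core_works :: "nat => nat => nat list => nat => nat => (nat => nat) => nat => nat => bool" where
 "core_works w L D J hb Y C Lam \<longleftrightarrow> (ALL sg M out t v s1 r K bp l. extends w D M --> sg 10 = hb --> sg 11 = t --> t <= L -->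
 sg 12 = v --> v < 2 ^ t --> sg 13 = s1 --> 1 <= s1 --> s1 <= 2 ^ L --> sg 15 = (v + 1) * 2 ^ (L - t) --> sg 16 = r -->
 sg 17 = K --> 0 < K --> sg 18 = bp --> sg 19 = l --> l < 2 ^ L --> length D <= bp --> bp + K <= length M -->
 T w (core_com J) (%tm (sg', M', out'). M' = wr M bp (core_out L Y K l r s1 t v) &
 sg' 18 = bp + length (core_out L Y K l r s1 t v) &
 tm <= C * (1 + length (core_out L Y K l r s1 t v) + Lam)) (sg, M, out))"

context core_run
begin

text \<open>Inside a node positions and \<open>x\<close>-ranks are ordered alike, so the points
  right of the border form a final segment and nothing is lost by ending at the first of them. The
  two lists are then equal because both are strictly increasing and have the same elements.\<close>

lemma feed_result:
 assumes v: "v < 2 ^ t" and p0: "p0 = rank t v l" and pend: "pend = (v + 1) * S t"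
 and Y: "!!y. y < N ==> Y (X y) = y"
 shows "fst (feed bad xp (filter good [p0..<Nb * B]) ([], K)) = core_out L Y K l r s1 t v"
proof -
 have pN: "pend <= N" using mult_le_mono1[of "v + 1" "2 ^ t" "S t"] v S_dvd[OF t] pend by simp
 have p0p: "p0 <= pend" using rank_le[of t v l] p0 pend by simp
 have p0v: "v * S t <= p0" using rank_ge p0 by simp
 have node: "p < N" "p div S t = v" if "p0 <= p" "p < pend" for p
 proof -
 show "p < N" using that pN by simp
 show "p div S t = v" using that p0v pend by (intro div_nat_eqI) (auto simp: mult.commute)
 qed
 define Q where "Q = (%p. X (A t p) < r)"
 have tw: "takeWhile (%p. \<not> bad p) (filter good [p0..<Nb * B]) = filter (%p. good p & Q p) [p0..<pend]"
 proof -
 have sp: "filter good [p0..<Nb * B] = filter good [p0..<pend] @ filter good [pend..<Nb * B]"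
 by (rule filter_good_split[OF p0p]) (use pN Nb(1) in linarith)
 have "takeWhile (%p. \<not> bad p) (filter good [p0..<Nb * B]) = takeWhile (%p. \<not> bad p) (filter good [p0..<pend])"
 proof (cases "filter good [pend..<Nb * B]")
 case Nil
 then show ?thesis unfolding sp by simp
 next
 case (Cons z zs)
 then have "z \<in> set (filter good [pend..<Nb * B])" by simp
 then have "bad z" by (simp add: bad_def)
 then show ?thesis unfolding sp Cons by (simp add: takeWhile_tail)
 qed
 also have "... = takeWhile Q (filter good [p0..<pend])"
 by (rule takeWhile_cong) (auto simp: bad_def Q_def)
 also have "... = filter (%p. good p & Q p) [p0..<pend]"
 proof (rule takeWhile_filter_upt)
 fix p q assume "p0 <= p" "p <= q" "q < pend" "Q q"
 then show "Q p" using X_A_less[OF t, of p q] node[of p] node[of q] by (cases "p = q") (auto simp: Q_def)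
 qed
 finally show ?thesis .
 qed
 define ps where "ps = filter (%p. good p & Q p) [p0..<pend]"
 have "sorted_wrt (<) (map xp ps)"
 proof -
 have "sorted_wrt (<) ps" unfolding ps_def by (intro sorted_wrt_filter) simp
 then have "sorted_wrt (%p q. xp p < xp q) ps"
 proof (rule sorted_wrt_mono_rel[rotated])
 fix p q assume "p \<in> set ps" "q \<in> set ps" "p < q"
 then show "xp p < xp q" using X_A_less[OF t, of p q] node[of p] node[of q] by (auto simp: ps_def xp_def)
 qed
 then show ?thesis by (simp add: sorted_wrt_map)
 qed
 then have srt: "sorted (map xp ps)" "distinct (map xp ps)" by (auto simp: strict_sorted_iff)
 define F where "F = filter (%x. l <= x & x < r & s1 <= Y x + 1 & Y x div 2 ^ (L - t) = v) [0..<N]"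
 have "set (map xp ps) = set F"
 proof (intro set_eqI iffI)
 fix x assume "x \<in> set (map xp ps)"
 then obtain p where p: "p0 <= p" "p < pend" "s1 <= val t p" "X (A t p) < r" "x = X (A t p)"
 by (auto simp: ps_def good_def Q_def xp_def)
 note nd = node[OF p(1,2)]
 have "\<not> X (A t p) < l" using less_rank_iff[OF t nd, of l] p(1) p0 by simp
 moreover have "Y x = A t p" using Y A_less[OF t nd(1)] p(5) by simp
 moreover have "A t p div S t = v" using A_div[OF t nd(1)] nd(2) by simp
 ultimately show "x \<in> set F" using p nd X_less[OF A_less[OF t nd(1)]] by (simp add: F_def val_def S_def)
 next
 fix x assume "x \<in> set F"
 then have x: "x < N" "l <= x" "x < r" "s1 <= Y x + 1" "Y x div S t = v" by (auto simp: F_def S_def)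
 obtain y where y: "y < N" "x = X y" using bij x(1) by (auto simp: bij_betw_def image_iff)
 have Yx: "Y x = y" using Y y by simp
 define p where "p = pos t y"
 have p: "p < N" "A t p = y" "p div S t = v" using pos_less[OF y(1) t] A_pos[OF t y(1)] pos_div[OF y(1), of t] x(5) Yx
 by (auto simp: p_def)
 have "p0 <= p" using less_rank_iff[OF t p(1,3), of l] p(2) y(2) x(2) p0 by simp
 moreover have "p < pend" using p(3) pend dividend_less_div_times[OF S_pos, of p t] by (simp add: add.commute)
 ultimately have "p \<in> set ps" using p x y Yx by (simp add: ps_def good_def Q_def val_def)
 then show "x \<in> set (map xp ps)" using p(2) y(2) by (auto simp: xp_def)
 qed
 moreover have "sorted F" "distinct F" by (auto simp: F_def sorted_filter[of id, simplified] intro: sorted_wrt_filter)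
 ultimately have "map xp ps = F" using srt sorted_distinct_set_unique by blast
 then show ?thesis unfolding feed_takeWhile tw ps_def[symmetric] by (simp add: core_out_def F_def)
qed

end

definition Ccore :: "nat => nat => nat" where
 "Ccore I J = 1000 * (I + 1) * (J + 2) + core_run.Cs I J"

lemma (in core_full) core_works:
 assumes Y: "!!y. y < N ==> Y (X y) = y"
 shows "core_works w L D J hb Y (Ccore I J) Lam"
 unfolding core_works_def
proof (intro allI impI)
 fix sg :: "reg => nat" and M out t v s1 r K bp l
 assume a: "extends w D M" "sg 10 = hb" "sg 11 = t" "t <= L" "sg 12 = v" "v < 2 ^ t" "sg 13 = s1" "1 <= s1" "s1 <= 2 ^ L"
 "sg 15 = (v + 1) * 2 ^ (L - t)" "sg 16 = r" "sg 17 = K" "0 < K" "sg 18 = bp" "sg 19 = l" "l < 2 ^ L" "length D <= bp" "bp + K <= length M"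
 define p0 where "p0 = rank t v l"
 define pend where "pend = (v + 1) * S t"
 interpret core_run L X w hb D I FL BL fld bas par d J Nb Lam enc trow t s1 p0 pend r bp M
 by unfold_locales (use a in auto)
 define ou where "ou = core_out L Y K l r s1 t v"
 have p0N: "p0 <= N"
 proof -
 have "(v + 1) * S t <= 2 ^ t * S t" using a(6) by (intro mult_le_mono1) simp
 then show ?thesis using rank_le[of t v l] S_dvd[OF a(4)] by (simp add: p0_def)
 qed
 have loc: "T w locate (%tm (sg', _). tm <= 500 * (I + 1) * (J + 2) * (Lam + 2) & sg' 14 = p0) (sg, M, out)"
 unfolding p0_def by (rule T_locate) (use a in \<open>auto simp: S_def\<close>)
 have wr0: "wr M bp [] = M" by (simp add: wr_def)
 show "T w (core_com J) (%tm (sg', M', out'). M' = wr M bp (core_out L Y K l r s1 t v) &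
 sg' 18 = bp + length (core_out L Y K l r s1 t v) &
 tm <= Ccore I J * (1 + length (core_out L Y K l r s1 t v) + Lam)) (sg, M, out)"
 unfolding core_com_def ou_def[symmetric]
 apply (rule T_seq_call[OF loc], simp)
 subgoal premises prems for tm1 sg1
 proof -
 have fr: "sg1 x = sg x" if "x \<in> {10, 11, 13, 15, 16, 17, 18}" for x by (rule prems(2)) (use that in auto)
 have v1: "sg1 10 = hb" "sg1 11 = t" "sg1 13 = s1" "sg1 15 = pend" "sg1 16 = r" "sg1 17 = K" "sg1 18 = bp" "sg1 14 = p0"
 using fr[of 10] fr[of 11] fr[of 13] fr[of 15] fr[of 16] fr[of 17] fr[of 18] a(2,3,7,10,11,12,14) prems(1)
 by (simp_all add: pend_def S_def)
 have pr: "pre sg1 [] K" unfolding pre_def glob_def using v1 a(18) by simp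
 show ?thesis
 proof (rule T_mono[OF T_scan[OF pr a(13) p0N, unfolded wr0]], goal_cases)
 case (1 t2 s')
 then obtain ou' rem' where o: "feed bad xp (filter good [p0..<Nb * B]) ([], K) = (ou', rem')"
 "fst s' 18 = bp + length ou'" "fst (snd s') = wr M bp ou'" "t2 <= Cs * (1 + length ou' + Lam)"
 by (auto simp: res_def)
 have ou: "ou' = ou" using feed_result[OF a(6) p0_def pend_def Y, of K] o(1) by (simp add: ou_def)
 define U where "U = 1 + length ou + Lam"
 have "500 * (I + 1) * (J + 2) * (Lam + 2) <= 500 * (I + 1) * (J + 2) * (2 * U)"
 by (rule mult_le_mono2) (simp add: U_def)
 also have "... = 1000 * (I + 1) * (J + 2) * U" by (simp add: algebra_simps)
 finally have "tm1 <= 1000 * (I + 1) * (J + 2) * U" using prems(1) by simp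
 then have "tm1 + t2 <= Ccore I J * U"
 using o(4) unfolding ou Ccore_def add_mult_distrib U_def[symmetric] by linarith
 then show ?case using o ou by (cases s') (simp add: U_def)
 qed
 qed
 done
qed

section \<open>Four-sided queries\<close>

fun mrg :: "nat list => nat list => nat list" where
 "mrg [] ys = ys"
| "mrg xs [] = xs"
| "mrg (x # xs) (y # ys) = (if x < y then x # mrg xs (y # ys) else y # mrg (x # xs) ys)"

lemma mrg_Nil2 [simp]: "mrg xs [] = xs"
 by (cases xs) auto

lemma mrg_filter:
 assumes "!!x. \<not> (P x & Q x)" "sorted_wrt (<) zs"
 shows "mrg (filter P zs) (filter Q zs) = filter (%x. P x \<or> Q x) zs"
 using assms(2)
proof (induction zs)
 case (Cons z zs)
 have IH: "mrg (filter P zs) (filter Q zs) = filter (%x. P x \<or> Q x) zs" using Cons by simp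
 have gt: "!!y. y \<in> set zs ==> z < y" using Cons.prems by auto
 have *: "mrg (z # filter P zs) ys = z # mrg (filter P zs) ys" if "\<forall>y\<in>set ys. z < y" for ys
 using that by (cases ys) auto
 have **: "mrg xs (z # filter Q zs) = z # mrg xs (filter Q zs)" if "\<forall>y\<in>set xs. z < y" for xs
 using that by (cases xs) auto
 show ?case using IH assms(1)[of z] gt * ** by auto
qed simp

text \<open>The first \<open>k\<close> elements of a merged list are among the first
  \<open>k\<close> of the two lists, so each three-sided search may be cut off at the number of
  wanted points.\<close>

lemma take_mrg: "k <= a ==> k <= b ==> take k (mrg (take a xs) (take b ys)) = take k (mrg xs ys)"
proof (induction k arbitrary: a b xs ys)
 case (Suc k)
 obtain a' b' where ab: "a = Suc a'" "b = Suc b'" using Suc.prems by (metis Suc_le_D)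
 show ?case
 proof (cases xs)
 case Nil
 then show ?thesis using Suc.prems by (simp add: min_def)
 next
 case X: (Cons x xs')
 show ?thesis
 proof (cases ys)
 case Nil
 then show ?thesis using Suc.prems by (simp add: min_def)
 next
 case Y: (Cons y ys')
 have 1: "take k (mrg (take a' xs') (take b ys)) = take k (mrg xs' ys)"
 by (rule Suc.IH) (use Suc.prems ab in auto)
 have 2: "take k (mrg (take a xs) (take b' ys')) = take k (mrg xs ys')"
 by (rule Suc.IH) (use Suc.prems ab in auto)
 show ?thesis using 1 2 unfolding X Y ab by simp
 qed
 qed
qed simp

definition htest :: com where
 "htest = Assign 68 (Bin Equal (Bin Div (Var 62) (Arr 9 (Var 67))) (Bin Div (Var 63) (Arr 9 (Var 67))))"

definition left_com :: "nat => com" where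
 "left_com J = Seq (Assign 11 (Bin Sub (Scal 8) (Var 65)))
 (Seq (Assign 12 (Bin Sub (Bin Div (Var 63) (Arr 9 (Var 65))) (Num 1)))
 (Seq (Assign 13 (Bin Add (Var 62) (Num 1)))
 (Seq (Assign 15 (Var 69))
 (Seq (Assign 16 (Var 61))
 (Seq (Assign 17 (Var 64))
 (Seq (Assign 18 (Scal 6))
 (Seq (Assign 19 (Var 60))
 (Seq (Assign 10 (Num 100))
 (Seq (core_com J)
 (Seq (Assign 10 (Num 0))
 (Write (Var 18) (Scal 1))))))))))))"

text \<open>Level, right border and left border are still in registers 11, 16 and 19 after the
  search on the other side. Node, threshold and end of the node are those of the reversed
  order.\<close>

definition right_com :: "nat => com" where
 "right_com J = Seq (Assign 12 (Bin Sub (Bin Div (Bin Sub (Scal 1) (Var 69)) (Arr 9 (Var 65))) (Num 1)))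
 (Seq (Assign 13 (Bin Add (Bin Sub (Scal 1) (Var 63)) (Num 1)))
 (Seq (Assign 15 (Bin Sub (Scal 1) (Var 69)))
 (Seq (Assign 17 (Var 64))
 (Seq (Assign 18 (Scal 7))
 (Seq (Assign 10 (Num 200))
 (Seq (core_com J)
 (Seq (Assign 10 (Num 0))
 (Write (Var 18) (Scal 1)))))))))"

definition mcond :: exp where "mcond = Bin Less (Num 0) (Var 64)"

definition mbody :: com where
 "mbody = Seq (Assign 72 (Mem (Var 70))) (Seq (Assign 73 (Mem (Var 71)))
 (Seq (If (Bin Less (Var 72) (Var 73))
 (Seq (Assign 74 (Var 72)) (Assign 70 (Bin Add (Var 70) (Num 1))))
 (Seq (Assign 74 (Var 73)) (Assign 71 (Bin Add (Var 71) (Num 1)))))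
 (If (Bin Less (Var 74) (Scal 1))
 (Seq (Emit (Arr 4 (Var 74))) (Seq (Emit (Arr 5 (Var 74))) (Assign 64 (Bin Sub (Var 64) (Num 1)))))
 (Assign 64 (Num 0)))))"

definition merge_com :: com where
 "merge_com = Seq (Assign 70 (Scal 6)) (Seq (Assign 71 (Scal 7)) (While mcond mbody))"

definition work :: "nat => com" where
 "work J = Seq (Assign 65 (Num 0)) (Seq (Assign 66 (Scal 8)) (Seq (bisect 65 66 67 68 htest)
 (Seq (Assign 65 (Bin Sub (Var 65) (Num 1)))
 (Seq (Assign 69 (Bin Mul (Bin Div (Var 63) (Arr 9 (Var 65))) (Arr 9 (Var 65))))
 (Seq (left_com J) (Seq (right_com J) merge_com))))))"

definition clampl :: "reg => nat => reg => com" where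
 "clampl x k y = If (Bin Less (Var x) (Bin Add (Scal 0) (Num 1))) (Assign y (Arr k (Var x)))
 (Assign y (Arr k (Bin Add (Scal 0) (Num 1))))"

text \<open>Query coordinates are arbitrary words and are clamped to the index range of the tables.
  The closed upper end becomes an exclusive bound, hence the additional 1.\<close>

definition clampr :: "reg => nat => reg => com" where
 "clampr x k y = If (Bin Less (Var x) (Scal 0)) (Assign y (Arr k (Bin Add (Var x) (Num 1))))
 (Assign y (Arr k (Bin Add (Scal 0) (Num 1))))"

definition main_com :: "nat => com" where
 "main_com J = Seq (Assign 10 (Num 0)) (Seq (clampl 0 2 60) (Seq (clampr 1 2 61) (Seq (clampl 2 3 62) (Seq (clampr 3 3 63)
 (Seq (If (Bin Less (Var 4) (Scal 1)) (Assign 64 (Var 4)) (Assign 64 (Scal 1)))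
 (If (Bin Mul (Bin Mul (Bin Less (Var 60) (Var 61)) (Bin Less (Var 62) (Var 63))) (Bin Less (Num 0) (Var 64)))
 (work J) (Assign 10 (Num 0))))))))"

lemma main_vars_ok: "J < 40 ==> vars_ok (main_com J)"
 using core_com_syntax(3)[of J]
 by (simp add: main_com_def clampl_def clampr_def work_def htest_def left_com_def right_com_def merge_com_def mcond_def mbody_def)

text \<open>\<open>CX\<close> and \<open>CY\<close> translate coordinates to ranks,
  \<open>PX\<close> and \<open>PY\<close> translate an \<open>x\<close>-rank back to the two
  coordinates. Cells 6 and 7 hold the addresses of two buffers behind \<open>D\<close>, each with
  room for \<open>2 ^ L\<close> ranks and a sentinel.\<close>

locale query_mem =
 fixes w L n J C Lam :: nat and D :: "nat list" and Y CX CY PX PY :: "nat => nat"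
 assumes sc0: "scal D 0 0 n" and sc1: "scal D 0 1 (2 ^ L)" and tab2: "tab D 0 2 (n + 2) CX" and tab3: "tab D 0 3 (n + 2) CY"
 and tab4: "tab D 0 4 n PX" and tab5: "tab D 0 5 n PY" and sc6: "scal D 0 6 (length D)"
 and sc7: "scal D 0 7 (length D + 2 ^ L + 1)" and sc8: "scal D 0 8 L" and tab9: "tab D 0 9 (L + 1) (%i. 2 ^ i)"
 and nL: "n < 2 ^ L" and CX: "!!v. CX v <= n" and CY: "!!v. CY v <= n"
 and core1: "core_works w L D J 100 Y C Lam" and core2: "core_works w L D J 200 (%x. 2 ^ L - 1 - Y x) C Lam"
 and Y: "!!x. x < 2 ^ L ==> Y x < 2 ^ L" and word: "1000 + 8 * 2 ^ L < (2::nat) ^ w" and LLam: "L + 1 < 2 ^ Lam"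
begin

abbreviation "N \<equiv> (2::nat) ^ L"

text \<open>Both lists end with the sentinel \<open>N\<close>, which is larger than every rank in
  them, so the comparison needs no separate test for an exhausted list; when the sentinel is the
  smaller head, both are exhausted and the counter is cleared.\<close>

lemma merge_loop:
 "extends w D M ==> sg 10 = 0 ==> sg 64 = K ==> sg 70 = p ==> sg 71 = q ==>
 p + length xs < length M ==> q + length ys < length M ==>
 (\<forall>i<length xs. M ! (p + i) = xs ! i) ==> M ! (p + length xs) = N ==>
 (\<forall>i<length ys. M ! (q + i) = ys ! i) ==> M ! (q + length ys) = N ==>
 \<forall>x\<in>set xs \<union> set ys. x < n ==>
 T w (While mcond mbody) (%tm (sg', M', out'). M' = M &
 out' = out @ concat (map (%x. [PX x, PY x]) (take K (mrg xs ys))) &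
 tm <= 100 * (1 + length (take K (mrg xs ys)))) (sg, M, out)"
proof (induction K arbitrary: sg p q xs ys out rule: less_induct)
 case (less K)
 note P = less.prems
 have c: "ok w sg M mcond" "ev sg M mcond ~= 0 \<longleftrightarrow> 0 < K" "ecost mcond = 3" using P(3) word by (auto simp: mcond_def)
 show ?case
 proof (cases "K = 0")
 case True
 then show ?thesis using c by (subst T_While_unfold) simp
 next
 case False
 have Mw: "length M < 2 ^ w" using P(1) by (simp add: extends_def)
 define a b where "a = (if xs = [] then N else hd xs)" and "b = (if ys = [] then N else hd ys)"
 have Ma: "M ! p = a" using P(8)[rule_format, of 0] P(9) by (cases xs) (auto simp: a_def)
 have Mb: "M ! q = b" using P(10)[rule_format, of 0] P(11) by (cases ys) (auto simp: b_def)
 have an: "xs ~= [] ==> a < n" "ys ~= [] ==> b < n" using P(12) by (auto simp: a_def b_def)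
 have w1: "1 < (2::nat) ^ w" using word by linarith
 have pw: "p + 1 < 2 ^ w" "q + 1 < 2 ^ w" if True using P(6,7) Mw by linarith+
 define x where "x = (if a < b then a else b)"
 define xs' ys' where "xs' = (if a < b then tl xs else xs)" and "ys' = (if a < b then ys else tl ys)"
 define p' q' where "p' = (if a < b then p + 1 else p)" and "q' = (if a < b then q else q + 1)"
 note S1 = Scal_eval[OF sc1 P(1)]
 define sg1 where "sg1 = sg(72 := a, 73 := b, 74 := x, 70 := p', 71 := q')"
 have ifpart: "T w (If (Bin Less (Var 72) (Var 73))
 (Seq (Assign 74 (Var 72)) (Assign 70 (Bin Add (Var 70) (Num 1))))
 (Seq (Assign 74 (Var 73)) (Assign 71 (Bin Add (Var 71) (Num 1)))))
 (%tm s. tm <= 20 & s = (sg1, M, out)) (sg(72 := a, 73 := b), M, out)"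
 using P(4,5) pw w1 by (auto simp: sg1_def x_def p'_def q'_def fun_eq_iff)
 have rest: "T w (If (Bin Less (Var 74) (Scal 1))
 (Seq (Emit (Arr 4 (Var 74))) (Seq (Emit (Arr 5 (Var 74))) (Assign 64 (Bin Sub (Var 64) (Num 1)))))
 (Assign 64 (Num 0))) (%t1. T w (While mcond mbody) (%t2 (sg', M', out'). M' = M &
 out' = out @ concat (map (%x. [PX x, PY x]) (take K (mrg xs ys))) &
 t1 + t2 + 50 <= 100 * (1 + length (take K (mrg xs ys))))) (sg1, M, out)"
 proof (cases "xs = [] & ys = []")
 case True
 then have x: "x = N" by (simp add: x_def a_def b_def)
 have s1: "ok w sg1 M (Bin Less (Var 74) (Scal 1))" "ev sg1 M (Bin Less (Var 74) (Scal 1)) = 0"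
 using S1[of sg1] P(2) x by (auto simp: sg1_def)
 define sg2 where "sg2 = sg1(64 := 0)"
 have "T w (While mcond mbody) (%t2 s. t2 <= 10 & s = (sg2, M, out)) (sg2, M, out)"
 using word by (subst T_While_unfold) (simp add: mcond_def sg2_def)
 then show ?thesis using s1 True word by (auto simp: sg2_def elim!: T_mono)
 next
 case ne: False
 have xn: "x < n" using ne an nL by (auto simp: x_def a_def b_def split: if_splits)
 have mr: "mrg xs ys = x # mrg xs' ys'"
 proof (cases xs)
 case X: Nil
 then obtain y ys2 where Yc: "ys = y # ys2" using ne by (cases ys) auto
 then have "\<not> a < b" using X an nL by (auto simp: a_def b_def)
 then show ?thesis using X Yc by (simp add: x_def xs'_def ys'_def b_def)
 next
 case X: (Cons x1 xs2)
 show ?thesis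
 proof (cases ys)
 case Nil
 then have "a < b" using X an nL by (auto simp: a_def b_def)
 then show ?thesis using X Nil by (simp add: x_def xs'_def ys'_def a_def)
 next
 case (Cons y ys2)
 then show ?thesis using X by (simp add: x_def xs'_def ys'_def a_def b_def)
 qed
 qed
 have s1: "ok w sg1 M (Bin Less (Var 74) (Scal 1))" "ev sg1 M (Bin Less (Var 74) (Scal 1)) ~= 0"
 using S1[of sg1] P(2) xn nL by (auto simp: sg1_def)
 have A4: "ev sg1 M (Arr 4 (Var 74)) = PX x" "ok w sg1 M (Arr 4 (Var 74))"
 and A5: "ev sg1 M (Arr 5 (Var 74)) = PY x" "ok w sg1 M (Arr 5 (Var 74))"
 using Arr_eval[OF tab4 P(1), of sg1 "Var 74"] Arr_eval[OF tab5 P(1), of sg1 "Var 74"] P(2) xn by (auto simp: sg1_def)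
 define sg2 where "sg2 = sg1(64 := K - 1)"
 have IH: "T w (While mcond mbody) (%tm (sg', M', out'). M' = M &
 out' = (out @ [PX x, PY x]) @ concat (map (%x. [PX x, PY x]) (take (K - 1) (mrg xs' ys'))) &
 tm <= 100 * (1 + length (take (K - 1) (mrg xs' ys')))) (sg2, M, out @ [PX x, PY x])"
 proof (rule less.IH[of "K - 1" sg2 p' q'])
 have lt: "a < b ==> xs ~= []" "\<not> a < b ==> ys ~= []" using ne an nL by (auto simp: a_def b_def)
 have tlx: "p' + i = p + (length xs - length xs') + i" "length xs' + (length xs - length xs') = length xs"
 "xs' = drop (length xs - length xs') xs" for i
 using lt by (auto simp: xs'_def p'_def drop_Suc[symmetric] Suc_leI)
 (metis One_nat_def Suc_leI diff_diff_cancel drop_0 drop_Suc length_greater_0_conv)+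
 have tly: "q' + i = q + (length ys - length ys') + i" "length ys' + (length ys - length ys') = length ys"
 "ys' = drop (length ys - length ys') ys" for i
 using lt by (auto simp: ys'_def q'_def drop_Suc[symmetric] Suc_leI)
 (metis One_nat_def Suc_leI diff_diff_cancel drop_0 drop_Suc length_greater_0_conv)+
 show "p' + length xs' < length M" using tlx(1)[of "length xs'"] tlx(2) P(6) by linarith
 show "q' + length ys' < length M" using tly(1)[of "length ys'"] tly(2) P(7) by linarith
 have px: "p' + length xs' = p + length xs" using tlx(1)[of "length xs'"] tlx(2) by linarith
 show "M ! (p' + length xs') = N" unfolding px by (rule P(9))
 have qx: "q' + length ys' = q + length ys" using tly(1)[of "length ys'"] tly(2) by linarith
 show "M ! (q' + length ys') = N" unfolding qx by (rule P(11))
 show "\<forall>i<length xs'. M ! (p' + i) = xs' ! i"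
 proof (intro allI impI)
 fix i assume i: "i < length xs'"
 show "M ! (p' + i) = xs' ! i"
 proof (cases "a < b")
 case True
 then show ?thesis using P(8)[rule_format, of "Suc i"] i lt(1) by (cases xs) (auto simp: xs'_def p'_def)
 next
 case False
 then show ?thesis using P(8) i by (simp add: xs'_def p'_def)
 qed
 qed
 show "\<forall>i<length ys'. M ! (q' + i) = ys' ! i"
 proof (intro allI impI)
 fix i assume i: "i < length ys'"
 show "M ! (q' + i) = ys' ! i"
 proof (cases "a < b")
 case False
 then show ?thesis using P(10)[rule_format, of "Suc i"] i lt(2) by (cases ys) (auto simp: ys'_def q'_def)
 next
 case True
 then show ?thesis using P(10) i by (simp add: ys'_def q'_def)
 qed
 qed
 show "\<forall>x\<in>set xs' \<union> set ys'. x < n"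
 using P(12) by (auto simp: xs'_def ys'_def dest: list.set_sel(2)[rotated] in_set_dropD[of _ 1, unfolded drop_Suc drop_0, simplified]
 split: if_splits) (metis list.sel(2) list.set_sel(2) UnI1 UnI2)+
 qed (use P False in \<open>auto simp: sg2_def sg1_def\<close>)
 have tk: "take K (mrg xs ys) = x # take (K - 1) (mrg xs' ys')" using False mr by (cases K) auto
 have K1: "sg1 64 = K" using P(3) by (simp add: sg1_def)
 show ?thesis
 using s1 A4 A5 K1 False w1 unfolding tk T_If T_Seq T_Emit
 by simp (rule T_mono[OF IH[unfolded sg2_def One_nat_def]], auto)
 qed
 have "T w mbody (%t1. T w (While mcond mbody) (%t2 (sg', M', out'). M' = M &
 out' = out @ concat (map (%x. [PX x, PY x]) (take K (mrg xs ys))) &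
 ecost mcond + 1 + t1 + 1 + t2 <= 100 * (1 + length (take K (mrg xs ys))))) (sg, M, out)"
 apply (subst mbody_def)
 apply (rule T_seq_assign[where v = a])
 subgoal using P(4,6) by simp
 subgoal using P(4) Ma by simp
 apply (rule T_seq_assign[where v = b])
 subgoal using P(5,7) by simp
 subgoal using P(5) Mb by simp
 unfolding T_Seq[of w "If _ _ _"]
 apply (rule T_mono[OF ifpart], elim conjE, hypsubst)
 apply (rule T_mono[OF rest])
 apply (erule T_mono)
 using c(3) by auto
 then show ?thesis using c False by (subst T_While_unfold) simp
 qed
qed

end

section \<open>Memory layout\<close>

lemma div_eq_iff_between: "0 < m ==> (y div m = c) \<longleftrightarrow> c * m <= y & y < (c + 1) * (m::nat)"
 using less_eq_div_iff_mult_less_eq[of m c y] div_less_iff_less_mult[of m y "c + 1"] by auto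

text \<open>Tables are appended one at a time, and the directory cell that names a table receives
  the length of the memory before the table is appended. The tables already present keep their
  addresses.\<close>

lemma layout:
 fixes tbs :: "(nat \<times> nat \<times> (nat => nat)) list"
 assumes "distinct (map fst tbs)" "\<forall>x\<in>set tbs. fst x < H"
 shows "EX D. length D = H + (\<Sum>x\<leftarrow>tbs. fst (snd x)) & (\<forall>a<H. a ~: fst ` set tbs --> D ! a = v a) &
 (\<forall>(a, n, f)\<in>set tbs. H <= D ! a & D ! a + n <= length D & (\<forall>i<n. D ! (D ! a + i) = f i)) &
 (ALL B. (\<forall>a<H. v a < B) --> length D < B --> (\<forall>(a, n, f)\<in>set tbs. \<forall>i<n. f i < B) --> set D \<subseteq> {..<B})"
 using assms
proof (induction tbs)
 case Nil
 show ?case by (rule exI[of _ "map v [0..<H]"]) auto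
next
 case (Cons x xs)
 obtain a n f where x: "x = (a, n, f)" by (cases x) auto
 have pr: "distinct (map fst xs)" "\<forall>x\<in>set xs. fst x < H" using Cons.prems by simp_all
 obtain D where D: "length D = H + (\<Sum>x\<leftarrow>xs. fst (snd x))" "\<forall>a<H. a ~: fst ` set xs --> D ! a = v a"
 and D3: "\<forall>(a, n, f)\<in>set xs. H <= D ! a & D ! a + n <= length D & (\<forall>i<n. D ! (D ! a + i) = f i)"
 and D4: "ALL B. (\<forall>a<H. v a < B) --> length D < B --> (\<forall>(a, n, f)\<in>set xs. \<forall>i<n. f i < B) --> set D \<subseteq> {..<B}"
 using Cons.IH[OF pr] by (elim exE conjE)
 have a: "a < H" "a ~: fst ` set xs" using Cons.prems x by auto
 have aD: "a < length D" using a D(1) by simp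
 define E where "E = D[a := length D] @ map f [0..<n]"
 have E: "E ! b = D ! b" if "b < length D" "b ~= a" for b using that by (simp add: E_def nth_append)
 have Ea: "E ! a = length D" using aD by (simp add: E_def nth_append)
 show ?case
 proof (intro exI[of _ E] conjI)
 show "length E = H + (\<Sum>x\<leftarrow>x # xs. fst (snd x))" using D(1) x by (simp add: E_def)
 show "\<forall>b<H. b ~: fst ` set (x # xs) --> E ! b = v b" using D(1,2) E x by auto
 show "\<forall>(b, m, g)\<in>set (x # xs). H <= E ! b & E ! b + m <= length E & (\<forall>i<m. E ! (E ! b + i) = g i)"
 proof (intro ballI, clarify)
 fix b m g assume b: "(b, m, g) \<in> set (x # xs)"
 show "H <= E ! b & E ! b + m <= length E & (\<forall>i<m. E ! (E ! b + i) = g i)"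
 proof (cases "(b, m, g) \<in> set xs")
 case True
 then have ba: "b ~= a" "b < H" using a Cons.prems(2) by force+
 have d: "H <= D ! b" "D ! b + m <= length D" "!!i. i < m ==> D ! (D ! b + i) = g i" using bspec[OF D3 True] by auto
 have e: "E ! b = D ! b" by (rule E) (use ba D(1) in auto)
 have "E ! (D ! b + i) = D ! (D ! b + i)" if "i < m" for i by (rule E) (use that d a in auto)
 then show ?thesis using d unfolding e by (simp add: E_def)
 next
 case False
 then have "b = a" "m = n" "g = f" using b x by auto
 then show ?thesis using Ea D(1) by (simp add: E_def nth_append)
 qed
 qed
 show "ALL B. (\<forall>a<H. v a < B) --> length E < B --> (\<forall>(a, n, f)\<in>set (x # xs). \<forall>i<n. f i < B) --> set E \<subseteq> {..<B}"
 proof (intro allI impI)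
 fix B assume h: "\<forall>a<H. v a < B" "length E < B" "\<forall>(a, n, f)\<in>set (x # xs). \<forall>i<n. f i < B"
 have "set D \<subseteq> {..<B}"
 proof (rule D4[rule_format])
 show "v a < B" if "a < H" for a using h(1) that by simp
 show "length D < B" using h(2) by (simp add: E_def)
 show "case y of (a, n, f) => \<forall>i<n. f i < B" if "y \<in> set xs" for y using h(3) that by simp
 qed
 then show "set E \<subseteq> {..<B}" using h x set_update_subset_insert[of D a "length D"] by (auto simp: E_def)
 qed
 qed
qed

definition holds :: "nat list => nat => (nat \<times> nat) list => (nat \<times> nat \<times> (nat => nat)) list => bool" where
 "holds D hb scs tbs \<longleftrightarrow> (\<forall>(a, v)\<in>set scs. scal D hb a v) & (\<forall>(a, n, f)\<in>set tbs. tab D hb a n f)"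

lemma holds_append [simp]: "holds D hb (s1 @ s2) (t1 @ t2) \<longleftrightarrow> holds D hb s1 t1 & holds D hb s2 t2"
 unfolding holds_def set_append ball_Un by blast

lemma holdsD: "holds D hb scs tbs ==> (a, v) \<in> set scs ==> scal D hb a v"
 "holds D hb scs tbs ==> (a, n, f) \<in> set tbs ==> tab D hb a n f"
 by (auto simp: holds_def)

section \<open>Sizes of the predecessor families and decision tables\<close>

lemma sum_card_fibres:
 assumes "finite W" "!!k. k < m ==> finite (Z k)" "!!k z. k < m ==> z \<in> Z k ==> (k, z) \<in> g ` W"
 shows "(\<Sum>k<(m::nat). card (Z k)) <= card W"
proof -
 have "(\<Sum>k<m. card (Z k)) = card (SIGMA k:{..<m}. Z k)" using assms(2) by (subst card_SigmaI) auto
 also have "... <= card (g ` W)" by (rule card_mono) (use assms in auto)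
 also have "... <= card W" by (rule card_image_le) fact
 finally show ?thesis .
qed

context core_tables
begin

lemma level_props:
 assumes "k ~= 0" "k < 2 * 2 ^ L"
 shows "level k <= L" "2 ^ level k <= k" "k - 2 ^ level k < 2 ^ level k"
proof -
 have "k < 2 ^ Suc L" using assms by simp
 then show "level k <= L" unfolding level_def by (rule Least_le)
 have l: "k < 2 ^ Suc (level k)" unfolding level_def by (rule LeastI[of _ L]) fact
 show g: "2 ^ level k <= k"
 proof (cases "level k")
 case (Suc m)
 then have "\<not> k < 2 ^ Suc m" using not_less_Least[of m "%t. k < 2 ^ Suc t"] by (simp add: level_def)
 then show ?thesis using Suc by simp
 qed (use assms in simp)
 show "k - 2 ^ level k < 2 ^ level k" using l g by simp
qed

lemma fam1_facts:
 assumes k: "k < 2 * 2 ^ L"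
 shows "X1 k \<subseteq> {..<2 ^ L}" "F1 k q i <= 2 ^ L" "finite (X1 k)"
proof -
 show X: "X1 k \<subseteq> {..<2 ^ L}" using level_props[OF _ k] X_less A_less by (auto simp: X1_def smp_def)
 then show "finite (X1 k)" by (rule finite_subset) simp
 show "F1 k q i <= 2 ^ L"
 proof (cases "k = 0")
 case False
 note l = level_props[OF False k]
 define t v where "t = level k" and "v = k - 2 ^ level k"
 have "start t v q <= rank t v q" by (rule start_props) (use l in \<open>auto simp: t_def v_def\<close>)
 also have "... <= (v + 1) * S t" using rank_le[of t v q] by simp
 also have "... <= 2 ^ t * S t" using l by (intro mult_le_mono1) (simp add: t_def v_def)
 also have "... = N" using S_dvd[of t] l by (simp add: t_def)
 finally show ?thesis using False by (simp add: F1_def t_def v_def)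
 qed (simp add: F1_def)
qed

text \<open>There are at most \<open>Nb\<close> multiples of \<open>B\<close> below
  \<open>N\<close>, and each lies in one node per level.\<close>

lemma fam1_card: "(\<Sum>k<2 * 2 ^ L. card (X1 k)) <= (L + 1) * Nb"
proof -
 define W where "W = {..L} \<times> {..<Nb}"
 have "(\<Sum>k<2 * 2 ^ L. card (X1 k)) <= (\<Sum>k<2 * 2 ^ L. card (if k = 0 then {} else smp (level k) (k - 2 ^ level k)))"
 proof (rule sum_mono)
 fix k show "card (X1 k) <= card (if k = 0 then {} else smp (level k) (k - 2 ^ level k))"
 unfolding X1_def by (auto intro!: card_image_le simp: smp_def)
 qed
 also have "... <= card W"
 proof (rule sum_card_fibres[where g = "%(t, j). (2 ^ t + (j * B) div S t, j * B)"])
 show "finite W" by (simp add: W_def)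
 show "finite (if k = 0 then {} else smp (level k) (k - 2 ^ level k))" for k by (auto simp: smp_def)
 fix k z assume k: "k < 2 * 2 ^ L" and z: "z \<in> (if k = 0 then {} else smp (level k) (k - 2 ^ level k))"
 have k0: "k ~= 0" using z by (cases "k = 0") simp_all
 note l = level_props[OF k0 k]
 have zz: "z < N" "z div S (level k) = k - 2 ^ level k" "B dvd z" using z k0 by (auto simp: smp_def)
 then obtain j where j: "z = j * B" by (auto simp: dvd_def mult.commute)
 have "j * B < Nb * B" using zz(1) Nb(1) j by linarith
 then have jN: "j < Nb" by simp
 show "(k, z) \<in> (%(t, j). (2 ^ t + (j * B) div S t, j * B)) ` W"
 by (rule image_eqI[of _ _ "(level k, j)"]) (use l zz j jN in \<open>auto simp: W_def\<close>)
 qed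
 also have "... = (L + 1) * Nb" by (simp add: W_def card_cartesian_product)
 finally show ?thesis .
qed

lemma div_level: "k < (L + 1) * Nb ==> k div Nb <= L"
 using less_mult_imp_div_less[of k "L + 1" Nb] by auto

lemma fam2_facts:
 assumes k: "k < (L + 1) * Nb"
 shows "X2 k \<subseteq> {..<2 ^ L}" "F2 k q i <= (L + 1) * (L + 1) * (Nb + 1)" "finite (X2 k)" "card (X2 k) <= (L + 1) * Lam"
proof -
 define t j where "t = k div Nb" and "j = k mod Nb"
 have tj: "t <= L" "j < Nb" using div_level[OF k] Nb(2) by (auto simp: t_def j_def)
 interpret blocks L Nb Lam "tmx t" by (rule blocks[OF tj(1)])
 have X2: "X2 k = breaks j" by (simp add: X2_def t_def j_def)
 show "X2 k \<subseteq> {..<2 ^ L}" "finite (X2 k)" "card (X2 k) <= (L + 1) * Lam" using breaks_props[of j] by (auto simp: X2)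
 define h where "h = hs j q - 1"
 have h: "h <= L" using hs_props(1)[of j q] by (simp add: h_def)
 have big: "Nb + 1 <= (L + 1) * (L + 1) * (Nb + 1)" by simp
 have el: "above q j (wend j h) ! i <= Nb" if "i < length (above q j (wend j h))"
 using nth_mem[OF that] by (auto simp: above_def wend_def)
 have "t * (L + 1) + h + 1 <= (L + 1) * (L + 1)" using tj(1) h mult_le_mono1[of t L "L + 1"] by simp
 then have "(t * (L + 1) + h + 1) * (Nb + 1) <= (L + 1) * (L + 1) * (Nb + 1)" by (rule mult_le_mono1)
 moreover have "j div 2 ^ h + 1 <= Nb + 1" using tj(2) div_le_dividend[of j "2 ^ h"] by linarith
 moreover have "u + 1 * (Nb + 1) <= V ==> x <= Nb + 1 ==> u + x <= V" for u V x :: nat by simp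
 ultimately have "(t * (L + 1) + h) * (Nb + 1) + (j div 2 ^ h + 1) <= (L + 1) * (L + 1) * (Nb + 1)"
 unfolding add_mult_distrib[of "t * (L + 1) + h" 1] by blast
 moreover have "i < length (above q j (wend j h)) ==> above q j (wend j h) ! i <= (L + 1) * (L + 1) * (Nb + 1)"
 using el big by linarith
 moreover have "Nb <= (L + 1) * (L + 1) * (Nb + 1)" using big by linarith
 ultimately show "F2 k q i <= (L + 1) * (L + 1) * (Nb + 1)"
 unfolding F2_def Let_def t_def[symmetric] j_def[symmetric] h_def[symmetric] by (simp del: mult_Suc mult_Suc_right add_mult_distrib)
qed

lemma fam3_facts:
 assumes k: "k < (L + 1) * (L + 1) * (Nb + 1)"
 shows "X3 k \<subseteq> {..<2 ^ L}" "F3 k q i <= Nb" "finite (X3 k)"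
proof -
 define i' h t where "i' = k mod (Nb + 1)" and "h = k div (Nb + 1) mod (L + 1)" and "t = k div (Nb + 1) div (L + 1)"
 have "k div (Nb + 1) < (L + 1) * (L + 1)" using k by (simp add: less_mult_imp_div_less)
 then have "t < L + 1" unfolding t_def by (rule less_mult_imp_div_less)
 then have t: "t <= L" by simp
 interpret blocks L Nb Lam "tmx t" by (rule blocks[OF t])
 show X: "X3 k \<subseteq> {..<2 ^ L}"
 unfolding X3_def Let_def t_def[symmetric] i'_def[symmetric] h_def[symmetric] using tm_less by auto
 then show "finite (X3 k)" by (rule finite_subset) simp
 have el: "rlist h i' q ! m < Nb" if "m < length (rlist h i' q)" for m
 using nth_mem[OF that] by (auto simp: rlist_def above_def)
 have "rnext h i' q <= Nb" using el[of "Lam - 1"] Lam2 by (auto simp: rnext_def Suc_le_eq)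
 moreover have "i < length (take Lam (rlist h i' q)) ==> take Lam (rlist h i' q) ! i <= Nb" using el[of i] by simp
 ultimately show "F3 k q i <= Nb"
 unfolding F3_def Let_def t_def[symmetric] i'_def[symmetric] h_def[symmetric] by simp
qed

text \<open>Dyadic intervals of one height are disjoint, so a block is counted once for each pair of
  a level and a height.\<close>

lemma fam3_card: "(\<Sum>k<(L + 1) * (L + 1) * (Nb + 1). card (X3 k)) <= (L + 1) * (L + 1) * Nb"
proof -
 define Z where "Z = (%k. let i = k mod (Nb + 1); h = k div (Nb + 1) mod (L + 1) in {min Nb (i * 2 ^ h)..<min Nb ((i + 1) * 2 ^ h)})"
 have "(\<Sum>k<(L + 1) * (L + 1) * (Nb + 1). card (X3 k)) <= (\<Sum>k<(L + 1) * (L + 1) * (Nb + 1). card (Z k))"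
 by (rule sum_mono) (simp add: X3_def Z_def Let_def card_image_le[OF finite_atLeastLessThan, simplified])
 also have "... <= card ({..<(L + 1) * (L + 1)} \<times> {..<Nb})"
 proof (rule sum_card_fibres[where g = "%(u, j). (u * (Nb + 1) + j div 2 ^ (u mod (L + 1)), j)"])
 fix k z assume k: "k < (L + 1) * (L + 1) * (Nb + 1)" and z: "z \<in> Z k"
 define i u where "i = k mod (Nb + 1)" and "u = k div (Nb + 1)"
 have zz: "i * 2 ^ (u mod (L + 1)) <= z" "z < (i + 1) * 2 ^ (u mod (L + 1))" "z < Nb"
 using z by (auto simp: Z_def Let_def i_def u_def)
 have "z div 2 ^ (u mod (L + 1)) = i" using zz by (subst div_eq_iff_between) auto
 moreover have "u * (Nb + 1) + i = k" unfolding u_def i_def by (rule div_mult_mod_eq)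
 moreover have "u < (L + 1) * (L + 1)" unfolding u_def using k by (rule less_mult_imp_div_less)
 ultimately show "(k, z) \<in> (%(u, j). (u * (Nb + 1) + j div 2 ^ (u mod (L + 1)), j)) ` ({..<(L + 1) * (L + 1)} \<times> {..<Nb})"
 using zz(3) by (intro image_eqI[of _ _ "(u, z)"]) auto
 qed (auto simp: Z_def Let_def)
 also have "... = (L + 1) * (L + 1) * Nb" by (simp add: card_cartesian_product)
 finally show ?thesis .
qed

end

lemma ex_trow:
 assumes inj: "inj_on enc {xs :: nat list. set xs \<subseteq> {..<d} & length xs = d}"
 shows "EX trow. (ALL k. trow k <= d) & (ALL xs i. set xs \<subseteq> {..<d} --> length xs = d --> i < d -->
 trow (enc xs * (d + (d + 1) * (d + 1)) + i) = xs ! i) &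
 (ALL xs c q. set xs \<subseteq> {..<d} --> length xs = d --> c <= d --> q <= d -->
 trow (enc xs * (d + (d + 1) * (d + 1)) + d + c * (d + 1) + q) = next_child d xs c q)"
proof -
 define W where "W = d + (d + 1) * (d + 1)"
 define dc where "dc = inv_into {xs :: nat list. set xs \<subseteq> {..<d} & length xs = d} enc"
 define trow where "trow = (%k. min d (if k mod W < d then dc (k div W) ! (k mod W)
 else next_child d (dc (k div W)) ((k mod W - d) div (d + 1)) ((k mod W - d) mod (d + 1))))"
 have dc: "dc (enc xs) = xs" if "set xs \<subseteq> {..<d}" "length xs = d" for xs
 unfolding dc_def using that by (intro inv_into_f_f[OF inj]) auto
 show ?thesis unfolding W_def[symmetric]
 proof (intro exI[of _ trow] conjI allI impI)
 show "trow k <= d" for k by (simp add: trow_def)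
 fix xs :: "nat list" and i assume xs: "set xs \<subseteq> {..<d}" "length xs = d" and i: "i < d"
 have iW: "i < W" using i by (simp add: W_def)
 have "xs ! i \<in> {..<d}" by (rule subsetD[OF xs(1)]) (use xs i in simp)
 then show "trow (enc xs * W + i) = xs ! i"
 using div_mod_mult_add[OF iW, of "enc xs"] i dc[OF xs] by (simp add: trow_def)
 next
 fix xs :: "nat list" and c q assume xs: "set xs \<subseteq> {..<d}" "length xs = d" and cq: "c <= d" "q <= d"
 have q1: "q < d + 1" using cq by simp
 define j where "j = c * (d + 1) + q"
 have "c * (d + 1) <= d * (d + 1)" using cq by (intro mult_le_mono1)
 then have jW: "d + j < W" using q1 unfolding j_def W_def by (simp add: algebra_simps)
 have e: "enc xs * W + d + c * (d + 1) + q = enc xs * W + (d + j)" by (simp add: j_def)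
 have "j div (d + 1) = c" "j mod (d + 1) = q" unfolding j_def using div_mod_mult_add[OF q1, of c] by auto
 then show "trow (enc xs * W + d + c * (d + 1) + q) = next_child d xs c q"
 unfolding e using div_mod_mult_add[OF jW, of "enc xs"] dc[OF xs] next_child(2)[OF cq(2) xs(1), of c] by (simp add: trow_def)
 qed
qed

text \<open>\<open>m\<close> is the size of the children of the lowest common ancestor of
  \<open>s\<close> and \<open>e\<close>, \<open>P\<close> the number of nodes of this size and
  \<open>q\<close> the child containing \<open>e\<close>. Different quotients with equal halves are
  consecutive, so \<open>s\<close> lies in node \<open>q - 1\<close>. There the upper bound holds
  automatically; in node \<open>q\<close> the lower bound does, and the reversal
  \<open>y -> P * m - 1 - y\<close> turns the upper bound \<open>e\<close> into the threshold
  \<open>P * m - e\<close> in node \<open>P - q - 1\<close>.\<close>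

lemma split_point:
 fixes s e m P :: nat
 assumes m: "0 < m" and se: "s < e" "e < P * m" and hi: "s div m div 2 = e div m div 2" and lo: "s div m ~= e div m"
 defines "q \<equiv> e div m"
 shows "1 <= q" "q < P" "s < q * m" "q * m <= e" "(P * m - q * m) div m = P - q"
 "(P - q - 1 + 1) * m = P * m - q * m" "q * m <= P * m"
 "(s + 1 <= y + 1 & y div m = q - 1) \<longleftrightarrow> s <= y & y < q * m"
 "y < P * m ==> (P * m - e + 1 <= (P * m - 1 - y) + 1 & (P * m - 1 - y) div m = P - q - 1) \<longleftrightarrow> q * m <= y & y < e"
proof -
 have "s div m <= q" unfolding q_def using se by (intro div_le_mono) simp
 moreover have "(a::nat) <= b ==> a div 2 = b div 2 ==> a ~= b ==> a + 1 = b" for a b by presburger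
 ultimately have a: "s div m + 1 = q" using hi lo unfolding q_def by blast
 then have s: "(q - 1) * m <= s" "s < q * m" using div_eq_iff_between[OF m, of s "q - 1"] by auto
 show "1 <= q" using a by simp
 show qP: "q < P" unfolding q_def using se(2) by (simp add: less_mult_imp_div_less)
 show "s < q * m" by fact
 have e: "q * m <= e" "e < (q + 1) * m" using div_eq_iff_between[OF m, of e q] q_def by auto
 then show "q * m <= e" by simp
 obtain c where P: "P = q + 1 + c" using qP less_iff_Suc_add by auto
 show "(P * m - q * m) div m = P - q" using m by (simp flip: diff_mult_distrib)
 show "(P - q - 1 + 1) * m = P * m - q * m" unfolding P by (simp add: algebra_simps)
 show "q * m <= P * m" using qP by simp
 have "(q - 1 + 1) * m = q * m" using a by simp
 then show "(s + 1 <= y + 1 & y div m = q - 1) \<longleftrightarrow> s <= y & y < q * m"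
 using div_eq_iff_between[OF m, of y "q - 1"] s by auto
 assume y: "y < P * m"
 have E: "P * m = q * m + m + c * m" "(P - q - 1) * m = c * m" "(P - q - 1 + 1) * m = c * m + m" "(q + 1) * m = q * m + m"
 unfolding P by (auto simp: algebra_simps)
 show "(P * m - e + 1 <= (P * m - 1 - y) + 1 & (P * m - 1 - y) div m = P - q - 1) \<longleftrightarrow> q * m <= y & y < e"
 unfolding div_eq_iff_between[OF m] E(2,3) using y e se(2) E(1,4) by linarith
qed

section \<open>The complete four-sided query\<close>

context query_mem
begin

lemma T_core_buf:
 assumes cw: "core_works w L D J hb Y' C Lam" and a: "extends w D M" "sg 10 = hb" "sg 11 = t" "t <= L" "sg 12 = v" "v < 2 ^ t"
 "sg 13 = s1" "1 <= s1" "s1 <= 2 ^ L" "sg 15 = (v + 1) * 2 ^ (L - t)" "sg 16 = r" "sg 17 = K" "0 < K" "sg 18 = bp"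
 "sg 19 = l" "l < 2 ^ L" "length D <= bp" "bp + K < length M"
 defines "ou \<equiv> core_out L Y' K l r s1 t v"
 shows "T w (Seq (core_com J) (Seq (Assign 10 (Num 0)) (Write (Var 18) (Scal 1))))
 (%tm (sg', M', out'). M' = wr M bp (ou @ [N]) & out' = out & (\<forall>r\<in>{11, 16, 19} \<union> {60..69}. sg' r = sg r) & sg' 10 = 0 &
 tm <= C * (1 + length ou + Lam) + 20) (sg, M, out)"
proof -
 have c: "T w (core_com J) (%tm (sg', M', out'). M' = wr M bp ou & sg' 18 = bp + length ou & tm <= C * (1 + length ou + Lam)) (sg, M, out)"
 unfolding ou_def by (rule cw[unfolded core_works_def, rule_format]) (use a in auto)
 have lo: "length ou <= K" by (simp add: ou_def core_out_def)
 show ?thesis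
 apply (rule T_seq_call_gen[OF c core_com_syntax(2)])
 subgoal premises p for tm sg1 M1
 proof -
 have p1: "M1 = wr M bp ou" "sg1 18 = bp + length ou" "tm <= C * (1 + length ou + Lam)" using p(1) by auto
 have l: "bp + length ou < length M" using lo a(18) by linarith
 have e: "extends w D M1" unfolding p1 by (rule wr_extends) (use l a in auto)
 have fr: "sg1 r = sg r" if "r \<in> {11, 16, 19} \<union> {60..69}" for r
 by (rule p(2)) (use that core_com_syntax(1)[of J] in auto)
 note S = Scal_eval[OF sc1 e, of "sg1(10 := 0)"]
 have u: "M1[bp + length ou := N] = wr M bp (ou @ [N])" unfolding p1 by (rule wr_props(4)) (use l in auto)
 have lm: "length M1 = length M" unfolding p1 by (rule wr_props(1)) (use l in simp)
 show ?thesis using S p1(2,3) l u lm fr by simp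
 qed
 done
qed

definition buf :: "nat list => nat => nat list => bool" where
 "buf M bp ou \<longleftrightarrow> bp + length ou < length M & (\<forall>i<length ou. M ! (bp + i) = ou ! i) & M ! (bp + length ou) = N"

lemma buf_wr: "bp + length ou < length M ==> buf (wr M bp (ou @ [N])) bp ou"
 using wr_props[of bp "ou @ [N]" M] wr_props(3)[of bp "ou @ [N]" M "length ou"] by (auto simp: buf_def nth_append)

lemma buf_wr_below:
 assumes "buf M bp ou" "bp + length ou < bp'" "bp' + length z <= length M"
 shows "buf (wr M bp' z) bp ou"
proof -
 have "wr M bp' z ! i = M ! i" if "i < bp'" for i using wr_props(2)[OF assms(3) that] .
 then show ?thesis using assms wr_props(1)[OF assms(3)] by (auto simp: buf_def)
qed

abbreviation sel :: "nat => nat => nat => nat => nat list" where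
 "sel l r s e \<equiv> filter (%x. l <= x & x < r & s <= Y x & Y x < e) [0..<2 ^ L]"

definition Cw :: nat where "Cw = 2 * C + 2000"

text \<open>As \<open>n < 2 ^ L\<close>, the exclusive bound \<open>e <= n\<close> is itself a leaf
  number, so \<open>s < e\<close> have a lowest common ancestor; its height is found by binary
  search over \<open>L\<close> heights. The sides are ranges of \<open>y\<close>-ranks, and their
  outputs are disjoint and increasing in the \<open>x\<close>-rank.\<close>

lemma T_work:
 assumes M: "extends w D M" "length M = length D + 2 * (N + 1)" and 10: "sg 10 = 0"
 and v: "sg 60 = l" "sg 61 = r" "sg 62 = s" "sg 63 = e" "sg 64 = K"
 and b: "l < r" "r <= n" "s < e" "e <= n" "0 < K" "K <= N"
 shows "T w (work J) (%tm (sg', M', out'). take (length D) M' = D &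
 out' = concat (map (%x. [PX x, PY x]) (take K (sel l r s e))) &
 tm <= Cw * (1 + length (take K (sel l r s e)) + Lam)) (sg, M, [])"
proof -
 have eN: "e < N" "s < N" "l < N" using b nL by linarith+
 have w1: "1 < (2::nat) ^ w" "2 < (2::nat) ^ w" "100 < (2::nat) ^ w" "200 < (2::nat) ^ w" "8 * N < 2 ^ w" using word by linarith+
 define sg1 where "sg1 = sg(65 := 0, 66 := L)"
 note S8 = Scal_eval[OF sc8 M(1)] and A9 = Arr_eval[OF tab9 M(1)]
 have LN: "L + L < 2 ^ w" using less_exp[of L] w1 by linarith
 have bis: "T w (bisect 65 66 67 68 htest) (%t (sg', _). t <= Lam * (30 + 19) + 4 &
 0 <= sg' 65 & sg' 65 <= L & (ALL i. 0 <= i & i < sg' 65 --> \<not> (s div 2 ^ i = e div 2 ^ i)) &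
 (ALL i. sg' 65 <= i & i < L --> s div 2 ^ i = e div 2 ^ i)) (sg1, M, [])"
 proof (rule T_bisect)
 fix sg' assume fr: "!!r. r ~: insert 65 (insert 66 (insert 67 (mods htest))) ==> sg' r = sg1 r" and i: "0 <= sg' 67" "sg' 67 < L"
 have f: "sg' 10 = 0" "sg' 62 = s" "sg' 63 = e"
 using fr[of 10] fr[of 62] fr[of 63] 10 v by (simp_all add: sg1_def htest_def)
 show "T w htest (%t (sg'', _). t <= 30 & (sg'' 68 ~= 0 \<longleftrightarrow> s div 2 ^ sg' 67 = e div 2 ^ sg' 67)) (sg', M, [])"
 using A9[of sg' "Var 67"] f i w1 by (simp add: htest_def)
 next
 fix i j :: nat assume "i <= j" "s div 2 ^ i = e div 2 ^ i"
 then show "s div 2 ^ j = e div 2 ^ j" by (metis div_mult2_eq le_add_diff_inverse power_add)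
 qed (use LLam LN w1 in \<open>auto simp: sg1_def htest_def\<close>)
 show ?thesis
 unfolding work_def
 apply (rule T_seq_assign[where v = 0])
 subgoal using w1 by simp
 subgoal by simp
 apply (rule T_seq_assign[where v = L])
 subgoal using S8[of "sg(65 := 0)"] 10 by simp
 subgoal using S8[of "sg(65 := 0)"] 10 by simp
 unfolding sg1_def[symmetric]
 apply (rule T_seq_call[OF bis])
 subgoal by (simp add: htest_def)
 subgoal premises p for tb sg2
 proof -
 have fr: "sg2 r = sg r" if "r < 65" for r using p(2)[of r] that by (simp add: htest_def sg1_def)
 have h0: "sg2 65 ~= 0"
 proof
 assume "sg2 65 = 0"
 then show False using p(1) b(3) eN by (cases "L = 0") auto
 qed
 define h where "h = sg2 65 - 1"
 have h: "sg2 65 = Suc h" "h < L" using h0 p(1) by (auto simp: h_def)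
 have hh: "s div 2 ^ h ~= e div 2 ^ h" using p(1) h by auto
 have h1: "s div 2 ^ Suc h = e div 2 ^ Suc h"
 proof (cases "Suc h < L")
 case True
 then show ?thesis using p(1) h by (simp del: power_Suc)
 next
 case False
 then have "Suc h = L" using h by simp
 then show ?thesis using eN by (simp del: power_Suc)
 qed
 define m P where "m = (2::nat) ^ h" and "P = (2::nat) ^ (L - h)"
 have mP: "0 < m" "N = P * m" using h by (auto simp: m_def P_def power_add[symmetric])
 have "s div m div 2 = e div m div 2" using h1 by (simp add: m_def div_mult2_eq[symmetric] mult.commute)
 note sp = split_point[OF mP(1) b(3) eN(1)[unfolded mP(2)] this hh[folded m_def], folded mP(2)]
 define q where "q = e div m"
 note sp = sp[folded q_def]
 define mid where "mid = q * m"
 have midN: "mid <= N" "mid < 2 ^ w" using sp(7) w1 unfolding mid_def by linarith+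
 define lt rt where "lt = core_out L Y K l r (s + 1) (L - h) (q - 1)"
 and "rt = core_out L (%x. N - 1 - Y x) K l r (N - e + 1) (L - h) (P - q - 1)"
 have lt: "lt = take K (sel l r s mid)"
 unfolding lt_def core_out_def
 by (rule arg_cong[where f = "take K"], rule filter_cong[OF refl])
 (use sp(8) h in \<open>auto simp: m_def[symmetric] mid_def\<close>)
 have rt: "rt = take K (sel l r mid e)"
 unfolding rt_def core_out_def
 apply (rule arg_cong[where f = "take K"], rule filter_cong[OF refl])
 subgoal for x using sp(9)[of "Y x"] Y[of x] h by (simp add: m_def[symmetric] mid_def)
 done
 have mr: "take K (mrg lt rt) = take K (sel l r s e)"
 proof -
 have se: "s <= mid" "mid <= e" using sp(3,4) by (auto simp: mid_def)
 have "mrg (sel l r s mid) (sel l r mid e) = sel l r s e"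
 by (subst mrg_filter) (use se in \<open>auto intro!: filter_cong\<close>)
 then show ?thesis unfolding lt rt by (subst take_mrg) auto
 qed
 have len: "length lt <= K" "length rt <= K" by (simp_all add: lt rt)
 have lens: "length lt <= length (take K (sel l r s e))" "length rt <= length (take K (sel l r s e))"
 proof -
 have "length (sel l r s mid) <= length (sel l r s e)" "length (sel l r mid e) <= length (sel l r s e)"
 using sp(3,4) unfolding length_filter_conv_card
 by (auto intro!: card_mono simp: mid_def)
 then show "length lt <= length (take K (sel l r s e))" "length rt <= length (take K (sel l r s e))"
 unfolding lt rt by auto
 qed
 define bp1 bp2 where "bp1 = length D" and "bp2 = length D + N + 1"
 define M1 where "M1 = wr M bp1 (lt @ [N])"
 define M2 where "M2 = wr M1 bp2 (rt @ [N])"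
 have l1: "bp1 + length lt < length M" "bp1 + length lt < bp2" using len(1) b(6) M(2) by (auto simp: bp1_def bp2_def)
 have e1: "extends w D M1" "length M1 = length M" unfolding M1_def
 using wr_extends[OF _ M(1), of bp1 "lt @ [N]"] wr_props(1)[of bp1 "lt @ [N]" M] l1 by (auto simp: bp1_def)
 have l2: "bp2 + length rt < length M1" using len(2) b(6) M(2) e1 by (auto simp: bp2_def)
 have e2: "extends w D M2" "length M2 = length M" unfolding M2_def
 using wr_extends[OF _ e1(1), of bp2 "rt @ [N]"] wr_props(1)[of bp2 "rt @ [N]" M1] l2 e1 by (auto simp: bp2_def)
 have bf1: "buf M2 bp1 lt" unfolding M2_def M1_def
 by (rule buf_wr_below[OF buf_wr]) (use l1 l2 e1 in \<open>auto simp: M1_def\<close>)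
 have bf2: "buf M2 bp2 rt" unfolding M2_def by (rule buf_wr[OF l2])
 note S1 = Scal_eval[OF sc1 M(1)] and S6 = Scal_eval[OF sc6 M(1)] and S7' = Scal_eval[OF sc7 e1(1)]
 and S1' = Scal_eval[OF sc1 e1(1)] and A9' = Arr_eval[OF tab9 e1(1)]
 and S6'' = Scal_eval[OF sc6 e2(1)] and S7'' = Scal_eval[OF sc7 e2(1)]
 define sg3 where "sg3 = sg2(65 := h, 69 := mid)"
 have v3: "sg3 10 = 0" "sg3 60 = l" "sg3 61 = r" "sg3 62 = s" "sg3 63 = e" "sg3 64 = K" "sg3 65 = h" "sg3 69 = mid"
 using fr 10 v by (auto simp: sg3_def)
 have sw: "s + 1 < 2 ^ w" "N - e + 1 < 2 ^ w" using eN w1 by linarith+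
 have tmN: "q - 1 < 2 ^ (L - h)" "P - q - 1 < 2 ^ (L - h)" using sp(1,2) unfolding P_def by linarith+
 have hL: "L - (L - h) = h" using h by simp
 have NeN: "N - e + 1 <= N" using b(3) eN by linarith
 have left: "T w (left_com J) (%tm (sg', M', out'). M' = M1 & out' = [] & sg' 11 = L - h & sg' 16 = r & sg' 19 = l &
 (\<forall>r\<in>{60..69}. sg' r = sg3 r) & sg' 10 = 0 & tm <= C * (1 + length lt + Lam) + 120) (sg3, M, [])"
 proof -
 define sg4 where "sg4 = sg3(11 := L - h, 12 := q - 1, 13 := s + 1, 15 := mid, 16 := r, 17 := K, 18 := bp1, 19 := l, 10 := 100)"
 have q1: "q - 1 + 1 = q" using sp(1) by simp
 have v4: "sg4 10 = 100" "sg4 11 = L - h" "sg4 12 = q - 1" "sg4 13 = s + 1"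
 "sg4 15 = (q - 1 + 1) * 2 ^ (L - (L - h))" "sg4 16 = r" "sg4 17 = K" "sg4 18 = bp1" "sg4 19 = l"
 unfolding hL m_def[symmetric] q1 by (simp_all add: sg4_def mid_def)
 have l4: "length D <= bp1" "bp1 + K < length M" using b(6) M(2) by (simp_all add: bp1_def)
 have c: "T w (Seq (core_com J) (Seq (Assign 10 (Num 0)) (Write (Var 18) (Scal 1))))
 (%tm (sg', M', out'). M' = M1 & out' = [] & (\<forall>r\<in>{11, 16, 19} \<union> {60..69}. sg' r = sg4 r) & sg' 10 = 0 &
 tm <= C * (1 + length lt + Lam) + 20) (sg4, M, [])"
 unfolding M1_def lt_def
 by (rule T_core_buf[OF core1 M(1) v4(1,2) _ v4(3) tmN(1) v4(4) _ _ v4(5,6,7) b(5) v4(8,9) eN(3) l4]) (use eN in simp_all)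
 show ?thesis
 unfolding left_com_def
 apply (rule T_seq_assign[where v = "L - h"])
 subgoal using S8[of sg3] v3 h by simp
 subgoal using S8[of sg3] v3 h by simp
 apply (rule T_seq_assign[where v = "q - 1"])
 subgoal using A9[of "sg3(11 := L - h)" "Var 65"] v3 h w1 sp(1) by (simp add: m_def[symmetric] q_def)
 subgoal using A9[of "sg3(11 := L - h)" "Var 65"] v3 h by (simp add: m_def[symmetric] q_def)
 apply (rule T_seq_assign[where v = "s + 1"])
 subgoal using v3 sw w1 by simp
 subgoal using v3 by simp
 apply (rule T_seq_assign[where v = mid])
 subgoal by simp
 subgoal using v3 by simp
 apply (rule T_seq_assign[where v = r])
 subgoal by simp
 subgoal using v3 by simp
 apply (rule T_seq_assign[where v = K])
 subgoal by simp
 subgoal using v3 by simp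
 apply (rule T_seq_assign[where v = bp1])
 subgoal by (rule S6(2)) (use v3 in simp)
 subgoal unfolding bp1_def by (rule S6(1)) (use v3 in simp)
 apply (rule T_seq_assign[where v = l])
 subgoal by simp
 subgoal using v3 by simp
 apply (rule T_seq_assign[where v = 100])
 subgoal using w1 by simp
 subgoal by simp
 unfolding sg4_def[symmetric]
 apply (rule T_mono[OF c])
 by (auto simp: sg4_def)
 qed
 have right: "T w (right_com J) (%tm (sg', M', out'). M' = M2 & out' = [] &
 sg' 64 = K & sg' 10 = 0 & tm <= C * (1 + length rt + Lam) + 120) (sg5, M1, [])"
 if v5: "sg5 11 = L - h" "sg5 16 = r" "sg5 19 = l" "\<forall>r\<in>{60..69}. sg5 r = sg3 r" "sg5 10 = 0" for sg5
 proof -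
 have w5: "sg5 63 = e" "sg5 64 = K" "sg5 65 = h" "sg5 69 = mid" using v5(4) v3 by auto
 define sg6 where "sg6 = sg5(12 := P - q - 1, 13 := N - e + 1, 15 := N - mid, 17 := K, 18 := bp2, 10 := 200)"
 have v6: "sg6 10 = 200" "sg6 11 = L - h" "sg6 12 = P - q - 1" "sg6 13 = N - e + 1"
 "sg6 15 = (P - q - 1 + 1) * 2 ^ (L - (L - h))" "sg6 16 = r" "sg6 17 = K" "sg6 18 = bp2" "sg6 19 = l"
 unfolding hL m_def[symmetric] sp(6) using v5(1-3) by (simp_all add: sg6_def mid_def)
 have l6: "length D <= bp2" "bp2 + K < length M1" using b(6) M(2) e1(2) by (simp_all add: bp2_def)
 have c: "T w (Seq (core_com J) (Seq (Assign 10 (Num 0)) (Write (Var 18) (Scal 1))))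
 (%tm (sg', M', out'). M' = M2 & out' = [] & (\<forall>r\<in>{11, 16, 19} \<union> {60..69}. sg' r = sg6 r) & sg' 10 = 0 &
 tm <= C * (1 + length rt + Lam) + 20) (sg6, M1, [])"
 unfolding M2_def rt_def
 by (rule T_core_buf[OF core2 e1(1) v6(1,2) _ v6(3) tmN(2) v6(4) _ NeN v6(5,6,7) b(5) v6(8,9) eN(3) l6]) simp_all
 show ?thesis
 unfolding right_com_def
 apply (rule T_seq_assign[where v = "P - q - 1"])
 subgoal using A9'[of sg5 "Var 65"] S1'[of sg5] v5 w5 h w1 sp(2,5) midN by (simp add: m_def[symmetric] mid_def)
 subgoal using A9'[of sg5 "Var 65"] S1'[of sg5] v5 w5 h sp(5) by (simp add: m_def[symmetric] mid_def)
 apply (rule T_seq_assign[where v = "N - e + 1"])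
 subgoal using S1'[of "sg5(12 := P - q - 1)"] v5 w5 w1 sw eN by simp
 subgoal using S1'[of "sg5(12 := P - q - 1)"] v5 w5 by simp
 apply (rule T_seq_assign[where v = "N - mid"])
 subgoal using S1'[of "sg5(12 := P - q - 1, 13 := N - e + 1)"] v5 w5 midN by simp
 subgoal using S1'[of "sg5(12 := P - q - 1, 13 := N - e + 1)"] v5 w5 midN by simp
 apply (rule T_seq_assign[where v = K])
 subgoal by simp
 subgoal using w5 by simp
 apply (rule T_seq_assign[where v = bp2])
 subgoal by (rule S7'(2)) (use v5 in simp)
 subgoal unfolding bp2_def by (rule S7'(1)) (use v5 in simp)
 apply (rule T_seq_assign[where v = 200])
 subgoal using w1 by simp
 subgoal by simp
 unfolding sg6_def[symmetric]
 apply (rule T_mono[OF c])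
 using w5 by (auto simp: sg6_def)
 qed
 note B1 = bf1[unfolded buf_def, THEN conjunct1] bf1[unfolded buf_def, THEN conjunct2, THEN conjunct1]
 bf1[unfolded buf_def, THEN conjunct2, THEN conjunct2]
 and B2 = bf2[unfolded buf_def, THEN conjunct1] bf2[unfolded buf_def, THEN conjunct2, THEN conjunct1]
 bf2[unfolded buf_def, THEN conjunct2, THEN conjunct2]
 have ltn: "\<forall>x\<in>set lt \<union> set rt. x < n"
 unfolding lt rt using b(2) by (auto dest!: in_set_takeD)
 have merge: "T w merge_com (%tm (sg', M', out'). M' = M2 &
 out' = concat (map (%x. [PX x, PY x]) (take K (mrg lt rt))) &
 tm <= 100 * (1 + length (take K (mrg lt rt))) + 20) (sg7, M2, [])"
 if v7: "sg7 10 = 0" "sg7 64 = K" for sg7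
 unfolding merge_com_def
 apply (rule T_seq_assign[where v = bp1])
 subgoal by (rule S6''(2)) (use v7 in simp)
 subgoal unfolding bp1_def by (rule S6''(1)) (use v7 in simp)
 apply (rule T_seq_assign[where v = bp2])
 subgoal by (rule S7''(2)) (use v7 in simp)
 subgoal unfolding bp2_def by (rule S7''(1)) (use v7 in simp)
 apply (rule T_mono[OF merge_loop[OF e2(1) _ _ _ _ B1(1) B2(1) B1(2,3) B2(2,3) ltn]])
 using v7 by auto
 define U where "U = 1 + length (take K (sel l r s e)) + Lam"
 have CU: "C * (1 + length lt + Lam) <= C * U" "C * (1 + length rt + Lam) <= C * U"
 using lens unfolding U_def by (auto intro!: mult_le_mono2)
 have tbU: "tb <= 49 * U" using p(1) unfolding U_def by simp
 have mU: "100 * (1 + length (take K (sel l r s e))) <= 100 * U" "1 <= U" unfolding U_def by auto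
 have CwU: "Cw * U = 2 * (C * U) + 2000 * U" unfolding Cw_def by (simp add: algebra_simps)
 show ?thesis
 apply (rule T_seq_assign[where v = h])
 subgoal using h w1 by simp
 subgoal using h by simp
 apply (rule T_seq_assign[where v = mid])
 subgoal using A9[of "sg2(65 := h)" "Var 65"] fr 10 v h midN by (simp add: m_def[symmetric] mid_def q_def)
 subgoal using A9[of "sg2(65 := h)" "Var 65"] fr 10 v h by (simp add: m_def[symmetric] mid_def q_def)
 unfolding sg3_def[symmetric] U_def[symmetric] T_Seq[of w "left_com J"]
 apply (rule T_mono[OF left])
 subgoal premises pl for t1 s1
 proof -
 obtain sg5 where s1: "s1 = (sg5, M1, [])" "t1 <= C * (1 + length lt + Lam) + 120"
 and v5: "sg5 11 = L - h" "sg5 16 = r" "sg5 19 = l" "\<forall>r\<in>{60..69}. sg5 r = sg3 r" "sg5 10 = 0"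
 using pl by (cases s1) auto
 show ?thesis unfolding s1(1) T_Seq[of w "right_com J"]
 proof (rule T_mono[OF right[OF v5]], goal_cases)
 case (1 t2 s2)
 then obtain sg7 where s2: "s2 = (sg7, M2, [])" "sg7 10 = 0" "sg7 64 = K" "t2 <= C * (1 + length rt + Lam) + 120"
 by (cases s2) auto
 show ?case unfolding s2(1)
 proof (rule T_mono[OF merge[OF s2(2,3)]], goal_cases)
 case (1 t3 s3)
 then show ?case using CU tbU mU CwU e2(1) s1(2) s2(4) unfolding mr by (cases s3) (simp add: extends_def)
 qed
 qed
 qed
 done
 qed
 done
qed

lemma T_main:
 assumes M: "extends w D M" "length M = length D + 2 * (N + 1)"
 and aw: "sg 0 < 2 ^ w" "sg 1 < 2 ^ w" "sg 2 < 2 ^ w" "sg 3 < 2 ^ w" "sg 4 < 2 ^ w"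
 defines "F \<equiv> take (min (sg 4) N) (sel (CX (min (sg 0) (n + 1))) (CX (min (sg 1) n + 1)) (CY (min (sg 2) (n + 1))) (CY (min (sg 3) n + 1)))"
 shows "T w (main_com J) (%tm (sg', M', out'). take (length D) M' = D &
 out' = concat (map (%x. [PX x, PY x]) F) & tm <= (Cw + 500) * (1 + length F + Lam)) (sg, M, [])"
proof -
 have w1: "1 < (2::nat) ^ w" "n + 1 < 2 ^ w" using word nL by linarith+
 note S0 = Scal_eval[OF sc0 M(1)] and S1 = Scal_eval[OF sc1 M(1)]
 and A2 = Arr_eval[OF tab2 M(1)] and A3 = Arr_eval[OF tab3 M(1)]
 have cl: "T w (clampl x k y) (%tm s. tm <= 40 & s = (sg'(y := f (min (sg' x) (n + 1))), M, [])) (sg', M, [])"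
 if "tab D 0 k (n + 2) f" "sg' 10 = 0" for x k y f sg'
 unfolding clampl_def
 using that(2) S0[of sg'] Arr_eval[OF that(1) M(1), of sg'  "Var x"]
 Arr_eval[OF that(1) M(1), of sg'  "Bin Add (Scal 0) (Num 1)"] w1 by (auto simp: min_def)
 have cr: "T w (clampr x k y) (%tm s. tm <= 40 & s = (sg'(y := f (min (sg' x) n + 1)), M, [])) (sg', M, [])"
 if "tab D 0 k (n + 2) f" "sg' 10 = 0" for x k y f sg'
 unfolding clampr_def
 using that(2) S0[of sg'] Arr_eval[OF that(1) M(1), of sg'  "Bin Add (Var x) (Num 1)"]
 Arr_eval[OF that(1) M(1), of sg'  "Bin Add (Scal 0) (Num 1)"] w1 by (auto simp: min_def)
 define l r s e K where "l = CX (min (sg 0) (n + 1))" and "r = CX (min (sg 1) n + 1)" and "s = CY (min (sg 2) (n + 1))"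
 and "e = CY (min (sg 3) n + 1)" and "K = min (sg 4) N"
 have F: "F = take K (sel l r s e)" by (simp add: F_def l_def r_def s_def e_def K_def)
 define sg1 where "sg1 = sg(10 := 0, 60 := l, 61 := r, 62 := s, 63 := e)"
 define sg2 where "sg2 = sg1(64 := K)"
 define U where "U = 1 + length F + Lam"
 have mn: "T w (If (Bin Less (Var 4) (Scal 1)) (Assign 64 (Var 4)) (Assign 64 (Scal 1)))
 (%tm s. tm <= 40 & s = (sg2, M, [])) (sg1, M, [])"
 using S1[of sg1] by (auto simp: sg2_def sg1_def K_def min_def)
 have last: "T w (If (Bin Mul (Bin Mul (Bin Less (Var 60) (Var 61)) (Bin Less (Var 62) (Var 63))) (Bin Less (Num 0) (Var 64)))
 (work J) (Assign 10 (Num 0))) (%tm (sg', M', out'). take (length D) M' = D &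
 out' = concat (map (%x. [PX x, PY x]) F) & tm <= Cw * U + 40) (sg2, M, [])"
 proof (cases "l < r & s < e & 0 < K")
 case True
 have wk: "T w (work J) (%tm (sg', M', out'). take (length D) M' = D &
 out' = concat (map (%x. [PX x, PY x]) F) & tm <= Cw * U) (sg2, M, [])"
 unfolding U_def F by (rule T_work[OF M]) (use True CX CY in \<open>auto simp: sg2_def sg1_def K_def r_def e_def\<close>)
 show ?thesis using True w1 unfolding T_If
 by (simp add: sg2_def sg1_def) (rule T_mono[OF wk[unfolded sg2_def sg1_def]], auto)
 next
 case False
 then have "F = []" unfolding F by (auto simp: filter_empty_conv)
 then show ?thesis using False w1 M(1) by (auto simp: sg2_def sg1_def extends_def)
 qed
 have c1: "T w (clampl 0 2 60) (%tm s. tm <= 40 & s = (sg(10 := 0, 60 := l), M, [])) (sg(10 := 0), M, [])"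
 using cl[OF tab2, of "sg(10 := 0)" 0 60] by (simp add: l_def)
 have c2: "T w (clampr 1 2 61) (%tm s. tm <= 40 & s = (sg(10 := 0, 60 := l, 61 := r), M, [])) (sg(10 := 0, 60 := l), M, [])"
 using cr[OF tab2, of "sg(10 := 0, 60 := l)" 1 61] by (simp add: r_def)
 have c3: "T w (clampl 2 3 62) (%tm s. tm <= 40 & s = (sg(10 := 0, 60 := l, 61 := r, 62 := s'), M, [])) (sg(10 := 0, 60 := l, 61 := r), M, [])"
 if "s' = s" for s' using cl[OF tab3, of "sg(10 := 0, 60 := l, 61 := r)" 2 62] that by (simp add: s_def)
 note c3 = c3[OF refl]
 have c4: "T w (clampr 3 3 63) (%tm s. tm <= 40 & s = (sg1, M, [])) (sg(10 := 0, 60 := l, 61 := r, 62 := s), M, [])"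
 using cr[OF tab3, of "sg(10 := 0, 60 := l, 61 := r, 62 := s)" 3 63] by (simp add: e_def sg1_def)
 have U: "(Cw + 500) * U = Cw * U + 500 * U" "1 <= U" by (auto simp: U_def algebra_simps)
 show ?thesis
 unfolding main_com_def U_def[symmetric]
 apply (rule T_seq_assign[where v = 0])
 subgoal using w1 by simp
 subgoal by simp
 unfolding T_Seq[of w "clampl _ _ _"] T_Seq[of w "clampr _ _ _"] T_Seq[of w "If _ _ _"]
 apply (rule T_mono[OF c1], elim conjE, hypsubst)
 apply (rule T_mono[OF c2], elim conjE, hypsubst)
 apply (rule T_mono[OF c3], elim conjE, hypsubst)
 apply (rule T_mono[OF c4], elim conjE, hypsubst)
 apply (rule T_mono[OF mn], elim conjE, hypsubst)
 apply (rule T_mono[OF last])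
 using U by auto
qed

end

section \<open>All tables of one structure\<close>

text \<open>The numbers and functions from which the tables will be made, before any memory
  exists.\<close>

locale core_params = perm_tree L X for L X +
 fixes w I FL BL d J Nb Lam :: nat and fld bas par trow :: "nat => nat" and enc :: "nat list => nat"
 assumes word: "1000 + 8 * 2 ^ L < (2::nat) ^ w" and dec: "dec_fun w I FL fld BL bas par"
 and fld_word: "fld i < 2 ^ w" and par_word: "par i < 2 ^ w" and bas_le: "bas i <= 2 * 2 ^ L"
 and d: "d >= 1" "d <= 2 ^ Lam" and J: "J >= 1" "J < 30" and Lam2: "Lam >= 2"
 and Nb: "N <= Nb * d ^ J" "0 < Nb" "(Nb - 1) * d ^ J < N" and strw: "2 * (Nb * d ^ J) + 2 * d < 2 ^ w"
 and enc: "!!xs. set xs \<subseteq> {..<d} ==> length xs = d ==> enc xs < d ^ d"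
 and trow_sel: "!!xs i. set xs \<subseteq> {..<d} ==> length xs = d ==> i < d ==>
 trow (enc xs * (d + (d + 1) * (d + 1)) + i) = xs ! i"
 and trow_next: "!!xs c q. set xs \<subseteq> {..<d} ==> length xs = d ==> c <= d ==> q <= d ==>
 trow (enc xs * (d + (d + 1) * (d + 1)) + d + c * (d + 1) + q) = next_child d xs c q"
 and trow_le: "trow k <= d" and L_Lam: "L + 1 < 2 ^ Lam" and Lamw: "Lam + 2 < 2 ^ w"
 and roww: "d ^ d * (d + (d + 1) * (d + 1)) < 2 ^ w"
begin

text \<open>The row counts for hashing the three families: the number of sets plus
  \<open>L + 1\<close> trie nodes for each key.\<close>

definition R1 :: nat where "R1 = 2 * 2 ^ L + (L + 1) * ((L + 1) * Nb)"
definition R2 :: nat where "R2 = (L + 1) * Nb + (L + 1) * ((L + 1) * Nb * ((L + 1) * Lam))"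
definition R3 :: nat where "R3 = (L + 1) * (L + 1) * (Nb + 1) + (L + 1) * ((L + 1) * (L + 1) * Nb)"

definition cscs :: "(nat \<times> nat) list" where
 "cscs = [(0, L), (1, 2 ^ L), (10, d), (11, Lam), (12, Nb), (13, d ^ J)]"

definition ctbs :: "(nat \<times> nat \<times> (nat => nat)) list" where
 "ctbs = [(2, L + 1, %i. 2 ^ i), (3, 8 * (L + 1), par), (4, FL, fld), (5, BL, bas), (6, 2 ^ L, X),
 (7, d ^ d * (d + (d + 1) * (d + 1)), trow), (8, J + 1, %i. Nb * d ^ (J - i)), (9, J + 1, %i. d ^ i)]
 @ map (%i. (30 + 2 * i, (L + 1) * core.str d J Nb i,
 %k. enc (core.ord L X d (k div core.str d J Nb i) (i - 1) (k mod core.str d J Nb i)) * (d + (d + 1) * (d + 1)))) [1..<J + 1]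
 @ map (%i. (31 + 2 * i, (L + 1) * core.str d J Nb i,
 %k. core.mx L X d (k div core.str d J Nb i) i (k mod core.str d J Nb i))) [1..<J + 1]"

lemma core_tables_intro:
 assumes h: "holds D hb cscs ctbs"
 shows "core_tables L X w hb D I FL BL fld bas par d J Nb Lam enc trow"
proof -
 note s = holdsD(1)[OF h] and t = holdsD(2)[OF h]
 have mem: "memory w L hb D"
 by unfold_locales (use s[of 0] s[of 1] t[of 2] word in \<open>auto simp: cscs_def ctbs_def\<close>)
 interpret memory w L hb D by (rule mem)
 have "decoder L X w hb D I FL BL fld bas par"
 by unfold_locales (use t[of 3] t[of 4] t[of 5] dec fld_word in \<open>auto simp: ctbs_def\<close>)
 then interpret decoder L X w hb D I FL BL fld bas par .
 have "core L X w hb D I FL BL fld bas par d J Nb Lam enc trow"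
 by unfold_locales (use d J Lam2 Nb strw enc trow_sel trow_next t[of 6] t[of 7] t[of 8] t[of 9] s[of 10] in \<open>auto simp: ctbs_def cscs_def\<close>)
 then interpret core L X w hb D I FL BL fld bas par d J Nb Lam enc trow .
 show ?thesis
 proof unfold_locales
 fix i assume i: "1 <= i" "i <= J"
 show "tab D hb (30 + 2 * i) ((L + 1) * str i) (%k. enc (ord (k div str i) (i - 1) (k mod str i)) * width)"
 by (rule t) (use i in \<open>auto simp: ctbs_def image_iff intro!: bexI[of _ i]\<close>)
 show "tab D hb (31 + 2 * i) ((L + 1) * str i) (%k. mx (k div str i) i (k mod str i))"
 by (rule t) (use i in \<open>auto simp: ctbs_def image_iff intro!: bexI[of _ i]\<close>)
 qed
qed

lemma ctbs_slots: "distinct (map fst ctbs)" "x \<in> set ctbs ==> fst x \<in> {2..9} \<union> {32..<100}"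
proof -
 have "distinct (map (%i. 30 + 2 * i) [1..<J + 1])" "distinct (map (%i. 31 + 2 * i) [1..<J + 1])"
 by (auto simp: distinct_map inj_on_def)
 moreover have "30 + 2 * i ~= 31 + 2 * j" for i j :: nat by presburger
 ultimately show "distinct (map fst ctbs)" by (auto simp: ctbs_def comp_def)
 show "x \<in> set ctbs ==> fst x \<in> {2..9} \<union> {32..<100}" using J by (auto simp: ctbs_def)
qed

lemma ctbs_notin: "a ~: {2..9} \<union> {32..<100} ==> a ~: fst ` set ctbs"
 using ctbs_slots(2) by blast

text \<open>The predecessor families are defined in a locale that presupposes a memory with the
  tables of the block trees. This auxiliary memory only makes the definitions available; the
  families do not depend on it.\<close>

lemma ex_core_tables: "EX D. core_tables L X w 0 D I FL BL fld bas par d J Nb Lam enc trow"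
proof -
 define v where "v = (%a. case map_of cscs a of None => 0 | Some z => z)"
 obtain D where D: "length D = 100 + (\<Sum>x\<leftarrow>ctbs. fst (snd x))" "\<forall>a<100. a ~: fst ` set ctbs --> D ! a = v a"
 and D3: "\<forall>(a, n, f)\<in>set ctbs. 100 <= D ! a & D ! a + n <= length D & (\<forall>i<n. D ! (D ! a + i) = f i)"
 using layout[OF ctbs_slots(1), of 100 v] ctbs_slots(2) by force
 have "holds D 0 cscs ctbs"
 unfolding holds_def
 proof (intro conjI ballI; clarify)
 fix a z assume az: "(a, z) \<in> set cscs"
 have "map_of cscs a = Some z" by (rule map_of_is_SomeI[OF _ az]) (simp add: cscs_def)
 moreover have "a ~: fst ` set ctbs" by (rule ctbs_notin) (use az in \<open>auto simp: cscs_def\<close>)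
 moreover have "a < 100" using az by (auto simp: cscs_def)
 ultimately show "scal D 0 a z" using D by (simp add: scal_def v_def)
 next
 fix a n f assume t: "(a, n, f) \<in> set ctbs"
 have "a < 100" using ctbs_slots(2)[OF t] by auto
 then show "tab D 0 a n f" using bspec[OF D3 t] D(1) by (auto simp: tab_def)
 qed
 then show ?thesis by (intro exI core_tables_intro)
qed

definition famtabs :: "nat => nat => nat => (nat => nat) => (nat => nat) => (nat => nat) => (nat \<times> nat \<times> (nat => nat)) list" where
 "famtabs k R om Tf disp cf = [(k, 2 * 2 ^ L, Tf), (k + 1, R, disp), (k + 2, (2 * R + 2 * 2 ^ L) * (om + 1), cf)]"

definition famscs :: "nat => nat => nat => (nat \<times> nat) list" where
 "famscs k R om = [(k + 3, R), (k + 4, om + 1)]"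

definition fsize :: "nat => nat => nat" where
 "fsize R om = 2 * 2 ^ L + R + (2 * R + 2 * 2 ^ L) * (om + 1)"

text \<open>Lists cells and tables instead of building a memory: any memory that holds them, with
  the directory at any address \<open>hb\<close>, supports the three-sided search. This allows two
  such lists to be placed side by side.\<close>

lemma ex_pack:
 assumes Rw: "2 * (R1 + R2 + R3) * 2 ^ L + 2 * (R1 + R2 + R3) + 4 * 2 ^ L + 1 < 2 ^ w"
 shows "EX scs tbs. distinct (map fst tbs) & (\<forall>x\<in>set tbs. fst x < 100) & distinct (map fst scs) &
 (\<forall>x\<in>set scs. fst x < 100 & fst x ~: fst ` set tbs & snd x < 2 ^ w) & (\<forall>(a, n, f)\<in>set tbs. \<forall>i<n. f i < 2 ^ w) &
 (\<Sum>x\<leftarrow>tbs. fst (snd x)) <= 9 * (L + 1) + FL + BL + 2 ^ L + d ^ d * (d + (d + 1) * (d + 1)) + 2 * (J + 1) +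
 2 * (J * ((L + 1) * (Nb * d ^ (J - 1)))) + fsize R1 1 + fsize R2 (Lam + 1) + fsize R3 (Lam + 1) &
 (ALL D hb Y. holds D hb scs tbs --> (\<forall>y<N. Y (X y) = y) --> core_works w L D J hb Y (Ccore I J) Lam)"
proof -
 obtain D0 where D0: "core_tables L X w 0 D0 I FL BL fld bas par d J Nb Lam enc trow" using ex_core_tables by blast
 interpret K: core_tables L X w 0 D0 I FL BL fld bas par d J Nb Lam enc trow by (rule D0)
 define V where "V = R1 + R2 + R3"
 have w1: "8 * 2 ^ L < (2::nat) ^ w" "2 * V + 1 < 2 ^ w" using word Rw by (auto simp: V_def)
 have Rpos: "0 < R1" "0 < R2" "0 < R3" using Nb(2) by (auto simp: R1_def R2_def R3_def)
 have RV: "R1 <= V" "R2 <= V" "R3 <= V" "Nb <= V" "2 ^ L <= V" "(L + 1) * (L + 1) * (Nb + 1) <= V"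
 proof -
 show "(L + 1) * (L + 1) * (Nb + 1) <= V" "R1 <= V" "R2 <= V" "R3 <= V" "2 ^ L <= V" unfolding V_def R1_def R3_def by linarith+
 have "Nb <= R2" unfolding R2_def by simp
 then show "Nb <= V" unfolding V_def by simp
 qed
 have cw: "V + 2 * R * 2 ^ L < 2 ^ w" "2 * R * 2 ^ L + 2 * R + 4 * 2 ^ L + 1 < 2 ^ w" "2 * R < 2 ^ w" if "R <= V" for R
 proof -
 have "2 * R * 2 ^ L <= 2 * V * 2 ^ L" using that by simp
 then show "V + 2 * R * 2 ^ L < 2 ^ w" "2 * R * 2 ^ L + 2 * R + 4 * 2 ^ L + 1 < 2 ^ w" "2 * R < 2 ^ w"
 using Rw[folded V_def] that by linarith+
 qed
 have "EX Tf disp cf. pred_fun L (2 * 2 ^ L) K.X1 K.F1 1 R1 Tf disp cf & (ALL i. cf i <= V + 2 * R1 * 2 ^ L)"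
 proof (rule ex_pred_fun)
 show "K.X1 id \<subseteq> {..<2 ^ L}" if "id < 2 * 2 ^ L" for id by (rule K.fam1_facts[OF that])
 show "K.F1 id q i = K.F1 id q' i" if "\<forall>x\<in>K.X1 id. (x < q) = (x < q')" for id q q' i by (rule K.F1_agree[OF that])
 show "K.F1 id q i <= V" if "id < 2 * 2 ^ L" for id q i using K.fam1_facts(2)[OF that, of q i] RV(5) by linarith
 show "2 * 2 ^ L + (L + 1) * (\<Sum>id<2 * 2 ^ L. card (K.X1 id)) <= R1"
 unfolding R1_def using K.fam1_card by (intro add_left_mono mult_le_mono2)
 qed (use Rpos in \<open>auto simp: R1_def\<close>)
 then obtain T1 D1 c1 where P1: "pred_fun L (2 * 2 ^ L) K.X1 K.F1 1 R1 T1 D1 c1" "ALL i. c1 i <= V + 2 * R1 * 2 ^ L" by blast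
 have "EX Tf disp cf. pred_fun L ((L + 1) * Nb) K.X2 K.F2 (Lam + 1) R2 Tf disp cf & (ALL i. cf i <= V + 2 * R2 * 2 ^ L)"
 proof (rule ex_pred_fun)
 show "K.X2 id \<subseteq> {..<2 ^ L}" if "id < (L + 1) * Nb" for id by (rule K.fam2_facts[OF that])
 show "K.F2 id q i = K.F2 id q' i" if "id < (L + 1) * Nb" "\<forall>x\<in>K.X2 id. (x < q) = (x < q')" for id q q' i by (rule K.F2_agree[OF that])
 show "K.F2 id q i <= V" if "id < (L + 1) * Nb" for id q i using K.fam2_facts(2)[OF that, of q i] RV(6) by linarith
 have "(\<Sum>id<(L + 1) * Nb. card (K.X2 id)) <= (\<Sum>id<(L + 1) * Nb. (L + 1) * Lam)"
 by (rule sum_mono) (use K.fam2_facts(4) in simp)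
 then have "(\<Sum>id<(L + 1) * Nb. card (K.X2 id)) <= (L + 1) * Nb * ((L + 1) * Lam)" by simp
 then show "(L + 1) * Nb + (L + 1) * (\<Sum>id<(L + 1) * Nb. card (K.X2 id)) <= R2"
 unfolding R2_def by (intro add_left_mono mult_le_mono2)
 qed (use Rpos in \<open>auto simp: R2_def\<close>)
 then obtain T2 D2 c2 where P2: "pred_fun L ((L + 1) * Nb) K.X2 K.F2 (Lam + 1) R2 T2 D2 c2" "ALL i. c2 i <= V + 2 * R2 * 2 ^ L" by blast
 have "EX Tf disp cf. pred_fun L ((L + 1) * (L + 1) * (Nb + 1)) K.X3 K.F3 (Lam + 1) R3 Tf disp cf & (ALL i. cf i <= V + 2 * R3 * 2 ^ L)"
 proof (rule ex_pred_fun)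
 show "K.X3 id \<subseteq> {..<2 ^ L}" if "id < (L + 1) * (L + 1) * (Nb + 1)" for id by (rule K.fam3_facts[OF that])
 show "K.F3 id q i = K.F3 id q' i" if "id < (L + 1) * (L + 1) * (Nb + 1)" "\<forall>x\<in>K.X3 id. (x < q) = (x < q')" for id q q' i
 by (rule K.F3_agree[OF that])
 show "K.F3 id q i <= V" if "id < (L + 1) * (L + 1) * (Nb + 1)" for id q i using K.fam3_facts(2)[OF that, of q i] RV(4) by linarith
 show "(L + 1) * (L + 1) * (Nb + 1) + (L + 1) * (\<Sum>id<(L + 1) * (L + 1) * (Nb + 1). card (K.X3 id)) <= R3"
 unfolding R3_def using K.fam3_card by (intro add_left_mono mult_le_mono2)
 qed (use Rpos in \<open>auto simp: R3_def\<close>)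
 then obtain T3 D3 c3 where P3: "pred_fun L ((L + 1) * (L + 1) * (Nb + 1)) K.X3 K.F3 (Lam + 1) R3 T3 D3 c3"
 "ALL i. c3 i <= V + 2 * R3 * 2 ^ L" by blast
 define scs where "scs = cscs @ famscs 14 R1 1 @ famscs 19 R2 (Lam + 1) @ famscs 24 R3 (Lam + 1)"
 define tbs where "tbs = ctbs @ famtabs 14 R1 1 T1 D1 c1 @ famtabs 19 R2 (Lam + 1) T2 D2 c2 @ famtabs 24 R3 (Lam + 1) T3 D3 c3"
 note notin = ctbs_notin
 show ?thesis
 proof (intro exI[of _ scs] exI[of _ tbs] conjI)
 have "distinct (map fst (famtabs 14 R1 1 T1 D1 c1 @ famtabs 19 R2 (Lam + 1) T2 D2 c2 @ famtabs 24 R3 (Lam + 1) T3 D3 c3))"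
 by (simp add: famtabs_def)
 moreover have "fst ` set ctbs \<inter> fst ` set (famtabs 14 R1 1 T1 D1 c1 @ famtabs 19 R2 (Lam + 1) T2 D2 c2 @ famtabs 24 R3 (Lam + 1) T3 D3 c3) = {}"
 using notin by (simp add: famtabs_def)
 ultimately show "distinct (map fst tbs)" using ctbs_slots(1) unfolding tbs_def map_append[of fst ctbs] distinct_append set_map by blast
 show "\<forall>x\<in>set tbs. fst x < 100" using ctbs_slots(2) by (fastforce simp: tbs_def famtabs_def)
 show "distinct (map fst scs)" by (simp add: scs_def cscs_def famscs_def)
 have Nbw: "L < 2 ^ w" "d < 2 ^ w" "Nb < 2 ^ w" "d ^ J < 2 ^ w" "R1 < 2 ^ w" "R2 < 2 ^ w" "R3 < 2 ^ w" "Lam < 2 ^ w" "(2::nat) ^ L < 2 ^ w" "2 < (2::nat) ^ w"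
 proof -
 show "L < 2 ^ w" "(2::nat) ^ L < 2 ^ w" "2 < (2::nat) ^ w" using less_exp[of L] word by linarith+
 show "d < 2 ^ w" "Nb < 2 ^ w" "R1 < 2 ^ w" "R2 < 2 ^ w" "R3 < 2 ^ w" "Lam < 2 ^ w" using strw RV w1 Lamw by linarith+
 have "1 * d ^ J <= Nb * d ^ J" using Nb(2) by (intro mult_le_mono1) simp
 then show "d ^ J < 2 ^ w" using strw by linarith
 qed
 show "\<forall>x\<in>set scs. fst x < 100 & fst x ~: fst ` set tbs & snd x < 2 ^ w"
 using notin Nbw Lamw by (simp add: scs_def cscs_def famscs_def tbs_def famtabs_def image_Un)
 show "\<forall>(a, n, f)\<in>set tbs. \<forall>i<n. f i < 2 ^ w"
 proof (intro ballI, clarify)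
 fix a n f i assume t: "(a, n, f) \<in> set tbs" and i: "i < n"
 have fam: "Tf z < 2 ^ w" "dp z < 2 ^ w" "cf z < 2 ^ w"
 if "pred_fun L ids Xs F om R Tf dp cf" "ALL i. cf i <= V + 2 * R * 2 ^ L" "R <= V" for ids Xs F om R Tf dp cf z
 proof -
 have "Tf z < R" "dp z <= 2 * R" using that(1) by (auto simp: pred_fun_def)
 then show "Tf z < 2 ^ w" "dp z < 2 ^ w" using cw[OF that(3)] by linarith+
 show "cf z < 2 ^ w" using cw(1)[OF that(3)] that(2) le_less_trans by blast
 qed
 note fs = fam[OF P1 RV(1)] fam[OF P2 RV(2)] fam[OF P3 RV(3)]
 show "f i < 2 ^ w"
 proof (cases "(a, n, f) \<in> set ctbs")
 case False
 then show ?thesis using t fs by (auto simp: tbs_def famtabs_def)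
 next
 case True
 have pw: "(2::nat) ^ i < 2 ^ w" if "i < L + 1" for i
 proof -
 have "(2::nat) ^ i <= 2 ^ L" using that by (intro power_increasing) auto
 then show ?thesis using w1 by linarith
 qed
 have dj: "Nb * d ^ j < 2 ^ w" "d ^ j < 2 ^ w" if "j <= J" for j
 proof -
 have "d ^ j <= d ^ J" using that d(1) by (intro power_increasing) auto
 then have "Nb * d ^ j <= Nb * d ^ J" "d ^ j <= d ^ J" by auto
 then show "Nb * d ^ j < 2 ^ w" "d ^ j < 2 ^ w" using strw Nbw(4) by linarith+
 qed
 have b: "bas i < 2 ^ w" "trow i < 2 ^ w" for i using bas_le[of i] trow_le[of i] w1 Nbw by linarith+
 have x: "X i < 2 ^ w" if "i < 2 ^ L" using X_less[of i] that w1 by linarith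
 have ty: "enc (K.ord t j k) * (d + (d + 1) * (d + 1)) < 2 ^ w" for t j k
 proof -
 have "enc (K.ord t j k) < d ^ d" by (rule enc) (use K.ord[of t j k] in auto)
 then have "enc (K.ord t j k) * (d + (d + 1) * (d + 1)) <= d ^ d * (d + (d + 1) * (d + 1))" by (intro mult_le_mono1) simp
 then show ?thesis using roww by linarith
 qed
 note ty' = ty[unfolded Suc_eq_plus1[symmetric]]
 have mx: "K.mx (k div K.str j) j m < 2 ^ w" if "k < (L + 1) * K.str j" for k j m
 proof -
 have "k div K.str j <= L" using less_mult_imp_div_less[OF that] by simp
 then have "K.mx (k div K.str j) j m <= N" by (rule K.mx_le)
 then show ?thesis using w1 by linarith
 qed
 show ?thesis using True i unfolding ctbs_def
 by (auto simp del: mult_Suc mult_Suc_right add_2_eq_Suc add_2_eq_Suc' intro: par_word fld_word b x pw dj ty ty' mx)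
 qed
 qed
 have str: "(L + 1) * K.str i <= (L + 1) * (Nb * d ^ (J - 1))" if "1 <= i" for i
 unfolding K.str_def using that d(1) by (intro mult_le_mono2 power_increasing) auto
 have "(\<Sum>i\<leftarrow>[1..<J + 1]. (L + 1) * K.str i) <= (\<Sum>i\<leftarrow>[1..<J + 1]. (L + 1) * (Nb * d ^ (J - 1)))"
 by (rule sum_list_mono) (use str in auto)
 also have "... = J * ((L + 1) * (Nb * d ^ (J - 1)))" by (simp add: sum_list_triv)
 finally have ss: "(\<Sum>i\<leftarrow>[1..<J + 1]. (L + 1) * K.str i) <= J * ((L + 1) * (Nb * d ^ (J - 1)))" .
 have c: "(\<Sum>x\<leftarrow>ctbs. fst (snd x)) = (L + 1) + 8 * (L + 1) + FL + BL + 2 ^ L + d ^ d * (d + (d + 1) * (d + 1)) + (J + 1) + (J + 1) +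
 (\<Sum>i\<leftarrow>[1..<J + 1]. (L + 1) * K.str i) + (\<Sum>i\<leftarrow>[1..<J + 1]. (L + 1) * K.str i)"
 unfolding ctbs_def map_append sum_list_append map_map comp_def by simp
 have f: "(\<Sum>x\<leftarrow>famtabs k R om Tf dp cf. fst (snd x)) = fsize R om" for k R om Tf dp cf by (simp add: famtabs_def fsize_def)
 show "(\<Sum>x\<leftarrow>tbs. fst (snd x)) <= 9 * (L + 1) + FL + BL + 2 ^ L + d ^ d * (d + (d + 1) * (d + 1)) + 2 * (J + 1) +
 2 * (J * ((L + 1) * (Nb * d ^ (J - 1)))) + fsize R1 1 + fsize R2 (Lam + 1) + fsize R3 (Lam + 1)"
 unfolding tbs_def map_append sum_list_append f c
 proof -
 have "a + 8 * a + b + b' + m + D + j + j + s + s + (x + (y + z)) <= 9 * a + b + b' + m + D + 2 * j + 2 * Q + x + y + z"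
 if "s <= Q" for a b b' m D j s Q x y z :: nat using that by simp
 from this[OF ss] show "L + 1 + 8 * (L + 1) + FL + BL + N + d ^ d * (d + (d + 1) * (d + 1)) + (J + 1) + (J + 1) +
 (\<Sum>i\<leftarrow>[1..<J + 1]. (L + 1) * K.str i) + (\<Sum>i\<leftarrow>[1..<J + 1]. (L + 1) * K.str i) +
 (fsize R1 1 + (fsize R2 (Lam + 1) + fsize R3 (Lam + 1)))
 <= 9 * (L + 1) + FL + BL + N + d ^ d * (d + (d + 1) * (d + 1)) + 2 * (J + 1) +
 2 * (J * ((L + 1) * (Nb * d ^ (J - 1)))) + fsize R1 1 + fsize R2 (Lam + 1) + fsize R3 (Lam + 1)" .
 qed
 show "ALL D hb Y. holds D hb scs tbs --> (\<forall>y<N. Y (X y) = y) --> core_works w L D J hb Y (Ccore I J) Lam"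
 proof (intro allI impI)
 fix D hb Y assume h: "holds D hb scs tbs" and Yi: "\<forall>y<N. Y (X y) = y"
 have h1: "holds D hb cscs ctbs" and h2: "holds D hb (famscs 14 R1 1) (famtabs 14 R1 1 T1 D1 c1)"
 "holds D hb (famscs 19 R2 (Lam + 1)) (famtabs 19 R2 (Lam + 1) T2 D2 c2)"
 "holds D hb (famscs 24 R3 (Lam + 1)) (famtabs 24 R3 (Lam + 1) T3 D3 c3)"
 using h by (simp_all add: scs_def tbs_def)
 interpret M: core_tables L X w hb D I FL BL fld bas par d J Nb Lam enc trow by (rule core_tables_intro[OF h1])
 have pm: "M.pred_mem k (k + 1) (k + 2) (k + 3) (k + 4) ids Xs F om"
 if "holds D hb (famscs k R om) (famtabs k R om Tf dp cf)" "pred_fun L ids Xs F om R Tf dp cf" "R <= V" "0 < R"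
 "!!id. id < ids ==> Xs id \<subseteq> {..<2 ^ L}" for k R om Tf dp cf ids Xs F
 unfolding M.pred_mem_def
 by (rule exI[of _ R], rule exI[of _ Tf], rule exI[of _ dp], rule exI[of _ cf])
 (use that cw(2)[OF that(3)] in \<open>auto simp: holds_def famscs_def famtabs_def\<close>)
 have "core_full L X w hb D I FL BL fld bas par d J Nb Lam enc trow"
 proof unfold_locales
 show "L + 1 < 2 ^ Lam" by (rule L_Lam)
 show "scal D hb 11 Lam" "scal D hb 12 Nb" "scal D hb 13 (d ^ J)" using h1 by (auto simp: holds_def cscs_def)
 show "M.pred_mem 14 15 16 17 18 (2 * 2 ^ L) K.X1 K.F1 1"
 using pm[OF h2(1) P1(1) RV(1) Rpos(1) K.fam1_facts(1)] by simp
 show "M.pred_mem 19 20 21 22 23 ((L + 1) * Nb) K.X2 K.F2 (Lam + 1)"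
 using pm[OF h2(2) P2(1) RV(2) Rpos(2) K.fam2_facts(1)] by simp
 show "M.pred_mem 24 25 26 27 28 ((L + 1) * (L + 1) * (Nb + 1)) K.X3 K.F3 (Lam + 1)"
 using pm[OF h2(3) P3(1) RV(3) Rpos(3) K.fam3_facts(1)] by simp
 show "(L + 1) * (L + 1) * (Nb + 1) < 2 ^ w" using RV(6) w1(2) by linarith
 qed
 then interpret F: core_full L X w hb D I FL BL fld bas par d J Nb Lam enc trow .
 show "core_works w L D J hb Y (Ccore I J) Lam" by (rule F.core_works) (use Yi in simp)
 qed
 qed
qed

end

section \<open>Rank space\<close>

definition pack :: "nat => (nat \<times> nat) list => (nat \<times> nat \<times> (nat => nat)) list => bool" where
 "pack w scs tbs \<longleftrightarrow> distinct (map fst tbs) & (\<forall>x\<in>set tbs. fst x < 100) & distinct (map fst scs) &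
 (\<forall>x\<in>set scs. fst x < 100 & fst x ~: fst ` set tbs & snd x < 2 ^ w) & (\<forall>(a, n, f)\<in>set tbs. \<forall>i<n. f i < 2 ^ w)"

definition shift :: "nat => (nat \<times> nat \<times> (nat => nat)) list => (nat \<times> nat \<times> (nat => nat)) list" where
 "shift hb tbs = map (%(a, n, f). (hb + a, n, f)) tbs"

lemma shift_simps: "map fst (shift hb tbs) = map ((+) hb) (map fst tbs)" "(\<Sum>x\<leftarrow>shift hb tbs. fst (snd x)) = (\<Sum>x\<leftarrow>tbs. fst (snd x))"
 "(a, n, f) \<in> set tbs ==> (hb + a, n, f) \<in> set (shift hb tbs)"
 by (force simp: shift_def comp_def case_prod_beta intro!: arg_cong[where f = sum_list])+

text \<open>Directory \<open>h\<close> occupies 100 cells from \<open>100 * h\<close> on. Shifting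
  the cell numbers makes the three directories disjoint, so that one application of
  \<open>layout\<close> places everything.\<close>

lemma layout_packs:
 fixes s :: "nat => (nat \<times> nat) list"
 assumes p: "!!h. h < 3 ==> pack w (s h) (t h)"
 and len: "len = 300 + (\<Sum>x\<leftarrow>t 0. fst (snd x)) + (\<Sum>x\<leftarrow>t 1. fst (snd x)) + (\<Sum>x\<leftarrow>t 2. fst (snd x))" "len < 2 ^ w"
 shows "EX D. length D = len & set D \<subseteq> {..<2 ^ w} & (\<forall>h<3. holds D (100 * h) (s h) (t h))"
proof -
 define TB where "TB = shift 0 (t 0) @ shift 100 (t 1) @ shift 200 (t 2)"
 define v where "v = (%a. case map_of (s (a div 100)) (a mod 100) of None => 0 | Some z => z)"
 have rng: "fst ` set (shift (100 * h) (t h)) = (%a. 100 * h + a) ` fst ` set (t h)" for h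
 using arg_cong[OF shift_simps(1)[of "100 * h" "t h"], of set] by (simp add: image_image)
 have lt: "a < 100" if "a \<in> fst ` set (t h)" "h < 3" for a h using p[OF that(2)] that(1) by (auto simp: pack_def)
 have rng': "x div 100 = h" "x mod 100 \<in> fst ` set (t h)" if xh: "x \<in> fst ` set (shift (100 * h) (t h))" "h < 3" for x h
 proof -
 obtain a where a: "x = 100 * h + a" "a \<in> fst ` set (t h)" using xh(1) unfolding rng by blast
 then show "x div 100 = h" "x mod 100 \<in> fst ` set (t h)" using lt[OF a(2) xh(2)] by simp_all
 qed
 have ds: "distinct (map fst (shift (100 * h) (t h)))" if "h < 3" for h
 using p[OF that] unfolding shift_simps by (subst distinct_map) (auto simp: pack_def inj_on_def)
 have sub: "set (shift (100 * h) (t h)) \<subseteq> set TB" if h3: "h < 3" for h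
 proof -
 consider "h = 0" | "h = 1" | "h = 2" using h3 by linarith
 then show ?thesis by cases (auto simp: TB_def)
 qed
 have TBe: "\<exists>h<3. x \<in> set (shift (100 * h) (t h))" if "x \<in> set TB" for x
 using that by (auto simp: TB_def intro: exI[of _ 0] exI[of _ 1] exI[of _ 2])
 have d0: "distinct (map fst TB)"
 proof -
 have dj: "fst ` set (shift (100 * h) (t h)) \<inter> fst ` set (shift (100 * h') (t h')) = {}" if "h < 3" "h' < 3" "h ~= h'" for h h'
 using rng'(1)[OF _ that(1)] rng'(1)[OF _ that(2)] that(3) by blast
 show ?thesis unfolding TB_def map_append distinct_append set_append set_map
 using ds[of 0] ds[of 1] ds[of 2] dj[of 0 1] dj[of 0 2] dj[of 1 2] by (simp add: Int_Un_distrib)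
 qed
 have lt300: "\<forall>x\<in>set TB. fst x < 300"
 proof
 fix x assume "x \<in> set TB"
 then obtain h where h: "h < 3" "x \<in> set (shift (100 * h) (t h))" using TBe by blast
 then have "fst x div 100 = h" using rng'(1)[of "fst x" h] by blast
 then show "fst x < 300" using h(1) by linarith
 qed
 obtain D where D: "length D = 300 + (\<Sum>x\<leftarrow>TB. fst (snd x))" "\<forall>a<300. a ~: fst ` set TB --> D ! a = v a"
 and D3: "\<forall>(a, n, f)\<in>set TB. 300 <= D ! a & D ! a + n <= length D & (\<forall>i<n. D ! (D ! a + i) = f i)"
 and D4: "ALL B. (\<forall>a<300. v a < B) --> length D < B --> (\<forall>(a, n, f)\<in>set TB. \<forall>i<n. f i < B) --> set D \<subseteq> {..<B}"
 using layout[OF d0 lt300, of v] by (elim exE conjE)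
 have lD: "length D = len" unfolding D(1) len(1) TB_def by (simp add: shift_simps(2))
 have h: "holds D (100 * h) (s h) (t h)" if h: "h < 3" for h
 unfolding holds_def
 proof (intro conjI ballI; clarify)
 fix a z assume az: "(a, z) \<in> set (s h)"
 have a: "a < 100" "a ~: fst ` set (t h)" using p[OF h] az by (force simp: pack_def)+
 have dm: "(100 * h + a) div 100 = h" "(100 * h + a) mod 100 = a" using a(1) by auto
 have "100 * h + a ~: fst ` set TB"
 proof
 assume "100 * h + a \<in> fst ` set TB"
 then obtain h' where "h' < 3" "100 * h + a \<in> fst ` set (shift (100 * h') (t h'))" using TBe by blast
 then have "h' = h" "a \<in> fst ` set (t h')" using rng'[of "100 * h + a" h'] dm by auto
 then show False using a(2) by simp
 qed
 moreover have "map_of (s h) a = Some z" by (rule map_of_is_SomeI[OF _ az]) (use p[OF h] in \<open>simp add: pack_def\<close>)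
 moreover have "100 * h + a < 300" using h a(1) by linarith
 ultimately show "scal D (100 * h) a z" using D dm by (simp add: scal_def v_def)
 next
 fix a n f assume tt: "(a, n, f) \<in> set (t h)"
 have "(100 * h + a, n, f) \<in> set TB" using shift_simps(3)[OF tt] sub[OF h] by blast
 from bspec[OF D3 this] have "300 <= D ! (100 * h + a)" "D ! (100 * h + a) + n <= length D" "\<forall>i<n. D ! (D ! (100 * h + a) + i) = f i" by auto
 moreover have "100 * h + a < 300" using h lt[of a h] tt by force
 ultimately show "tab D (100 * h) a n f" using D(1) by (simp add: tab_def)
 qed
 have "set D \<subseteq> {..<2 ^ w}"
 proof (rule D4[rule_format])
 fix a :: nat assume "a < 300"
 then have h: "a div 100 < 3" by linarith
 show "v a < 2 ^ w"
 proof (cases "map_of (s (a div 100)) (a mod 100)")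
 case (Some z)
 then show ?thesis using p[OF h] map_of_SomeD[OF Some] by (force simp: pack_def v_def)
 qed (simp add: v_def)
 next
 show "length D < 2 ^ w" using lD len(2) by simp
 fix x assume "x \<in> set TB"
 then obtain h where h: "h < 3" "x \<in> set (shift (100 * h) (t h))" using TBe by blast
 then obtain a n f where x: "x = (100 * h + a, n, f)" "(a, n, f) \<in> set (t h)" by (auto simp: shift_def)
 show "case x of (a, n, f) => \<forall>i<n. f i < 2 ^ w" using p[OF h(1)] x by (auto simp: pack_def)
 qed
 then show ?thesis using lD h by blast
qed

section \<open>Counting the words of the decoding tables\<close>

text \<open>With \<open>k\<close> fields of width \<open>b t\<close> in a word,
  \<open>w < 2 * k * b t\<close>, so a level needs at most \<open>2 * N * b t / w\<close> words up
  to rounding. The widths sum to at most \<open>L * Q\<close>, and \<open>L <= w\<close>.\<close>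

lemma field_words_bound:
 fixes b :: "nat => nat" and L N w Q :: nat
 assumes "!!t. t < L ==> 0 < b t & b t <= w" "(\<Sum>t<L. b t) <= L * Q" "L <= w" "0 < w"
 shows "(\<Sum>t<L. N div (w div b t) + 1) <= L + 2 * N * Q"
proof -
 have "(\<Sum>t<L. N div (w div b t)) * w <= (2 * N * Q) * w"
 proof -
 have "(\<Sum>t<L. N div (w div b t)) * w = (\<Sum>t<L. N div (w div b t) * w)" by (rule sum_distrib_right)
 also have "... <= (\<Sum>t<L. 2 * N * b t)"
 proof (rule sum_mono)
 fix t assume "t \<in> {..<L}"
 then have t: "0 < b t" "b t <= w" using assms(1) by auto
 define k where "k = w div b t"
 have k: "1 <= k" unfolding k_def using t by (simp add: Suc_le_eq div_greater_zero_iff)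
 have "w < (k + 1) * b t" unfolding k_def using dividend_less_div_times[OF t(1), of w] by simp
 also have "... <= 2 * k * b t" using k by (intro mult_le_mono1) simp
 finally have "N div k * w <= N div k * (2 * k * b t)" by (intro mult_le_mono2) simp
 also have "... = 2 * (N div k * k) * b t" by simp
 also have "... <= 2 * N * b t" by (intro mult_le_mono1 mult_le_mono2 div_times_less_eq_dividend)
 finally show "N div (w div b t) * w <= 2 * N * b t" unfolding k_def .
 qed
 also have "... = 2 * N * (\<Sum>t<L. b t)" by (rule sum_distrib_left[symmetric])
 also have "... <= 2 * N * (L * Q)" using assms(2) by (rule mult_le_mono2)
 also have "... <= 2 * N * (w * Q)" using assms(3) by (intro mult_le_mono2 mult_le_mono1)
 also have "... = (2 * N * Q) * w" by simp
 finally show ?thesis .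
 qed
 then have "(\<Sum>t<L. N div (w div b t)) <= 2 * N * Q" using assms(4) by simp
 then show ?thesis unfolding sum.distrib by simp
qed

text \<open>Whole blocks contribute at most \<open>2 ^ L div 2 ^ ell\<close> per level, which sums
  to at most \<open>2 ^ L\<close> since \<open>L <= 2 ^ ell\<close>. The additional block of each
  level contributes at most \<open>2 ^ (L - t)\<close>, and these form a geometric sum.\<close>

lemma base_words_bound:
 fixes g :: "nat => nat"
 assumes "!!t. t < L ==> g t <= L - t" "L <= 2 ^ ell"
 shows "(\<Sum>t<L. (2 ^ L div 2 ^ (g t + ell) + 1) * 2 ^ g t) <= 3 * (2::nat) ^ L"
proof -
 have "(\<Sum>t<L. (2 ^ L div 2 ^ (g t + ell) + 1) * 2 ^ g t) <= (\<Sum>t<L. 2 ^ L div 2 ^ ell + (2::nat) ^ (L - t))"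
 proof (rule sum_mono)
 fix t assume t: "t \<in> {..<L}"
 have "(2::nat) ^ L div 2 ^ (g t + ell) * 2 ^ g t = (2 ^ L div 2 ^ ell) div 2 ^ g t * 2 ^ g t"
 by (simp add: power_add div_mult2_eq mult.commute)
 also have "... <= 2 ^ L div 2 ^ ell" by (rule div_times_less_eq_dividend)
 finally have "(2::nat) ^ L div 2 ^ (g t + ell) * 2 ^ g t <= 2 ^ L div 2 ^ ell" .
 moreover have "(2::nat) ^ g t <= 2 ^ (L - t)" using assms(1) t by (intro power_increasing) auto
 ultimately show "(2 ^ L div 2 ^ (g t + ell) + 1) * 2 ^ g t <= 2 ^ L div 2 ^ ell + (2::nat) ^ (L - t)"
 by (simp only: add_mult_distrib)
 qed
 also have "... = L * (2 ^ L div 2 ^ ell) + (\<Sum>t<L. (2::nat) ^ (L - t))" by (simp add: sum.distrib)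
 also have "L * ((2::nat) ^ L div 2 ^ ell) <= 2 ^ ell * (2 ^ L div 2 ^ ell)" using assms(2) by (rule mult_le_mono1)
 also have "2 ^ ell * ((2::nat) ^ L div 2 ^ ell) <= 2 ^ L" by (rule times_div_less_eq_dividend)
 also have "(\<Sum>t<L. (2::nat) ^ (L - t)) <= 2 * 2 ^ L"
 proof -
 have "(\<Sum>t<m. (2::nat) ^ (m - t)) + 2 = 2 * 2 ^ m" for m
 by (induction m) (simp_all add: sum.lessThan_Suc_shift del: sum.lessThan_Suc)
 from this[of L] show ?thesis by linarith
 qed
 finally show ?thesis by simp
qed

section \<open>From coordinates to ranks\<close>

lemma sorted_nth_less_iff:
 fixes xs :: "'a::linorder list"
 assumes "sorted xs" "i < length xs"
 shows "xs ! i < v \<longleftrightarrow> i < length (filter (%z. z < v) xs)"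
 using assms
proof (induction xs arbitrary: i)
 case (Cons a xs)
 show ?case
 proof (cases "a < v")
 case True
 then show ?thesis using Cons by (cases i) auto
 next
 case False
 then have "\<forall>z\<in>set (a # xs). \<not> z < v" using Cons.prems(1) by auto
 then show ?thesis using Cons.prems(2) nth_mem[OF Cons.prems(2)] by (metis filter_False less_nat_zero_code list.size(3))
 qed
qed simp

text \<open>The program caps the requested number of points by \<open>2 ^ L\<close>. The second
  alternative covers the case where the cap matters: both numbers are then at least the number of
  points.\<close>

lemma sorted_report_take:
 assumes ps: "distinct ps" "set ps = S" "sorted (map fst ps)" and k: "k = K \<or> card S <= k & card S <= K"
 shows "sorted_report S Q k (take K (filter (%p. p \<in> Q) ps))"
proof -
 define zs where "zs = filter (%p. p \<in> Q) ps"
 have zs: "distinct zs" "set zs = S \<inter> Q" using ps by (auto simp: zs_def)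
 have srt: "sorted (map fst zs)" unfolding zs_def using ps(3) by (simp add: sorted_filter)
 have "finite S" using ps(2) by auto
 then have len: "length zs = card (S \<inter> Q)" "card (S \<inter> Q) <= card S" using distinct_card[OF zs(1)] zs(2) card_mono[of S "S \<inter> Q"] by auto
 have app: "sorted (map fst (take K zs) @ map fst (drop K zs))" using srt by (simp flip: map_append)
 show ?thesis unfolding sorted_report_def zs_def[symmetric]
 proof (intro conjI ballI)
 show "distinct (take K zs)" using zs by simp
 show "set (take K zs) \<subseteq> S \<inter> Q" using set_take_subset[of K zs] zs(2) by simp
 show "length (take K zs) = min k (card (S \<inter> Q))" using k len by auto
 show "sorted (map fst (take K zs))" using app by (simp add: sorted_append)
 fix p q assume "p \<in> set (take K zs)" "q \<in> S \<inter> Q - set (take K zs)"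
 moreover then have "q \<in> set (drop K zs)" using zs(2) set_append[of "take K zs" "drop K zs"] by auto
 ultimately show "fst p <= fst q" using app by (auto simp: sorted_append)
 qed
qed

lemma map_nth_filter: "map ((!) ps) (filter (%x. P (ps ! x)) [0..<length ps]) = filter P ps"
proof -
 have "filter P (map ((!) ps) [0..<length ps]) = map ((!) ps) (filter (P \<circ> (!) ps) [0..<length ps])" by (rule filter_map)
 then show ?thesis by (simp add: map_nth comp_def)
qed

text \<open>Ties are broken by the sorted lists \<open>ps\<close> and \<open>qs\<close>, which makes
  all ranks distinct. The ranks from \<open>n\<close> on are dummy points with equal ranks in both
  orders; they are never reported because \<open>CX\<close> is at most \<open>n\<close>.\<close>

lemma rank_space:
 fixes S :: "point set"
 assumes S: "S \<subseteq> {1..n} \<times> {1..n}" "card S = n" and n: "n >= 1" "n < 2 ^ L"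
 shows "EX Y X CX CY PX PY. bij_betw X {..<2 ^ L} {..<2 ^ L} & (\<forall>y<2 ^ L. Y (X y) = y) & (\<forall>x<2 ^ L. Y x < 2 ^ L) &
 (ALL v. CX v <= n) & (ALL v. CY v <= n) & (\<forall>x<n. PX x <= n & PY x <= n) &
 (ALL a b c d k F. F = take (min k (2 ^ L)) (filter (%x. CX (min a (n + 1)) <= x & x < CX (min b n + 1) &
 CY (min c (n + 1)) <= Y x & Y x < CY (min d n + 1)) [0..<2 ^ L]) -->
 (EX ps. concat (map (%x. [PX x, PY x]) F) = encode_points ps & length ps = length F &
 sorted_report S ({a..b} \<times> {c..d}) k ps))"
proof -
 have fin: "finite S" using S n by (metis card.infinite not_one_le_zero)
 obtain zs where zs: "set zs = S" "distinct zs" using finite_distinct_list[OF fin] by blast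
 define ps where "ps = sort_key fst zs"
 define qs where "qs = sort_key snd zs"
 have ps: "set ps = S" "distinct ps" "sorted (map fst ps)" using zs by (auto simp: ps_def)
 have qs: "set qs = S" "distinct qs" "sorted (map snd qs)" using zs by (auto simp: qs_def)
 have len: "length ps = n" "length qs = n" using distinct_card[OF ps(2)] distinct_card[OF qs(2)] ps(1) qs(1) S(2) by auto
 have co: "fst (ps ! x) <= n" "snd (ps ! x) <= n" if "x < n" for x
 using nth_mem[of x ps] that len ps(1) S(1) by auto
 have "\<exists>j<n. qs ! j = ps ! x" if "x < n" for x
 proof -
 have "ps ! x \<in> set qs" using nth_mem[of x ps] that len ps(1) qs(1) by simp
 then show ?thesis using len(2) by (metis in_set_conv_nth)
 qed
 then obtain Y0 where Y0: "!!x. x < n ==> Y0 x < n & qs ! Y0 x = ps ! x" by metis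
 define Y where "Y = (%x. if x < n then Y0 x else x)"
 have Yinj: "inj_on Y {..<2 ^ L}"
 proof (rule inj_onI)
 fix x y assume "x \<in> {..<(2::nat) ^ L}" "y \<in> {..<(2::nat) ^ L}" and e: "Y x = Y y"
 show "x = y"
 proof (cases "x < n")
 case True
 then have "y < n" using e Y0[of x] by (auto simp: Y_def split: if_splits)
 then have "ps ! x = ps ! y" using e Y0[of x] Y0[of y] True by (simp add: Y_def)
 then show ?thesis using nth_eq_iff_index_eq[OF ps(2)] True \<open>y < n\<close> len by simp
 next
 case False
 then show ?thesis using e Y0[of y] by (auto simp: Y_def split: if_splits)
 qed
 qed
 have Yr: "Y x < 2 ^ L" if "x < 2 ^ L" for x using Y0[of x] that n(2) by (auto simp: Y_def)
 have Yb: "bij_betw Y {..<2 ^ L} {..<2 ^ L}"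
 unfolding bij_betw_def
 proof
 show "Y ` {..<2 ^ L} = {..<2 ^ L}" by (rule endo_inj_surj) (use Yinj Yr in auto)
 qed (rule Yinj)
 define X where "X = inv_into {..<2 ^ L} Y"
 have Xb: "bij_betw X {..<2 ^ L} {..<2 ^ L}" unfolding X_def by (rule bij_betw_inv_into[OF Yb])
 have YX: "Y (X y) = y" if "y < 2 ^ L" for y unfolding X_def by (rule bij_betw_inv_into_right[OF Yb]) (use that in simp)
 define CX where "CX = (%v. length (filter (%z. z < v) (map fst ps)))"
 define CY where "CY = (%v. length (filter (%z. z < v) (map snd qs)))"
 have CXn: "CX v <= n" "CY v <= n" for v
 using length_filter_le[of "%z. z < v" "map fst ps"] length_filter_le[of "%z. z < v" "map snd qs"] len by (auto simp: CX_def CY_def)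
 have cx: "fst (ps ! x) < v \<longleftrightarrow> x < CX v" if "x < n" for x v
 using sorted_nth_less_iff[OF ps(3), of x v] that len by (simp add: CX_def)
 have cy: "snd (ps ! x) < v \<longleftrightarrow> Y x < CY v" if "x < n" for x v
 using sorted_nth_less_iff[OF qs(3), of "Y x" v] Y0[OF that] that len by (simp add: CY_def Y_def)
 define PX where "PX = (%x. fst (ps ! x))"
 define PY where "PY = (%x. snd (ps ! x))"
 show ?thesis
 proof (rule exI[of _ Y], rule exI[of _ X], rule exI[of _ CX], rule exI[of _ CY], rule exI[of _ PX], rule exI[of _ PY], intro conjI allI impI)
 fix a b c d k F
 assume F: "F = take (min k (2 ^ L)) (filter (%x. CX (min a (n + 1)) <= x & x < CX (min b n + 1) &
 CY (min c (n + 1)) <= Y x & Y x < CY (min d n + 1)) [0..<2 ^ L])"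
 define Q where "Q = {a..b} \<times> {c..d}"
 let ?P = "%x. CX (min a (n + 1)) <= x & x < CX (min b n + 1) & CY (min c (n + 1)) <= Y x & Y x < CY (min d n + 1)"
 have iff: "?P x \<longleftrightarrow> ps ! x \<in> Q" if x: "x < n" for x
 proof -
 have "?P x \<longleftrightarrow> \<not> fst (ps ! x) < min a (n + 1) & fst (ps ! x) < min b n + 1 & \<not> snd (ps ! x) < min c (n + 1) & snd (ps ! x) < min d n + 1"
 unfolding cx[OF x] cy[OF x] by (simp add: not_less)
 also have "... \<longleftrightarrow> ps ! x \<in> Q" using co[OF x] by (cases "ps ! x") (simp add: Q_def min_def, linarith)
 finally show ?thesis .
 qed
 have up: "[0..<2 ^ L] = [0..<n] @ [n..<2 ^ L]" using n(2) upt_add_eq_append[of 0 n "2 ^ L - n"] by simp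
 have e: "filter ?P [n..<2 ^ L] = []" using CXn(1)[of "min b n + 1"] by (auto simp: filter_empty_conv)
 have "filter ?P [0..<2 ^ L] = filter ?P [0..<n]" unfolding up filter_append e by simp
 also have "... = filter (%x. ps ! x \<in> Q) [0..<length ps]" unfolding len(1) by (rule filter_cong) (use iff in auto)
 finally have F': "F = take (min k (2 ^ L)) (filter (%x. ps ! x \<in> Q) [0..<length ps])" using F by simp
 have rs: "map ((!) ps) F = take (min k (2 ^ L)) (filter (%p. p \<in> Q) ps)" unfolding F' take_map[symmetric] map_nth_filter[of ps "%p. p \<in> Q"] ..
 show "EX rs. concat (map (%x. [PX x, PY x]) F) = encode_points rs & length rs = length F & sorted_report S ({a..b} \<times> {c..d}) k rs"
 proof (rule exI[of _ "map ((!) ps) F"], intro conjI)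
 show "concat (map (%x. [PX x, PY x]) F) = encode_points (map ((!) ps) F)"
 by (simp add: encode_points_def PX_def PY_def comp_def case_prod_beta)
 show "sorted_report S ({a..b} \<times> {c..d}) k (map ((!) ps) F)"
 unfolding rs Q_def[symmetric] by (rule sorted_report_take[OF ps(2,1,3)]) (use n(2) S(2) in auto)
 qed simp
 qed (simp_all add: Xb YX Yr CXn co PX_def PY_def)
qed

section \<open>The data structure\<close>

lemma family_bounds:
 fixes L Lam Nb :: nat
 assumes "1 <= L" "Lam <= 3 * L" "1 <= Nb"
 shows "(L + 1) * ((L + 1) * Nb) <= 4 * (L ^ 5 * Nb)"
 "(L + 1) * Nb + (L + 1) * ((L + 1) * Nb * ((L + 1) * Lam)) <= 26 * (L ^ 4 * Nb)"
 "(L + 1) * (L + 1) * (Nb + 1) + (L + 1) * ((L + 1) * (L + 1) * Nb) <= 16 * (L ^ 4 * Nb)" "L ^ 4 * Nb <= L ^ 5 * Nb"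
 "L ^ 4 * Nb * (2 * Lam + 5) <= 11 * (L ^ 5 * Nb)"
proof -
 have L1: "L + 1 <= 2 * L" using assms(1) by simp
 have p: "L ^ 2 = L * L" "L ^ 3 = L * L * L" "L ^ 4 = L * L * L * L" "L ^ 5 = L * L * L * L * L" by (simp_all add: eval_nat_numeral)
 have pw: "L ^ i * Nb <= L ^ j * Nb" if "i <= j" for i j using that assms(1) by (intro mult_le_mono1 power_increasing) auto
 have "(L + 1) * ((L + 1) * Nb) <= 2 * L * (2 * L * Nb)" using L1 by (intro mult_le_mono) auto
 also have "... = 4 * (L ^ 2 * Nb)" by (simp add: p algebra_simps)
 finally show "(L + 1) * ((L + 1) * Nb) <= 4 * (L ^ 5 * Nb)" using pw[of 2 5] by linarith
 have "(L + 1) * Nb + (L + 1) * ((L + 1) * Nb * ((L + 1) * Lam)) <= 2 * L * Nb + 2 * L * (2 * L * Nb * (2 * L * (3 * L)))"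
 using L1 assms(2) by (intro add_mono mult_le_mono) auto
 also have "... = 2 * (L ^ 1 * Nb) + 24 * (L ^ 4 * Nb)" by (simp add: p algebra_simps)
 finally show "(L + 1) * Nb + (L + 1) * ((L + 1) * Nb * ((L + 1) * Lam)) <= 26 * (L ^ 4 * Nb)" using pw[of 1 4] by linarith
 have "(L + 1) * (L + 1) * (Nb + 1) + (L + 1) * ((L + 1) * (L + 1) * Nb) <= 2 * L * (2 * L) * (2 * Nb) + 2 * L * (2 * L * (2 * L) * Nb)"
 using L1 assms(3) by (intro add_mono mult_le_mono) auto
 also have "... = 8 * (L ^ 2 * Nb) + 8 * (L ^ 3 * Nb)" by (simp add: p algebra_simps)
 finally show "(L + 1) * (L + 1) * (Nb + 1) + (L + 1) * ((L + 1) * (L + 1) * Nb) <= 16 * (L ^ 4 * Nb)"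
 using pw[of 2 4] pw[of 3 4] by linarith
 show "L ^ 4 * Nb <= L ^ 5 * Nb" by (rule pw) simp
 have "L ^ 4 * Nb * (2 * Lam + 5) <= L ^ 4 * Nb * (11 * L)" using assms by (intro mult_le_mono2) simp
 also have "... = 11 * (L ^ 5 * Nb)" by (simp add: p algebra_simps)
 finally show "L ^ 4 * Nb * (2 * Lam + 5) <= 11 * (L ^ 5 * Nb)" .
qed

definition core_size :: "nat => nat => nat => nat => nat => nat => nat => nat" where
 "core_size K I L d Nb Lam G = (74 + 483 * K) * 2 ^ L + 4 * I * (2 ^ L * G) + 6 * (2 ^ L * Lam) + 24 * ((L + 1) * (Nb * d ^ 11))"

text \<open>\<open>Lam\<close> also serves as the parameter \<open>ell\<close> of the decoder, since
  \<open>L <= 2 ^ Lam\<close>. The lower bound on the word length is quadratic in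
  \<open>2 ^ L\<close> because a hash code combines the number of a set with a trie node.\<close>

lemma ex_core_pack:
 fixes L :: nat
 assumes bij: "bij_betw X {..<2 ^ L} {..<2 ^ L}" and L: "1 <= L" and K: "1 <= K"
 and d: "1 <= d" "d <= 2 ^ Lam" and Lam: "2 <= Lam" "L + 1 < 2 ^ Lam" "2 ^ Lam <= 4 * (L + 1)" "Lam <= L + 2"
 and Nb: "2 ^ L <= Nb * d ^ 12" "0 < Nb" "(Nb - 1) * d ^ 12 < 2 ^ L" and G: "2 <= G" "L <= G ^ I" "G <= L + 2"
 and b: "L ^ 5 * Nb <= K * 2 ^ L" "Nb * d ^ 12 <= K * 2 ^ L" "d ^ d * (d + (d + 1) * (d + 1)) <= K * 2 ^ L"
 and w: "21 * L <= w" "(2000 + 2000 * K + 20 * I) * (2 ^ L * 2 ^ L) < 2 ^ w"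
 shows "EX scs tbs. pack w scs tbs & (\<Sum>x\<leftarrow>tbs. fst (snd x)) <= core_size K I L d Nb Lam G &
 (ALL D hb Y. holds D hb scs tbs --> (\<forall>y<2 ^ L. Y (X y) = y) --> core_works w L D 12 hb Y (Ccore (I + 1) 12) Lam)"
proof -
 define Nn where "Nn = (2::nat) ^ L"
 define W where "W = Nn * Nn"
 have N1: "L + 1 <= Nn" "1 <= Nn" using Suc_leI[OF less_exp[of L]] by (simp_all add: Nn_def)
 have NW: "Nn <= W" "1 <= W" using N1(2) by (auto simp: W_def)
 have big: "2000 * W + 2000 * (K * W) + 20 * (I * W) < 2 ^ w" using w(2) unfolding Nn_def[symmetric] W_def[symmetric] by (simp add: algebra_simps)
 have KW: "K * Nn <= K * W" "W <= K * W" using NW K by auto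
 note b = b[folded Nn_def] and Nb = Nb[folded Nn_def]
 interpret perm_tree L X by unfold_locales (rule bij)
 obtain nxt cl where nx: "\<forall>t<L. t < nxt t & nxt t <= L & cl (nxt t) < cl t" "ALL t. cl t <= I + 1" "(\<Sum>t<L. nxt t - t) <= L + I * L * G"
 using jump_schedule[OF G(1,2)] by blast
 have lw: "4 * L + 4 * Lam + 4 < w" using w(1) Lam(4) L by linarith
 define FL BL where "FL = (\<Sum>t<L. Nn div (w div (2 * (nxt t - t) + Lam + 1)) + 1)"
 and "BL = (\<Sum>t<L. (Nn div 2 ^ (nxt t - t + Lam) + 1) * 2 ^ (nxt t - t))"
 obtain fld bas par where dec: "dec_fun w (I + 1) FL fld BL bas par" "ALL i. fld i < 2 ^ w" "ALL i. bas i <= 2 * 2 ^ L"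
 "FL < 2 ^ w --> BL < 2 ^ w --> (ALL i. par i < 2 ^ w)"
 using ex_dec_fun[OF nx(1,2) lw] unfolding FL_def BL_def Nn_def by blast
 define Q where "Q = 3 + 2 * (I * G) + Lam"
 have FL: "FL <= L + 2 * Nn * Q" unfolding FL_def
 proof (rule field_words_bound)
 show "0 < 2 * (nxt t - t) + Lam + 1 & 2 * (nxt t - t) + Lam + 1 <= w" if "t < L" for t
 proof -
 have "nxt t <= L" using nx(1) that by blast
 then show ?thesis using lw by linarith
 qed
 have "(\<Sum>t<L. 2 * (nxt t - t) + Lam + 1) = 2 * (\<Sum>t<L. nxt t - t) + L * (Lam + 1)"
 unfolding sum.distrib sum_distrib_left[symmetric] by simp
 also have "... <= 2 * (L + I * L * G) + L * (Lam + 1)" using nx(3) by simp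
 also have "... = L * Q" by (simp add: Q_def algebra_simps)
 finally show "(\<Sum>t<L. 2 * (nxt t - t) + Lam + 1) <= L * Q" .
 show "L <= w" "0 < w" using w(1) L by linarith+
 qed
 have BL: "BL <= 3 * Nn" unfolding BL_def Nn_def
 proof (rule base_words_bound)
 show "nxt t - t <= L - t" if "t < L" for t using nx(1) that by (meson diff_le_mono)
 show "L <= 2 ^ Lam" using Lam(2) by simp
 qed
 have lamN: "Lam <= 2 * Nn" "G <= 2 * Nn" "Lam <= 3 * L" using Lam(4) G(3) N1 L by linarith+
 have NG: "Nn * G <= 2 * W" "Nn * Lam <= 2 * W" using mult_le_mono2[OF lamN(2), of Nn] mult_le_mono2[OF lamN(1), of Nn] by (auto simp: W_def)
 have NQ: "2 * Nn * Q = 6 * Nn + 4 * I * (Nn * G) + 2 * (Nn * Lam)" by (simp add: Q_def algebra_simps)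
 have IG: "I * (Nn * G) <= 2 * (I * W)" using mult_le_mono2[OF NG(1), of I] by simp
 have FLw: "FL < 2 ^ w"
 proof -
 have "4 * I * (Nn * G) = 4 * (I * (Nn * G))" by simp
 then show ?thesis using FL NQ IG NG(2) big N1 NW by linarith
 qed
 have BLw: "BL < 2 ^ w" using BL big NW by linarith
 obtain enc where enc: "inj_on enc {xs :: nat list. set xs \<subseteq> {..<d} & length xs = d}"
 "ALL xs. set xs \<subseteq> {..<d} & length xs = d --> enc xs < d ^ d" using ex_type_code[of d] by blast
 obtain trow where trow: "ALL k. trow k <= d" "ALL xs i. set xs \<subseteq> {..<d} --> length xs = d --> i < d -->
 trow (enc xs * (d + (d + 1) * (d + 1)) + i) = xs ! i"
 "ALL xs c q. set xs \<subseteq> {..<d} --> length xs = d --> c <= d --> q <= d -->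
 trow (enc xs * (d + (d + 1) * (d + 1)) + d + c * (d + 1) + q) = next_child d xs c q" using ex_trow[OF enc(1)] by blast
 have dN: "d <= 4 * Nn" by (rule order_trans[OF order_trans[OF d(2) Lam(3)] mult_le_mono2[OF N1(1)]])
 interpret core_params L X w "I + 1" FL BL d 12 Nb Lam fld bas par trow enc
 proof (unfold_locales)
 show "1000 + 8 * 2 ^ L < (2::nat) ^ w" using big NW unfolding Nn_def[symmetric] by linarith
 show "par i < 2 ^ w" for i using dec(4) FLw BLw by blast
 show "2 * (Nb * d ^ 12) + 2 * d < 2 ^ w" using b(2) dN big KW NW by linarith
 show "Lam + 2 < 2 ^ w" using lamN(1) big NW by linarith
 show "d ^ d * (d + (d + 1) * (d + 1)) < 2 ^ w" using b(3) KW big by linarith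
 qed (use dec(1-3) d Lam Nb enc(2) trow in \<open>auto simp: Nn_def\<close>)
 define Pn where "Pn = L ^ 5 * Nb"
 have PK: "Pn <= K * Nn" using b(1) by (simp add: Pn_def)
 note fb = family_bounds[OF L lamN(3), of Nb]
 have Nb1: "1 <= Nb" using Nb(2) by simp
 have R1: "R1 <= 2 * Nn + 4 * Pn" using fb(1)[OF Nb1] by (simp only: R1_def Pn_def Nn_def)
 have R2: "R2 <= 26 * (L ^ 4 * Nb)" using fb(2)[OF Nb1] by (simp only: R2_def)
 have R3: "R3 <= 16 * (L ^ 4 * Nb)" using fb(3)[OF Nb1] by (simp only: R3_def)
 have P4: "L ^ 4 * Nb <= Pn" "L ^ 4 * Nb * (2 * Lam + 5) <= 11 * Pn" using fb(4,5)[OF Nb1] by (simp_all only: Pn_def)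
 define V where "V = R1 + R2 + R3"
 have V: "V <= 2 * Nn + 46 * (K * Nn)" using R1 R2 R3 P4(1) PK unfolding V_def by linarith
 have VN: "V * Nn <= 2 * W + 46 * (K * W)"
 using mult_le_mono1[OF V, of Nn] by (simp add: W_def algebra_simps)
 have Rw: "2 * (R1 + R2 + R3) * 2 ^ L + 2 * (R1 + R2 + R3) + 4 * 2 ^ L + 1 < 2 ^ w"
 proof -
 have "2 * V * Nn + 2 * V + 4 * Nn + 1 < 2 ^ w" using VN V KW NW big by linarith
 then show ?thesis by (simp add: V_def Nn_def)
 qed
 obtain scs tbs where pk: "distinct (map fst tbs)" "\<forall>x\<in>set tbs. fst x < 100" "distinct (map fst scs)"
 "\<forall>x\<in>set scs. fst x < 100 & fst x ~: fst ` set tbs & snd x < 2 ^ w" "\<forall>(a, n, f)\<in>set tbs. \<forall>i<n. f i < 2 ^ w"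
 and sz: "(\<Sum>x\<leftarrow>tbs. fst (snd x)) <= 9 * (L + 1) + FL + BL + 2 ^ L + d ^ d * (d + (d + 1) * (d + 1)) + 2 * (12 + 1) +
 2 * (12 * ((L + 1) * (Nb * d ^ (12 - 1)))) + fsize R1 1 + fsize R2 (Lam + 1) + fsize R3 (Lam + 1)"
 and wk: "ALL D hb Y. holds D hb scs tbs --> (\<forall>y<2 ^ L. Y (X y) = y) --> core_works w L D 12 hb Y (Ccore (I + 1) 12) Lam"
 using ex_pack[OF Rw] by (elim exE conjE)
 have fs: "fsize R (Lam + 1) <= 6 * Nn + 2 * (Nn * Lam) + c * 11 * Pn" if "R <= c * (L ^ 4 * Nb)" for R c
 proof -
 have 1: "fsize R (Lam + 1) = 6 * Nn + 2 * (Nn * Lam) + R * (2 * Lam + 5)" by (simp add: fsize_def Nn_def algebra_simps)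
 have 2: "R * (2 * Lam + 5) <= c * (L ^ 4 * Nb) * (2 * Lam + 5)" using that by (rule mult_le_mono1)
 have 3: "c * (L ^ 4 * Nb) * (2 * Lam + 5) <= c * 11 * Pn" using mult_le_mono2[OF P4(2), of c] by (simp only: mult.assoc)
 show ?thesis unfolding 1 using order_trans[OF 2 3] by (rule add_left_mono)
 qed
 have f1: "fsize R1 1 <= 16 * Nn + 20 * Pn" unfolding fsize_def Nn_def[symmetric] using R1 by simp
 define E where "E = (L + 1) * (Nb * d ^ 11)"
 have e: "2 * (12 * ((L + 1) * (Nb * d ^ (12 - 1)))) = 24 * E" by (simp add: E_def)
 have "(\<Sum>x\<leftarrow>tbs. fst (snd x)) <= (74 + 483 * K) * Nn + 4 * I * (Nn * G) + 6 * (Nn * Lam) + 24 * E"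
 using sz[folded Nn_def, unfolded e] FL NQ BL b(3) f1 fs[OF R2] fs[OF R3] N1 PK by (simp only: add_mult_distrib add_mult_distrib2 mult.assoc)
 then have szz: "(\<Sum>x\<leftarrow>tbs. fst (snd x)) <= core_size K I L d Nb Lam G" unfolding core_size_def E_def Nn_def .
 have pkk: "pack w scs tbs" unfolding pack_def by (intro conjI pk)
 show ?thesis by (rule exI[of _ scs], rule exI[of _ tbs], intro conjI) (rule pkk szz wk)+
qed

lemma log_length:
 fixes n :: nat
 assumes "n >= 1"
 defines "L \<equiv> nat \<lfloor>log 2 (real n)\<rfloor> + 1"
 shows "n < 2 ^ L" "2 ^ L <= 2 * n" "real L <= 2 * lg (real n)" "real L + 1 <= 4 * lg (real n)"
proof -
 have f: "0 <= \<lfloor>log 2 (real n)\<rfloor>" using assms(1) by simp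
 define k where "k = nat \<lfloor>log 2 (real n)\<rfloor>"
 have k: "\<lfloor>log 2 (real n)\<rfloor> = int k" using f by (simp add: k_def)
 then have p: "2 powr real k <= real n" "real n < 2 powr (real k + 1)"
 using floor_log_eq_powr_iff[of "real n" 2 "int k"] assms(1) by auto
 have "2 powr real k = 2 ^ k" "2 powr (real k + 1) = 2 ^ (k + 1)" by (simp_all add: powr_realpow powr_add)
 then have "real (2 ^ k) <= real n" "real n < real (2 ^ (k + 1))" using p by simp_all
 then have "2 ^ k <= n" "n < 2 ^ (k + 1)" by linarith+
 then show "n < 2 ^ L" "2 ^ L <= 2 * n" by (simp_all add: L_def k_def[symmetric])
 have "real k <= log 2 (real n)" using k by linarith
 then have "real k <= lg (real n)" "1 <= lg (real n)" by (auto simp: lg_def)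
 then show "real L <= 2 * lg (real n)" "real L + 1 <= 4 * lg (real n)" by (simp_all add: L_def k_def[symmetric])
qed

text \<open>Used with \<open>g = lg n\<close>: \<open>2 ^ Lam\<close> is at most
  \<open>16 * g\<close>, and the summand 4 from the logarithm is absorbed by the factor 6 because
  \<open>lg\<close> is at least 1.\<close>

lemma lamLe:
 fixes L Lam :: nat
 assumes "2 ^ Lam <= 4 * (L + 1)" "real L + 1 <= 4 * g" "1 <= g"
 shows "1 + real Lam <= 6 * lg g"
proof -
 have "real (2 ^ Lam) <= real (4 * (L + 1))" using assms(1) by (rule of_nat_mono)
 then have "2 ^ Lam <= 16 * g" using assms(2) by simp
 then have "log 2 (2 ^ Lam) <= log 2 (16 * g)" using assms(3) by (intro log_mono) auto
 moreover have "log 2 (16 * g) = 4 + log 2 g" using assms(3) log_pow_cancel[of 2 4] by (subst log_mult) auto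
 ultimately show ?thesis by (simp add: lg_def max_def)
qed

theorem theorem2:
 fixes \<epsilon> :: real
 assumes "\<epsilon> > 0"
 shows "\<exists>(P :: instr list) (c :: nat) (C :: real).
 c >= 1 &
 (\<forall>(n :: nat) (S :: point set).
 n >= 1 & S \<subseteq> {1..n} \<times> {1..n} & card S = n -->
 (\<exists>(D :: nat list) (m :: nat).
 space_in_words n (word_length c n) m <= C * (real n * lg (real n) powr \<epsilon>) &
 answers_sorted_reporting (word_length c n) P D m S
 (%k. C * (lg (lg (real n)) + real k))))"
proof -
 obtain I K where K1: "1 <= K" and par: "\<forall>L::nat. 1 <= L --> (\<exists>d Nb Lam G :: nat. 1 <= d & d <= 2 ^ Lam & 2 <= Lam &
 L + 1 < 2 ^ Lam & 2 ^ Lam <= 4 * (L + 1) & Lam <= L + 2 & 2 ^ L <= Nb * d ^ 12 & 0 < Nb & (Nb - 1) * d ^ 12 < 2 ^ L &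
 2 <= G & L <= G ^ I & G <= L + 2 & real Lam <= real K * real L powr \<epsilon> & real G <= real K * real L powr \<epsilon> &
 real ((L + 1) * (Nb * d ^ 11)) <= real K * (2 ^ L * real L powr \<epsilon>) & L ^ 5 * Nb <= K * 2 ^ L & Nb * d ^ 12 <= K * 2 ^ L &
 d ^ d * (d + (d + 1) * (d + 1)) <= K * 2 ^ L)"
 using ex_params[OF assms] by (elim exE conjE)
 define Kb where "Kb = 2000 + 2000 * K + 20 * I"
 \<comment> \<open>\<open>Kb * L + 2 * L\<close> bits suffice for \<open>Kb\<close> times the square
   of \<open>2 ^ L\<close>, because \<open>Kb < 2 ^ Kb\<close>. The summand 21 in place of 2 makes
   room for the \<open>4 * L + 4 * Lam + 4\<close> bits required by the packed fields.\<close>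
 define c where "c = Kb + 21"
 \<comment> \<open>The constant of the query program, \<open>Cw + 500\<close>, and 1 for the final
   \<open>Halt\<close>.\<close>
 define Cq where "Cq = 2 * Ccore (I + 1) 12 + 2501"
 define K5 where "K5 = 74 + 513 * K + 4 * I * K"
 define C1 C2 where "C1 = 6 * real Cq" and "C2 = 4 * real c * (2 * real K5 + 313) * 2 powr \<epsilon>"
 have C12: "0 <= C1" "0 <= C2" by (simp_all add: C1_def C2_def)
 show ?thesis
 proof (rule exI[of _ "program (main_com 12)"], rule exI[of _ c], rule exI[of _ "C1 + C2"], rule conjI, goal_cases)
 case 1
 show ?case by (simp add: c_def)
 next
 case 2
 show ?case
 proof (intro allI impI)
 fix n :: nat and S :: "point set"
 assume a: "n >= 1 & S \<subseteq> {1..n} \<times> {1..n} & card S = n"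
 define L where "L = nat \<lfloor>log 2 (real n)\<rfloor> + 1"
 define w where "w = word_length c n"
 have w: "w = c * L" by (simp add: w_def word_length_def L_def)
 have L1: "1 <= L" by (simp add: L_def)
 note ll = log_length[of n, folded L_def]
 have nL: "n < 2 ^ L" "2 ^ L <= 2 * n" "real L <= 2 * lg (real n)" "real L + 1 <= 4 * lg (real n)" using ll a by blast+
 obtain d Nb Lam G where d: "1 <= d" "d <= 2 ^ Lam" and Lam: "2 <= Lam" "L + 1 < 2 ^ Lam" "2 ^ Lam <= 4 * (L + 1)" "Lam <= L + 2"
 and Nb: "2 ^ L <= Nb * d ^ 12" "0 < Nb" "(Nb - 1) * d ^ 12 < 2 ^ L" and G: "2 <= G" "L <= G ^ I" "G <= L + 2"
 and re: "real Lam <= real K * real L powr \<epsilon>" "real G <= real K * real L powr \<epsilon>"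
 "real ((L + 1) * (Nb * d ^ 11)) <= real K * (2 ^ L * real L powr \<epsilon>)"
 and b: "L ^ 5 * Nb <= K * 2 ^ L" "Nb * d ^ 12 <= K * 2 ^ L" "d ^ d * (d + (d + 1) * (d + 1)) <= K * 2 ^ L"
 using par[rule_format, OF L1] by (elim exE conjE)
 have S: "S \<subseteq> {1..n} \<times> {1..n}" "card S = n" "n >= 1" using a by blast+
 obtain Y X CX CY PX PY where X: "bij_betw X {..<2 ^ L} {..<2 ^ L}" and YX: "\<forall>y<2 ^ L. Y (X y) = y" and Yr: "\<forall>x<2 ^ L. Y x < 2 ^ L"
 and CX: "ALL v. CX v <= n" "ALL v. CY v <= n" "\<forall>x<n. PX x <= n & PY x <= n"
 and rep: "ALL a b c d k F. F = take (min k (2 ^ L)) (filter (%x. CX (min a (n + 1)) <= x & x < CX (min b n + 1) &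
 CY (min c (n + 1)) <= Y x & Y x < CY (min d n + 1)) [0..<2 ^ L]) -->
 (EX ps. concat (map (%x. [PX x, PY x]) F) = encode_points ps & length ps = length F &
 sorted_report S ({a..b} \<times> {c..d}) k ps)"
 using rank_space[OF S nL(1)] by (elim exE conjE)
 \<comment> \<open>The permutation with reversed \<open>y\<close>-order; its inverse maps
   \<open>x\<close> to \<open>2 ^ L - 1 - Y x\<close>.\<close>
 define X' where "X' = (%y. X (2 ^ L - 1 - y))"
 have refl: "bij_betw (%y. 2 ^ L - 1 - y) {..<2 ^ L} {..<(2::nat) ^ L}"
 by (rule bij_betw_byWitness[of _ "%y. 2 ^ L - 1 - y"]) auto
 have X': "bij_betw X' {..<2 ^ L} {..<2 ^ L}" unfolding X'_def using bij_betw_trans[OF refl X] by (simp add: comp_def)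
 have YX': "\<forall>y<2 ^ L. 2 ^ L - 1 - Y (X' y) = y"
 proof (intro allI impI)
 fix y :: nat assume "y < 2 ^ L"
 moreover have "Y (X (2 ^ L - 1 - y)) = 2 ^ L - 1 - y" by (rule YX[rule_format]) simp
 ultimately show "2 ^ L - 1 - Y (X' y) = y" by (simp add: X'_def)
 qed
 define N where "N = (2::nat) ^ L"
 define W where "W = N * N"
 have N1: "L + 1 <= N" "1 <= N" "n <= N" using Suc_leI[OF less_exp[of L]] nL(1) by (simp_all add: N_def)
 have NW: "N <= W" using N1(2) by (auto simp: W_def)
 have w21: "21 * L <= w" unfolding w c_def by simp
 have wbig: "Kb * (2 ^ L * 2 ^ L) < 2 ^ w"
 proof -
 have "Kb < 2 ^ Kb" by (rule less_exp)
 also have "(2::nat) ^ Kb <= 2 ^ (Kb * L)" using L1 by (intro power_increasing) auto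
 finally have "Kb * (2 ^ L * 2 ^ L) < 2 ^ (Kb * L) * (2 ^ L * 2 ^ L)" by (intro mult_less_mono1) auto
 also have "... = 2 ^ (Kb * L + L + L)" by (simp add: power_add)
 also have "... <= 2 ^ w" unfolding w c_def by (intro power_increasing) (auto simp: algebra_simps)
 finally show ?thesis .
 qed
 have big: "2000 * W + 2000 * (K * W) + 20 * (I * W) < 2 ^ w"
 using wbig unfolding Kb_def N_def[symmetric] W_def[symmetric] by (simp add: algebra_simps)
 note ecp = ex_core_pack[OF _ L1 K1 d Lam Nb G b w21 wbig[unfolded Kb_def]]
 obtain s1 t1 where p1: "pack w s1 t1" "(\<Sum>x\<leftarrow>t1. fst (snd x)) <= core_size K I L d Nb Lam G"
 "ALL D hb Y. holds D hb s1 t1 --> (\<forall>y<2 ^ L. Y (X y) = y) --> core_works w L D 12 hb Y (Ccore (I + 1) 12) Lam"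
 using ecp[OF X] by (elim exE conjE)
 obtain s2 t2 where p2: "pack w s2 t2" "(\<Sum>x\<leftarrow>t2. fst (snd x)) <= core_size K I L d Nb Lam G"
 "ALL D hb Y. holds D hb s2 t2 --> (\<forall>y<2 ^ L. Y (X' y) = y) --> core_works w L D 12 hb Y (Ccore (I + 1) 12) Lam"
 using ecp[OF X'] by (elim exE conjE)
 define Z where "Z = core_size K I L d Nb Lam G"
 define E where "E = (L + 1) * (Nb * d ^ 11)"
 have Z: "Z = (74 + 483 * K) * N + 4 * I * (N * G) + 6 * (N * Lam) + 24 * E" by (simp only: Z_def core_size_def E_def N_def)
 have EW: "E <= K * W"
 proof -
 have "Nb * d ^ 11 <= Nb * d ^ 12" using d(1) by (intro mult_le_mono2 power_increasing) auto
 from order_trans[OF this b(2)] have "Nb * d ^ 11 <= K * N" unfolding N_def .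
 from mult_le_mono[OF N1(1) this] have "E <= N * (K * N)" unfolding E_def .
 then show ?thesis by (simp add: W_def mult.left_commute)
 qed
 have GL: "G <= 2 * N" "Lam <= 2 * N" using G(3) Lam(4) N1 by linarith+
 have NG0: "N * G <= 2 * W" "N * Lam <= 2 * W"
 using mult_le_mono2[OF GL(1), of N] mult_le_mono2[OF GL(2), of N] by (auto simp: W_def)
 have NG: "I * (N * G) <= 2 * (I * W)" "N * Lam <= 2 * W" using mult_le_mono2[OF NG0(1), of I] NG0(2) by simp_all
 have KW: "K * N <= K * W" using NW by simp
 have Zw: "Z <= 86 * W + 507 * (K * W) + 8 * (I * W)"
 unfolding Z add_mult_distrib mult.assoc using EW NG KW NW by linarith
 \<comment> \<open>The length of the structure is fixed before the structure is built, since
   \<open>s0\<close> stores it as the address of the output buffers. The 300 cells are the three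
   directories.\<close>
 define len where "len = 300 + ((n + 2) + (n + 2) + n + n + (L + 1)) + (\<Sum>x\<leftarrow>t1. fst (snd x)) + (\<Sum>x\<leftarrow>t2. fst (snd x))"
 have lenZ: "len + 2 * N + 2 <= 2 * Z + 313 * N"
 using p1(2) p2(2) N1 unfolding len_def Z_def[symmetric] by linarith
 have lenw: "len + 2 * N + 2 < 2 ^ w" using lenZ Zw big NW by linarith
 define s0 where "s0 = [(0::nat, n), (1, 2 ^ L), (6, len), (7, len + 2 ^ L + 1), (8, L)]"
 define t0 where "t0 = [(2::nat, n + 2, CX), (3, n + 2, CY), (4, n, PX), (5, n, PY), (9, L + 1, %i. 2 ^ i)]"
 have nw: "n < 2 ^ w" "L < 2 ^ w" "N < 2 ^ w" "len < 2 ^ w" "len + N + 1 < 2 ^ w" using lenw N1 by linarith+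
 have p0: "pack w s0 t0"
 proof -
 have "(2::nat) ^ i < 2 ^ w" if "i < L + 1" for i
 proof -
 have "(2::nat) ^ i <= N" unfolding N_def using that by (intro power_increasing) auto
 then show ?thesis using nw(3) by linarith
 qed
 moreover have "CX i < 2 ^ w" "CY i < 2 ^ w" for i using CX(1,2) nw(1) le_less_trans by blast+
 moreover have "PX i < 2 ^ w" "PY i < 2 ^ w" if "i < n" for i using CX(3) nw(1) that le_less_trans by blast+
 ultimately show ?thesis using nw by (auto simp: pack_def s0_def t0_def N_def)
 qed
 define s t where "s = (%h::nat. if h = 0 then s0 else if h = 1 then s1 else s2)"
 and "t = (%h::nat. if h = 0 then t0 else if h = 1 then t1 else t2)"
 have "EX D. length D = len & set D \<subseteq> {..<2 ^ w} & (\<forall>h<3. holds D (100 * h) (s h) (t h))"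
 by (rule layout_packs) (use p0 p1(1) p2(1) nw(4) in \<open>auto simp: s_def t_def len_def t0_def\<close>)
 then obtain D where D: "length D = len" "set D \<subseteq> {..<2 ^ w}" "\<forall>h<3. holds D (100 * h) (s h) (t h)" by (elim exE conjE)
 have h0: "holds D 0 s0 t0" and h1: "holds D 100 s1 t1" and h2: "holds D 200 s2 t2"
 using D(3)[rule_format, of 0] D(3)[rule_format, of 1] D(3)[rule_format, of 2] by (simp_all add: s_def t_def)
 interpret Q: query_mem w L n 12 "Ccore (I + 1) 12" Lam D Y CX CY PX PY
 proof unfold_locales
 show "scal D 0 0 n" "scal D 0 1 (2 ^ L)" "scal D 0 6 (length D)" "scal D 0 7 (length D + 2 ^ L + 1)" "scal D 0 8 L"
 unfolding D(1) by (rule holdsD(1)[OF h0], simp add: s0_def)+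
 show "tab D 0 2 (n + 2) CX" "tab D 0 3 (n + 2) CY" "tab D 0 4 n PX" "tab D 0 5 n PY" "tab D 0 9 (L + 1) (%i. 2 ^ i)"
 by (rule holdsD(2)[OF h0], simp add: t0_def)+
 show "core_works w L D 12 100 Y (Ccore (I + 1) 12) Lam" using p1(3) h1 YX by blast
 show "core_works w L D 12 200 (%x. 2 ^ L - 1 - Y x) (Ccore (I + 1) 12) Lam" using p2(3)[rule_format, OF h2, of "%x. 2 ^ L - 1 - Y x"] YX' by blast
 show "1000 + 8 * 2 ^ L < (2::nat) ^ w" using big NW N1(2) unfolding N_def[symmetric] by linarith
 qed (use nL CX Yr Lam in auto)
 \<comment> \<open>The working space consists of the two output buffers, each of
   \<open>2 ^ L\<close> ranks and a sentinel.\<close>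
 define m where "m = length D + 2 * (2 ^ L + 1)"
 have g1: "1 <= lg (real n)" by (simp add: lg_def)
 have lamlg: "1 + real Lam <= 6 * lg (lg (real n))" by (rule lamLe[OF Lam(3) nL(4) g1])
 have space: "space_in_words n w m <= C2 * (real n * lg (real n) powr \<epsilon>)"
 proof -
 define q where "q = real L powr \<epsilon>"
 have q1: "1 <= q" unfolding q_def using L1 assms by (intro ge_one_powr_ge_zero) auto
 have ql: "q <= 2 powr \<epsilon> * lg (real n) powr \<epsilon>"
 proof -
 have "q <= (2 * lg (real n)) powr \<epsilon>" unfolding q_def using nL(3) assms by (intro powr_mono2) auto
 then show ?thesis using g1 by (simp add: powr_mult)
 qed
 define Nr where "Nr = (2::real) ^ L"
 have Nr: "0 <= Nr" "real N = Nr" "Nr <= 2 * real n"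
 proof -
 have "real (2 ^ L) <= real (2 * n)" using nL(2) by (rule of_nat_mono)
 then show "Nr <= 2 * real n" by (simp add: Nr_def)
 qed (simp_all add: Nr_def N_def)
 have NrX: "Nr * y <= real K * (Nr * q)" if "y <= real K * q" for y
 proof -
 have "Nr * y <= Nr * (real K * q)" by (rule mult_left_mono[OF that Nr(1)])
 also have "... = real K * (Nr * q)" by simp
 finally show ?thesis .
 qed
 have NqN: "Nr <= Nr * q" using mult_left_mono[OF q1 Nr(1)] by (simp only: mult_1_right)
 have "real Z <= real K5 * (Nr * q)"
 proof -
 have "real Z = (74 + 483 * real K) * Nr + 4 * real I * (Nr * real G) + 6 * (Nr * real Lam) + 24 * real E"
 unfolding Z by (simp add: Nr(2))
 moreover have "(74 + 483 * real K) * Nr <= (74 + 483 * real K) * (Nr * q)" using NqN by (intro mult_left_mono) auto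
 moreover have "4 * real I * (Nr * real G) <= 4 * real I * (real K * (Nr * q))" using NrX[OF re(2)[folded q_def]] by (intro mult_left_mono) auto
 moreover have "6 * (Nr * real Lam) <= 6 * (real K * (Nr * q))" using NrX[OF re(1)[folded q_def]] by linarith
 moreover have "24 * real E <= 24 * (real K * (Nr * q))" using re(3) unfolding E_def Nr_def q_def by linarith
 moreover have "(74 + 483 * real K) * (Nr * q) + 4 * real I * (real K * (Nr * q)) + 6 * (real K * (Nr * q)) + 24 * (real K * (Nr * q)) = real K5 * (Nr * q)"
 by (simp add: K5_def algebra_simps)
 ultimately show ?thesis by linarith
 qed
 moreover have "real m <= 2 * real Z + 313 * Nr"
 proof -
 have "m <= 2 * Z + 313 * N" using lenZ by (simp add: m_def D(1) N_def)
 then have "real m <= real (2 * Z + 313 * N)" by (rule of_nat_mono)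
 then show ?thesis using Nr(2) by simp
 qed
 ultimately have "real m <= 2 * (real K5 * (Nr * q)) + 313 * (Nr * q)" using NqN by linarith
 also have "... = (2 * real K5 + 313) * (Nr * q)" by (simp add: algebra_simps)
 finally have mb: "real m <= (2 * real K5 + 313) * (Nr * q)" .
 have "Nr * q <= (2 * real n) * (2 powr \<epsilon> * lg (real n) powr \<epsilon>)" using Nr ql q1 by (intro mult_mono) auto
 then have "(2 * real K5 + 313) * (Nr * q) <= (2 * real K5 + 313) * ((2 * real n) * (2 powr \<epsilon> * lg (real n) powr \<epsilon>))"
 by (intro mult_left_mono) auto
 with mb have mb2: "real m <= (2 * real K5 + 313) * ((2 * real n) * (2 powr \<epsilon> * lg (real n) powr \<epsilon>))" by linarith
 have "real (m * w) / lg (real n) = real m * (real c * (real L / lg (real n)))" by (simp add: w)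
 also have "... <= real m * (real c * 2)" using nL(3) g1 by (intro mult_left_mono) (auto simp: divide_le_eq)
 also have "... <= (2 * real K5 + 313) * ((2 * real n) * (2 powr \<epsilon> * lg (real n) powr \<epsilon>)) * (real c * 2)"
 using mb2 by (intro mult_right_mono) auto
 also have "... = C2 * (real n * lg (real n) powr \<epsilon>)" by (simp add: C2_def algebra_simps)
 finally show ?thesis by (simp add: space_in_words_def)
 qed
 have nn: "0 <= real n * lg (real n) powr \<epsilon>" by simp
 have sp: "space_in_words n w m <= (C1 + C2) * (real n * lg (real n) powr \<epsilon>)"
 proof -
 have "C2 * (real n * lg (real n) powr \<epsilon>) <= (C1 + C2) * (real n * lg (real n) powr \<epsilon>)"
 by (rule mult_right_mono) (use C12 nn in auto)
 then show ?thesis using space by linarith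
 qed
 have ans: "answers_sorted_reporting w (program (main_com 12)) D m S (%k. (C1 + C2) * (lg (lg (real n)) + real k))"
 unfolding answers_sorted_reporting_def
 proof (intro conjI allI impI)
 show "length D <= m" by (simp add: m_def)
 show "set D \<subseteq> {..<2 ^ w}" by (rule D(2))
 fix M and a b c' d' k :: nat
 assume h: "length M = m & set M \<subseteq> {..<2 ^ w} & take (length D) M = D & {a, b, c', d', k} \<subseteq> {..<2 ^ w}"
 define sg where "sg = (%r. if r < length [a, b, c', d', k] then [a, b, c', d', k] ! r else 0)"
 have s: "sg 0 = a" "sg 1 = b" "sg 2 = c'" "sg 3 = d'" "sg 4 = k" by (simp_all add: sg_def numeral_eq_Suc)
 have lt: "a < 2 ^ w" "b < 2 ^ w" "c' < 2 ^ w" "d' < 2 ^ w" "k < 2 ^ w" using h by auto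
 have ext: "extends w D M" using h lenw by (simp add: extends_def m_def D(1) N_def)
 have lM: "length M = length D + 2 * (2 ^ L + 1)" using h by (simp add: m_def)
 define F where "F = take (min k (2 ^ L)) (filter (%x. CX (min a (n + 1)) <= x & x < CX (min b n + 1) &
 CY (min c' (n + 1)) <= Y x & Y x < CY (min d' n + 1)) [0..<2 ^ L])"
 have "T w (main_com 12) (%tm (sg', M', out'). take (length D) M' = D &
 out' = concat (map (%x. [PX x, PY x]) F) & tm <= (Q.Cw + 500) * (1 + length F + Lam)) (sg, M, [])"
 using Q.T_main[OF ext lM lt[folded s]] unfolding s F_def .
 then obtain tm s' where ex: "exec w (main_com 12) (sg, M, []) tm s'"
 "case s' of (sg', M', out') => take (length D) M' = D & out' = concat (map (%x. [PX x, PY x]) F) & tm <= (Q.Cw + 500) * (1 + length F + Lam)"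
 unfolding T_def by blast
 obtain sg' M' out' where s': "s' = (sg', M', out')" by (cases s')
 have r: "take (length D) M' = D" "out' = concat (map (%x. [PX x, PY x]) F)" "tm <= (Q.Cw + 500) * (1 + length F + Lam)"
 using ex(2) unfolding s' prod.case by blast+
 have wo: "words_ok w sg M"
 proof -
 have "[a, b, c', d', k] ! r < 2 ^ w" if "r < 5" for r
 proof -
 have "[a, b, c', d', k] ! r \<in> set [a, b, c', d', k]" by (rule nth_mem) (use that in simp)
 then show ?thesis using lt by auto
 qed
 then show ?thesis using h by (simp add: words_ok_def sg_def)
 qed
 have vo: "vars_ok (main_com 12)" by (rule main_vars_ok) simp
 have w0: "w > 0" using w21 L1 by linarith
 obtain st where st: "halts_in w (program (main_com 12)) (|pc = 0, regs = sg, mem = M, outp = []|) (Suc tm) st" "mem st = M'" "outp st = out'"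
 using program_halts[OF ex(1)[unfolded s'] vo wo w0] by (elim exE conjE)
 obtain ps where ps: "concat (map (%x. [PX x, PY x]) F) = encode_points ps" "length ps = length F" "sorted_report S ({a..b} \<times> {c'..d'}) k ps"
 using rep[rule_format, OF F_def] by (elim exE conjE)
 have time: "real (Suc tm) <= (C1 + C2) * (lg (lg (real n)) + real (length ps))"
 proof -
 define g where "g = lg (lg (real n))"
 have g0: "0 <= g" by (simp add: g_def lg_def)
 have "Suc tm <= Cq * (1 + length F + Lam)"
 proof -
 have cq: "Cq = Q.Cw + 500 + 1" unfolding Cq_def Q.Cw_def by simp
 have c: "Cq * U = (Q.Cw + 500) * U + U" for U by (simp add: cq algebra_simps)
 define U where "U = 1 + length F + Lam"
 have tmU: "tm <= (Q.Cw + 500) * U" using r(3) unfolding U_def .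
 have U1: "1 <= U" by (simp add: U_def)
 from add_mono[OF tmU U1] show ?thesis unfolding U_def[symmetric] c by (simp only: Suc_eq_plus1)
 qed
 then have "real (Suc tm) <= real (Cq * (1 + length F + Lam))" by (rule of_nat_mono)
 also have "... = real Cq * ((1 + real Lam) + real (length F))" by (simp add: algebra_simps)
 also have "... <= real Cq * (6 * g + 6 * real (length F))" using lamlg unfolding g_def by (intro mult_left_mono) auto
 also have "... = C1 * (g + real (length F))" by (simp add: C1_def algebra_simps)
 also have "... <= (C1 + C2) * (g + real (length F))" using C12 g0 by (intro mult_right_mono) auto
 finally show ?thesis by (simp only: g_def ps(2))
 qed
 have init: "initial [a, b, c', d', k] M = (|pc = 0, regs = sg, mem = M, outp = []|)" by (simp only: initial_def sg_def)
 have out: "outp st = encode_points ps" unfolding st(3) r(2) by (rule ps(1))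
 have mem: "take (length D) (mem st) = D" unfolding st(2) by (rule r(1))
 show "EX tt st ps. halts_in w (program (main_com 12)) (initial [a, b, c', d', k] M) tt st & outp st = encode_points ps &
 sorted_report S ({a..b} \<times> {c'..d'}) k ps & take (length D) (mem st) = D & real tt <= (C1 + C2) * (lg (lg (real n)) + real (length ps))"
 by (rule exI[of _ "Suc tm"], rule exI[of _ st], rule exI[of _ ps], intro conjI)
 (rule st(1)[folded init] out ps(3) mem time)+
 qed
 show "EX D m. space_in_words n (word_length c n) m <= (C1 + C2) * (real n * lg (real n) powr \<epsilon>) &
 answers_sorted_reporting (word_length c n) (program (main_com 12)) D m S (%k. (C1 + C2) * (lg (lg (real n)) + real k))"
 using sp ans unfolding w_def by blast
 qed
 qed
qed

end
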